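(* Let $\mathscr{D}$, $\omega$, $\varphi$, $V$, $P_N$, $\kappa_N$, $C_N$, $D_N$ be as in the context. There exist $0<\rho<1$, bounded holomorphic functions $B_j$ ($j=0,1,2,\ldots$) on $\mathbb{C}\setminus\overline{\mathscr{D}_\rho}$ with $B_0\equiv1$ and $B_j(\infty)=0$ for $j\ge1$, and real constants $(d_j)_{j\ge 1}$, such that: (1) for every $\varkappa\in\mathbb{N}$ and $A>0$, the monic orthogonal polynomials $\pi_N=\kappa_N^{-1}P_N$ satisfy $\pi_N(z)=C_N\varphi'(z)\varphi(z)^N\mathrm{e}^{V(z)}\big(\sum_{j=0}^{\varkappa}N^{-j}B_j(z)+\mathrm{O}(N^{-\varkappa-1})\big)$ as $N\to\infty$, uniformly for $\mathrm{dist}_{\mathbb{C}}(z,\mathbb{C}\setminus\mathscr{D})\le AN^{-1}\log N$, and $D_N=1+\sum_{j=1}^{\varkappa}N^{-j}d_j+\mathrm{O}(N^{-\varkappa-1})$ (that is, $B_j$ and $d_j$ are the coefficients of the pointwise expansion of $\pi_N$ and of the expansion of the leading coefficient); (2) for every $\varkappa\in\mathbb{N}$, if $$F_N(z)=D_N N^{\frac12}\varphi'(z)\varphi(z)^N\mathrm{e}^{V(z)}\sum_{j=0}^{\varkappa}N^{-j}B_j(z),$$ and $\chi_0$ is a smooth cut-off function with values in $[0,1]$ that equals $1$ in a fixed neighborhood of $\mathbb{C}\setminus\mathscr{D}$ and vanishes in a neighborhood of $\overline{\mathscr{D}_\rho}$, then $$\int_{\mathscr{D}}\big|P_N(z)-\chi_0(z)F_N(z)\big|^2\,\omega(z)\,\mathrm{dA}(z)=\mathrm{O}(N^{-\varkappa-1})\qquad\text{as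 }N\to+\infty$$ (where $\chi_0F_N$ is understood to be $0$ wherever $\chi_0$ vanishes).
   Context: $\mathscr{D}\subset\mathbb{C}$ is a bounded Jordan domain with real-analytic boundary, and $\omega\ge 0$ is a continuous weight function on $\mathscr{D}$ such that $\log\omega$ extends to a real-analytic function in a neighborhood of $\partial\mathscr{D}$ (so $\omega$ is defined and strictly positive near $\partial\mathscr{D}$). $\mathbb{N}=\{0,1,2,\ldots\}$, $\mathbb{D}_{\mathrm e}=\{|z|>1\}$, $\mathrm{dA}=\pi^{-1}\mathrm{d}x\,\mathrm{d}y$. $\varphi$ is the conformal mapping of $\mathbb{C}\setminus\overline{\mathscr{D}}$ onto $\mathbb{D}_{\mathrm e}$ with $\varphi(\infty)=\infty$ and $\varphi'(\infty)>0$; it extends to a univalent holomorphic function in a neighborhood of $\mathbb{C}\setminus\mathscr{D}$. For $\rho<1$ close to $1$, $\mathscr{D}_\rho\subset\mathscr{D}$ denotes the bounded Jordan domain whose boundary is the curve $|\varphi(z)|=\rho$; $\rho$ is always taken so close to $1$ that $\varphi$ and $V$ are holomorphic in a neighborhood of $\mathbb{C}\setminus\mathscr{D}_\rho$, with $\varphi$ univalent there. $V$ is the Szegő function of $\omega$ relative to $\mathscr{D}$: the unique bounded holomorphic function on $\mathbb{C}\setminus\overline{\mathscr{D}}$ (including at $\infty$) with $2\,\mathrm{Re}\,V=-\log\omega$ on $\partial\mathscr{D}$ and $V(\infty)\in\mathbb{R}$; it extends holomorphically across $\partial\mathscr{D}$. $P_N$ is the normalized orthogonal polynomial of degree $N$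 for $L^2(\mathscr{D},\omega\,\mathrm{dA})$: it has degree $N$, positive leading coefficient $\kappa_N$, unit norm, and is orthogonal to all polynomials of degree $\le N-1$. Constants, for $N\ge1$: $C_N=(\varphi'(\infty))^{-N-1}\mathrm{e}^{-V(\infty)}$, and $D_N>0$ is defined by $\kappa_N=N^{\frac12}C_N^{-1}D_N$. *)

theory Defs
  imports
    "HOL-Analysis.Analysis"
    "HOL-Complex_Analysis.Complex_Analysis"
    "HOL-Computational_Algebra.Polynomial"
    "HOL-Library.Landau_Symbols"
begin

definition real_analytic_curve :: "(real \<Rightarrow> complex) \<Rightarrow> bool" where
  "real_analytic_curve \<gamma> \<longleftrightarrow>
     (\<forall>t0. \<exists>a r. 0 < r \<and>
        (\<forall>t. \<bar>t - t0\<bar> < r \<longrightarrow> (\<lambda>n. (t - t0) ^ n *\<^sub>R a n) sums \<gamma> t))"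

definition real_analytic_on :: "(complex \<Rightarrow> real) \<Rightarrow> complex set \<Rightarrow> bool" where
  "real_analytic_on f U \<longleftrightarrow>
     (\<forall>a\<in>U. \<exists>c r. 0 < r \<and> ball a r \<subseteq> U \<and>
        (\<forall>z\<in>ball a r.
          ((\<lambda>(m, n). c m n * Re (z - a) ^ m * Im (z - a) ^ n) has_sum f z)
            (UNIV :: (nat \<times> nat) set)))"

primrec Ck :: "nat \<Rightarrow> (complex \<Rightarrow> real) \<Rightarrow> bool" where
  "Ck 0 f \<longleftrightarrow> continuous_on UNIV f"
| "Ck (Suc k) f \<longleftrightarrow>
     (\<forall>z. f differentiable (at z)) \<and> (\<forall>v. Ck k (\<lambda>z. frechet_derivative f (at z) v))"

definition smooth :: "(complex \<Rightarrow> real) \<Rightarrow> bool" where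
  "smooth f \<longleftrightarrow> (\<forall>k. Ck k f)"

definition jordan_domain :: "complex set \<Rightarrow> bool" where
  "jordan_domain D \<longleftrightarrow>
     (\<exists>\<gamma>. simple_path \<gamma> \<and> pathfinish \<gamma> = pathstart \<gamma> \<and> D = inside (path_image \<gamma>))"

text \<open>The parametrization is regular, real-analytic and 1-periodic on the whole line, so that it is
  also analytic across the common endpoint of the loop.\<close>

definition analytic_jordan_domain :: "complex set \<Rightarrow> bool" where
  "analytic_jordan_domain D \<longleftrightarrow>
     (\<exists>\<gamma>. simple_path \<gamma> \<and> pathfinish \<gamma> = pathstart \<gamma> \<and>
          real_analytic_curve \<gamma> \<and> (\<forall>t. \<gamma> (t + 1) = \<gamma> t) \<and>
          (\<forall>t. vector_derivative \<gamma> (at t) \<noteq> 0) \<and>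
          D = inside (path_image \<gamma>))"

text \<open>Near the boundary, \<open>\<omega>\<close> stands for its extension; its values away from
  \<open>D\<close> and a neighborhood of the boundary are irrelevant.\<close>

definition admissible_weight :: "complex set \<Rightarrow> (complex \<Rightarrow> real) \<Rightarrow> bool" where
  "admissible_weight D \<omega> \<longleftrightarrow>
     continuous_on D \<omega> \<and> (\<forall>z\<in>D. 0 \<le> \<omega> z) \<and>
     (\<exists>U. open U \<and> frontier D \<subseteq> U \<and> (\<forall>z\<in>U. 0 < \<omega> z) \<and>
          real_analytic_on (\<lambda>z. ln (\<omega> z)) U)"

text \<open>In the next two definitions \<open>\<phi>\<close> and \<open>V\<close> stand for the holomorphic extensions
  across the boundary of \<open>D\<close> of the functions on the exterior of \<open>D\<close>.\<close>

definition exterior_conformal_map :: "complex set \<Rightarrow> (complex \<Rightarrow> complex) \<Rightarrow> bool" where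
  "exterior_conformal_map D \<phi> \<longleftrightarrow>
     (\<exists>W. open W \<and> - D \<subseteq> W \<and> \<phi> holomorphic_on W \<and> inj_on \<phi> W) \<and>
     bij_betw \<phi> (- closure D) {w. 1 < norm w} \<and>
     filterlim \<phi> at_infinity at_infinity \<and>
     (\<exists>c::real. 0 < c \<and> (deriv \<phi> \<longlongrightarrow> of_real c) at_infinity)"

definition szego_function ::
    "complex set \<Rightarrow> (complex \<Rightarrow> real) \<Rightarrow> (complex \<Rightarrow> complex) \<Rightarrow> bool" where
  "szego_function D \<omega> V \<longleftrightarrow>
     (\<exists>W. open W \<and> - D \<subseteq> W \<and> V holomorphic_on W) \<and>
     bounded (V ` (- closure D)) \<and>
     (\<forall>z\<in>frontier D. 2 * Re (V z) = - ln (\<omega> z)) \<and>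
     (\<exists>v::real. (V \<longlongrightarrow> of_real v) at_infinity)"

text \<open>The real parts in the next two definitions are harmless: both limits are real.\<close>

definition deriv_at_inf :: "(complex \<Rightarrow> complex) \<Rightarrow> real" where
  "deriv_at_inf \<phi> = Re (Lim at_infinity (deriv \<phi>))"

definition value_at_inf :: "(complex \<Rightarrow> complex) \<Rightarrow> real" where
  "value_at_inf V = Re (Lim at_infinity V)"

definition dA :: "complex measure" where
  "dA = density lborel (\<lambda>_. ennreal (1 / pi))"

definition weighted_inner ::
    "complex set \<Rightarrow> (complex \<Rightarrow> real) \<Rightarrow> (complex \<Rightarrow> complex) \<Rightarrow> (complex \<Rightarrow> complex) \<Rightarrow> complex" where
  "weighted_inner D \<omega> f g = (LINT z:D|dA. f z * cnj (g z) * of_real (\<omega> z))"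

definition normalized_orthogonal_polynomials ::
    "complex set \<Rightarrow> (complex \<Rightarrow> real) \<Rightarrow> (nat \<Rightarrow> complex poly) \<Rightarrow> bool" where
  "normalized_orthogonal_polynomials D \<omega> P \<longleftrightarrow>
     (\<forall>N. degree (P N) = N \<and>
          (\<exists>\<kappa>::real. 0 < \<kappa> \<and> lead_coeff (P N) = of_real \<kappa>) \<and>
          weighted_inner D \<omega> (poly (P N)) (poly (P N)) = 1 \<and>
          (\<forall>q. degree q < N \<longrightarrow> weighted_inner D \<omega> (poly (P N)) (poly q) = 0))"

definition leading_const :: "(nat \<Rightarrow> complex poly) \<Rightarrow> nat \<Rightarrow> real" where
  "leading_const P N = Re (lead_coeff (P N))"

definition monic_op :: "(nat \<Rightarrow> complex poly) \<Rightarrow> nat \<Rightarrow> complex poly" where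
  "monic_op P N = smult (inverse (of_real (leading_const P N))) (P N)"

definition C_const :: "(complex \<Rightarrow> complex) \<Rightarrow> (complex \<Rightarrow> complex) \<Rightarrow> nat \<Rightarrow> real" where
  "C_const \<phi> V N = inverse (deriv_at_inf \<phi> ^ (N + 1)) * exp (- value_at_inf V)"

text \<open>Solved from \<open>\<kappa>\<^sub>N = N\<^bsup>1/2\<^esup> D\<^sub>N / C\<^sub>N\<close>; only meaningful for \<open>N \<ge> 1\<close>.\<close>

definition D_const ::
    "(complex \<Rightarrow> complex) \<Rightarrow> (complex \<Rightarrow> complex) \<Rightarrow> (nat \<Rightarrow> complex poly) \<Rightarrow> nat \<Rightarrow> real" where
  "D_const \<phi> V P N = leading_const P N * C_const \<phi> V N / sqrt (real N)"

text \<open>\<open>Dr\<close> is the bounded Jordan domain with boundary curve \<open>|\<phi>| = \<rho>\<close>, where \<open>\<rho>\<close> is so close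
  to 1 that \<open>\<phi>\<close> and \<open>V\<close> are holomorphic, with \<open>\<phi>\<close> univalent, near the complement of \<open>Dr\<close>.
  The domain \<open>W\<close> is needed because \<open>\<phi>\<close> is a total function whose values deep inside \<open>D\<close> are
  arbitrary.\<close>

definition level_domain ::
    "complex set \<Rightarrow> (complex \<Rightarrow> complex) \<Rightarrow> (complex \<Rightarrow> complex) \<Rightarrow> real \<Rightarrow> complex set \<Rightarrow> bool" where
  "level_domain D \<phi> V \<rho> Dr \<longleftrightarrow>
     jordan_domain Dr \<and> Dr \<subseteq> D \<and>
     (\<exists>W. open W \<and> - Dr \<subseteq> W \<and> \<phi> holomorphic_on W \<and> inj_on \<phi> W \<and> V holomorphic_on W \<and>
          frontier Dr = {z \<in> W. norm (\<phi> z) = \<rho>})"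

definition cutoff_function :: "complex set \<Rightarrow> complex set \<Rightarrow> (complex \<Rightarrow> real) \<Rightarrow> bool" where
  "cutoff_function D Dr \<eta> \<longleftrightarrow>
     smooth \<eta> \<and> (\<forall>z. 0 \<le> \<eta> z \<and> \<eta> z \<le> 1) \<and>
     (\<exists>U. open U \<and> - D \<subseteq> U \<and> (\<forall>z\<in>U. \<eta> z = 1)) \<and>
     (\<exists>U. open U \<and> closure Dr \<subseteq> U \<and> (\<forall>z\<in>U. \<eta> z = 0))"

definition F_approx ::
    "(complex \<Rightarrow> complex) \<Rightarrow> (complex \<Rightarrow> complex) \<Rightarrow> (nat \<Rightarrow> complex poly) \<Rightarrow>
     (nat \<Rightarrow> complex \<Rightarrow> complex) \<Rightarrow> nat \<Rightarrow> nat \<Rightarrow> complex \<Rightarrow> complex" where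
  "F_approx \<phi> V P B \<kappa> N z =
     of_real (D_const \<phi> V P N * sqrt (real N)) * deriv \<phi> z * \<phi> z ^ N * exp (V z) *
     (\<Sum>j\<le>\<kappa>. B j z / of_nat N ^ j)"

end

theory Submission
  imports Defs "HOL-Computational_Algebra.Formal_Power_Series"
begin

text \<open>Let \<open>\<psi>\<close> be the inverse of \<open>\<phi>\<close> on \<open>|w| > \<rho>\<close> and \<open>\<Phi>\<^sub>N (\<psi> w) = w\<^sup>N v w\<close> with
  \<open>v w = exp (V (\<psi> w)) / \<psi>' w\<close>. In the coordinates \<open>z = \<psi> (exp (- x / 2 + i \<theta>))\<close>, polarizing the
  real-analytic weight and shifting the circle of integration to \<open>|\<sigma>| = 1\<close>, the scalar product of
  \<open>\<Phi>\<^sub>N g\<close> and \<open>\<Phi>\<^sub>N h\<close> over a collar of the boundary becomes the mean over \<open>|\<sigma>| = 1\<close> of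
  \<open>cnj (h \<sigma>)\<close> times the Laplace integral of \<open>exp (- N x) g (exp (- x) \<sigma>) K x \<sigma>\<close> over \<open>0 \<le> x \<le> x0\<close>,
  where \<open>K\<close> is holomorphic in both variables and \<open>K 0 \<sigma> = 1\<close>. The coefficients \<open>b j\<close> are chosen
  recursively so that for \<open>g = \<Sum>j. N\<^sup>-\<^sup>j b j\<close> each term of the expansion of this Laplace integral
  extends holomorphically to the disc; then the pairing with every \<open>h\<close> that is holomorphic outside
  and vanishes at infinity is negligible.

  The polynomial part \<open>Q\<close> of \<open>\<Phi>\<^sub>N g\<close> (a generalized Faber polynomial) is exponentially close to
  \<open>\<Phi>\<^sub>N g\<close> near the boundary and exponentially small inside. Its difference from \<open>\<pi>\<^sub>N / C\<^sub>N\<close> has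
  degree less than \<open>N\<close>, so its squared norm is its scalar product with \<open>Q\<close>, which is negligible.
  This gives the expansion in the mean and, by the reproducing property of circle means in a
  shrinking collar, the pointwise expansion. The squared norm of \<open>Q\<close> gives the expansion of
  \<open>1 / D\<^sub>N\<^sup>2\<close>, hence that of \<open>D\<^sub>N\<close>.\<close>

section \<open>Circle means and Laurent splitting\<close>


text \<open>The coordinate x is normalized so that |w|^(2 N) = exp (- N x): the power of \<phi>
  becomes the Laplace weight, while the area element, the modulus of \<open>v\<close> and \<omega>
  collect into \<open>K\<close>. The value \<open>K 0 \<sigma> = 1\<close> is the boundary condition
  on \<open>V\<close>. It makes the term of order l in the expansion equal to \<open>b l\<close>
  plus known quantities, so the recursion can be solved explicitly. The obstacle is that only a norm
  of the difference between Q and the orthogonal polynomial is under control, while the pairing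
  estimate asks for a supremum on the unit circle and the pointwise expansion for values at depth of
  order log N / N. Passing from the norm to such values costs a factor N, and a further power of N
  that depends on the width of the neighborhood. Since the truncation order is free, the series is
  carried far enough to pay for these losses and is then cut back to the required length.\<close>

definition cmean :: "(complex \<Rightarrow> complex) \<Rightarrow> real \<Rightarrow> complex" where
  "cmean f r = integral {0..2*pi} (\<lambda>\<theta>. f (of_real r * cis \<theta>)) / of_real (2*pi)"

lemma cmean_cong:
  assumes "0 \<le> r" "\<And>w. norm w = r \<Longrightarrow> f w = g w"
  shows "cmean f r = cmean g r"
proof -
  have "f (of_real r * cis \<theta>) = g (of_real r * cis \<theta>)" for \<theta>
    using assms by (intro assms(2)) (auto simp: norm_mult)
  thus ?thesis by (simp add: cmean_def)
qed

lemma continuous_on_circle_param: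
  assumes "0 \<le> r" "continuous_on (sphere 0 r) f"
  shows "continuous_on A (\<lambda>\<theta>. f (of_real r * cis \<theta>))"
  by (rule continuous_on_compose2[OF assms(2)])
     (use assms(1) in \<open>auto intro!: continuous_intros simp: norm_mult\<close>)

lemma integrable_circle_param:
  assumes "0 \<le> r" "continuous_on (sphere 0 r) f"
  shows "(\<lambda>\<theta>. f (of_real r * cis \<theta>) :: 'a::banach) integrable_on {0..2*pi}"
  by (intro integrable_continuous_interval continuous_on_circle_param assms)

lemma cmean_add:
  assumes "0 \<le> r" "continuous_on (sphere 0 r) f" "continuous_on (sphere 0 r) g"
  shows "cmean (\<lambda>w. f w + g w) r = cmean f r + cmean g r"
  unfolding cmean_def
  by (subst integral_add) (auto intro!: integrable_circle_param assms simp: add_divide_distrib)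

lemma cmean_diff:
  assumes "0 \<le> r" "continuous_on (sphere 0 r) f" "continuous_on (sphere 0 r) g"
  shows "cmean (\<lambda>w. f w - g w) r = cmean f r - cmean g r"
  unfolding cmean_def
  by (subst integral_diff) (auto intro!: integrable_circle_param assms simp: diff_divide_distrib)

lemma cmean_mult_left: "cmean (\<lambda>w. c * f w) r = c * cmean f r"
  unfolding cmean_def by simp

lemma cmean_bound:
  assumes "0 \<le> r" "continuous_on (sphere 0 r) f" "\<And>w. norm w = r \<Longrightarrow> norm (f w) \<le> M"
  shows "norm (cmean f r) \<le> M"
proof -
  have "norm (integral {0..2*pi} (\<lambda>\<theta>. f (of_real r * cis \<theta>))) \<le> integral {0..2*pi} (\<lambda>_. M)"
    by (intro integral_norm_bound_integral integrable_circle_param assms) (use assms(1) in \<open>auto simp: norm_mult\<close>)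
  also have "\<dots> = M * (2 * pi)" by simp
  finally show ?thesis unfolding cmean_def by (simp add: norm_divide divide_le_eq)
qed

lemma cmean_norm_le_mean_norm:
  assumes "0 \<le> r" "continuous_on (sphere 0 r) f" "continuous_on (sphere 0 r) g"
    "\<And>w. norm w = r \<Longrightarrow> norm (f w) \<le> g w"
  shows "norm (cmean f r) \<le> integral {0..2*pi} (\<lambda>\<theta>. g (of_real r * cis \<theta>)) / (2*pi)"
proof -
  have "norm (integral {0..2*pi} (\<lambda>\<theta>. f (of_real r * cis \<theta>))) \<le> integral {0..2*pi} (\<lambda>\<theta>. g (of_real r * cis \<theta>))"
    by (intro integral_norm_bound_integral integrable_circle_param assms) (use assms(1) in \<open>auto simp: norm_mult\<close>)
  thus ?thesis unfolding cmean_def by (simp add: norm_divide divide_right_mono)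
qed

lemma hol_comp:
  assumes "f holomorphic_on T" "g holomorphic_on S" "\<And>x. x \<in> S \<Longrightarrow> g x \<in> T"
  shows "(\<lambda>x. f (g x)) holomorphic_on S"
  using holomorphic_on_compose_gen[OF assms(2,1)] assms(3) by (auto simp: o_def)

lemma hol_localI:
  assumes "\<And>x. x \<in> S \<Longrightarrow> \<exists>T. open T \<and> x \<in> T \<and> f holomorphic_on T"
  shows "f holomorphic_on S"
  unfolding holomorphic_on_def
proof
  fix x assume "x \<in> S"
  then obtain T where T: "open T" "x \<in> T" "f holomorphic_on T" using assms by blast
  hence "f field_differentiable at x" by (intro holomorphic_on_imp_differentiable_at)
  thus "f field_differentiable at x within S" by (rule field_differentiable_at_within)
qed

text \<open>The primitive of \<open>f \<circ> exp\<close> on a strip changes by a constant under translation by the period.\<close>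

lemma cmean_const:
  assumes hol: "f holomorphic_on {w. r1 < norm w \<and> norm w < r2}"
    and r: "0 \<le> r1" "r1 < r" "r < r2" "r1 < s" "s < r2"
  shows "cmean f r = cmean f s"
proof -
  \<comment> \<open>\<open>r1\<close> may be 0, which has no useful logarithm, so the strip starts
    at a positive radius between \<open>r1\<close> and the two given radii.\<close>
  define p where "p = (r1 + min r s) / 2"
  have p: "0 < p" "r1 < p" "p < r" "p < s" using r by (auto simp: p_def min_def field_simps)
  define S where "S = {\<zeta>. Re \<zeta> > ln p} \<inter> {\<zeta>. Re \<zeta> < ln r2}"
  have S: "open S" "convex S"
    unfolding S_def by (auto intro!: open_Int open_halfspace_Re_gt open_halfspace_Re_lt
      convex_Int convex_halfspace_Re_gt convex_halfspace_Re_lt)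
  have r2: "r2 > 0" using r by simp
  have Sexp: "r1 < norm (exp \<zeta>) \<and> norm (exp \<zeta>) < r2" if "\<zeta> \<in> S" for \<zeta>
  proof -
    have "exp (ln p) < exp (Re \<zeta>)" "exp (Re \<zeta>) < exp (ln r2)" using that by (auto simp: S_def)
    thus ?thesis using p r2 by simp
  qed
  have "(\<lambda>\<zeta>. f (exp \<zeta>)) holomorphic_on S"
    by (rule hol_comp[OF hol]) (use Sexp in \<open>auto intro: holomorphic_intros\<close>)
  from holomorphic_convex_primitive'[OF S(2,1) this]
  obtain \<Phi> where \<Phi>0: "\<And>\<zeta>. \<zeta> \<in> S \<Longrightarrow> (\<Phi> has_field_derivative f (exp \<zeta>)) (at \<zeta> within S)"
    by blast
  have \<Phi>: "(\<Phi> has_field_derivative f (exp \<zeta>)) (at \<zeta>)" if "\<zeta> \<in> S" for \<zeta>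
    using \<Phi>0[OF that] unfolding at_within_open[OF that S(1)] .
  have "\<exists>c. \<forall>\<zeta>\<in>S. \<Phi> (\<zeta> + 2*pi*\<i>) - \<Phi> \<zeta> = c"
  proof (rule has_field_derivative_zero_constant[OF S(2)])
    fix \<zeta> assume \<zeta>: "\<zeta> \<in> S"
    have "\<zeta> + 2*pi*\<i> \<in> S" using \<zeta> by (auto simp: S_def)
    hence "((\<lambda>\<zeta>. \<Phi> (\<zeta> + 2*pi*\<i>)) has_field_derivative f (exp (\<zeta> + 2*pi*\<i>)) * 1) (at \<zeta>)"
      by (rule DERIV_chain2[OF \<Phi>]) (auto intro!: derivative_eq_intros)
    from DERIV_diff[OF this \<Phi>[OF \<zeta>]]
    have "((\<lambda>\<zeta>. \<Phi> (\<zeta> + 2*pi*\<i>) - \<Phi> \<zeta>) has_field_derivative f (exp (\<zeta> + 2*pi*\<i>)) * 1 - f (exp \<zeta>)) (at \<zeta>)" .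
    moreover have "exp (\<zeta> + 2*pi*\<i>) = exp \<zeta>" by (simp add: exp_add exp_eq_1 exp_two_pi_i)
    ultimately show "((\<lambda>\<zeta>. \<Phi> (\<zeta> + 2*pi*\<i>) - \<Phi> \<zeta>) has_field_derivative 0) (at \<zeta> within S)"
      by (simp add: has_field_derivative_at_within)
  qed
  then obtain c where c: "\<And>\<zeta>. \<zeta> \<in> S \<Longrightarrow> \<Phi> (\<zeta> + 2*pi*\<i>) - \<Phi> \<zeta> = c" by blast
  have "cmean f t = (c / \<i>) / of_real (2*pi)" if t: "p < t" "t < r2" for t
  proof -
    define x where "x = ln t"
    have t0: "t > 0" using t p by simp
    have xS: "of_real x + \<i> * of_real \<theta> \<in> S" for \<theta>
      using t p r2 t0 by (auto simp: S_def x_def)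
    \<comment> \<open>Along the vertical line over x = ln t the primitive increases by
      \<open>c\<close> per period. As \<open>c\<close> does not depend on x, the radius drops
      out.\<close>
    have "((\<lambda>\<theta>. f (exp (of_real x + \<i> * of_real \<theta>))) has_integral
        (\<Phi> (of_real x + \<i> * of_real (2*pi)) / \<i> - \<Phi> (of_real x + \<i> * of_real 0) / \<i>)) {0..2*pi}"
    proof (rule fundamental_theorem_of_calculus)
      fix \<theta> assume "\<theta> \<in> {0..2*pi}"
      have "((\<lambda>z. \<Phi> (of_real x + \<i> * z) / \<i>) has_field_derivative
              f (exp (of_real x + \<i> * of_real \<theta>)) * \<i> / \<i>) (at (of_real \<theta>))"
        by (intro DERIV_cdivide DERIV_chain2[where g = "\<lambda>z. of_real x + \<i> * z", OF \<Phi>] xS)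
          (auto intro!: derivative_eq_intros)
      from has_vector_derivative_real_field[OF this]
      show "((\<lambda>\<theta>. \<Phi> (of_real x + \<i> * of_real \<theta>) / \<i>) has_vector_derivative
              f (exp (of_real x + \<i> * of_real \<theta>))) (at \<theta> within {0..2*pi})"
        unfolding nonzero_mult_div_cancel_right[OF complex_i_not_zero]
        by (rule has_vector_derivative_at_within)
    qed simp
    also have "(\<lambda>\<theta>. f (exp (of_real x + \<i> * of_real \<theta>))) = (\<lambda>\<theta>. f (of_real t * cis \<theta>))"
      using t0 by (simp add: exp_add x_def exp_of_real cis_conv_exp)
    also have "\<Phi> (of_real x + \<i> * of_real (2*pi)) / \<i> - \<Phi> (of_real x + \<i> * of_real 0) / \<i> = c / \<i>"
      using c[OF xS[of 0]] unfolding diff_divide_distrib [symmetric] by (simp add: mult_ac)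
    finally have "((\<lambda>\<theta>. f (of_real t * cis \<theta>)) has_integral c / \<i>) {0..2*pi}" .
    thus ?thesis by (simp add: cmean_def integral_unique)
  qed
  thus ?thesis using p r by simp
qed

lemma continuous_on_mean_radius:
  assumes "continuous_on {w. norm w \<in> T} f" "T \<subseteq> {0..}"
  shows "continuous_on T (\<lambda>r. cmean f r)"
proof -
  have "continuous_on T (\<lambda>r. integral (cbox 0 (2*pi)) (\<lambda>\<theta>. f (of_real r * cis \<theta>)))"
    by (rule integral_continuous_on_param)
       (use assms(2) in \<open>auto intro!: continuous_on_compose2[OF assms(1)] continuous_intros simp: split_def norm_mult\<close>)
  thus ?thesis unfolding cmean_def by (auto intro!: continuous_intros)
qed

lemma cmean_holomorphic:
  assumes "f holomorphic_on ball 0 R" "0 \<le> r" "r < R"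
  shows "cmean f r = f 0"
proof -
  have *: "((\<lambda>t. f (0 + of_real r * cis t) / (of_real r * cis t) ^ Suc 0 * of_real r * \<i> * cis t) has_integral (2 * of_real pi * \<i> * f 0)) {0..2*pi}" if "r > 0"
  proof -
    have "((\<lambda>u. f u/(u-0)) has_contour_integral (2 * of_real pi * \<i> * f 0)) (circlepath 0 r)"
      by (rule Cauchy_integral_circlepath)
         (use assms that in \<open>auto intro!: holomorphic_on_imp_continuous_on holomorphic_on_subset[OF assms(1)]\<close>)
    thus ?thesis unfolding circlepath_def
      by (subst (asm) has_contour_integral_part_circlepath_iff) auto
  qed
  show ?thesis
  proof (cases "r = 0")
    case True thus ?thesis by (simp add: cmean_def scaleR_conv_of_real)
  next
    case False
    hence "((\<lambda>t. \<i> * f (of_real r * cis t)) has_integral (\<i> * (2 * of_real pi * f 0))) {0..2*pi}"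
      using * assms by (simp add: field_simps)
    hence "((\<lambda>t. f (of_real r * cis t)) has_integral (2 * of_real pi * f 0)) {0..2*pi}"
      using has_integral_mult_right[of "\<lambda>t. \<i> * f (of_real r * cis t)" "\<i> * (2 * of_real pi * f 0)" "{0..2*pi}" "-\<i>"]
      by (simp add: mult.assoc[symmetric])
    thus ?thesis by (simp add: cmean_def integral_unique)
  qed
qed

text \<open>Inversion reverses the sense in which the circle is traversed, and a mean over the angle
  does not see this: \<theta> becomes - \<theta>, and periodicity brings it back to the original
  interval.\<close>

lemma cmean_inverse:
  assumes "r > 0"
  shows "cmean (\<lambda>w. f (1 / w)) r = cmean f (1 / r)"
proof -
  have "integral {0..2*pi} (\<lambda>\<theta>. f (of_real (1/r) * cis (- \<theta>))) = integral {-2*pi..0} (\<lambda>\<theta>. f (of_real (1/r) * cis \<theta>))"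
    using Henstock_Kurzweil_Integration.integral_reflect_real[of "2*pi" 0 "\<lambda>\<theta>. f (of_real (1/r) * cis (- \<theta>))"] by simp
  also have "\<dots> = integral {0..2*pi} (\<lambda>\<theta>. f (of_real (1/r) * cis (\<theta> - 2*pi)))"
    using integral_shift_Icc_real[of 0 "2*pi" "\<lambda>\<theta>. f (of_real (1/r) * cis \<theta>)" "-2*pi"] by (simp add: o_def)
  also have "(\<lambda>\<theta>. cis (\<theta> - 2*pi)) = cis" by (rule ext) (simp add: cis_divide [symmetric])
  hence "integral {0..2*pi} (\<lambda>\<theta>. f (of_real (1/r) * cis (\<theta> - 2*pi))) = integral {0..2*pi} (\<lambda>\<theta>. f (of_real (1/r) * cis \<theta>))"
    by (metis (no_types))
  finally have *: "integral {0..2*pi} (\<lambda>\<theta>. f (of_real (1/r) * cis (- \<theta>))) =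
    integral {0..2*pi} (\<lambda>\<theta>. f (of_real (1/r) * cis \<theta>))" .
  have "1 / (of_real r * cis \<theta>) = of_real (1/r) * cis (- \<theta>)" for \<theta>
    by (simp add: divide_inverse)
  thus ?thesis unfolding cmean_def using * by simp
qed

text \<open>A contour integral of f is 2 pi i times the mean of \<zeta> f, so the Cauchy kernel
  appears as \<zeta> / (\<zeta> - \<sigma>). Inversion turns it into 1 / (1 - \<sigma> \<omega>),
  which has no singularity in the disc of radius 1 / r, and the mean is its value at 0.\<close>

lemma cmean_kernel_inside:
  assumes "norm \<sigma> < r"
  shows "cmean (\<lambda>\<zeta>. \<zeta> / (\<zeta> - \<sigma>)) r = 1"
proof -
  have r: "r > 0" using assms norm_ge_zero[of \<sigma>] by linarith
  have "cmean (\<lambda>\<zeta>. \<zeta> / (\<zeta> - \<sigma>)) r = cmean (\<lambda>\<zeta>. 1 / (1 - \<sigma> * (1 / \<zeta>))) r"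
    using r assms by (intro cmean_cong) (auto simp: field_simps)
  also have "\<dots> = cmean (\<lambda>\<omega>. 1 / (1 - \<sigma> * \<omega>)) (1 / r)" by (rule cmean_inverse[OF r])
  also have "\<dots> = 1 / (1 - \<sigma> * 0)"
  \<comment> \<open>The reciprocal of the midpoint of norm \<sigma> and r exceeds 1 / r, stays below
    the modulus 1 / norm \<sigma> of the pole, and makes sense also for \<sigma> = 0.\<close>
  proof (rule cmean_holomorphic[where R = "2 / (r + norm \<sigma>)"])
    have "\<sigma> * \<omega> \<noteq> 1" if "norm \<omega> < 2 / (r + norm \<sigma>)" for \<omega>
    proof
      assume "\<sigma> * \<omega> = 1"
      hence 1: "norm \<sigma> * norm \<omega> = 1" by (metis norm_mult norm_one)
      have "norm \<sigma> * norm \<omega> \<le> norm \<sigma> * (2 / (r + norm \<sigma>))"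
        using that by (intro mult_left_mono) auto
      also have "\<dots> < 1" using assms r by (simp add: field_simps add_pos_nonneg)
      finally show False using 1 by simp
    qed
    thus "(\<lambda>\<omega>. 1 / (1 - \<sigma> * \<omega>)) holomorphic_on ball 0 (2 / (r + norm \<sigma>))"
      by (auto intro!: holomorphic_intros)
    show "1 / r < 2 / (r + norm \<sigma>)" using assms r by (simp add: field_simps add_pos_nonneg)
  qed (use r in auto)
  finally show ?thesis by simp
qed

lemma cmean_kernel_outside:
  assumes "0 \<le> r" "r < norm \<sigma>"
  shows "cmean (\<lambda>\<zeta>. \<zeta> / (\<zeta> - \<sigma>)) r = 0"
proof -
  have "cmean (\<lambda>\<zeta>. \<zeta> / (\<zeta> - \<sigma>)) r = 0 / (0 - \<sigma>)"
    by (rule cmean_holomorphic[where R = "norm \<sigma>"]) (use assms in \<open>auto intro!: holomorphic_intros\<close>)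
  thus ?thesis by simp
qed

lemma open_annulus: "open {w::complex. r1 < norm w \<and> norm w < r2}"
  by (intro open_Collect_conj open_Collect_less continuous_intros)

lemma open_exterior: "open {w::complex. r < norm w}"
  by (intro open_Collect_less continuous_intros)

text \<open>The difference quotient at \<sigma> extends holomorphically, so it contributes equally
  on both circles. What remains is \<open>f \<sigma>\<close> times the mean of the kernel, which is
  1 on the outer circle and 0 on the inner one.\<close>

lemma cmean_laurent:
  assumes hol: "f holomorphic_on {w. r1 < norm w \<and> norm w < r2}"
    and r: "0 \<le> r1" "r1 < p" "p < norm \<sigma>" "norm \<sigma> < q" "q < r2"
  shows "f \<sigma> = cmean (\<lambda>\<zeta>. f \<zeta> * \<zeta> / (\<zeta> - \<sigma>)) q - cmean (\<lambda>\<zeta>. f \<zeta> * \<zeta> / (\<zeta> - \<sigma>)) p"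
proof -
  let ?A = "{w. r1 < norm w \<and> norm w < r2}"
  define g where "g \<zeta> = (if \<zeta> = \<sigma> then deriv f \<sigma> else (f \<zeta> - f \<sigma>) / (\<zeta> - \<sigma>))" for \<zeta>
  have g: "g holomorphic_on ?A" unfolding g_def
    by (rule pole_lemma[OF hol]) (use r in \<open>auto simp: interior_open open_annulus\<close>)
  have eq: "cmean (\<lambda>\<zeta>. f \<zeta> * \<zeta> / (\<zeta> - \<sigma>)) t = cmean (\<lambda>\<zeta>. \<zeta> * g \<zeta>) t + f \<sigma> * cmean (\<lambda>\<zeta>. \<zeta> / (\<zeta> - \<sigma>)) t"
    if t: "t \<noteq> norm \<sigma>" "r1 < t" "t < r2" for t
  proof -
    have "cmean (\<lambda>\<zeta>. f \<zeta> * \<zeta> / (\<zeta> - \<sigma>)) t = cmean (\<lambda>\<zeta>. \<zeta> * g \<zeta> + f \<sigma> * (\<zeta> / (\<zeta> - \<sigma>))) t"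
    proof (rule cmean_cong)
      fix w :: complex assume w: "norm w = t"
      hence ne: "w - \<sigma> \<noteq> 0" using t by auto
      have "f w * w / (w - \<sigma>) = w * ((f w - f \<sigma>) / (w - \<sigma>)) + f \<sigma> * (w / (w - \<sigma>))"
        by (simp add: add_divide_distrib [symmetric] algebra_simps)
      thus "f w * w / (w - \<sigma>) = w * g w + f \<sigma> * (w / (w - \<sigma>))" using ne by (simp add: g_def)
    qed (use t r in auto)
    also have "\<dots> = cmean (\<lambda>\<zeta>. \<zeta> * g \<zeta>) t + cmean (\<lambda>\<zeta>. f \<sigma> * (\<zeta> / (\<zeta> - \<sigma>))) t"
    proof (rule cmean_add)
      show "continuous_on (sphere 0 t) (\<lambda>\<zeta>. \<zeta> * g \<zeta>)"
        using t by (intro continuous_intros continuous_on_subset[OF holomorphic_on_imp_continuous_on[OF g]]) auto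
      show "continuous_on (sphere 0 t) (\<lambda>\<zeta>. f \<sigma> * (\<zeta> / (\<zeta> - \<sigma>)))"
        using t by (intro continuous_intros) auto
    qed (use t r in auto)
    finally show ?thesis by (simp only: cmean_mult_left)
  qed
  have "cmean (\<lambda>\<zeta>. \<zeta> * g \<zeta>) p = cmean (\<lambda>\<zeta>. \<zeta> * g \<zeta>) q"
    by (rule cmean_const[where ?r1.0 = r1 and ?r2.0 = r2]) (use r in \<open>auto intro!: holomorphic_intros g\<close>)
  thus ?thesis using r eq[of p] eq[of q] cmean_kernel_inside[of \<sigma> q] cmean_kernel_outside[of p \<sigma>] by simp
qed

text \<open>The position of the pole is a general function \<open>p\<close> of the circle point: the
  identity is used for Laurent series, and \<psi> for Faber polynomials.\<close>

lemma cauchy_transform_holomorphic: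
  assumes r: "0 \<le> r" and G: "continuous_on (sphere 0 r) G" and p: "continuous_on (sphere 0 r) p"
  shows "(\<lambda>z. cmean (\<lambda>w. G w / (p w - z)) r) holomorphic_on - (p ` sphere 0 r)"
proof (rule hol_localI)
  fix z0 assume z0: "z0 \<in> - (p ` sphere 0 r)"
  have "closed (p ` sphere 0 r)" by (intro compact_imp_closed compact_continuous_image p) auto
  then obtain e where e: "e > 0" "ball z0 e \<subseteq> - (p ` sphere 0 r)"
    using z0 by (meson open_Compl open_contains_ball)
  have ne: "p w \<noteq> z" if "norm w = r" "z \<in> ball z0 e" for w z using e that by auto
  have nw: "norm (of_real r * cis \<theta>) = r" for \<theta> using r by (simp add: norm_mult)
  note cw = continuous_on_compose2[OF continuous_on_circle_param[OF r G, of UNIV] _ subset_UNIV]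
    continuous_on_compose2[OF continuous_on_circle_param[OF r p, of UNIV] _ subset_UNIV]
  have "(\<lambda>z. integral (cbox 0 (2*pi)) (\<lambda>\<theta>. G (of_real r * cis \<theta>) / (p (of_real r * cis \<theta>) - z))) holomorphic_on ball z0 e"
  proof (rule leibniz_rule_holomorphic)
    fix z \<theta> assume z: "z \<in> ball z0 e"
    show "((\<lambda>z. G (of_real r * cis \<theta>) / (p (of_real r * cis \<theta>) - z)) has_field_derivative
        G (of_real r * cis \<theta>) / (p (of_real r * cis \<theta>) - z)^2) (at z within ball z0 e)"
      using ne[OF nw z, of \<theta>]
      by (auto intro!: derivative_eq_intros simp: power2_eq_square)
  next
    fix z assume z: "z \<in> ball z0 e"
    show "(\<lambda>\<theta>. G (of_real r * cis \<theta>) / (p (of_real r * cis \<theta>) - z)) integrable_on cbox 0 (2*pi)"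
      by (rule integrable_continuous) (use ne[OF nw z] in \<open>auto intro!: continuous_intros cw\<close>)
  next
    show "continuous_on (ball z0 e \<times> cbox 0 (2*pi)) (\<lambda>(z, \<theta>). G (of_real r * cis \<theta>) / (p (of_real r * cis \<theta>) - z)^2)"
      unfolding split_def by (intro continuous_intros cw) (use ne[OF nw] in auto)
  qed simp
  hence "(\<lambda>z. cmean (\<lambda>w. G w / (p w - z)) r) holomorphic_on ball z0 e"
    unfolding cmean_def by (auto intro!: holomorphic_intros)
  thus "\<exists>T. open T \<and> z0 \<in> T \<and> (\<lambda>z. cmean (\<lambda>w. G w / (p w - z)) r) holomorphic_on T"
    using e by (intro exI[of _ "ball z0 e"]) auto
qed

lemma cauchy_transform_tendsto_0:
  assumes r: "0 \<le> r" and G: "continuous_on (sphere 0 r) G" and p: "continuous_on (sphere 0 r) p"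
  shows "((\<lambda>z. cmean (\<lambda>w. G w / (p w - z)) r) \<longlongrightarrow> 0) at_infinity"
proof -
  have "compact (sphere (0::complex) r)" by simp
  from compact_imp_bounded[OF compact_continuous_image[OF G this]]
  obtain M where M: "M > 0" "\<And>w. norm w = r \<Longrightarrow> norm (G w) \<le> M" unfolding bounded_pos by auto
  from compact_imp_bounded[OF compact_continuous_image[OF p \<open>compact (sphere (0::complex) r)\<close>]]
  obtain L where L: "L > 0" "\<And>w. norm w = r \<Longrightarrow> norm (p w) \<le> L" unfolding bounded_pos by auto
  have "norm (cmean (\<lambda>w. G w / (p w - z)) r) \<le> M / (norm z - L)" if z: "norm z > L" for z
  proof (rule cmean_bound[OF r])
    have ge: "norm (p w - z) \<ge> norm z - L" if "norm w = r" for w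
      using L(2)[OF that] norm_triangle_ineq2[of z "p w"] by (simp add: norm_minus_commute)
    thus "continuous_on (sphere 0 r) (\<lambda>w. G w / (p w - z))"
      using L(2) z by (intro continuous_intros G p) fastforce
    fix w :: complex assume w: "norm w = r"
    show "norm (G w / (p w - z)) \<le> M / (norm z - L)"
      unfolding norm_divide using M w ge[OF w] z by (intro frac_le) auto
  qed
  hence "\<forall>\<^sub>F z in at_infinity. norm (cmean (\<lambda>w. G w / (p w - z)) r) \<le> M / (norm z - L)"
    unfolding eventually_at_infinity by (intro exI[of _ "L+1"]) auto
  moreover have "((\<lambda>z::complex. M / (norm z - L)) \<longlongrightarrow> 0) at_infinity"
  proof -
    have "filterlim (\<lambda>z::complex. - L + norm z) at_top at_infinity"
      by (rule filterlim_tendsto_add_at_top[OF tendsto_const filterlim_norm_at_top])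
    hence "filterlim (\<lambda>z::complex. norm z - L) at_top at_infinity" by simp
    thus ?thesis by (rule real_tendsto_divide_at_top[OF tendsto_const])
  qed
  ultimately show ?thesis by (rule Lim_null_comparison)
qed

text \<open>In Laurent's formula the integral over an outer circle is holomorphic in the disc, and
  the one over an inner circle is holomorphic outside and vanishes at infinity. Letting the circles
  follow the point extends both parts to their full domains.\<close>

lemma laurent_splitting:
  assumes hol: "f holomorphic_on {w. a < norm w \<and> norm w < b}" and ab: "0 \<le> a" "a < b"
  obtains g h where "g holomorphic_on ball 0 b" "h holomorphic_on {w. a < norm w}" "(h \<longlongrightarrow> 0) at_infinity"
    "\<And>w. a < norm w \<Longrightarrow> norm w < b \<Longrightarrow> f w = g w + h w"
proof -
  define k where "k \<sigma> \<zeta> = f \<zeta> * \<zeta> / (\<zeta> - \<sigma>)" for \<sigma> \<zeta>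
  have k1: "cmean (k \<sigma>) p = cmean (k \<sigma>) p'"
    if "a < p" "p < norm \<sigma>" "p < b" "a < p'" "p' < norm \<sigma>" "p' < b" for \<sigma> p p'
  proof (rule cmean_const[where ?r1.0 = a and ?r2.0 = "min b (norm \<sigma>)"])
    show "k \<sigma> holomorphic_on {w. a < norm w \<and> norm w < min b (norm \<sigma>)}"
      unfolding k_def by (auto intro!: holomorphic_intros holomorphic_on_subset[OF hol])
  qed (use that ab in auto)
  have k2: "cmean (k \<sigma>) p = cmean (k \<sigma>) p'"
    if "a < p" "p > norm \<sigma>" "p < b" "a < p'" "p' > norm \<sigma>" "p' < b" for \<sigma> p p'
  proof (rule cmean_const[where ?r1.0 = "max a (norm \<sigma>)" and ?r2.0 = b])
    show "k \<sigma> holomorphic_on {w. max a (norm \<sigma>) < norm w \<and> norm w < b}"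
      unfolding k_def by (auto intro!: holomorphic_intros holomorphic_on_subset[OF hol])
  qed (use that ab in auto)
  have cont: "continuous_on (sphere 0 p) (\<lambda>\<zeta>. f \<zeta> * \<zeta>)" if "a < p" "p < b" for p
    using that by (intro continuous_intros continuous_on_subset[OF holomorphic_on_imp_continuous_on[OF hol]]) auto
  have khol: "(\<lambda>\<sigma>. cmean (k \<sigma>) p) holomorphic_on - sphere 0 p" if "a < p" "p < b" for p
    using cauchy_transform_holomorphic[OF _ cont[OF that] continuous_on_id] that ab unfolding k_def by simp
  define h where "h \<sigma> = - cmean (k \<sigma>) ((a + min (norm \<sigma>) b) / 2)" for \<sigma>
  define g where "g \<sigma> = cmean (k \<sigma>) ((b + max (norm \<sigma>) a) / 2)" for \<sigma>
  have h: "h \<sigma> = - cmean (k \<sigma>) p" if "a < p" "p < norm \<sigma>" "p < b" for \<sigma> p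
    unfolding h_def using that ab k1[of "(a + min (norm \<sigma>) b) / 2" \<sigma> p] by (auto simp: min_def)
  have g: "g \<sigma> = cmean (k \<sigma>) p" if "a < p" "p > norm \<sigma>" "p < b" for \<sigma> p
    unfolding g_def using that ab k2[of "(b + max (norm \<sigma>) a) / 2" \<sigma> p] by (auto simp: max_def)
  show ?thesis
  proof
    show "h holomorphic_on {w. a < norm w}"
    proof (rule hol_localI)
      fix x :: complex assume x: "x \<in> {w. a < norm w}"
      define p where "p = (a + min (norm x) b) / 2"
      have p: "a < p" "p < norm x" "p < b" using x ab by (auto simp: p_def min_def)
      have "(\<lambda>\<sigma>. - cmean (k \<sigma>) p) holomorphic_on {w. p < norm w}"
        using p by (intro holomorphic_intros holomorphic_on_subset[OF khol]) auto
      hence "h holomorphic_on {w. p < norm w}"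
        by (rule holomorphic_transform) (use h p in auto)
      thus "\<exists>T. open T \<and> x \<in> T \<and> h holomorphic_on T" using p open_exterior by blast
    qed
    show "g holomorphic_on ball 0 b"
    proof (rule hol_localI)
      fix x assume x: "x \<in> ball (0::complex) b"
      define p where "p = (b + max (norm x) a) / 2"
      have p: "a < p" "p > norm x" "p < b" using x ab by (auto simp: p_def max_def)
      have "(\<lambda>\<sigma>. cmean (k \<sigma>) p) holomorphic_on ball 0 p"
        using p by (intro holomorphic_intros holomorphic_on_subset[OF khol]) auto
      hence "g holomorphic_on ball 0 p"
        by (rule holomorphic_transform) (use g p in auto)
      thus "\<exists>T. open T \<and> x \<in> T \<and> g holomorphic_on T" using p by (intro exI[of _ "ball 0 p"]) auto
    qed
    define p where "p = (a + b) / 2"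
    have p: "a < p" "p < b" using ab by (auto simp: p_def)
    have "((\<lambda>\<sigma>. - cmean (k \<sigma>) p) \<longlongrightarrow> - 0) at_infinity"
      using cauchy_transform_tendsto_0[OF _ cont[OF p] continuous_on_id] p ab unfolding k_def
      by (intro tendsto_minus) auto
    moreover have "\<forall>\<^sub>F \<sigma> in at_infinity. - cmean (k \<sigma>) p = h \<sigma>"
      unfolding eventually_at_infinity by (intro exI[of _ "p+1"]) (use h p in auto)
    ultimately show "(h \<longlongrightarrow> 0) at_infinity" by (simp add: tendsto_cong)
    fix w :: complex assume w: "a < norm w" "norm w < b"
    define p where "p = (a + norm w) / 2" define q where "q = (b + norm w) / 2"
    have "f w = cmean (k w) q - cmean (k w) p" unfolding k_def
      by (rule cmean_laurent[OF hol]) (use ab w in \<open>auto simp: p_def q_def\<close>)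
    also have "\<dots> = g w + h w" using g[of q w] h[of p w] ab w by (auto simp: p_def q_def)
    finally show "f w = g w + h w" .
  qed
qed

text \<open>This is Laurent's formula with the outer circle sent to infinity, where its mean dies
  out because f tends to 0.\<close>

lemma cauchy_exterior:
  assumes hol: "f holomorphic_on {w. a < norm w}" and lim: "(f \<longlongrightarrow> 0) at_infinity"
    and r: "0 \<le> a" "a < r" "r < norm u"
  shows "f u = - cmean (\<lambda>\<zeta>. f \<zeta> * \<zeta> / (\<zeta> - u)) r"
proof -
  have "norm (f u + cmean (\<lambda>\<zeta>. f \<zeta> * \<zeta> / (\<zeta> - u)) r) \<le> e" if e: "e > 0" for e
  proof -
    have "\<forall>\<^sub>F z in at_infinity. norm (f z) < e / 2" using tendstoD[OF lim, of "e/2"] e by simp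
    then obtain b where b: "\<And>z. norm z \<ge> b \<Longrightarrow> norm (f z) < e / 2" unfolding eventually_at_infinity by blast
    \<comment> \<open>The entry 2 norm u bounds |\<zeta> / (\<zeta> - u)| by 2 on the outer circle,
      which matches the e / 2 in the choice of b.\<close>
    define q where "q = max b (2 * norm u)"
    have u: "norm u > 0" using r by linarith
    have q: "q \<ge> b" "q \<ge> 2 * norm u" "q > norm u" "q > 0" using u unfolding q_def by linarith+
    have "f u = cmean (\<lambda>\<zeta>. f \<zeta> * \<zeta> / (\<zeta> - u)) q - cmean (\<lambda>\<zeta>. f \<zeta> * \<zeta> / (\<zeta> - u)) r"
      by (rule cmean_laurent[of _ a "q+1"]) (use r q in \<open>auto intro!: holomorphic_on_subset[OF hol]\<close>)
    hence "f u + cmean (\<lambda>\<zeta>. f \<zeta> * \<zeta> / (\<zeta> - u)) r = cmean (\<lambda>\<zeta>. f \<zeta> * \<zeta> / (\<zeta> - u)) q" by simp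
    also have "norm \<dots> \<le> e"
    proof (rule cmean_bound)
      show "continuous_on (sphere 0 q) (\<lambda>\<zeta>. f \<zeta> * \<zeta> / (\<zeta> - u))"
        using q r by (intro continuous_intros continuous_on_subset[OF holomorphic_on_imp_continuous_on[OF hol]]) auto
      fix w :: complex assume w: "norm w = q"
      have "norm (w - u) \<ge> q - norm u" using norm_triangle_ineq2[of w u] w by simp
      hence wu: "norm (w - u) \<ge> q / 2" using q by simp
      have "norm (f w * w / (w - u)) \<le> (e / 2 * q) / (q / 2)"
        unfolding norm_divide norm_mult w using b[of w] w q wu e
        by (intro frac_le mult_right_mono) auto
      thus "norm (f w * w / (w - u)) \<le> e" using q by simp
    qed (use q in auto)
    finally show ?thesis .
  qed
  hence "norm (f u + cmean (\<lambda>\<zeta>. f \<zeta> * \<zeta> / (\<zeta> - u)) r) \<le> 0"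
    using field_le_epsilon[of "norm (f u + cmean (\<lambda>\<zeta>. f \<zeta> * \<zeta> / (\<zeta> - u)) r)" 0] by simp
  thus ?thesis by (simp add: add_eq_0_iff)
qed

section \<open>Watson expansion of Laplace integrals\<close>


text \<open>On the unit circle \<sigma> = 1 / cnj \<sigma>, so \<open>cnj (h \<sigma>)\<close> is
  the boundary value of the reflected function cnj (h (1 / cnj \<sigma>)). That function is
  holomorphic in the punctured disc and tends to cnj l at 0, so the mean value property applies to
  its product with \<open>R\<close>. In particular the pairing vanishes for l = 0.\<close>

lemma cmean_pairing:
  assumes a: "0 < a" "a < 1" and R: "R holomorphic_on ball 0 (1/a)"
    and h: "h holomorphic_on {w. a < norm w}" and lim: "(h \<longlongrightarrow> l) at_infinity"
  shows "cmean (\<lambda>\<sigma>. R \<sigma> * cnj (h \<sigma>)) 1 = R 0 * cnj l"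
proof -
  have inv: "a < norm (inverse \<sigma>)" if "norm \<sigma> < 1/a" "\<sigma> \<noteq> 0" for \<sigma> :: complex
  proof -
    have "a * norm \<sigma> < 1" using that a by (simp add: field_simps)
    thus ?thesis using that by (simp add: norm_divide inverse_eq_divide pos_less_divide_eq)
  qed
  have "(\<lambda>\<sigma>. h (inverse \<sigma>)) holomorphic_on (ball 0 (1/a) - {0})"
    by (rule hol_comp[OF h]) (use inv in \<open>auto intro!: holomorphic_intros\<close>)
  moreover have "cnj ` (ball 0 (1/a) - {0}) = ball 0 (1/a) - {0}"
    by (auto simp: image_def intro!: exI[of _ "cnj _"] bexI[of _ "cnj _"])
  ultimately have "cnj \<circ> (\<lambda>\<sigma>. h (inverse \<sigma>)) \<circ> cnj holomorphic_on (ball 0 (1/a) - {0})"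
    by (intro holomorphic_on_compose_cnj_cnj) (auto intro!: open_delete)
  hence hc: "(\<lambda>\<sigma>. R \<sigma> * cnj (h (inverse (cnj \<sigma>)))) holomorphic_on (ball 0 (1/a) - {0})"
    using R by (auto simp: o_def intro!: holomorphic_intros intro: holomorphic_on_subset)
  have "filterlim cnj (at 0) (at 0)"
    using a by (auto simp: filterlim_at eventually_at_filter intro!: tendsto_eq_intros)
  hence "filterlim (\<lambda>\<sigma>. inverse (cnj \<sigma>)) at_infinity (at 0)"
    by (rule filterlim_compose[OF filterlim_inverse_at_infinity])
  hence "((\<lambda>\<sigma>. cnj (h (inverse (cnj \<sigma>)))) \<longlongrightarrow> cnj l) (at 0)"
    by (intro tendsto_cnj filterlim_compose[OF lim])
  moreover have "(R \<longlongrightarrow> R 0) (at 0)"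
    using holomorphic_on_imp_continuous_on[OF R] a continuous_on_eq_continuous_at[of "ball 0 (1/a)" R]
    by (auto simp: isCont_def)
  ultimately have "((\<lambda>\<sigma>. R \<sigma> * cnj (h (inverse (cnj \<sigma>)))) \<longlongrightarrow> R 0 * cnj l) (at 0)"
    by (intro tendsto_mult)
  from removable_singularity[OF hc _ this]
  have "(\<lambda>\<sigma>. if \<sigma> = 0 then R 0 * cnj l else R \<sigma> * cnj (h (inverse (cnj \<sigma>)))) holomorphic_on ball 0 (1/a)" by simp
  from cmean_holomorphic[OF this, of 1]
  have *: "cmean (\<lambda>\<sigma>. if \<sigma> = 0 then R 0 * cnj l else R \<sigma> * cnj (h (inverse (cnj \<sigma>)))) 1 = R 0 * cnj l"
    using a by simp
  have "inverse (cnj \<sigma>) = \<sigma>" if "norm \<sigma> = 1" for \<sigma>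
    using that complex_norm_square[of \<sigma>] by (intro inverse_unique) (simp add: mult.commute)
  hence "cmean (\<lambda>\<sigma>. R \<sigma> * cnj (h \<sigma>)) 1 = cmean (\<lambda>\<sigma>. if \<sigma> = 0 then R 0 * cnj l else R \<sigma> * cnj (h (inverse (cnj \<sigma>)))) 1"
    by (intro cmean_cong) auto
  thus ?thesis using * by simp
qed

lemma higher_deriv_cmean:
  assumes g: "g holomorphic_on ball z R" and e: "0 < e" "e < R"
  shows "(deriv ^^ k) g z = fact k * cmean (\<lambda>\<zeta>. g (z + \<zeta>) / \<zeta> ^ k) e"
proof -
  have "((\<lambda>u. g u / (u-z) ^ (Suc k)) has_contour_integral ((2 * pi * \<i>) / (fact k) * (deriv ^^ k) g z)) (circlepath z e)"
    by (rule Cauchy_has_contour_integral_higher_derivative_circlepath)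
       (use e in \<open>auto intro!: holomorphic_on_imp_continuous_on holomorphic_on_subset[OF g]\<close>)
  hence "((\<lambda>t. g (z + of_real e * cis t) / (z + of_real e * cis t - z) ^ Suc k * of_real e * \<i> * cis t)
      has_integral ((2 * pi * \<i>) / (fact k) * (deriv ^^ k) g z)) {0..2*pi}"
    unfolding circlepath_def by (subst (asm) has_contour_integral_part_circlepath_iff) auto
  also have "(\<lambda>t. g (z + of_real e * cis t) / (z + of_real e * cis t - z) ^ Suc k * of_real e * \<i> * cis t)
      = (\<lambda>t. \<i> * (g (z + of_real e * cis t) / (of_real e * cis t) ^ k))"
    using e by (intro ext) (simp add: field_simps)
  finally have "integral {0..2*pi} (\<lambda>t. \<i> * (g (z + of_real e * cis t) / (of_real e * cis t) ^ k)) = (2 * pi * \<i>) / (fact k) * (deriv ^^ k) g z"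
    by (rule integral_unique)
  thus ?thesis unfolding cmean_def integral_mult_right by (simp add: field_simps)
qed

section \<open>Holomorphic dependence on parameters\<close>

lemma hol_param_integral:
  fixes G :: "complex \<Rightarrow> real \<Rightarrow> complex"
  assumes U: "open U" and cont: "continuous_on (U \<times> {a..b}) (\<lambda>(z, t). G z t)"
    and hol: "\<And>t. t \<in> {a..b} \<Longrightarrow> (\<lambda>z. G z t) holomorphic_on U"
  shows "(\<lambda>z. integral {a..b} (G z)) holomorphic_on U"
proof (rule hol_localI)
  fix z0 assume z0: "z0 \<in> U"
  then obtain e0 where e0: "e0 > 0" "ball z0 e0 \<subseteq> U" using U by (meson open_contains_ball)
  \<comment> \<open>Around every point of the ball of radius e about z0 a circle of radius e still
    lies in U. The mean over it expresses the derivative in z in a jointly continuous form, as the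
    Leibniz rule requires.\<close>
  define e where "e = e0 / 3"
  have e: "e > 0" and sub: "\<And>z y. z \<in> ball z0 e \<Longrightarrow> dist z y < 2 * e \<Longrightarrow> y \<in> U"
  proof -
    show "e > 0" using e0 by (simp add: e_def)
    fix z y assume "z \<in> ball z0 e" "dist z y < 2 * e"
    hence "dist z0 y < e0" using dist_triangle[of z0 y z] by (simp add: e_def)
    thus "y \<in> U" using e0 by auto
  qed
  have ec: "z + of_real e * cis \<theta> \<in> U" if "z \<in> ball z0 e" for z \<theta>
    using sub[OF that, of "z + of_real e * cis \<theta>"] e by (simp add: dist_norm norm_mult)
  have zU: "z \<in> U" if "z \<in> ball z0 e" for z using sub[OF that, of z] e by simp
  have d: "deriv (\<lambda>z. G z t) z = cmean (\<lambda>\<zeta>. G (z + \<zeta>) t / \<zeta>) e" if "z \<in> ball z0 e" "t \<in> {a..b}" for z t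
  proof -
    have "(\<lambda>z. G z t) holomorphic_on ball z (2 * e)"
      by (rule holomorphic_on_subset[OF hol[OF that(2)]]) (use sub[OF that(1)] in auto)
    from higher_deriv_cmean[OF this, of e 1] show ?thesis using e by simp
  qed
  have "(\<lambda>z. integral (cbox a b) (G z)) holomorphic_on ball z0 e"
  proof (rule leibniz_rule_holomorphic)
    fix z t assume z: "z \<in> ball z0 e" and t: "t \<in> cbox a b"
    have "(\<lambda>z. G z t) field_differentiable at z"
      using t by (intro holomorphic_on_imp_differentiable_at[OF hol U zU[OF z]]) auto
    hence "((\<lambda>z. G z t) has_field_derivative deriv (\<lambda>z. G z t) z) (at z)"
      by (simp add: DERIV_deriv_iff_field_differentiable)
    thus "((\<lambda>z. G z t) has_field_derivative cmean (\<lambda>\<zeta>. G (z + \<zeta>) t / \<zeta>) e) (at z within ball z0 e)"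
      using d[OF z] t by (auto intro: has_field_derivative_at_within)
  next
    fix z assume z: "z \<in> ball z0 e"
    show "G z integrable_on cbox a b"
      by (rule integrable_continuous)
         (use zU[OF z] in \<open>auto intro!: continuous_on_compose2[OF cont, of _ "\<lambda>t. (z, t)", simplified] continuous_intros\<close>)
  next
    have "continuous_on (ball z0 e \<times> cbox a b) (\<lambda>p. integral (cbox 0 (2*pi))
        (\<lambda>\<theta>. G (fst p + of_real e * cis \<theta>) (snd p) / (of_real e * cis \<theta>)))"
    proof (rule integral_continuous_on_param)
      have "continuous_on ((ball z0 e \<times> cbox a b) \<times> cbox 0 (2*pi))
         (\<lambda>q. (\<lambda>(z, t). G z t) (fst (fst q) + of_real e * cis (snd q), snd (fst q)))"
        by (rule continuous_on_compose2[OF cont]) (use ec in \<open>auto intro!: continuous_intros\<close>)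
      thus "continuous_on ((ball z0 e \<times> cbox a b) \<times> cbox 0 (2*pi))
         (\<lambda>(p, \<theta>). G (fst p + of_real e * cis \<theta>) (snd p) / (of_real e * cis \<theta>))"
        using e by (auto simp: split_def intro!: continuous_intros)
    qed
    thus "continuous_on (ball z0 e \<times> cbox a b) (\<lambda>(z, t). cmean (\<lambda>\<zeta>. G (z + \<zeta>) t / \<zeta>) e)"
      unfolding cmean_def split_def by (auto intro!: continuous_intros)
  qed simp
  thus "\<exists>T. open T \<and> z0 \<in> T \<and> (\<lambda>z. integral {a..b} (G z)) holomorphic_on T"
    using e by (intro exI[of _ "ball z0 e"]) auto
qed

text \<open>By Cauchy's formula the derivative in x at 0 is a mean over a fixed x-circle, hence an
  integral with \<sigma> as a parameter.\<close>

lemma param_higher_deriv_holomorphic: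
  assumes U: "open U" and e: "0 < e" "e < R"
    and cont: "continuous_on (ball 0 R \<times> U) (\<lambda>(x, \<sigma>). G x \<sigma>)"
    and holx: "\<And>\<sigma>. \<sigma> \<in> U \<Longrightarrow> (\<lambda>x. G x \<sigma>) holomorphic_on ball 0 R"
    and hols: "\<And>x. x \<in> ball 0 R \<Longrightarrow> G x holomorphic_on U"
  shows "(\<lambda>\<sigma>. (deriv ^^ k) (\<lambda>x. G x \<sigma>) 0) holomorphic_on U"
proof -
  have n: "of_real e * cis \<theta> \<in> ball 0 R" for \<theta> using e by (simp add: norm_mult)
  have "(\<lambda>\<sigma>. integral {0..2*pi} (\<lambda>\<theta>. G (of_real e * cis \<theta>) \<sigma> / (of_real e * cis \<theta>) ^ k)) holomorphic_on U"
  proof (rule hol_param_integral[OF U])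
    have "continuous_on (U \<times> {0..2*pi}) (\<lambda>q. (\<lambda>(x, \<sigma>). G x \<sigma>) (of_real e * cis (snd q), fst q))"
      by (rule continuous_on_compose2[OF cont]) (use n in \<open>auto intro!: continuous_intros\<close>)
    thus "continuous_on (U \<times> {0..2*pi}) (\<lambda>(\<sigma>, \<theta>). G (of_real e * cis \<theta>) \<sigma> / (of_real e * cis \<theta>) ^ k)"
      using e by (auto simp: split_def intro!: continuous_intros)
    show "(\<lambda>z. G (of_real e * cis t) z / (of_real e * cis t) ^ k) holomorphic_on U" for t
      using hols[OF n] e by (auto intro!: holomorphic_intros)
  qed
  hence "(\<lambda>\<sigma>. fact k * cmean (\<lambda>\<zeta>. G (0 + \<zeta>) \<sigma> / \<zeta> ^ k) e) holomorphic_on U"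
    unfolding cmean_def by (auto intro!: holomorphic_intros)
  thus ?thesis
    by (rule holomorphic_transform) (rule higher_deriv_cmean[OF holx e, symmetric])
qed

definition laplace :: "nat \<Rightarrow> real \<Rightarrow> (complex \<Rightarrow> complex) \<Rightarrow> complex" where
  "laplace N x0 Y = integral {0..x0} (\<lambda>x. of_real (exp (- (real N * x))) * Y (of_real x))"

lemma laplace_by_parts:
  assumes Y: "Y holomorphic_on ball 0 x1" and x: "0 < x0" "x0 < x1" and N: "N \<ge> 1"
  shows "laplace N x0 Y = (Y 0 - of_real (exp (- (real N * x0))) * Y (of_real x0)) / of_nat N + laplace N x0 (deriv Y) / of_nat N"
proof -
  have xb: "of_real x \<in> ball (0::complex) x1" if "x \<in> {0..x0}" for x using that x by simp
  have dY: "deriv Y holomorphic_on ball 0 x1" by (rule holomorphic_deriv[OF Y]) simp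
  have c: "continuous_on {0..x0} (\<lambda>x. Y (of_real x))" "continuous_on {0..x0} (\<lambda>x. deriv Y (of_real x))"
    by (auto intro!: continuous_on_compose2[OF holomorphic_on_imp_continuous_on[OF Y]]
       continuous_on_compose2[OF holomorphic_on_imp_continuous_on[OF dY]] continuous_intros xb simp del: mem_ball)
  let ?E = "\<lambda>x::real. of_real (exp (- (real N * x))) :: complex"
  have "((\<lambda>x. ?E x * Y (of_real x) - ?E x * deriv Y (of_real x) / of_nat N) has_integral
     (- ?E x0 * Y (of_real x0) / of_nat N - (- ?E 0 * Y (of_real 0) / of_nat N))) {0..x0}"
  proof (rule fundamental_theorem_of_calculus)
    fix x assume xx: "x \<in> {0..x0}"
    have "(Y has_field_derivative deriv Y (of_real x)) (at (of_real x))"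
      using holomorphic_derivI[OF Y _ xb[OF xx]] by simp
    from has_vector_derivative_real_field[OF this]
    have v: "((\<lambda>x. Y (of_real x)) has_vector_derivative deriv Y (of_real x)) (at x)" .
    have w: "(?E has_vector_derivative of_real (- real N * exp (- (real N * x)))) (at x)"
      unfolding has_vector_derivative_complex_iff
      by (auto intro!: derivative_eq_intros)
    have "((\<lambda>x. - (1 / of_nat N) * (?E x * Y (of_real x))) has_vector_derivative
        - (1 / of_nat N) * (?E x * deriv Y (of_real x) + of_real (- real N * exp (- (real N * x))) * Y (of_real x))) (at x)"
      by (intro has_vector_derivative_mult_right has_vector_derivative_mult v w)
    also have "- (1 / of_nat N) * (?E x * deriv Y (of_real x) + of_real (- real N * exp (- (real N * x))) * Y (of_real x))
        = ?E x * Y (of_real x) - ?E x * deriv Y (of_real x) / of_nat N"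
      using N by (simp add: field_simps)
    finally show "((\<lambda>x. - ?E x * Y (of_real x) / of_nat N) has_vector_derivative
        ?E x * Y (of_real x) - ?E x * deriv Y (of_real x) / of_nat N) (at x within {0..x0})"
      by (auto intro: has_vector_derivative_at_within)
  qed (use x in auto)
  hence "integral {0..x0} (\<lambda>x. ?E x * Y (of_real x) - ?E x * deriv Y (of_real x) / of_nat N) =
     - ?E x0 * Y (of_real x0) / of_nat N - (- ?E 0 * Y (of_real 0) / of_nat N)" by (rule integral_unique)
  moreover have "integral {0..x0} (\<lambda>x. ?E x * Y (of_real x) - ?E x * deriv Y (of_real x) / of_nat N) =
     integral {0..x0} (\<lambda>x. ?E x * Y (of_real x)) - integral {0..x0} (\<lambda>x. ?E x * deriv Y (of_real x) / of_nat N)"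
    using N by (intro integral_diff integrable_continuous_interval continuous_intros c) auto
  moreover have "integral {0..x0} (\<lambda>x. ?E x * deriv Y (of_real x) / of_nat N) = laplace N x0 (deriv Y) / of_nat N"
    by (simp add: laplace_def)
  ultimately have "laplace N x0 Y - laplace N x0 (deriv Y) / of_nat N = (Y 0 - ?E x0 * Y (of_real x0)) / of_nat N"
    unfolding laplace_def by (simp add: diff_divide_distrib)
  thus ?thesis by (simp add: diff_eq_eq)
qed

lemma laplace_expansion:
  assumes x: "0 < x0" "x0 < x1" and N: "N \<ge> 1"
  shows "Y holomorphic_on ball 0 x1 \<Longrightarrow> laplace N x0 Y =
    (\<Sum>i\<le>m. ((deriv ^^ i) Y 0 - of_real (exp (- (real N * x0))) * (deriv ^^ i) Y (of_real x0)) / of_nat N ^ Suc i)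
     + laplace N x0 ((deriv ^^ Suc m) Y) / of_nat N ^ Suc m"
proof (induction m)
  case 0 thus ?case using laplace_by_parts[OF 0 x N] by simp
next
  case (Suc m)
  have "(deriv ^^ Suc m) Y holomorphic_on ball 0 x1" by (rule holomorphic_higher_deriv[OF Suc.prems]) simp
  from laplace_by_parts[OF this x N] Suc.IH[OF Suc.prems] show ?case
    using N by (simp add: add_divide_distrib power_add)
qed

text \<open>A single term of the exponential series bounds its sum from below. This absorbs the
  endpoint terms at x0 into any power of 1 / N.\<close>

lemma exp_neg_le_power:
  assumes "0 < x0" "N \<ge> (1::nat)"
  shows "exp (- (real N * x0)) \<le> (fact k / x0 ^ k) / real N ^ k"
proof -
  have "(real N * x0) ^ k / fact k \<le> exp (real N * x0)"
  proof -
    have "(\<Sum>n\<in>{k}. (real N * x0) ^ n /\<^sub>R fact n) \<le> (\<Sum>n. (real N * x0) ^ n /\<^sub>R fact n)"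
      using assms by (intro sum_le_suminf summable_exp_generic) auto
    thus ?thesis unfolding exp_def by (simp add: field_simps)
  qed
  hence "1 / exp (real N * x0) \<le> 1 / ((real N * x0) ^ k / fact k)"
    using assms by (intro divide_left_mono) auto
  thus ?thesis using assms by (simp add: exp_minus field_simps power_mult_distrib)
qed

text \<open>The constant depends on m, x0 and x1 but not on Y or N, because the lemma is applied to
  a family of integrands indexed by the unit circle. Integration by parts leaves the terms at 0,
  exponentially small terms at x0, and a remainder integral; Cauchy estimates bound all derivatives
  on the segment by M.\<close>

lemma watson:
  assumes x: "0 < x0" "x0 < x1"
  obtains C where "C \<ge> 0" "\<And>Y M N. Y holomorphic_on ball 0 x1 \<Longrightarrow> (\<And>x. x \<in> ball 0 x1 \<Longrightarrow> norm (Y x) \<le> M) \<Longrightarrow> N \<ge> 1 \<Longrightarrow>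
    norm (laplace N x0 Y - (\<Sum>i\<le>m. (deriv ^^ i) Y 0 / of_nat N ^ Suc i)) \<le> C * M / real N ^ (m + 2)"
proof
  \<comment> \<open>Discs of radius 2 d about points of the segment [0, x0] stay inside the ball of
    radius x1.\<close>
  define d where "d = (x1 - x0) / 2"
  have d: "d > 0" using x by (simp add: d_def)
  define c where "c i = fact i / d ^ i" for i :: nat
  \<comment> \<open>The sum pays for the endpoint terms at x0, the last summand for the remainder
    integral.\<close>
  define C where "C = (\<Sum>i\<le>m. (fact (m+1) / x0 ^ (m+1)) * c i) + c (Suc m)"
  have c0: "c i \<ge> 0" for i using d by (simp add: c_def)
  show "C \<ge> 0" unfolding C_def using x by (intro add_nonneg_nonneg sum_nonneg mult_nonneg_nonneg c0) auto
  fix Y M and N :: nat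
  assume Y: "Y holomorphic_on ball 0 x1" and M: "\<And>x. x \<in> ball 0 x1 \<Longrightarrow> norm (Y x) \<le> M" and N: "N \<ge> 1"
  have M0: "M \<ge> 0" using order_trans[OF norm_ge_zero M[of 0]] x by simp
  have db: "norm ((deriv ^^ i) Y (of_real t)) \<le> c i * M" if t: "0 \<le> t" "t \<le> x0" for i t
  proof -
    have sub: "of_real t + w \<in> ball 0 x1" if "norm w < 2 * d" for w :: complex
      using norm_triangle_ineq[of "of_real t" w] that t by (simp add: d_def)
    have "Y holomorphic_on ball (of_real t) (2 * d)"
      by (rule holomorphic_on_subset[OF Y]) (metis sub mem_ball dist_norm norm_minus_commute add_diff_cancel_left' diff_add_cancel add.commute subsetI)
    hence "(deriv ^^ i) Y (of_real t) = fact i * cmean (\<lambda>\<zeta>. Y (of_real t + \<zeta>) / \<zeta> ^ i) d"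
      by (rule higher_deriv_cmean) (use d in auto)
    moreover have "norm (cmean (\<lambda>\<zeta>. Y (of_real t + \<zeta>) / \<zeta> ^ i) d) \<le> M / d ^ i"
    proof (rule cmean_bound)
      show "continuous_on (sphere 0 d) (\<lambda>\<zeta>. Y (of_real t + \<zeta>) / \<zeta> ^ i)"
        using d by (intro continuous_intros continuous_on_compose2[OF holomorphic_on_imp_continuous_on[OF Y]])
          (auto intro!: sub continuous_intros simp del: mem_ball)
      fix w :: complex assume w: "norm w = d"
      show "norm (Y (of_real t + w) / w ^ i) \<le> M / d ^ i"
        unfolding norm_divide norm_power w using d w by (intro divide_right_mono M sub) auto
    qed (use d in auto)
    ultimately show ?thesis using mult_left_mono[of "norm (cmean (\<lambda>\<zeta>. Y (of_real t + \<zeta>) / \<zeta> ^ i) d)" "M / d ^ i" "fact i"]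
      by (simp add: norm_mult c_def)
  qed
  let ?E = "of_real (exp (- (real N * x0))) :: complex"
  have Nr: "real N > 0" using N by simp
  have "laplace N x0 Y - (\<Sum>i\<le>m. (deriv ^^ i) Y 0 / of_nat N ^ Suc i) =
     laplace N x0 ((deriv ^^ Suc m) Y) / of_nat N ^ Suc m - (\<Sum>i\<le>m. ?E * (deriv ^^ i) Y (of_real x0) / of_nat N ^ Suc i)"
    unfolding laplace_expansion[OF x N Y, of m] by (simp add: diff_divide_distrib sum_subtractf)
  hence 0: "norm (laplace N x0 Y - (\<Sum>i\<le>m. (deriv ^^ i) Y 0 / of_nat N ^ Suc i)) \<le> norm (laplace N x0 ((deriv ^^ Suc m) Y) / of_nat N ^ Suc m) + norm (\<Sum>i\<le>m. ?E * (deriv ^^ i) Y (of_real x0) / of_nat N ^ Suc i)"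
    by (simp only: norm_triangle_ineq4)
  have 1: "norm (laplace N x0 ((deriv ^^ Suc m) Y) / of_nat N ^ Suc m) \<le> c (Suc m) * M / real N ^ (m + 2)"
  proof -
    have hd: "(deriv ^^ Suc m) Y holomorphic_on ball 0 x1" by (rule holomorphic_higher_deriv[OF Y]) simp
    have ei: "((\<lambda>t. exp (- (real N * t)) * (c (Suc m) * M)) has_integral
       (- exp (- (real N * x0)) / real N * (c (Suc m) * M) - (- exp (- (real N * 0)) / real N * (c (Suc m) * M)))) {0..x0}"
    proof (rule fundamental_theorem_of_calculus)
      fix t assume "t \<in> {0..x0}"
      have "((\<lambda>t. - exp (- (real N * t)) / real N * (c (Suc m) * M)) has_real_derivative exp (- (real N * t)) * (c (Suc m) * M)) (at t)"
        using N by (auto intro!: derivative_eq_intros)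
      thus "((\<lambda>t. - exp (- (real N * t)) / real N * (c (Suc m) * M)) has_vector_derivative exp (- (real N * t)) * (c (Suc m) * M)) (at t within {0..x0})"
        unfolding has_real_derivative_iff_has_vector_derivative by (rule has_vector_derivative_at_within)
    qed (use x in auto)
    have "norm (laplace N x0 ((deriv ^^ Suc m) Y)) \<le> integral {0..x0} (\<lambda>t. exp (- (real N * t)) * (c (Suc m) * M))"
      unfolding laplace_def
    proof (rule integral_norm_bound_integral)
      show "(\<lambda>t. of_real (exp (- (real N * t))) * (deriv ^^ Suc m) Y (of_real t)) integrable_on {0..x0}"
        using x by (intro integrable_continuous_interval continuous_intros continuous_on_compose2[OF holomorphic_on_imp_continuous_on[OF hd]])
          (auto intro!: continuous_intros)
      show "(\<lambda>t. exp (- (real N * t)) * (c (Suc m) * M)) integrable_on {0..x0}" using ei by blast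
      fix t assume "t \<in> {0..x0}"
      thus "norm (of_real (exp (- (real N * t))) * (deriv ^^ Suc m) Y (of_real t)) \<le> exp (- (real N * t)) * (c (Suc m) * M)"
        using db[of t "Suc m"] by (simp add: norm_mult)
    qed
    also have "\<dots> = (1 - exp (- (real N * x0))) / real N * (c (Suc m) * M)"
      unfolding integral_unique[OF ei] by (simp add: algebra_simps diff_divide_distrib)
    also have "\<dots> \<le> 1 / real N * (c (Suc m) * M)"
      using Nr c0 M0 by (intro mult_right_mono divide_right_mono) auto
    finally have "norm (laplace N x0 ((deriv ^^ Suc m) Y)) / real N ^ Suc m \<le> 1 / real N * (c (Suc m) * M) / real N ^ Suc m"
      by (intro divide_right_mono) auto
    thus ?thesis by (simp add: norm_divide norm_power norm_mult)
  qed
  have 2: "norm (\<Sum>i\<le>m. ?E * (deriv ^^ i) Y (of_real x0) / of_nat N ^ Suc i) \<le>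
      (\<Sum>i\<le>m. (fact (m+1) / x0 ^ (m+1)) * c i * M / real N ^ (m + 2))"
  proof (rule sum_norm_le)
    fix i assume "i \<in> {..m}"
    have "norm (?E * (deriv ^^ i) Y (of_real x0) / of_nat N ^ Suc i) = exp (- (real N * x0)) * norm ((deriv ^^ i) Y (of_real x0)) / real N ^ Suc i"
      by (simp add: norm_mult norm_divide norm_power)
    also have "\<dots> \<le> ((fact (m+1) / x0 ^ (m+1)) / real N ^ (m+1)) * (c i * M) / real N ^ Suc 0"
      using x N db[of x0 i] c0 M0
      by (intro frac_le mult_mono exp_neg_le_power power_increasing) auto
    also have "\<dots> = (fact (m+1) / x0 ^ (m+1)) * c i * M / real N ^ (m + 2)" by (simp add: mult_ac)
    finally show "norm (?E * (deriv ^^ i) Y (of_real x0) / of_nat N ^ Suc i) \<le> (fact (m+1) / x0 ^ (m+1)) * c i * M / real N ^ (m + 2)" .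
  qed
  have 3: "c (Suc m) * M / real N ^ (m + 2) + (\<Sum>i\<le>m. (fact (m+1) / x0 ^ (m+1)) * c i * M / real N ^ (m + 2)) = C * M / real N ^ (m + 2)"
    unfolding C_def distrib_right add_divide_distrib sum_distrib_right sum_divide_distrib by (simp only: add.commute)
  show "norm (laplace N x0 Y - (\<Sum>i\<le>m. (deriv ^^ i) Y 0 / of_nat N ^ Suc i)) \<le> C * M / real N ^ (m + 2)"
    using 0 1 2 3 by linarith
qed

section \<open>The coefficients of the expansion\<close>


lemma norm_exp_minus_mult_ge:
  assumes "norm (x::complex) \<le> y"
  shows "exp (- y) * norm \<sigma> \<le> norm (exp (- x) * \<sigma>)"
proof -
  have "- y \<le> Re (- x)" using assms abs_Re_le_cmod[of x] by simp
  thus ?thesis by (simp add: norm_mult mult_right_mono)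
qed

text \<open>These are the properties of the polarized weight on which the coefficient recursion
  rests; \<open>kernel_exists\<close> produces such a \<open>K\<close>.\<close>

locale annulus_kernel =
  fixes K :: "complex \<Rightarrow> complex \<Rightarrow> complex" and a x1 :: real
  assumes a: "0 < a" "a < 1" and x1: "0 < x1"
    and cont: "continuous_on (ball 0 x1 \<times> {w. a < norm w \<and> norm w < 1/a}) (\<lambda>(x, \<sigma>). K x \<sigma>)"
    and holx: "\<And>\<sigma>. a < norm \<sigma> \<Longrightarrow> norm \<sigma> < 1/a \<Longrightarrow> (\<lambda>x. K x \<sigma>) holomorphic_on ball 0 x1"
    and hols: "\<And>x. x \<in> ball 0 x1 \<Longrightarrow> K x holomorphic_on {w. a < norm w \<and> norm w < 1/a}"
    and K0: "\<And>\<sigma>. a < norm \<sigma> \<Longrightarrow> norm \<sigma> < 1/a \<Longrightarrow> K 0 \<sigma> = 1"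
begin

abbreviation "ann \<equiv> {w::complex. a < norm w \<and> norm w < 1/a}"
abbreviation "ext \<equiv> {w::complex. a < norm w}"

text \<open>By Watson's lemma this is the coefficient of N^(- i - 1) in the expansion of the Laplace
  integral of B (exp (- x) \<sigma>) K x \<sigma>.\<close>

definition T :: "nat \<Rightarrow> (complex \<Rightarrow> complex) \<Rightarrow> complex \<Rightarrow> complex" where
  "T i B \<sigma> = (deriv ^^ i) (\<lambda>x. B (exp (- x) * \<sigma>) * K x \<sigma>) 0"

lemma T_0: "\<sigma> \<in> ann \<Longrightarrow> T 0 B \<sigma> = B \<sigma>"
  by (simp add: T_def K0)

text \<open>The point exp (- x) \<sigma> must stay outside the circle of radius a, and the room for
  x shrinks as \<sigma> approaches that circle. Hence the proof is local, with an x-radius that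
  depends on \<sigma>0.\<close>

lemma T_holomorphic:
  assumes B: "B holomorphic_on ext"
  shows "T i B holomorphic_on ann"
proof (rule hol_localI)
  fix \<sigma>0 :: complex assume \<sigma>0: "\<sigma>0 \<in> ann"
  define p where "p = (a + norm \<sigma>0) / 2"
  have p: "a < p" "p < norm \<sigma>0" using \<sigma>0 by (auto simp: p_def)
  \<comment> \<open>The condition R < ln (p / a) means exp (- R) p > a, so exp (- x) \<sigma>
    remains in the domain of \<open>B\<close> for norm x < R and norm \<sigma> > p.\<close>
  define R where "R = min x1 (ln (p / a)) / 2"
  have lp: "ln (p / a) > 0" using p a by simp
  have R: "0 < R" "R < x1" "R < ln (p / a)" using lp x1 by (auto simp: R_def min_def)
  have "exp R < p / a" using R(3) p a by (metis exp_less_mono exp_ln divide_pos_pos order.strict_trans)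
  hence eR: "a < exp (- R) * p" using a by (simp add: exp_minus field_simps)
  define U where "U = ann \<inter> {w. p < norm w}"
  have U: "open U" "\<sigma>0 \<in> U" unfolding U_def using open_annulus open_exterior \<sigma>0 p by (auto intro: open_Int)
  have E: "a < norm (exp (- x) * \<sigma>)" if "x \<in> ball 0 R" "\<sigma> \<in> U" for x \<sigma>
  proof -
    have "exp (- R) * p \<le> exp (- R) * norm \<sigma>" using that by (intro mult_left_mono) (auto simp: U_def)
    moreover have "exp (- R) * norm \<sigma> \<le> norm (exp (- x) * \<sigma>)"
      by (rule norm_exp_minus_mult_ge) (use that in simp)
    ultimately show ?thesis using eR by linarith
  qed
  have "(\<lambda>\<sigma>. (deriv ^^ i) (\<lambda>x. B (exp (- x) * \<sigma>) * K x \<sigma>) 0) holomorphic_on U"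
  proof (rule param_higher_deriv_holomorphic[OF U(1), of "R/2" R])
    have "continuous_on (ball 0 R \<times> U) (\<lambda>q. B (exp (- fst q) * snd q))"
      by (rule continuous_on_compose2[OF holomorphic_on_imp_continuous_on[OF B]])
         (use E in \<open>auto intro!: continuous_intros\<close>)
    moreover have "continuous_on (ball 0 R \<times> U) (\<lambda>(x, \<sigma>). K x \<sigma>)"
      by (rule continuous_on_subset[OF cont]) (use R in \<open>auto simp: U_def\<close>)
    ultimately show "continuous_on (ball 0 R \<times> U) (\<lambda>(x, \<sigma>). B (exp (- x) * \<sigma>) * K x \<sigma>)"
      by (auto simp: split_def intro!: continuous_intros)
    show "(\<lambda>x. B (exp (- x) * \<sigma>) * K x \<sigma>) holomorphic_on ball 0 R" if "\<sigma> \<in> U" for \<sigma>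
    proof (intro holomorphic_on_mult)
      show "(\<lambda>x. B (exp (- x) * \<sigma>)) holomorphic_on ball 0 R"
        by (rule hol_comp[OF B]) (use E that in \<open>auto intro!: holomorphic_intros\<close>)
      show "(\<lambda>x. K x \<sigma>) holomorphic_on ball 0 R"
        by (rule holomorphic_on_subset[OF holx]) (use that R in \<open>auto simp: U_def\<close>)
    qed
    show "(\<lambda>\<sigma>. B (exp (- x) * \<sigma>) * K x \<sigma>) holomorphic_on U" if "x \<in> ball 0 R" for x
    proof (intro holomorphic_on_mult)
      show "(\<lambda>\<sigma>. B (exp (- x) * \<sigma>)) holomorphic_on U"
        by (rule hol_comp[OF B]) (use E that in \<open>auto intro!: holomorphic_intros\<close>)
      show "K x holomorphic_on U"
        by (rule holomorphic_on_subset[OF hols]) (use that R in \<open>auto simp: U_def\<close>)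
    qed
  qed (use R in auto)
  hence "T i B holomorphic_on U" unfolding T_def .
  thus "\<exists>T'. open T' \<and> \<sigma>0 \<in> T' \<and> T i B holomorphic_on T'" using U by blast
qed

text \<open>The negative Laurent part of the accumulated lower order terms is cancelled by \<open>b l\<close>, so that
  only the part \<open>R l\<close>, which is holomorphic in the disc, survives.\<close>

lemma expansion_coefficients:
  obtains b R where
    "b 0 = (\<lambda>_. 1)" "\<And>l. b l holomorphic_on ext" "\<And>l. l \<ge> 1 \<Longrightarrow> (b l \<longlongrightarrow> 0) at_infinity"
    "\<And>l. R l holomorphic_on ball 0 (1/a)" "\<And>\<sigma>. R 0 \<sigma> = 1"
    "\<And>l \<sigma>. \<sigma> \<in> ann \<Longrightarrow> (\<Sum>i\<le>l. T i (b (l - i)) \<sigma>) = R l \<sigma>"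
proof -
  \<comment> \<open>\<open>P b l r\<close> says that r is an admissible choice for
    \<open>b l\<close> given the earlier coefficients. The sum starts at i = 1 because the term i =
    0 is r itself by \<open>T_0\<close>, which makes the recursion explicit. The disc part is only
    asserted to exist here and is picked for all l afterwards.\<close>
  define P where "P b l r \<longleftrightarrow> (l = 0 \<longrightarrow> r = (\<lambda>_. 1)) \<and> r holomorphic_on ext \<and> (l > 0 \<longrightarrow> (r \<longlongrightarrow> 0) at_infinity) \<and>
     (\<exists>R. R holomorphic_on ball 0 (1/a) \<and> (l = 0 \<longrightarrow> R = (\<lambda>_. 1)) \<and> (\<forall>\<sigma>\<in>ann. r \<sigma> + (\<Sum>i\<in>{1..l}. T i (b (l - i)) \<sigma>) = R \<sigma>))"
    for b :: "nat \<Rightarrow> complex \<Rightarrow> complex" and l r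
  have "\<exists>b. \<forall>l. P b l (b l)"
  proof (rule dependent_wf_choice[of less_than])
    show "wf less_than" by simp
    fix f g :: "nat \<Rightarrow> complex \<Rightarrow> complex" and l r
    assume fg: "\<And>z. (z, l) \<in> less_than \<Longrightarrow> f z = g z"
    have "(\<Sum>i\<in>{1..l}. T i (f (l - i)) \<sigma>) = (\<Sum>i\<in>{1..l}. T i (g (l - i)) \<sigma>)" for \<sigma>
      by (intro sum.cong refl) (use fg in auto)
    thus "P f l r = P g l r" unfolding P_def by simp
  next
    fix l and b :: "nat \<Rightarrow> complex \<Rightarrow> complex"
    assume IH: "\<And>y. (y, l) \<in> less_than \<Longrightarrow> P b y (b y)"
    show "\<exists>r. P b l r"
    proof (cases "l = 0")
      case True thus ?thesis unfolding P_def
        by (intro exI[of _ "\<lambda>_. 1"]) (auto intro!: exI[of _ "\<lambda>_. 1"])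
    next
      case False
      have "(\<lambda>\<sigma>. \<Sum>i\<in>{1..l}. T i (b (l - i)) \<sigma>) holomorphic_on ann"
        by (intro holomorphic_intros T_holomorphic) (use IH False in \<open>auto simp: P_def\<close>)
      moreover have "0 \<le> a" "a < 1 / a"
        using a mult_strict_mono[of a 1 a 1] by (auto simp: less_divide_eq)
      ultimately obtain g h where gh:
        "g holomorphic_on ball 0 (1/a)" "h holomorphic_on ext" "(h \<longlongrightarrow> 0) at_infinity"
        "\<And>w. a < norm w \<Longrightarrow> norm w < 1/a \<Longrightarrow> (\<Sum>i\<in>{1..l}. T i (b (l - i)) w) = g w + h w"
        by (rule laurent_splitting) blast
      show ?thesis unfolding P_def
        using gh False tendsto_minus[OF gh(3)]
        by (intro exI[of _ "\<lambda>\<sigma>. - h \<sigma>"] conjI exI[of _ g]) (auto intro!: holomorphic_intros)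
    qed
  qed
  then obtain b where b: "\<And>l. P b l (b l)" by blast
  define Q where "Q l R \<longleftrightarrow> R holomorphic_on ball 0 (1/a) \<and> (l = 0 \<longrightarrow> R = (\<lambda>_. 1)) \<and>
     (\<forall>\<sigma>\<in>ann. b l \<sigma> + (\<Sum>i\<in>{1..l}. T i (b (l - i)) \<sigma>) = R \<sigma>)" for l R
  have "\<forall>l. \<exists>R. Q l R" using b unfolding P_def Q_def by blast
  then obtain R where "\<And>l. Q l (R l)" by metis
  hence R: "\<And>l. R l holomorphic_on ball 0 (1/a)" "\<And>l. l = 0 \<Longrightarrow> R l = (\<lambda>_. 1)"
    "\<And>l \<sigma>. \<sigma> \<in> ann \<Longrightarrow> b l \<sigma> + (\<Sum>i\<in>{1..l}. T i (b (l - i)) \<sigma>) = R l \<sigma>"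
    unfolding Q_def by blast+
  show ?thesis
  proof (rule that[of b R])
    fix l :: nat and \<sigma> :: complex assume \<sigma>: "\<sigma> \<in> ann"
    have "{..l} = insert 0 {1..l}" by auto
    hence "(\<Sum>i\<le>l. T i (b (l - i)) \<sigma>) = T 0 (b (l - 0)) \<sigma> + (\<Sum>i\<in>{1..l}. T i (b (l - i)) \<sigma>)" by simp
    thus "(\<Sum>i\<le>l. T i (b (l - i)) \<sigma>) = R l \<sigma>" using R(3)[OF \<sigma>] T_0[OF \<sigma>] by simp
  qed (use b R in \<open>auto simp: P_def\<close>)
qed

text \<open>The j-th coefficient already carries N^(- j), so Watson's lemma is applied to it only to
  order m - j; every error is then of order N^(- m - 2). Collecting the terms with i + j = l gives
  exactly the combinations that equal \<open>R l\<close>.\<close>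

lemma laplace_asymptotics:
  assumes b: "\<And>l. b l holomorphic_on ext"
    and R: "\<And>l \<sigma>. \<sigma> \<in> ann \<Longrightarrow> (\<Sum>i\<le>l. T i (b (l - i)) \<sigma>) = R l \<sigma>"
    and x: "0 < x0" "x0 < x2" "x2 < x1" "a < exp (- x2)"
  obtains C where "C \<ge> 0" "\<And>N \<sigma>. N \<ge> 1 \<Longrightarrow> norm \<sigma> = 1 \<Longrightarrow>
    norm (laplace N x0 (\<lambda>x. (\<Sum>j\<le>m. b j (exp (- x) * \<sigma>) / of_nat N ^ j) * K x \<sigma>)
      - (\<Sum>l\<le>m. R l \<sigma> / of_nat N ^ Suc l)) \<le> C / real N ^ (m + 2)"
proof -
  define Y where "Y j \<sigma> x = b j (exp (- x) * \<sigma>) * K x \<sigma>" for j \<sigma> x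
  have E: "a < norm (exp (- x) * \<sigma>)" if "norm x \<le> x2" "norm \<sigma> = 1" for x \<sigma> :: complex
    using norm_exp_minus_mult_ge[OF that(1), of \<sigma>] that x(4) by simp
  have annI: "\<sigma> \<in> ann" if "norm \<sigma> = 1" for \<sigma> using that a by simp
  have Yhol: "Y j \<sigma> holomorphic_on ball 0 x2" if "norm \<sigma> = 1" for j \<sigma>
    unfolding Y_def
  proof (intro holomorphic_on_mult)
    show "(\<lambda>x. b j (exp (- x) * \<sigma>)) holomorphic_on ball 0 x2"
      by (rule hol_comp[OF b]) (use E that in \<open>auto intro!: holomorphic_intros\<close>)
    show "(\<lambda>x. K x \<sigma>) holomorphic_on ball 0 x2"
      by (rule holomorphic_on_subset[OF holx]) (use that x a in auto)
  qed
  have "\<exists>M. \<forall>x\<in>cball 0 x2. \<forall>\<sigma>\<in>sphere 0 1. norm (Y j \<sigma> x) \<le> M" for j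
  proof -
    have "continuous_on (cball 0 x2 \<times> sphere 0 1) (\<lambda>q. b j (exp (- fst q) * snd q))"
      by (rule continuous_on_compose2[OF holomorphic_on_imp_continuous_on[OF b]])
         (use E in \<open>auto intro!: continuous_intros\<close>)
    moreover have "continuous_on (cball 0 x2 \<times> sphere 0 1) (\<lambda>(x, \<sigma>). K x \<sigma>)"
      by (rule continuous_on_subset[OF cont]) (use x a in auto)
    ultimately have "continuous_on (cball 0 x2 \<times> sphere 0 1) (\<lambda>q. Y j (snd q) (fst q))"
      by (auto simp: split_def Y_def intro!: continuous_intros)
    from compact_imp_bounded[OF compact_continuous_image[OF this]]
    show ?thesis unfolding bounded_iff by (auto simp: compact_Times)
  qed
  then obtain M where M: "\<And>j x \<sigma>. norm x \<le> x2 \<Longrightarrow> norm \<sigma> = 1 \<Longrightarrow> norm (Y j \<sigma> x) \<le> M j"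
    by (metis mem_cball_0 mem_sphere_0)
  \<comment> \<open>Packaging the conclusion of \<open>watson\<close> as a predicate allows the
    constants for all orders m - j to be chosen at once.\<close>
  define W where "W m C \<longleftrightarrow> C \<ge> 0 \<and> (\<forall>Y M N. Y holomorphic_on ball 0 x2 \<longrightarrow> (\<forall>x\<in>ball 0 x2. norm (Y x) \<le> M) \<longrightarrow> N \<ge> 1 \<longrightarrow>
    norm (laplace N x0 Y - (\<Sum>i\<le>m. (deriv ^^ i) Y 0 / of_nat N ^ Suc i)) \<le> C * M / real N ^ (m + 2))" for m C
  have "\<exists>C. W m C" for m
  proof (rule watson[OF x(1,2), of m])
    fix C assume "0 \<le> C" "\<And>Y M N. Y holomorphic_on ball 0 x2 \<Longrightarrow> (\<And>x. x \<in> ball 0 x2 \<Longrightarrow> norm (Y x) \<le> M) \<Longrightarrow> 1 \<le> N \<Longrightarrow>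
      norm (laplace N x0 Y - (\<Sum>i\<le>m. (deriv ^^ i) Y 0 / of_nat N ^ Suc i)) \<le> C * M / real N ^ (m + 2)"
    hence "W m C" unfolding W_def by blast
    thus "\<exists>C. W m C" ..
  qed
  then obtain c where "\<And>m. W m (c m)" by metis
  hence c: "\<And>m. c m \<ge> 0" "\<And>m Y M N. Y holomorphic_on ball 0 x2 \<Longrightarrow> (\<And>x. x \<in> ball 0 x2 \<Longrightarrow> norm (Y x) \<le> M) \<Longrightarrow> N \<ge> 1 \<Longrightarrow>
    norm (laplace N x0 Y - (\<Sum>i\<le>m. (deriv ^^ i) Y 0 / of_nat N ^ Suc i)) \<le> c m * M / real N ^ (m + 2)"
    unfolding W_def by blast+
  have M0: "M j \<ge> 0" for j using order_trans[OF norm_ge_zero M[of 0 1 j]] x by simp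
  define C where "C = (\<Sum>j\<le>m. c (m - j) * M j)"
  show ?thesis
  proof (rule that)
    show "C \<ge> 0" unfolding C_def by (intro sum_nonneg mult_nonneg_nonneg c M0)
    fix N :: nat and \<sigma> :: complex assume N: "N \<ge> 1" and \<sigma>: "norm \<sigma> = 1"
    have int: "(\<lambda>x. of_real (exp (- (real N * x))) * Y j \<sigma> (of_real x)) integrable_on {0..x0}" for j
      using x by (intro integrable_continuous_interval continuous_intros
        continuous_on_compose2[OF holomorphic_on_imp_continuous_on[OF Yhol[OF \<sigma>]]]) (auto intro!: continuous_intros)
    have "laplace N x0 (\<lambda>x. (\<Sum>j\<le>m. b j (exp (- x) * \<sigma>) / of_nat N ^ j) * K x \<sigma>)
       = integral {0..x0} (\<lambda>x. \<Sum>j\<le>m. (1 / of_nat N ^ j) * (of_real (exp (- (real N * x))) * Y j \<sigma> (of_real x)))"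
      unfolding laplace_def Y_def
      by (intro arg_cong[of _ _ "integral {0..x0}"] ext) (simp add: sum_distrib_left sum_distrib_right sum_divide_distrib mult_ac)
    also have "\<dots> = (\<Sum>j\<le>m. integral {0..x0} (\<lambda>x. (1 / of_nat N ^ j) * (of_real (exp (- (real N * x))) * Y j \<sigma> (of_real x))))"
      by (intro integral_sum integrable_on_mult_right int) simp
    also have "\<dots> = (\<Sum>j\<le>m. laplace N x0 (Y j \<sigma>) / of_nat N ^ j)"
      unfolding integral_mult_right laplace_def by simp
    finally have 1: "laplace N x0 (\<lambda>x. (\<Sum>j\<le>m. b j (exp (- x) * \<sigma>) / of_nat N ^ j) * K x \<sigma>) = (\<Sum>j\<le>m. laplace N x0 (Y j \<sigma>) / of_nat N ^ j)" .
    have "(\<Sum>l\<le>m. R l \<sigma> / of_nat N ^ Suc l) = (\<Sum>l\<le>m. \<Sum>i\<le>l. T i (b (l - i)) \<sigma> / of_nat N ^ Suc l)"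
      using R[OF annI[OF \<sigma>]] by (simp add: sum_divide_distrib[symmetric])
    also have "\<dots> = (\<Sum>l\<le>m. \<Sum>i\<le>l. T i (b (l - i)) \<sigma> / of_nat N ^ Suc i / of_nat N ^ (l - i))"
      by (intro sum.cong refl) (auto simp: power_add[symmetric])
    also have "\<dots> = (\<Sum>(i,j)\<in>{(i,j). i + j \<le> m}. T i (b j) \<sigma> / of_nat N ^ Suc i / of_nat N ^ j)"
      by (rule sum.triangle_reindex_eq[symmetric])
    also have "\<dots> = (\<Sum>(j,i)\<in>Sigma {..m} (\<lambda>j. {..m - j}). T i (b j) \<sigma> / of_nat N ^ Suc i / of_nat N ^ j)"
      by (rule sum.reindex_bij_witness[of _ "\<lambda>(j,i). (i,j)" "\<lambda>(i,j). (j,i)"]) auto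
    also have "\<dots> = (\<Sum>j\<le>m. \<Sum>i\<le>m - j. T i (b j) \<sigma> / of_nat N ^ Suc i / of_nat N ^ j)"
      by (rule sum.Sigma[symmetric]) auto
    also have "\<dots> = (\<Sum>j\<le>m. (\<Sum>i\<le>m - j. (deriv ^^ i) (Y j \<sigma>) 0 / of_nat N ^ Suc i) / of_nat N ^ j)"
      unfolding T_def Y_def by (simp add: sum_divide_distrib)
    finally have "laplace N x0 (\<lambda>x. (\<Sum>j\<le>m. b j (exp (- x) * \<sigma>) / of_nat N ^ j) * K x \<sigma>) - (\<Sum>l\<le>m. R l \<sigma> / of_nat N ^ Suc l) =
      (\<Sum>j\<le>m. (laplace N x0 (Y j \<sigma>) - (\<Sum>i\<le>m - j. (deriv ^^ i) (Y j \<sigma>) 0 / of_nat N ^ Suc i)) / of_nat N ^ j)"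
      unfolding 1 by (simp add: sum_subtractf diff_divide_distrib)
    also have "norm \<dots> \<le> (\<Sum>j\<le>m. c (m - j) * M j / real N ^ (m + 2))"
    proof (rule sum_norm_le)
      fix j assume j: "j \<in> {..m}"
      have "norm (laplace N x0 (Y j \<sigma>) - (\<Sum>i\<le>m - j. (deriv ^^ i) (Y j \<sigma>) 0 / of_nat N ^ Suc i)) \<le> c (m - j) * M j / real N ^ (m - j + 2)"
        by (rule c(2)[OF Yhol[OF \<sigma>] M N]) (use \<sigma> in auto)
      hence "norm ((laplace N x0 (Y j \<sigma>) - (\<Sum>i\<le>m - j. (deriv ^^ i) (Y j \<sigma>) 0 / of_nat N ^ Suc i)) / of_nat N ^ j) \<le> c (m - j) * M j / real N ^ (m - j + 2) / real N ^ j"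
        unfolding norm_divide norm_power norm_of_nat by (intro divide_right_mono) auto
      also have "\<dots> = c (m - j) * M j / real N ^ (m - j + 2 + j)" by (simp add: power_add)
      also have "m - j + 2 + j = m + 2" using j by simp
      finally show "norm ((laplace N x0 (Y j \<sigma>) - (\<Sum>i\<le>m - j. (deriv ^^ i) (Y j \<sigma>) 0 / of_nat N ^ Suc i)) / of_nat N ^ j) \<le> c (m - j) * M j / real N ^ (m + 2)" .
    qed
    also have "\<dots> = C / real N ^ (m + 2)" unfolding C_def by (simp add: sum_divide_distrib)
    finally show "norm (laplace N x0 (\<lambda>x. (\<Sum>j\<le>m. b j (exp (- x) * \<sigma>) / of_nat N ^ j) * K x \<sigma>)
      - (\<Sum>l\<le>m. R l \<sigma> / of_nat N ^ Suc l)) \<le> C / real N ^ (m + 2)" .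
  qed
qed

end

section \<open>Polarization of the weight\<close>


text \<open>The double power series still converges when the two real coordinates are replaced by
  independent complex variables. Holomorphy in two variables is expressed by composition with pairs
  of holomorphic functions of one variable, the form in which it is applied.\<close>

lemma local_polarization:
  fixes c :: "nat \<Rightarrow> nat \<Rightarrow> real" and a :: complex
  assumes r: "r > 0" and f: "\<And>z. z \<in> ball a r \<Longrightarrow>
    ((\<lambda>(m, n). c m n * Re (z - a) ^ m * Im (z - a) ^ n) has_sum f z) UNIV"
  obtains s G where "s > 0" "s \<le> r"
    "\<And>z. z \<in> ball a s \<Longrightarrow> G z (cnj z) = of_real (f z)"
    "\<And>T u v. open T \<Longrightarrow> u holomorphic_on T \<Longrightarrow> v holomorphic_on T \<Longrightarrow>
       (\<And>\<tau>. \<tau> \<in> T \<Longrightarrow> u \<tau> \<in> ball a s \<and> v \<tau> \<in> ball (cnj a) s) \<Longrightarrow> (\<lambda>\<tau>. G (u \<tau>) (v \<tau>)) holomorphic_on T"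
    "continuous_on (ball a s \<times> ball (cnj a) s) (\<lambda>(z, z'). G z z')"
proof -
  define s where "s = r / 2"
  have s: "s > 0" "s \<le> r" using r by (auto simp: s_def)
  \<comment> \<open>Absolute convergence at this corner point, whose two real coordinates relative
    to a are both s, dominates every term with norm u and norm v at most s. Halving r to get s
    suffices because sqrt 2 < 2.\<close>
  define z1 where "z1 = a + Complex s s"
  have "norm (Complex s s) = sqrt 2 * s" using s by (simp add: complex_norm_square cmod_def power2_eq_square real_sqrt_mult_self real_sqrt_mult)
  also have "\<dots> < 2 * s" using s sqrt2_less_2 by (intro mult_strict_right_mono) auto
  finally have "z1 \<in> ball a r" by (simp add: z1_def s_def dist_norm)
  from f[OF this] have "(\<lambda>(m, n). c m n * s ^ m * s ^ n) summable_on UNIV"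
    by (auto simp: z1_def summable_on_def)
  hence "(\<lambda>p. norm ((\<lambda>(m, n). c m n * s ^ m * s ^ n) p)) summable_on UNIV"
    by (subst (asm) summable_on_iff_abs_summable_on_real)
  hence M: "(\<lambda>(m, n). \<bar>c m n\<bar> * s ^ m * s ^ n) summable_on UNIV"
    using s by (simp add: split_def abs_mult)
  define t where "t u v = (\<lambda>(m, n). of_real (c m n) * u ^ m * v ^ n :: complex)" for u v :: complex
  have tM: "norm (t u v p) \<le> (\<lambda>(m, n). \<bar>c m n\<bar> * s ^ m * s ^ n) p" if "norm u \<le> s" "norm v \<le> s" for u v p
    using that s unfolding t_def split_def norm_mult norm_power
    by (intro mult_mono power_mono) auto
  define F where "F u v = (\<Sum>\<^sub>\<infinity>p. t u v p)" for u v
  \<comment> \<open>For z' = cnj z the values of \<xi> and \<eta> are Re (z - a) and Im (z -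
    a).\<close>
  define \<xi> where "\<xi> z z' = (z - a + (z' - cnj a)) / 2" for z z' :: complex
  define \<eta> where "\<eta> z z' = (z - a - (z' - cnj a)) / (2 * \<i>)" for z z' :: complex
  define G where "G z z' = F (\<xi> z z') (\<eta> z z')" for z z'
  have in_s: "norm (\<xi> z z') \<le> s" "norm (\<eta> z z') \<le> s" if "z \<in> ball a s" "z' \<in> ball (cnj a) s" for z z'
  proof -
    have "norm (z - a) < s" "norm (z' - cnj a) < s" using that by (auto simp: dist_norm norm_minus_commute)
    thus "norm (\<xi> z z') \<le> s" "norm (\<eta> z z') \<le> s"
      using norm_triangle_ineq[of "z - a" "z' - cnj a"] norm_triangle_ineq4[of "z - a" "z' - cnj a"]
      by (auto simp: \<xi>_def \<eta>_def norm_divide norm_mult)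
  qed
  have ul: "uniform_limit Y (\<lambda>X y. \<Sum>p\<in>X. t (u y) (v y) p) (\<lambda>y. F (u y) (v y)) (finite_subsets_at_top UNIV)"
    if "\<And>y. y \<in> Y \<Longrightarrow> norm (u y) \<le> s \<and> norm (v y) \<le> s" for u v and Y :: "'b set"
    unfolding F_def by (rule Weierstrass_m_test_general[OF _ M]) (use that tM in blast)
  show ?thesis
  proof (rule that[of s G])
    fix z assume z: "z \<in> ball a s"
    have "z - a + (cnj z - cnj a) = 2 * of_real (Re (z - a))" "z - a - (cnj z - cnj a) = 2 * \<i> * of_real (Im (z - a))"
      by (auto simp: complex_eq_iff)
    hence "\<xi> z (cnj z) = of_real (Re (z - a))" "\<eta> z (cnj z) = of_real (Im (z - a))"
      by (simp_all only: \<xi>_def \<eta>_def) auto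
    hence "G z (cnj z) = (\<Sum>\<^sub>\<infinity>p. of_real ((\<lambda>(m, n). c m n * Re (z - a) ^ m * Im (z - a) ^ n) p))"
      unfolding G_def F_def t_def by (simp add: split_def)
    moreover have "((\<lambda>p. of_real ((\<lambda>(m, n). c m n * Re (z - a) ^ m * Im (z - a) ^ n) p)) has_sum (of_real (f z) :: complex)) UNIV"
      using z s by (intro has_sum_of_real f) auto
    ultimately show "G z (cnj z) = of_real (f z)" by (simp add: infsumI)
  next
    fix T u v assume T: "open T" and u: "u holomorphic_on T" and v: "v holomorphic_on T"
      and uv: "\<And>\<tau>. \<tau> \<in> T \<Longrightarrow> u \<tau> \<in> ball a s \<and> v \<tau> \<in> ball (cnj a) s"
    have \<xi>: "(\<lambda>\<tau>. \<xi> (u \<tau>) (v \<tau>)) holomorphic_on T" "(\<lambda>\<tau>. \<eta> (u \<tau>) (v \<tau>)) holomorphic_on T"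
      unfolding \<xi>_def \<eta>_def by (auto intro!: holomorphic_intros u v)
    show "(\<lambda>\<tau>. G (u \<tau>) (v \<tau>)) holomorphic_on T"
    proof (rule hol_localI)
      fix \<tau>0 assume "\<tau>0 \<in> T"
      then obtain e where e: "e > 0" "cball \<tau>0 e \<subseteq> T" using T by (meson open_contains_cball)
      have hol: "(\<lambda>\<tau>. \<Sum>p\<in>X. t (\<xi> (u \<tau>) (v \<tau>)) (\<eta> (u \<tau>) (v \<tau>)) p) holomorphic_on T" for X
        unfolding t_def split_def by (intro holomorphic_intros \<xi>)
      have ul': "uniform_limit (cball \<tau>0 e) (\<lambda>X \<tau>. \<Sum>p\<in>X. t (\<xi> (u \<tau>) (v \<tau>)) (\<eta> (u \<tau>) (v \<tau>)) p)
          (\<lambda>\<tau>. F (\<xi> (u \<tau>) (v \<tau>)) (\<eta> (u \<tau>) (v \<tau>))) (finite_subsets_at_top UNIV)"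
        by (rule ul) (use uv in_s e in blast)
      have ev: "\<forall>\<^sub>F X in finite_subsets_at_top UNIV.
          continuous_on (cball \<tau>0 e) (\<lambda>\<tau>. \<Sum>p\<in>X. t (\<xi> (u \<tau>) (v \<tau>)) (\<eta> (u \<tau>) (v \<tau>)) p) \<and>
          (\<lambda>\<tau>. \<Sum>p\<in>X. t (\<xi> (u \<tau>) (v \<tau>)) (\<eta> (u \<tau>) (v \<tau>)) p) holomorphic_on ball \<tau>0 e"
        using e by (intro always_eventually allI conjI holomorphic_on_imp_continuous_on holomorphic_on_subset[OF hol]) auto
      have "(\<lambda>\<tau>. F (\<xi> (u \<tau>) (v \<tau>)) (\<eta> (u \<tau>) (v \<tau>))) holomorphic_on ball \<tau>0 e"
        by (rule holomorphic_uniform_limit[OF ev ul']) auto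
      thus "\<exists>T. open T \<and> \<tau>0 \<in> T \<and> (\<lambda>\<tau>. G (u \<tau>) (v \<tau>)) holomorphic_on T"
        unfolding G_def using e by (intro exI[of _ "ball \<tau>0 e"]) auto
    qed
  next
    have "continuous_on (ball a s \<times> ball (cnj a) s) (\<lambda>q. F (\<xi> (fst q) (snd q)) (\<eta> (fst q) (snd q)))"
    proof (rule uniform_limit_theorem)
      show "uniform_limit (ball a s \<times> ball (cnj a) s) (\<lambda>X q. \<Sum>p\<in>X. t (\<xi> (fst q) (snd q)) (\<eta> (fst q) (snd q)) p)
         (\<lambda>q. F (\<xi> (fst q) (snd q)) (\<eta> (fst q) (snd q))) (finite_subsets_at_top UNIV)"
        by (rule ul) (use in_s in auto)
      show "\<forall>\<^sub>F X in finite_subsets_at_top UNIV. continuous_on (ball a s \<times> ball (cnj a) s)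
         (\<lambda>q. \<Sum>p\<in>X. t (\<xi> (fst q) (snd q)) (\<eta> (fst q) (snd q)) p)"
        unfolding t_def split_def \<xi>_def \<eta>_def by (intro always_eventually allI continuous_intros) auto
    qed simp
    thus "continuous_on (ball a s \<times> ball (cnj a) s) (\<lambda>(z, z'). G z z')" unfolding G_def split_def .
  qed (use s in auto)
qed

text \<open>Local polarizations agree because, along the complex line through the midpoint of \<open>z\<close> and
  \<open>cnj z'\<close> that reaches \<open>(z, z')\<close> at the parameter \<open>\<i>\<close>, they coincide at real parameters.\<close>

lemma global_polarization:
  assumes f: "real_analytic_on f U"
  obtains E G where "open E" "\<And>z. z \<in> U \<Longrightarrow> (z, cnj z) \<in> E"
    "\<And>z. (z, cnj z) \<in> E \<Longrightarrow> z \<in> U \<and> G z (cnj z) = of_real (f z)"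
    "\<And>T u v. open T \<Longrightarrow> u holomorphic_on T \<Longrightarrow> v holomorphic_on T \<Longrightarrow>
       (\<And>\<tau>. \<tau> \<in> T \<Longrightarrow> (u \<tau>, v \<tau>) \<in> E) \<Longrightarrow> (\<lambda>\<tau>. G (u \<tau>) (v \<tau>)) holomorphic_on T"
    "continuous_on E (\<lambda>(z, z'). G z z')"
proof -
  define P where "P a s G \<longleftrightarrow> s > 0 \<and> ball a s \<subseteq> U \<and>
    (\<forall>z\<in>ball a s. G z (cnj z) = of_real (f z)) \<and>
    (\<forall>T u v. open T \<longrightarrow> u holomorphic_on T \<longrightarrow> v holomorphic_on T \<longrightarrow>
       (\<forall>\<tau>\<in>T. u \<tau> \<in> ball a s \<and> v \<tau> \<in> ball (cnj a) s) \<longrightarrow> (\<lambda>\<tau>. G (u \<tau>) (v \<tau>)) holomorphic_on T) \<and>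
    continuous_on (ball a s \<times> ball (cnj a) s) (\<lambda>(z, z'). G z z' :: complex)" for a s G
  have "\<exists>s G. P a s G" if "a \<in> U" for a
  proof -
    from f that obtain c r where r: "r > 0" "ball a r \<subseteq> U"
      "\<And>z. z \<in> ball a r \<Longrightarrow> ((\<lambda>(m, n). c m n * Re (z - a) ^ m * Im (z - a) ^ n) has_sum f z) UNIV"
      unfolding real_analytic_on_def by blast
    show ?thesis
    proof (rule local_polarization[of r a c f])
      fix s G assume *: "0 < s" "s \<le> r" "\<And>z. z \<in> ball a s \<Longrightarrow> G z (cnj z) = complex_of_real (f z)"
        "\<And>T u v. open T \<Longrightarrow> u holomorphic_on T \<Longrightarrow> v holomorphic_on T \<Longrightarrow>
          (\<And>\<tau>. \<tau> \<in> T \<Longrightarrow> u \<tau> \<in> ball a s \<and> v \<tau> \<in> ball (cnj a) s) \<Longrightarrow> (\<lambda>\<tau>. G (u \<tau>) (v \<tau>)) holomorphic_on T"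
        "continuous_on (ball a s \<times> ball (cnj a) s) (\<lambda>(z, z'). G z z')"
      have "ball a s \<subseteq> U" using r(2) *(2) by auto
      hence "P a s G" unfolding P_def using * by blast
      thus ?thesis by blast
    qed (use r in auto)
  qed
  then obtain s L where "\<And>a. a \<in> U \<Longrightarrow> P a (s a) (L a)" by metis
  hence s: "\<And>a. a \<in> U \<Longrightarrow> s a > 0" "\<And>a. a \<in> U \<Longrightarrow> ball a (s a) \<subseteq> U"
    and Lf: "\<And>a z. a \<in> U \<Longrightarrow> z \<in> ball a (s a) \<Longrightarrow> L a z (cnj z) = of_real (f z)"
    and Lhol: "\<And>a T u v. a \<in> U \<Longrightarrow> open T \<Longrightarrow> u holomorphic_on T \<Longrightarrow> v holomorphic_on T \<Longrightarrow>
       (\<And>\<tau>. \<tau> \<in> T \<Longrightarrow> u \<tau> \<in> ball a (s a) \<and> v \<tau> \<in> ball (cnj a) (s a)) \<Longrightarrow> (\<lambda>\<tau>. L a (u \<tau>) (v \<tau>)) holomorphic_on T"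
    and Lcont: "\<And>a. a \<in> U \<Longrightarrow> continuous_on (ball a (s a) \<times> ball (cnj a) (s a)) (\<lambda>(z, z'). L a z z')"
    unfolding P_def by blast+
  define Bi where "Bi a = ball a (s a) \<times> ball (cnj a) (s a)" for a
  have consistent: "L a z z' = L b z z'" if ab: "a \<in> U" "b \<in> U" and za: "(z, z') \<in> Bi a" and zb: "(z, z') \<in> Bi b" for a b z z'
  proof -
    define m where "m = (z + cnj z') / 2"
    define \<delta> where "\<delta> = (z - cnj z') / 2"
    define u where "u \<tau> = m - \<i> * \<delta> * \<tau>" for \<tau>
    define v where "v \<tau> = cnj m + \<i> * cnj \<delta> * \<tau>" for \<tau>
    \<comment> \<open>\<open>T\<close> is a preimage of balls under affine maps, hence convex and
      connected. It contains 0, near which real parameters accumulate, and \<i>, where the line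
      reaches (z, z').\<close>
    define T where "T = u -` (ball a (s a) \<inter> ball b (s b)) \<inter> v -` (ball (cnj a) (s a) \<inter> ball (cnj b) (s b))"
    have T: "open T" unfolding T_def u_def v_def
      by (intro open_Int open_vimage continuous_intros) auto
    have conv: "convex ((\<lambda>\<tau>::complex. p + q * \<tau>) -` S)" if "convex S" for p q :: complex and S
    proof (rule convexI)
      fix x y and k l :: real
      assume xy: "x \<in> (\<lambda>\<tau>. p + q * \<tau>) -` S" "y \<in> (\<lambda>\<tau>. p + q * \<tau>) -` S" and kl: "0 \<le> k" "0 \<le> l" "k + l = 1"
      have "k *\<^sub>R (p + q * x) + l *\<^sub>R (p + q * y) \<in> S"
        using convexD[OF that] xy kl by simp
      moreover have "k *\<^sub>R (p + q * x) + l *\<^sub>R (p + q * y) = of_real (k + l) * p + q * (k *\<^sub>R x + l *\<^sub>R y)"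
        by (simp add: scaleR_conv_of_real algebra_simps)
      ultimately show "k *\<^sub>R x + l *\<^sub>R y \<in> (\<lambda>\<tau>. p + q * \<tau>) -` S" using kl by simp
    qed
    have u': "u = (\<lambda>\<tau>. m + (- \<i> * \<delta>) * \<tau>)" and v': "v = (\<lambda>\<tau>. cnj m + (\<i> * cnj \<delta>) * \<tau>)"
      by (auto simp: u_def v_def)
    have Tc: "convex T" unfolding T_def u' v' by (intro convex_Int conv) auto
    \<comment> \<open>The product of a ball with its conjugate is convex and invariant under the
      swap of (z, z') with (cnj z', cnj z), so it contains the midpoint of these two points.\<close>
    have mid: "m \<in> ball c t \<and> cnj m \<in> ball (cnj c) t" if "z \<in> ball c t" "z' \<in> ball (cnj c) t" for c t
    proof -
      have "norm (z - c) < t" "norm (z' - cnj c) < t" using that by (auto simp: dist_norm norm_minus_commute)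
      hence 1: "norm (z - c) < t" "norm (cnj z' - c) < t" by (auto, metis complex_cnj_cnj complex_cnj_diff complex_mod_cnj)
      have "m - c = ((z - c) + (cnj z' - c)) / 2" by (simp add: m_def field_simps)
      hence "norm (m - c) = norm ((z - c) + (cnj z' - c)) / 2" by (simp only: norm_divide) simp
      also have "\<dots> \<le> (norm (z - c) + norm (cnj z' - c)) / 2"
        by (intro divide_right_mono norm_triangle_ineq) simp
      finally have "norm (m - c) \<le> (norm (z - c) + norm (cnj z' - c)) / 2" .
      hence mc: "norm (m - c) < t" using 1 by simp
      hence "norm (cnj m - cnj c) < t" by (metis complex_cnj_diff complex_mod_cnj)
      thus ?thesis using mc by (auto simp: dist_norm norm_minus_commute)
    qed
    have T0: "0 \<in> T" using mid[of a "s a"] mid[of b "s b"] za zb by (auto simp: T_def u_def v_def Bi_def)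
    have uvi: "u \<i> = z" "v \<i> = z'" by (auto simp: u_def v_def m_def \<delta>_def field_simps)
    hence Ti: "\<i> \<in> T" using za zb by (auto simp: T_def Bi_def)
    have uv: "v (of_real x) = cnj (u (of_real x))" for x by (simp add: u_def v_def)
    define H where "H \<tau> = L a (u \<tau>) (v \<tau>) - L b (u \<tau>) (v \<tau>)" for \<tau>
    have "H \<i> = 0"
    proof (rule analytic_continuation[of H T "of_real ` UNIV \<inter> T" 0])
      show "H holomorphic_on T" unfolding H_def
        using ab by (intro holomorphic_on_diff Lhol T) (auto simp: T_def u_def v_def intro!: holomorphic_intros)
      show "connected T" using Tc by (rule convex_connected)
      obtain e where e: "e > 0" "ball 0 e \<subseteq> T" using T T0 by (meson open_contains_ball)
      show "(0::complex) islimpt (of_real ` UNIV \<inter> T)"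
        unfolding islimpt_approachable
      proof (intro allI impI)
        fix d :: real assume d: "d > 0"
        have "of_real (min d e / 2) \<in> ball (0::complex) e" using d e by (auto simp: min_def)
        hence "of_real (min d e / 2) \<in> T" using e by blast
        thus "\<exists>x'\<in>of_real ` UNIV \<inter> T. x' \<noteq> 0 \<and> dist x' (0::complex) < d"
          using d e by (intro bexI[of _ "of_real (min d e / 2)"] IntI rangeI) (auto simp: min_def)
      qed
      fix \<tau> assume "\<tau> \<in> (of_real ` UNIV \<inter> T :: complex set)"
      then obtain x where x: "\<tau> = of_real x" "\<tau> \<in> T" by auto
      thus "H \<tau> = 0" using Lf[OF ab(1), of "u \<tau>"] Lf[OF ab(2), of "u \<tau>"] uv[of x] by (simp add: H_def T_def)
    qed (use T T0 Ti in auto)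
    thus ?thesis by (simp add: H_def uvi)
  qed
  define E where "E = (\<Union>a\<in>U. Bi a)"
  define G where "G z z' = L (SOME a. a \<in> U \<and> (z, z') \<in> Bi a) z z'" for z z'
  have G: "G z z' = L a z z'" if "a \<in> U" "(z, z') \<in> Bi a" for a z z'
  proof -
    have "(SOME a. a \<in> U \<and> (z, z') \<in> Bi a) \<in> U \<and> (z, z') \<in> Bi (SOME a. a \<in> U \<and> (z, z') \<in> Bi a)"
      by (rule someI[of _ a]) (use that in auto)
    thus ?thesis unfolding G_def using consistent that by blast
  qed
  have Biop: "open (Bi a)" for a unfolding Bi_def by (intro open_Times) auto
  show ?thesis
  proof (rule that[of E G])
    show "open E" unfolding E_def using Biop by blast
    show "(z, cnj z) \<in> E" if "z \<in> U" for z using that s(1)[OF that] by (auto simp: E_def Bi_def intro!: bexI[of _ z])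
    show "z \<in> U \<and> G z (cnj z) = of_real (f z)" if "(z, cnj z) \<in> E" for z
    proof -
      from that obtain a where a: "a \<in> U" "(z, cnj z) \<in> Bi a" by (auto simp: E_def)
      hence "z \<in> ball a (s a)" by (auto simp: Bi_def)
      thus ?thesis using G[OF a] Lf[OF a(1)] s(2)[OF a(1)] by auto
    qed
    show "continuous_on E (\<lambda>(z, z'). G z z')" unfolding E_def
    proof (rule continuous_on_open_UN)
      fix a assume a: "a \<in> U"
      have "continuous_on (Bi a) (\<lambda>(z, z'). L a z z')" using Lcont[OF a] by (simp add: Bi_def)
      thus "continuous_on (Bi a) (\<lambda>(z, z'). G z z')"
        by (rule continuous_on_eq) (use G[OF a] in auto)
    qed (use Biop in auto)
    fix T u v assume T: "open T" and u: "u holomorphic_on T" and v: "v holomorphic_on T"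
      and uv: "\<And>\<tau>. \<tau> \<in> T \<Longrightarrow> (u \<tau>, v \<tau>) \<in> E"
    show "(\<lambda>\<tau>. G (u \<tau>) (v \<tau>)) holomorphic_on T"
    proof (rule hol_localI)
      fix \<tau>0 assume \<tau>0: "\<tau>0 \<in> T"
      then obtain a where a: "a \<in> U" "(u \<tau>0, v \<tau>0) \<in> Bi a" using uv[OF \<tau>0] by (auto simp: E_def)
      define T' where "T' = T \<inter> (\<lambda>\<tau>. (u \<tau>, v \<tau>)) -` Bi a"
      have T': "open T'" unfolding T'_def
        by (intro continuous_open_preimage T Biop continuous_intros holomorphic_on_imp_continuous_on u v)
      have "(\<lambda>\<tau>. L a (u \<tau>) (v \<tau>)) holomorphic_on T'"
        by (intro Lhol[OF a(1) T'] holomorphic_on_subset[OF u] holomorphic_on_subset[OF v]) (auto simp: T'_def Bi_def)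
      hence "(\<lambda>\<tau>. G (u \<tau>) (v \<tau>)) holomorphic_on T'"
        by (rule holomorphic_transform) (use G[OF a(1)] in \<open>auto simp: T'_def\<close>)
      thus "\<exists>T. open T \<and> \<tau>0 \<in> T \<and> (\<lambda>\<tau>. G (u \<tau>) (v \<tau>)) holomorphic_on T"
        using T' \<tau>0 a by (intro exI[of _ T']) (auto simp: T'_def)
    qed
  qed
qed

lemma holomorphic_reflected:
  assumes h: "h holomorphic_on {w. \<rho> < norm w}" and A: "open A" "0 \<notin> A" "\<And>w. w \<in> A \<Longrightarrow> \<rho> < 1 / norm w"
  shows "(\<lambda>\<sigma>. cnj (h (cnj (1 / \<sigma>)))) holomorphic_on A"
proof -
  have "(\<lambda>w. h (1 / w)) holomorphic_on cnj ` A"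
    by (rule hol_comp[OF h]) (use A in \<open>auto intro!: holomorphic_intros simp: norm_divide\<close>)
  from holomorphic_on_compose_cnj_cnj[OF this A(1)] show ?thesis by (simp add: o_def)
qed

text \<open>On the circle of radius exp (- x / 2) the point \<sigma> = exp x w satisfies both exp (-
  x) \<sigma> = w and 1 / cnj \<sigma> = w. So the polarized weight at these two arguments is the
  weight itself at \<psi> w, while for independent x and \<sigma> the expression is holomorphic in
  each. The factor exp (- x) belongs to the area element. In the application \<open>v\<close> is V
  in the exterior coordinate.\<close>

lemma kernel_exists:
  assumes \<rho>: "0 < \<rho>" "\<rho> < 1" and \<psi>: "\<psi> holomorphic_on {w. \<rho> < norm w}" and v: "v holomorphic_on {w. \<rho> < norm w}"
    and f: "real_analytic_on f U" and U: "\<And>w. norm w = 1 \<Longrightarrow> \<psi> w \<in> U"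
    and v1: "\<And>w. norm w = 1 \<Longrightarrow> 2 * Re (v w) = - f (\<psi> w)"
  obtains K a x1 where "annulus_kernel K a x1" "\<rho> < a"
    "\<And>x w. 0 \<le> x \<Longrightarrow> x < x1 \<Longrightarrow> norm w = exp (- x / 2) \<Longrightarrow> a < norm w \<Longrightarrow>
       \<psi> w \<in> U \<and> K (of_real x) (of_real (exp x) * w) = of_real (exp (- x + f (\<psi> w) + 2 * Re (v w)))"
proof -
  obtain E G where E: "open E" "\<And>z. z \<in> U \<Longrightarrow> (z, cnj z) \<in> E"
    and Gf: "\<And>z. (z, cnj z) \<in> E \<Longrightarrow> z \<in> U \<and> G z (cnj z) = of_real (f z)"
    and Ghol: "\<And>T u v. open T \<Longrightarrow> u holomorphic_on T \<Longrightarrow> v holomorphic_on T \<Longrightarrow>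
       (\<And>\<tau>. \<tau> \<in> T \<Longrightarrow> (u \<tau>, v \<tau>) \<in> E) \<Longrightarrow> (\<lambda>\<tau>. G (u \<tau>) (v \<tau>)) holomorphic_on T"
    and Gcont: "continuous_on E (\<lambda>(z, z'). G z z')"
    by (rule global_polarization[OF f]) blast
  define Dom where "Dom = {(x::complex, \<sigma>::complex). \<rho> < norm (exp (- x) * \<sigma>) \<and> 0 < norm \<sigma> \<and> norm \<sigma> * \<rho> < 1}"
  have Dom: "open Dom" unfolding Dom_def split_def
    by (intro open_Collect_conj open_Collect_less continuous_intros)
  define g where "g = (\<lambda>(x, \<sigma>). (\<psi> (exp (- x) * \<sigma>), cnj (\<psi> (cnj (1 / \<sigma>)))))"
  have ext2: "\<rho> < norm (cnj (1 / \<sigma>))" if "0 < norm \<sigma>" "norm \<sigma> * \<rho> < 1" for \<sigma>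
    using that by (simp add: norm_divide pos_less_divide_eq mult.commute)
  have c\<psi>1: "continuous_on Dom (\<lambda>p. h (exp (- fst p) * snd p))"
    and c\<psi>2: "continuous_on Dom (\<lambda>p. cnj (h (cnj (1 / snd p))))"
    if "h holomorphic_on {w. \<rho> < norm w}" for h
    by (intro continuous_intros continuous_on_compose2[OF holomorphic_on_imp_continuous_on[OF that]];
        use ext2 in \<open>auto simp: Dom_def split_def\<close>)+
  have gc: "continuous_on Dom g" unfolding g_def split_def by (intro continuous_on_Pair c\<psi>1 c\<psi>2 \<psi>)
  define P where "P = Dom \<inter> g -` E"
  have P: "open P" unfolding P_def by (rule continuous_open_preimage[OF gc Dom E(1)])
  have unit: "cnj (1 / \<sigma>) = \<sigma>" if "norm \<sigma> = 1" for \<sigma>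
  proof -
    have "\<sigma> * cnj \<sigma> = 1" using that complex_norm_square[of \<sigma>] by simp
    hence "1 / cnj \<sigma> = \<sigma>" by (metis mult_eq_0_iff nonzero_eq_divide_eq zero_neq_one)
    thus ?thesis by simp
  qed
  \<comment> \<open>At x = 0 and norm \<sigma> = 1 both arguments of the polarization come from the
    same point \<sigma>. Compactness of this circle gives a neighborhood of uniform width \<epsilon>
    on which the polarization is defined.\<close>
  have "{0} \<times> sphere 0 1 \<subseteq> P" using \<rho> unit E(2)[OF U] by (auto simp: P_def Dom_def g_def)
  moreover have "compact ({0::complex} \<times> sphere (0::complex) 1)" by (intro compact_Times) auto
  ultimately obtain \<epsilon> where \<epsilon>: "\<epsilon> > 0" "(\<Union>p\<in>{0} \<times> sphere 0 1. ball p \<epsilon>) \<subseteq> P"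
    using compact_subset_open_imp_ball_epsilon_subset P by metis
  \<comment> \<open>The first entry keeps a above \<rho>. The second bounds both 1 - a and 1 / a - 1
    by \<epsilon> / 2, so that the annulus stays within \<epsilon> / 2 of the unit circle.\<close>
  define a where "a = max ((1 + \<rho>) / 2) (1 / (1 + \<epsilon> / 2))"
  define x1 where "x1 = \<epsilon> / 2"
  have a: "0 < a" "a < 1" "\<rho> < a" "1 - a < \<epsilon> / 2" "1 / a \<le> 1 + \<epsilon> / 2"
  proof -
    show "0 < a" "\<rho> < a" using \<rho> unfolding a_def less_max_iff_disj by (auto simp: field_simps)
    show "a < 1" using \<rho> \<epsilon> by (simp add: a_def)
    have "1 - 1 / (1 + \<epsilon> / 2) < \<epsilon> / 2" using \<epsilon> by (simp add: field_simps)
    moreover have ge: "1 / (1 + \<epsilon> / 2) \<le> a" by (simp add: a_def)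
    ultimately show "1 - a < \<epsilon> / 2" by simp
    show "1 / a \<le> 1 + \<epsilon> / 2" using ge \<open>0 < a\<close> \<epsilon> by (simp add: field_simps)
  qed
  have inP: "(x, \<sigma>) \<in> P" if "x \<in> ball 0 x1" "a < norm \<sigma>" "norm \<sigma> < 1 / a" for x \<sigma>
  proof -
    define \<sigma>' where "\<sigma>' = \<sigma> / of_real (norm \<sigma>)"
    have \<sigma>0: "norm \<sigma> > 0" using that a by linarith
    have 1: "norm \<sigma>' = 1" using \<sigma>0 by (simp add: \<sigma>'_def norm_divide)
    have "\<sigma> - \<sigma>' = of_real (norm \<sigma> - 1) * \<sigma>'" using \<sigma>0 by (simp add: \<sigma>'_def field_simps)
    hence "norm (\<sigma> - \<sigma>') = \<bar>norm \<sigma> - 1\<bar>" by (metis 1 mult.right_neutral norm_mult norm_of_real)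
    hence "dist \<sigma>' \<sigma> < \<epsilon> / 2" using that a by (simp add: dist_norm norm_minus_commute abs_if)
    moreover have "dist 0 x < \<epsilon> / 2" using that by (simp add: x1_def)
    moreover have "dist (0, \<sigma>') (x, \<sigma>) \<le> dist 0 x + dist \<sigma>' \<sigma>"
      unfolding dist_Pair_Pair by (rule sqrt_sum_squares_le_sum) auto
    ultimately have "(x, \<sigma>) \<in> ball (0, \<sigma>') \<epsilon>" by simp
    moreover have "(0, \<sigma>') \<in> {0} \<times> sphere 0 1" using 1 by simp
    ultimately show ?thesis using \<epsilon>(2) by blast
  qed
  let ?ann = "{w::complex. a < norm w \<and> norm w < 1/a}"
  define K where "K x \<sigma> = exp (- x + G (\<psi> (exp (- x) * \<sigma>)) (cnj (\<psi> (cnj (1 / \<sigma>))))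
     + v (exp (- x) * \<sigma>) + cnj (v (cnj (1 / \<sigma>))))" for x \<sigma>
  have D1: "\<rho> < norm (exp (- x) * \<sigma>)" and D2: "(\<psi> (exp (- x) * \<sigma>), cnj (\<psi> (cnj (1 / \<sigma>)))) \<in> E"
    and D3: "0 < norm \<sigma>" "norm \<sigma> * \<rho> < 1" if "x \<in> ball 0 x1" "a < norm \<sigma>" "norm \<sigma> < 1 / a" for x \<sigma>
    using inP[OF that] by (auto simp: P_def Dom_def g_def)
  have hols: "K x holomorphic_on ?ann" if x: "x \<in> ball 0 x1" for x
  proof -
    have h1: "(\<lambda>\<sigma>. h (exp (- x) * \<sigma>)) holomorphic_on ?ann" if "h holomorphic_on {w. \<rho> < norm w}" for h
      by (rule hol_comp[OF that]) (use D1[OF x] in \<open>auto intro!: holomorphic_intros\<close>)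
    have h2: "(\<lambda>\<sigma>. cnj (h (cnj (1 / \<sigma>)))) holomorphic_on ?ann" if "h holomorphic_on {w. \<rho> < norm w}" for h
      by (rule holomorphic_reflected[OF that open_annulus])
         (use D3[OF x] a in \<open>auto simp: less_divide_eq mult.commute\<close>)
    have "(\<lambda>\<sigma>. G (\<psi> (exp (- x) * \<sigma>)) (cnj (\<psi> (cnj (1 / \<sigma>))))) holomorphic_on ?ann"
      by (rule Ghol[OF open_annulus h1[OF \<psi>] h2[OF \<psi>]]) (use D2[OF x] in auto)
    thus ?thesis unfolding K_def by (intro holomorphic_intros h1[OF v] h2[OF v])
  qed
  have holx: "(\<lambda>x. K x \<sigma>) holomorphic_on ball 0 x1" if \<sigma>: "a < norm \<sigma>" "norm \<sigma> < 1/a" for \<sigma>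
  proof -
    have h1: "(\<lambda>x. h (exp (- x) * \<sigma>)) holomorphic_on ball 0 x1" if "h holomorphic_on {w. \<rho> < norm w}" for h
      by (rule hol_comp[OF that]) (use D1[OF _ \<sigma>] in \<open>auto intro!: holomorphic_intros\<close>)
    have "(\<lambda>x. G (\<psi> (exp (- x) * \<sigma>)) (cnj (\<psi> (cnj (1 / \<sigma>))))) holomorphic_on ball 0 x1"
      by (rule Ghol[OF open_ball h1[OF \<psi>] holomorphic_on_const]) (use D2[OF _ \<sigma>] in auto)
    thus ?thesis unfolding K_def by (intro holomorphic_intros h1[OF v])
  qed
  have sub: "ball 0 x1 \<times> ?ann \<subseteq> P" using inP by auto
  have contK: "continuous_on (ball 0 x1 \<times> ?ann) (\<lambda>(x, \<sigma>). K x \<sigma>)"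
  proof -
    have sD: "ball 0 x1 \<times> ?ann \<subseteq> Dom" using sub by (auto simp: P_def)
    have "continuous_on (ball 0 x1 \<times> ?ann) (\<lambda>p. (\<lambda>(z, z'). G z z') (g p))"
      by (rule continuous_on_compose2[OF Gcont continuous_on_subset[OF gc sD]]) (use sub in \<open>auto simp: P_def\<close>)
    hence "continuous_on (ball 0 x1 \<times> ?ann) (\<lambda>p. G (\<psi> (exp (- fst p) * snd p)) (cnj (\<psi> (cnj (1 / snd p)))))"
      by (simp add: g_def split_def)
    thus ?thesis unfolding K_def split_def
      by (intro continuous_intros continuous_on_subset[OF c\<psi>1[OF v] sD] continuous_on_subset[OF c\<psi>2[OF v] sD])
  qed
  have Kreal: "\<psi> w \<in> U \<and> K (of_real x) (of_real (exp x) * w) = of_real (exp (- x + f (\<psi> w) + 2 * Re (v w)))"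
    if x: "0 \<le> x" "x < x1" and w: "norm w = exp (- x / 2)" "a < norm w" for x w
  proof -
    define \<sigma> where "\<sigma> = of_real (exp x) * w"
    have n\<sigma>: "norm \<sigma> = exp (x / 2)" by (simp add: \<sigma>_def norm_mult w exp_add[symmetric])
    have "norm \<sigma> = 1 / norm w" unfolding n\<sigma> w by (simp add: exp_minus inverse_eq_divide)
    hence \<sigma>: "a < norm \<sigma>" "norm \<sigma> < 1 / a"
      using w a x by (auto simp: n\<sigma> divide_strict_left_mono intro: less_le_trans[OF a(2)])
    have e1: "exp (- of_real x) * \<sigma> = w"
      by (simp add: \<sigma>_def exp_minus exp_of_real field_simps)
    have "w * cnj w = of_real (exp (- x))" using complex_norm_square[of w] unfolding w
      by (simp add: power2_eq_square exp_add[symmetric] of_real_mult[symmetric] del: of_real_mult)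
    hence "cnj \<sigma> * w = 1" by (simp add: \<sigma>_def mult.assoc exp_add[symmetric] of_real_mult[symmetric] mult.commute[of "cnj w"] del: of_real_mult)
    hence e2: "cnj (1 / \<sigma>) = w" by (simp add: nonzero_divide_eq_eq) (metis mult_eq_0_iff nonzero_divide_eq_eq mult.commute zero_neq_one)
    have xb: "of_real x \<in> ball (0::complex) x1" using x by simp
    have "(\<psi> w, cnj (\<psi> w)) \<in> E" using D2[OF xb \<sigma>] by (simp only: e1 e2)
    hence *: "\<psi> w \<in> U" "G (\<psi> w) (cnj (\<psi> w)) = of_real (f (\<psi> w))" using Gf by auto
    have "K (of_real x) \<sigma> = exp (- of_real x + of_real (f (\<psi> w)) + v w + cnj (v w))"
      unfolding K_def e1 e2 *(2) ..
    also have "- of_real x + of_real (f (\<psi> w)) + v w + cnj (v w) = of_real (- x + f (\<psi> w) + 2 * Re (v w))"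
      by (simp add: complex_eq_iff)
    finally show ?thesis using * by (simp only: \<sigma>_def exp_of_real simp_thms)
  qed
  have K0: "K 0 \<sigma> = 1" if \<sigma>: "a < norm \<sigma>" "norm \<sigma> < 1/a" for \<sigma>
  proof -
    have x0: "0 \<in> ball (0::complex) x1" using \<epsilon> by (simp add: x1_def)
    \<comment> \<open>On the unit circle this is the boundary condition \<open>v1\<close>; the
      identity theorem carries it to the whole annulus.\<close>
    have "K 0 \<sigma> - 1 = 0"
    proof (rule analytic_continuation[of "\<lambda>\<sigma>. K 0 \<sigma> - 1" ?ann "sphere 0 1" 1])
      show "(\<lambda>\<sigma>. K 0 \<sigma> - 1) holomorphic_on ?ann" by (intro holomorphic_intros hols x0)
      show "connected ?ann" using connected_annulus(1)[of a "0::complex" "1/a"] by simp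
      show "(1::complex) islimpt sphere 0 1"
      proof (rule connected_imp_perfect)
        have "(1::complex) \<in> sphere 0 1" "(-1::complex) \<in> sphere 0 1" by auto
        thus "sphere (0::complex) 1 \<noteq> {x}" for x by (metis one_neq_neg_one singletonD)
      qed (auto intro!: connected_sphere)
      fix z :: complex assume z: "z \<in> sphere 0 1"
      have "K (of_real 0) (of_real (exp 0) * z) = of_real (exp (- 0 + f (\<psi> z) + 2 * Re (v z)))"
        using Kreal[of 0 z] z a \<epsilon> by (auto simp: x1_def)
      thus "K 0 z - 1 = 0" using v1[of z] z by simp
    qed (use \<sigma> a open_annulus in auto)
    thus ?thesis by simp
  qed
  show ?thesis
  proof (rule that[of K a x1])
    show "annulus_kernel K a x1"
      by unfold_locales (use a \<epsilon> contK holx hols K0 in \<open>auto simp: x1_def\<close>)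
  qed (use a Kreal in auto)
qed

section \<open>Area integrals in exterior coordinates\<close>


text \<open>The change of variables theorem used below is stated for vectors with a Jacobian matrix,
  so the plane is transported to \<open>real^2\<close> by a pair of mutually inverse
  isometries.\<close>

definition c2v :: "complex \<Rightarrow> real^2" where "c2v z = (\<chi> i. if i = 1 then Re z else Im z)"
definition v2c :: "real^2 \<Rightarrow> complex" where "v2c v = Complex (vec_nth v 1) (vec_nth v 2)"

lemma v2c_c2v [simp]: "v2c (c2v z) = z" by (simp add: c2v_def v2c_def)
lemma c2v_v2c [simp]: "c2v (v2c v) = v" by (simp add: c2v_def v2c_def vec_eq_iff forall_2)
lemma linear_c2v: "linear c2v" by (rule linearI) (auto simp: c2v_def vec_eq_iff)
lemma linear_v2c: "linear v2c" by (rule linearI) (auto simp: v2c_def complex_eq_iff)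
lemma bounded_linear_c2v: "bounded_linear c2v" using linear_c2v by (simp add: linear_conv_bounded_linear)
lemma bounded_linear_v2c: "bounded_linear v2c" using linear_v2c by (simp add: linear_conv_bounded_linear)

lemma norm_c2v [simp]: "norm (c2v z) = norm z"
  by (simp add: norm_vec_def L2_set_def UNIV_2 c2v_def cmod_def)

lemma c2v_cbox: "c2v ` cbox u v = cbox (c2v u) (c2v v)"
proof -
  have "x \<in> c2v ` cbox u v \<longleftrightarrow> x \<in> cbox (c2v u) (c2v v)" for x
  proof -
    have "x \<in> c2v ` cbox u v \<longleftrightarrow> v2c x \<in> cbox u v" by (metis c2v_v2c v2c_c2v image_iff)
    also have "\<dots> \<longleftrightarrow> x \<in> cbox (c2v u) (c2v v)"
      by (auto simp: mem_box_cart forall_2 v2c_def c2v_def in_cbox_complex_iff)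
    finally show ?thesis .
  qed
  thus ?thesis by blast
qed

lemma v2c_cbox: "v2c ` cbox u v = cbox (v2c u) (v2c v)"
proof -
  have "cbox u v = c2v ` cbox (v2c u) (v2c v)" by (simp add: c2v_cbox)
  hence "v2c ` cbox u v = (\<lambda>x. v2c (c2v x)) ` cbox (v2c u) (v2c v)" by (simp only: image_image)
  thus ?thesis by simp
qed

lemma content_complex_cbox:
  "measure lborel (cbox u v) = (if Re u \<le> Re v \<and> Im u \<le> Im v then (Re v - Re u) * (Im v - Im u) else 0)" for u v :: complex
  by (auto simp: content_cbox_cases Basis_complex_def inner_complex_def)

lemma ex_2_iff: "(\<exists>i::2. P i) \<longleftrightarrow> P 1 \<or> P 2"
  by (metis exhaust_2)

lemma content_c2v: "measure lborel (c2v ` cbox u v) = measure lborel (cbox u v)"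
proof -
  have e: "cbox (c2v u) (c2v v) = {} \<longleftrightarrow> Re v < Re u \<or> Im v < Im u"
    unfolding interval_eq_empty_cart ex_2_iff by (simp add: c2v_def)
  show ?thesis
    unfolding c2v_cbox content_complex_cbox content_cbox_if_cart e
    by (auto simp: UNIV_2 c2v_def)
qed

lemma content_v2c: "measure lborel (v2c ` cbox u v) = measure lborel (cbox u v)"
proof -
  have "measure lborel (v2c ` cbox u v) = measure lborel (c2v ` cbox (v2c u) (v2c v))"
    by (simp only: v2c_cbox content_c2v)
  thus ?thesis by (simp only: c2v_cbox c2v_v2c)
qed

text \<open>\<open>has_integral_twiddle\<close> works on boxes, so f is first extended by 0 to a box
  containing \<open>S\<close>; the scale factor is 1.\<close>

lemma has_integral_measure_preserving:
  fixes f :: "'b::euclidean_space \<Rightarrow> 'c::banach" and g :: "'a::euclidean_space \<Rightarrow> 'b"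
  assumes hg: "\<And>x. h (g x) = x" and gh: "\<And>x. g (h x) = x" and contg: "\<And>x. continuous (at x) g"
    and g: "\<And>u v. \<exists>w z. g ` cbox u v = cbox w z" and h: "\<And>u v. \<exists>w z. h ` cbox u v = cbox w z"
    and r: "\<And>u v. measure lborel (g ` cbox u v) = measure lborel (cbox u v)"
    and S: "bounded S" and f: "(f has_integral i) S"
  shows "((\<lambda>x. f (g x)) has_integral i) (h ` S)"
proof -
  obtain a b where ab: "S \<subseteq> cbox a b" using bounded_subset_cbox_symmetric[OF S] by blast
  have "((\<lambda>x. if x \<in> S then f x else 0) has_integral i) (cbox a b)" using ab f by simp
  from has_integral_twiddle[OF zero_less_one hg gh contg g h _ this]
  have "((\<lambda>x. if g x \<in> S then f (g x) else 0) has_integral i) (h ` cbox a b)" using r by simp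
  moreover have "g x \<in> S \<longleftrightarrow> x \<in> h ` S" for x by (metis hg gh image_iff)
  ultimately have "((\<lambda>x. if x \<in> h ` S then f (g x) else 0) has_integral i) (h ` cbox a b)" by simp
  moreover have "h ` S \<subseteq> h ` cbox a b" using ab by blast
  ultimately show ?thesis by simp
qed

lemma has_integral_v2c:
  fixes f :: "complex \<Rightarrow> 'c::banach"
  assumes "bounded S" "(f has_integral i) S"
  shows "((\<lambda>x. f (v2c x)) has_integral i) (c2v ` S)"
proof (rule has_integral_measure_preserving[OF _ _ _ _ _ _ assms])
  show "\<exists>w z. v2c ` cbox u v = cbox w z" for u v using v2c_cbox by blast
  show "\<exists>w z. c2v ` cbox u v = cbox w z" for u v using c2v_cbox by blast
qed (auto simp: linear_continuous_at[OF bounded_linear_v2c] content_v2c)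

lemma has_integral_c2v:
  fixes f :: "real^2 \<Rightarrow> 'c::banach"
  assumes "bounded S" "(f has_integral i) S"
  shows "((\<lambda>x. f (c2v x)) has_integral i) (v2c ` S)"
proof (rule has_integral_measure_preserving[OF _ _ _ _ _ _ assms])
  show "\<exists>w z. v2c ` cbox u v = cbox w z" for u v using v2c_cbox by blast
  show "\<exists>w z. c2v ` cbox u v = cbox w z" for u v using c2v_cbox by blast
qed (auto simp: linear_continuous_at[OF bounded_linear_c2v] content_c2v)

lemma v2c_scaleR_c2v: "v2c (r *\<^sub>R c2v y) = of_real r * y"
  by (simp add: v2c_def c2v_def complex_eq_iff)

lemma det_complex_mult: "det (matrix (\<lambda>h. c2v (p * v2c h))) = (norm p)\<^sup>2"
proof -
  have "v2c (axis 1 1) = 1" "v2c (axis 2 1) = \<i>"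
    by (auto simp: v2c_def axis_def complex_eq_iff)
  hence "det (matrix (\<lambda>h. c2v (p * v2c h))) = Re p * Re p + Im p * Im p"
    unfolding det_2 matrix_def by (simp add: c2v_def)
  thus ?thesis unfolding cmod_power2 by (simp add: power2_eq_square)
qed

lemma complex_change_of_variables:
  fixes f \<Psi> \<Psi>' :: "complex \<Rightarrow> complex"
  assumes S: "S \<in> sets borel" "bounded S" "bounded (\<Psi> ` S)"
    and der: "\<And>\<zeta>. \<zeta> \<in> S \<Longrightarrow> (\<Psi> has_field_derivative \<Psi>' \<zeta>) (at \<zeta>)"
    and inj: "inj_on \<Psi> S" and f: "f absolutely_integrable_on (\<Psi> ` S)"
  shows "((\<lambda>\<zeta>. of_real ((norm (\<Psi>' \<zeta>))\<^sup>2) * f (\<Psi> \<zeta>)) has_integral integral (\<Psi> ` S) f) S"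
proof -
  define I where "I = integral (\<Psi> ` S) f"
  have fI: "(f has_integral I) (\<Psi> ` S)" "(\<lambda>z. norm (f z)) integrable_on (\<Psi> ` S)"
    using f unfolding I_def absolutely_integrable_on_def by (auto simp: has_integral_integral)
  define F where "F = (\<lambda>x. c2v (f (v2c x)))"
  define g where "g = (\<lambda>x. c2v (\<Psi> (v2c x)))"
  define g' where "g' x h = c2v (\<Psi>' (v2c x) * v2c h)" for x h
  define S' where "S' = c2v ` S"
  have gS: "g ` S' = c2v ` \<Psi> ` S" by (auto simp: g_def S'_def image_image)
  have F1: "(F has_integral c2v I) (c2v ` \<Psi> ` S)"
    using has_integral_linear[OF has_integral_v2c[OF S(3) fI(1)] bounded_linear_c2v] by (simp add: F_def o_def)
  from fI(2) obtain J where "((\<lambda>z. norm (f z)) has_integral J) (\<Psi> ` S)" by blast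
  from has_integral_v2c[OF S(3) this] have F2: "(\<lambda>x. norm (F x)) integrable_on (c2v ` \<Psi> ` S)"
    by (auto simp: F_def)
  have F: "F absolutely_integrable_on g ` S' \<and> integral (g ` S') F = c2v I"
    using F1 F2 unfolding absolutely_integrable_on_def gS by (auto simp: integral_unique)
  have S'leb: "S' \<in> sets lebesgue"
  proof -
    have "v2c \<in> borel_measurable borel"
      by (intro borel_measurable_continuous_onI linear_continuous_on bounded_linear_v2c)
    from measurable_sets[OF this S(1)] have "v2c -` S \<in> sets borel" by simp
    moreover have "v2c -` S = S'"
    proof -
      have "x \<in> v2c -` S \<longleftrightarrow> x \<in> S'" for x unfolding S'_def by (metis c2v_v2c v2c_c2v imageE imageI vimage_eq)
      thus ?thesis by blast
    qed
    ultimately show ?thesis by simp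
  qed
  have derg: "(g has_derivative g' x) (at x within S')" if "x \<in> S'" for x
  proof -
    have "v2c x \<in> S" using that by (auto simp: S'_def)
    hence "(\<Psi> has_derivative (*) (\<Psi>' (v2c x))) (at (v2c x))" using der by (simp add: has_field_derivative_def)
    moreover have "(v2c has_derivative v2c) (at x within S')" by (rule bounded_linear_imp_has_derivative[OF bounded_linear_v2c])
    ultimately have "((\<lambda>x. \<Psi> (v2c x)) has_derivative (\<lambda>h. \<Psi>' (v2c x) * v2c h)) (at x within S')"
      using has_derivative_compose[of v2c v2c x S' \<Psi>] by simp
    thus ?thesis unfolding g_def g'_def by (rule bounded_linear.has_derivative[OF bounded_linear_c2v])
  qed
  have injg: "inj_on g S'"
    using inj unfolding inj_on_def g_def S'_def by (auto) (metis v2c_c2v)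
  have det: "\<bar>det (matrix (g' x))\<bar> = (norm (\<Psi>' (v2c x)))\<^sup>2" for x
    using det_complex_mult[of "\<Psi>' (v2c x)"] by (simp add: g'_def[abs_def])
  from has_absolute_integral_change_of_variables[OF S'leb derg injg, of F "c2v I"] F
  have "(\<lambda>x. \<bar>det (matrix (g' x))\<bar> *\<^sub>R F (g x)) absolutely_integrable_on S'"
    "integral S' (\<lambda>x. \<bar>det (matrix (g' x))\<bar> *\<^sub>R F (g x)) = c2v I" by auto
  hence "((\<lambda>x. \<bar>det (matrix (g' x))\<bar> *\<^sub>R F (g x)) has_integral c2v I) S'"
    unfolding absolutely_integrable_on_def by (auto simp: has_integral_integral)
  from has_integral_c2v[OF _ this]
  have "((\<lambda>x. \<bar>det (matrix (g' (c2v x)))\<bar> *\<^sub>R F (g (c2v x))) has_integral c2v I) (v2c ` S')"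
    unfolding S'_def using S(2) bounded_linear_image[OF S(2) bounded_linear_c2v] by simp
  moreover have "v2c ` S' = S" by (auto simp: S'_def image_image)
  ultimately have "((\<lambda>x. \<bar>det (matrix (g' (c2v x)))\<bar> *\<^sub>R F (g (c2v x))) has_integral c2v I) S" by simp
  from has_integral_linear[OF this bounded_linear_v2c] show ?thesis
    unfolding det o_def F_def g_def v2c_scaleR_c2v v2c_c2v I_def .
qed

lemma integral_complex_box:
  fixes F :: "complex \<Rightarrow> complex"
  assumes F: "continuous_on (cbox (Complex a c) (Complex b d)) F"
  shows "integral (cbox (Complex a c) (Complex b d)) F = integral {a..b} (\<lambda>x. integral {c..d} (\<lambda>y. F (Complex x y)))"
proof -
  let ?g = "\<lambda>p. Complex (fst p) (snd p)" and ?h = "\<lambda>z. (Re z, Im z)"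
  have cg: "continuous_on A ?g" for A
    unfolding Complex_eq by (intro continuous_intros)
  have gb: "?g ` cbox u v = cbox (?g u) (?g v)" for u v
  proof -
    have "z \<in> ?g ` cbox u v \<longleftrightarrow> ?h z \<in> cbox u v" for z
    proof
      assume "z \<in> ?g ` cbox u v"
      then obtain p where "p \<in> cbox u v" "z = ?g p" by blast
      moreover from this have "?h z = p" by simp
      ultimately show "?h z \<in> cbox u v" by simp
    next
      assume "?h z \<in> cbox u v"
      moreover have "z = ?g (?h z)" by simp
      ultimately show "z \<in> ?g ` cbox u v" by (intro image_eqI[of z ?g "?h z"])
    qed
    moreover have "?h z \<in> cbox u v \<longleftrightarrow> z \<in> cbox (?g u) (?g v)" for z
      by (cases u; cases v) (auto simp: in_cbox_complex_iff cbox_Pair_eq)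
    ultimately show ?thesis by blast
  qed
  have hb: "?h ` cbox u v = cbox (?h u) (?h v)" for u v
    using gb[of "?h u" "?h v"] by (auto simp: image_iff in_cbox_complex_iff cbox_Pair_eq intro!: bexI[of _ "Complex _ _"])
  have "(F has_integral integral (cbox (Complex a c) (Complex b d)) F) (cbox (Complex a c) (Complex b d))"
    using F by (intro integrable_integral integrable_continuous)
  hence "((\<lambda>p. F (?g p)) has_integral integral (cbox (Complex a c) (Complex b d)) F) (?h ` cbox (Complex a c) (Complex b d))"
  proof (rule has_integral_measure_preserving[rotated 7])
    show "measure lborel (?g ` cbox u v) = measure lborel (cbox u v)" for u v :: "real \<times> real"
      unfolding gb content_complex_cbox by (cases u; cases v) (auto simp: content_Pair)
    show "continuous (at x) ?g" for x
      using cg[of UNIV] by (cases x) (simp add: continuous_on_eq_continuous_at)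
  qed (use gb hb in auto)
  hence "integral (cbox (a, c) (b, d)) (\<lambda>p. F (?g p)) = integral (cbox (Complex a c) (Complex b d)) F"
    unfolding hb by (auto simp: integral_unique)
  moreover have "integral (cbox (a, c) (b, d)) (\<lambda>p. F (?g p)) = integral (cbox a b) (\<lambda>x. integral (cbox c d) (\<lambda>y. F (?g (x, y))))"
    by (rule integral_prod_continuous, rule continuous_on_compose2[OF F cg])
       (auto simp: in_cbox_complex_iff cbox_Pair_eq)
  ultimately show ?thesis by simp
qed

text \<open>With w = exp (s + i \<theta>) and r = exp s the Jacobian is the squared modulus of
  \<psi>' times r^2. The angular integral is 2 pi times a mean, and s = - x / 2 turns r^2 into exp
  (- x) and contributes a factor 1 / 2. Together this is the constant pi, which cancels against the
  normalization of \<open>dA\<close>.\<close>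

lemma exterior_area_integral:
  fixes f g \<psi> :: "complex \<Rightarrow> complex"
  assumes \<psi>: "\<psi> holomorphic_on {w. \<rho> < norm w}" "inj_on \<psi> {w. \<rho> < norm w}" and \<rho>: "\<rho> < exp (- x0 / 2)" and x0: "x0 > 0"
    and f: "f absolutely_integrable_on (\<psi> ` {w. exp (- x0 / 2) < norm w \<and> norm w < 1})"
    and g: "continuous_on {w. exp (- x0 / 2) \<le> norm w \<and> norm w \<le> 1} g"
    and fg: "\<And>w. exp (- x0 / 2) < norm w \<Longrightarrow> norm w < 1 \<Longrightarrow> f (\<psi> w) = g w"
  shows "integral (\<psi> ` {w. exp (- x0 / 2) < norm w \<and> norm w < 1}) f = of_real pi *
    integral {0..x0} (\<lambda>x. of_real (exp (- x)) * cmean (\<lambda>w. of_real ((norm (deriv \<psi> w))\<^sup>2) * g w) (exp (- x / 2)))"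
proof -
  \<comment> \<open>\<open>S\<close> is half open in the angle, so that exp is injective on it; the
    missing edges of the closed box form a null set.\<close>
  define S where "S = {\<zeta>. - x0 / 2 < Re \<zeta> \<and> Re \<zeta> < 0 \<and> 0 \<le> Im \<zeta> \<and> Im \<zeta> < 2 * pi}"
  let ?A = "{w::complex. exp (- x0 / 2) < norm w \<and> norm w < 1}"
  let ?C = "{w::complex. exp (- x0 / 2) \<le> norm w \<and> norm w \<le> 1}"
  have Sborel: "S \<in> sets borel" unfolding S_def by measurable
  have Sbox: "S \<subseteq> cbox (Complex (- x0 / 2) 0) (Complex 0 (2*pi))" unfolding S_def by (auto simp: in_cbox_complex_iff)
  have Sexp: "exp ` S = ?A"
  proof (intro equalityI subsetI)
    fix w assume "w \<in> exp ` S"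
    then obtain \<zeta> where \<zeta>: "\<zeta> \<in> S" "w = exp \<zeta>" by auto
    have "exp (- x0 / 2) < exp (Re \<zeta>)" "exp (Re \<zeta>) < exp 0" using \<zeta> unfolding S_def exp_less_cancel_iff by auto
    thus "w \<in> ?A" using \<zeta> by simp
  next
    fix w assume w: "w \<in> ?A"
    hence w0: "norm w > 0" using less_trans[OF exp_gt_zero] by auto
    define \<zeta> where "\<zeta> = Complex (ln (norm w)) (Arg2pi w)"
    have "exp \<zeta> = of_real (norm w) * exp (\<i> * of_real (Arg2pi w))"
      using w0 by (simp add: \<zeta>_def Complex_eq exp_add exp_of_real)
    hence "exp \<zeta> = w" using Arg2pi_eq[of w] by simp
    moreover have "- x0 / 2 < ln (norm w)" using w w0 by (metis (mono_tags, lifting) exp_less_cancel_iff exp_ln mem_Collect_eq)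
    hence "\<zeta> \<in> S" using w w0 Arg2pi_ge_0[of w] Arg2pi_lt_2pi[of w] by (auto simp: S_def \<zeta>_def)
    ultimately show "w \<in> exp ` S" by force
  qed
  have "?A \<subseteq> {w. \<rho> < norm w}" using \<rho> by auto
  define \<Psi> where "\<Psi> \<zeta> = \<psi> (exp \<zeta>)" for \<zeta>
  define \<Psi>' where "\<Psi>' \<zeta> = deriv \<psi> (exp \<zeta>) * exp \<zeta>" for \<zeta>
  have \<Psi>S: "\<Psi> ` S = \<psi> ` ?A" using Sexp by (metis (no_types, lifting) \<Psi>_def image_cong image_image)
  have d\<psi>: "deriv \<psi> holomorphic_on {w. \<rho> < norm w}" using \<psi>(1) open_exterior by (rule holomorphic_deriv)
  have "compact ?C"
  proof -
    have "?C = cball 0 1 - ball 0 (exp (- x0 / 2))" by auto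
    thus ?thesis by (simp add: compact_diff)
  qed
  have C\<rho>: "?C \<subseteq> {w. \<rho> < norm w}" using \<rho> by auto
  have "bounded (\<psi> ` ?C)"
    by (intro compact_imp_bounded compact_continuous_image \<open>compact ?C\<close> continuous_on_subset[OF holomorphic_on_imp_continuous_on[OF \<psi>(1)] C\<rho>])
  hence b: "bounded (\<Psi> ` S)" unfolding \<Psi>S by (rule bounded_subset) auto
  have "((\<lambda>\<zeta>. of_real ((norm (\<Psi>' \<zeta>))\<^sup>2) * f (\<Psi> \<zeta>)) has_integral integral (\<Psi> ` S) f) S"
  proof (rule complex_change_of_variables[OF Sborel _ b])
    show "bounded S" using Sbox bounded_cbox bounded_subset by blast
    show "(\<Psi> has_field_derivative \<Psi>' \<zeta>) (at \<zeta>)" if "\<zeta> \<in> S" for \<zeta>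
    proof -
      have "exp \<zeta> \<in> {w. \<rho> < norm w}" using that Sexp \<open>?A \<subseteq> _\<close> by blast
      hence "(\<psi> has_field_derivative deriv \<psi> (exp \<zeta>)) (at (exp \<zeta>))" using holomorphic_derivI[OF \<psi>(1) open_exterior] by blast
      thus ?thesis unfolding \<Psi>_def \<Psi>'_def by (rule DERIV_chain2) (rule DERIV_exp)
    qed
    show "inj_on \<Psi> S"
    proof (rule inj_onI)
      fix x y assume xy: "x \<in> S" "y \<in> S" "\<Psi> x = \<Psi> y"
      hence "exp x \<in> {w. \<rho> < norm w}" "exp y \<in> {w. \<rho> < norm w}" using Sexp \<open>?A \<subseteq> _\<close> by blast+
      hence "exp x = exp y" using xy(3) inj_onD[OF \<psi>(2)] by (auto simp: \<Psi>_def)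
      moreover have im: "\<bar>Im x - Im y\<bar> < 2 * pi" using xy unfolding S_def mem_Collect_eq by linarith
      ultimately show "x = y" by (rule exp_complex_eqI[rotated])
    qed
    show "f absolutely_integrable_on \<Psi> ` S" using f \<Psi>S by simp
  qed
  moreover define F where "F \<zeta> = of_real ((norm (\<Psi>' \<zeta>))\<^sup>2) * g (exp \<zeta>)" for \<zeta>
  have "of_real ((norm (\<Psi>' \<zeta>))\<^sup>2) * f (\<Psi> \<zeta>) = F \<zeta>" if "\<zeta> \<in> S" for \<zeta>
  proof -
    have "exp \<zeta> \<in> ?A" using that Sexp by blast
    thus ?thesis using fg[of "exp \<zeta>"] unfolding F_def \<Psi>_def by simp
  qed
  ultimately have "(F has_integral integral (\<Psi> ` S) f) S" by (rule has_integral_eq[rotated])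
  moreover have "negligible (cbox (Complex (- x0 / 2) 0) (Complex 0 (2*pi)) - S)"
    by (rule negligible_subset[OF negligible_frontier_interval[of "Complex (- x0 / 2) 0" "Complex 0 (2*pi)"]])
       (auto simp: S_def in_cbox_complex_iff in_box_complex_iff)
  ultimately have Fbox: "(F has_integral integral (\<Psi> ` S) f) (cbox (Complex (- x0 / 2) 0) (Complex 0 (2*pi)))"
    using Sbox by (subst has_integral_spike_set_eq[of _ S]) (auto elim!: negligible_subset)
  have expC: "exp \<zeta> \<in> ?C" if "\<zeta> \<in> cbox (Complex (- x0 / 2) 0) (Complex 0 (2*pi))" for \<zeta>
    using that by (auto simp: in_cbox_complex_iff)
  have "continuous_on (cbox (Complex (- x0 / 2) 0) (Complex 0 (2*pi))) F"
    unfolding F_def \<Psi>'_def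
    by (intro continuous_intros continuous_on_compose2[OF g]
         continuous_on_compose2[OF holomorphic_on_imp_continuous_on[OF d\<psi>]]) (use expC C\<rho> in blast)+
  from integral_complex_box[OF this]
  have I: "integral (\<Psi> ` S) f = integral {- x0 / 2..0} (\<lambda>x. integral {0..2*pi} (\<lambda>y. F (Complex x y)))"
    using Fbox by (simp add: integral_unique)
  define G where "G r = of_real (2 * pi) * of_real (r\<^sup>2) * cmean (\<lambda>w. of_real ((norm (deriv \<psi> w))\<^sup>2) * g w) r" for r
  have "integral {0..2*pi} (\<lambda>y. F (Complex x y)) = G (exp x)" for x
  proof -
    have "F (Complex x y) = of_real ((exp x)\<^sup>2) * (of_real ((norm (deriv \<psi> (of_real (exp x) * cis y)))\<^sup>2) * g (of_real (exp x) * cis y))" for y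
    proof -
      have "exp (Complex x y) = of_real (exp x) * cis y" by (simp add: Complex_eq exp_add exp_of_real cis_conv_exp)
      thus ?thesis by (simp add: F_def \<Psi>'_def norm_mult power_mult_distrib)
    qed
    thus ?thesis unfolding G_def cmean_def by simp
  qed
  hence I': "integral (\<Psi> ` S) f = integral {- x0 / 2..0} (\<lambda>x. G (exp x))" using I by simp
  have "continuous_on {w::complex. norm w \<in> {exp (- x0 / 2)..1}} (\<lambda>w. of_real ((norm (deriv \<psi> w))\<^sup>2) * g w)"
    by (intro continuous_intros continuous_on_subset[OF g] continuous_on_subset[OF holomorphic_on_imp_continuous_on[OF d\<psi>]]) (use \<rho> in auto)
  from continuous_on_mean_radius[OF this]
  have cm: "continuous_on {exp (- x0 / 2)..1} (cmean (\<lambda>w. of_real ((norm (deriv \<psi> w))\<^sup>2) * g w))"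
    by (auto intro: order_trans[OF exp_ge_zero])
  have "continuous_on {- x0 / 2..0} (\<lambda>x. G (exp x))"
    unfolding G_def by (intro continuous_intros continuous_on_compose2[OF cm]) auto
  hence "((\<lambda>x. G (exp x)) has_integral integral (\<Psi> ` S) f) (cbox (- x0 / 2) 0)"
    unfolding I' by (simp add: integrable_continuous_interval integrable_integral)
  from has_integral_affinity[OF this, of "-1/2" 0]
  have "((\<lambda>x. G (exp (- x / 2))) has_integral 2 *\<^sub>R integral (\<Psi> ` S) f) ((\<lambda>x. - 2 * x) ` {- x0 / 2..0})"
    by simp
  hence "((\<lambda>x. G (exp (- x / 2))) has_integral 2 * integral (\<Psi> ` S) f) ((\<lambda>x. - 2 * x) ` {- x0 / 2..0})"
    by (simp add: scaleR_conv_of_real)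
  moreover have "(\<lambda>x. - 2 * x) ` {- x0 / 2..0} = {0..x0}"
    using x0 image_affinity_atLeastAtMost[of "-2" 0 "- x0 / 2" 0] by simp
  ultimately have "((\<lambda>x. G (exp (- x / 2))) has_integral 2 * integral (\<Psi> ` S) f) {0..x0}" by simp
  hence "integral (\<Psi> ` S) f = integral {0..x0} (\<lambda>x. G (exp (- x / 2))) / 2" by (simp add: integral_unique)
  also have "(\<lambda>x. G (exp (- x / 2))) = (\<lambda>x. of_real (2 * pi) * (of_real (exp (- x)) * cmean (\<lambda>w. of_real ((norm (deriv \<psi> w))\<^sup>2) * g w) (exp (- x / 2))))"
  proof
    fix x :: real
    have "(exp (- x / 2))\<^sup>2 = exp (- x)" by (simp add: exp_double[symmetric])
    thus "G (exp (- x / 2)) = of_real (2 * pi) * (of_real (exp (- x)) * cmean (\<lambda>w. of_real ((norm (deriv \<psi> w))\<^sup>2) * g w) (exp (- x / 2)))"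
      unfolding G_def by (simp add: mult_ac)
  qed
  finally show ?thesis unfolding \<Psi>S by simp
qed

lemma set_integral_dA:
  fixes f :: "complex \<Rightarrow> 'a::{banach,second_countable_topology}"
  assumes "(\<lambda>z. indicator A z *\<^sub>R f z) \<in> borel_measurable borel"
  shows "(LINT z:A|dA. f z) = (1 / pi) *\<^sub>R (LINT z:A|lborel. f z)"
proof -
  have "(LINT z:A|dA. f z) = (LINT z|lborel. (1 / pi) *\<^sub>R (indicator A z *\<^sub>R f z))"
    unfolding dA_def set_lebesgue_integral_def using assms by (intro integral_density) auto
  thus ?thesis unfolding set_lebesgue_integral_def by (simp only: integral_scaleR_right)
qed

lemma set_integrable_dA_iff:
  fixes f :: "complex \<Rightarrow> 'a::{banach,second_countable_topology}"
  assumes "(\<lambda>z. indicator A z *\<^sub>R f z) \<in> borel_measurable borel"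
  shows "set_integrable dA A f \<longleftrightarrow> set_integrable lborel A f"
proof -
  have "set_integrable dA A f \<longleftrightarrow> integrable lborel (\<lambda>z. (1 / pi) *\<^sub>R (indicator A z *\<^sub>R f z))"
    unfolding dA_def set_integrable_def using assms by (intro integrable_density) auto
  also have "\<dots> \<longleftrightarrow> integrable lborel (\<lambda>z. indicator A z *\<^sub>R f z)"
  proof
    assume "integrable lborel (\<lambda>z. (1 / pi) *\<^sub>R (indicator A z *\<^sub>R f z))"
    hence "integrable lborel (\<lambda>z. pi *\<^sub>R (1 / pi) *\<^sub>R (indicator A z *\<^sub>R f z))" by (rule integrable_scaleR_right)
    thus "integrable lborel (\<lambda>z. indicator A z *\<^sub>R f z)" by simp
  qed (rule integrable_scaleR_right)
  finally show ?thesis unfolding set_integrable_def .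
qed

section \<open>Faber polynomials\<close>


text \<open>Integrating along a radius from a fixed circle bounds f z - c z by e / 2 times norm z
  plus a constant. This turns the normalization of the derivative of \<phi> into the limit of \<phi>
  z / z.\<close>

lemma tendsto_quotient_at_infinity:
  fixes f :: "complex \<Rightarrow> complex"
  assumes f: "f holomorphic_on {z. R0 < norm z}" and lim: "(deriv f \<longlongrightarrow> c) at_infinity"
  shows "((\<lambda>z. f z / z) \<longlongrightarrow> c) at_infinity"
proof (rule tendstoI)
  fix e :: real assume e: "e > 0"
  from tendstoD[OF lim, of "e/2"] e obtain b where b: "\<And>z. norm z \<ge> b \<Longrightarrow> norm (deriv f z - c) < e / 2"
    unfolding eventually_at_infinity dist_norm by auto
  define R where "R = max (max b R0) 0 + 1"
  have R: "R > 0" "R > R0" "R \<ge> b" by (auto simp: R_def)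
  have "compact (sphere (0::complex) R)" by simp
  moreover have "continuous_on (sphere 0 R) (\<lambda>z. f z - c * z)"
    using R by (intro continuous_intros continuous_on_subset[OF holomorphic_on_imp_continuous_on[OF f]]) auto
  ultimately have "bounded ((\<lambda>z. f z - c * z) ` sphere 0 R)"
    by (intro compact_imp_bounded compact_continuous_image)
  then obtain M where M: "M > 0" "\<And>z. norm z = R \<Longrightarrow> norm (f z - c * z) \<le> M"
    unfolding bounded_pos by auto
  have *: "norm (f z / z - c) < e" if z: "norm z > max R (2 * M / e)" for z
  proof -
    \<comment> \<open>The radial projection of z onto the circle of radius R; the segment from it to
      z stays outside the open disc.\<close>
    define z0 where "z0 = of_real (R / norm z) * z"
    have z1: "norm z > R" "norm z > 2 * M / e" using z by auto
    have nz: "norm z > 0" using z1 R by linarith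
    have z0: "norm z0 = R" using nz R by (simp add: z0_def norm_mult norm_divide)
    have seg: "norm \<zeta> \<ge> R" if \<zeta>: "\<zeta> \<in> closed_segment z0 z" for \<zeta>
    proof -
      obtain u where u: "0 \<le> u" "u \<le> 1" "\<zeta> = (1 - u) *\<^sub>R z0 + u *\<^sub>R z"
        using \<zeta> by (auto simp: in_segment)
      have "\<zeta> = of_real ((1 - u) * (R / norm z) + u) * z"
        by (simp add: u z0_def scaleR_conv_of_real algebra_simps)
      hence "norm \<zeta> = \<bar>(1 - u) * (R / norm z) + u\<bar> * norm z" by (simp only: norm_mult norm_of_real)
      also have "\<dots> = ((1 - u) * (R / norm z) + u) * norm z" using u R nz by simp
      also have "\<dots> = (1 - u) * R + u * norm z" using nz by (simp add: field_simps)
      also have "\<dots> \<ge> (1 - u) * R + u * R" using u z1 by (intro add_left_mono mult_left_mono) auto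
      finally show ?thesis by (simp add: algebra_simps)
    qed
    have "norm ((f z - c * z) - (f z0 - c * z0)) \<le> e / 2 * norm (z - z0)"
    proof (rule field_differentiable_bound[of "closed_segment z0 z" "\<lambda>z. f z - c * z" "\<lambda>z. deriv f z - c"])
      fix \<zeta> assume \<zeta>: "\<zeta> \<in> closed_segment z0 z"
      have "(f has_field_derivative deriv f \<zeta>) (at \<zeta>)"
        using seg[OF \<zeta>] R by (intro holomorphic_derivI[OF f open_exterior]) auto
      thus "((\<lambda>z. f z - c * z) has_field_derivative deriv f \<zeta> - c) (at \<zeta> within closed_segment z0 z)"
        by (auto intro!: derivative_eq_intros intro: has_field_derivative_at_within)
      show "norm (deriv f \<zeta> - c) \<le> e / 2" using b[of \<zeta>] seg[OF \<zeta>] R by simp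
    qed auto
    also have "norm (z - z0) \<le> norm z"
    proof -
      have "z - z0 = of_real (1 - R / norm z) * z" by (simp add: z0_def algebra_simps)
      hence "norm (z - z0) = \<bar>1 - R / norm z\<bar> * norm z" by (simp only: norm_mult norm_of_real)
      also have "\<dots> \<le> 1 * norm z" using R z1 nz by (intro mult_right_mono) (auto simp: field_simps)
      finally show ?thesis by simp
    qed
    hence "e / 2 * norm (z - z0) \<le> e / 2 * norm z" using e by (intro mult_left_mono) auto
    finally have "norm ((f z - c * z) - (f z0 - c * z0)) \<le> e / 2 * norm z" .
    hence "norm (f z - c * z) \<le> e / 2 * norm z + M"
      using M(2)[OF z0] norm_triangle_ineq2[of "f z - c * z" "f z0 - c * z0"] by linarith
    moreover have "M < e / 2 * norm z" using z1 e by (simp add: field_simps)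
    ultimately have "norm (f z - c * z) < e * norm z" by simp
    moreover have "f z / z - c = (f z - c * z) / z" using nz by (simp add: field_simps)
    ultimately show ?thesis using nz by (simp add: norm_divide pos_divide_less_eq)
  qed
  have "norm (f z / z - c) < e" if "max R (2 * M / e) + 1 \<le> norm z" for z
    by (rule *) (use that in linarith)
  thus "\<forall>\<^sub>F z in at_infinity. dist (f z / z) c < e"
    unfolding eventually_at_infinity dist_norm by blast
qed

lemma tendsto_poly_quotient:
  fixes q :: "complex poly"
  assumes "degree q \<le> N"
  shows "((\<lambda>z. poly q z / z ^ N) \<longlongrightarrow> coeff q N) at_infinity"
proof -
  have lim: "((\<lambda>z. \<Sum>i\<le>N. coeff q i * (inverse z) ^ (N - i)) \<longlongrightarrow> (\<Sum>i\<le>N. coeff q i * 0 ^ (N - i))) at_infinity"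
    by (intro tendsto_intros tendsto_inverse_0)
  have "(\<Sum>i\<le>N. coeff q i * 0 ^ (N - i)) = (\<Sum>i\<in>{N}. coeff q i)"
    by (rule sum.mono_neutral_cong_right) auto
  hence "((\<lambda>z. \<Sum>i\<le>N. coeff q i * (inverse z) ^ (N - i)) \<longlongrightarrow> coeff q N) at_infinity" using lim by simp
  moreover have "\<forall>\<^sub>F z in at_infinity. (\<Sum>i\<le>N. coeff q i * (inverse z) ^ (N - i)) = poly q z / z ^ N"
  proof -
    have "(\<Sum>i\<le>N. coeff q i * (inverse z) ^ (N - i)) = poly q z / z ^ N" if "z \<noteq> 0" for z
    proof -
      have "poly q z = (\<Sum>i\<le>N. coeff q i * z ^ i)"
        unfolding poly_altdef using assms by (intro sum.mono_neutral_left) (auto simp: coeff_eq_0)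
      also have "\<dots> / z ^ N = (\<Sum>i\<le>N. coeff q i * (inverse z) ^ (N - i))"
        unfolding sum_divide_distrib
      proof (intro sum.cong refl)
        fix i assume "i \<in> {..N}"
        hence "z ^ N = z ^ i * z ^ (N - i)" by (simp add: power_add[symmetric])
        thus "coeff q i * z ^ i / z ^ N = coeff q i * inverse z ^ (N - i)" using that by (simp add: field_simps)
      qed
      finally show ?thesis by simp
    qed
    moreover have "z \<noteq> 0" if "1 \<le> norm z" for z :: complex using that by auto
    ultimately show ?thesis unfolding eventually_at_infinity by blast
  qed
  ultimately show ?thesis by (rule Lim_transform_eventually)
qed

text \<open>\<rho> is a radius down to which \<phi> has a holomorphic inverse \<psi>. Both \<phi>
  and V are controlled on the image of \<psi>, their values deeper inside \<open>D\<close> being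
  arbitrary; statements are therefore transported to the variable w.\<close>

locale ext_map =
  fixes D :: "complex set" and \<phi> V \<psi> :: "complex \<Rightarrow> complex" and \<rho> c vinf :: real
  assumes \<rho>: "0 < \<rho>" "\<rho> < 1" and D: "open D" "bounded D"
    and \<psi>hol: "\<psi> holomorphic_on {w. \<rho> < norm w}" and \<phi>\<psi>: "\<And>w. \<rho> < norm w \<Longrightarrow> \<phi> (\<psi> w) = w"
    and \<phi>hol: "\<phi> holomorphic_on \<psi> ` {w. \<rho> < norm w}" and Vhol: "V holomorphic_on \<psi> ` {w. \<rho> < norm w}"
    and \<psi>D: "\<psi> ` {w. 1 \<le> norm w} = - D" and \<psi>inf: "filterlim \<psi> at_infinity at_infinity"
    and c: "0 < c" "(deriv \<phi> \<longlongrightarrow> of_real c) at_infinity" and vinf: "(V \<longlongrightarrow> of_real vinf) at_infinity"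
begin

abbreviation "ex r \<equiv> {w::complex. r < norm w}"
abbreviation "exc r \<equiv> {w::complex. r \<le> norm w}"

lemma \<psi>inj: "inj_on \<psi> (ex \<rho>)" using \<phi>\<psi> by (metis (mono_tags, lifting) inj_onI mem_Collect_eq)

lemma open_\<psi>_ex: "\<rho> \<le> r \<Longrightarrow> open (\<psi> ` ex r)"
  by (rule open_mapping_thm3[OF holomorphic_on_subset[OF \<psi>hol] open_exterior]) (auto intro: inj_on_subset[OF \<psi>inj])

text \<open>For r at most 1 the image is a compact collar together with the complement of
  \<open>D\<close>; for larger r it is a preimage under \<phi> within that complement.\<close>

lemma closed_\<psi>_exc: assumes "\<rho> < r" shows "closed (\<psi> ` exc r)"
proof -
  let ?C = "{w::complex. r \<le> norm w \<and> norm w \<le> 1}"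
  have "?C = cball 0 1 - ball 0 r" by auto
  hence "compact ?C" by (simp add: compact_diff)
  hence "compact (\<psi> ` ?C)"
    by (intro compact_continuous_image continuous_on_subset[OF holomorphic_on_imp_continuous_on[OF \<psi>hol]]) (use assms in auto)
  hence "closed (\<psi> ` ?C \<union> - D)" using closed_Compl[OF D(1)] by (intro closed_Un) (auto intro: compact_imp_closed)
  moreover have "\<psi> ` ?C \<union> - D = \<psi> ` exc r" if "r \<le> 1" unfolding \<psi>D[symmetric] image_Un[symmetric]
    using that by (intro arg_cong[of _ _ "\<lambda>A. \<psi> ` A"]) auto
  moreover have "closed (\<psi> ` exc r)" if r1: "r > 1"
  proof -
    have "\<psi> ` exc r = \<phi> -` exc r \<inter> - D"
    proof (intro equalityI subsetI)
      fix z assume "z \<in> \<psi> ` exc r"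
      then obtain w where w: "z = \<psi> w" "r \<le> norm w" by auto
      hence "\<phi> z = w" using \<phi>\<psi> assms by auto
      moreover have "z \<in> - D" unfolding \<psi>D[symmetric] using w r1 by auto
      ultimately show "z \<in> \<phi> -` exc r \<inter> - D" using w by auto
    next
      fix z assume z: "z \<in> \<phi> -` exc r \<inter> - D"
      then obtain w where w: "z = \<psi> w" "1 \<le> norm w" unfolding \<psi>D[symmetric] by auto
      hence "\<phi> z = w" using \<phi>\<psi> \<rho> by auto
      thus "z \<in> \<psi> ` exc r" using w z by auto
    qed
    moreover have "continuous_on (- D) \<phi>"
      unfolding \<psi>D[symmetric] by (rule continuous_on_subset[OF holomorphic_on_imp_continuous_on[OF \<phi>hol]]) (use \<rho> in auto)
    moreover have "closed (exc r)" by (intro closed_Collect_le continuous_intros)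
    ultimately show ?thesis using D
      by (metis closed_Compl continuous_on_closed_vimage)
  qed
  ultimately show ?thesis by (cases "r \<le> 1") auto
qed

lemma \<psi>_in_D: "\<rho> < norm w \<Longrightarrow> norm w < 1 \<Longrightarrow> \<psi> w \<in> D"
proof (rule ccontr)
  assume w: "\<rho> < norm w" "norm w < 1" "\<psi> w \<notin> D"
  then obtain u where u: "\<psi> u = \<psi> w" "1 \<le> norm u" using \<psi>D by (metis (mono_tags, lifting) ComplI image_iff mem_Collect_eq)
  have "\<phi> (\<psi> u) = u" using \<phi>\<psi>[of u] u \<rho> by simp
  hence "u = w" using \<phi>\<psi>[OF w(1)] unfolding u(1) by (rule trans[OF sym])
  thus False using u w by simp
qed

lemma mem_\<psi>_ex_iff: "\<rho> < norm w \<Longrightarrow> \<rho> \<le> r \<Longrightarrow> \<psi> w \<in> \<psi> ` ex r \<longleftrightarrow> r < norm w"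
  by (subst inj_on_image_mem_iff[OF \<psi>inj]) auto

lemma mem_\<psi>_exc_iff: "\<rho> < norm w \<Longrightarrow> \<rho> < r \<Longrightarrow> \<psi> w \<in> \<psi> ` exc r \<longleftrightarrow> r \<le> norm w"
  by (subst inj_on_image_mem_iff[OF \<psi>inj]) auto

lemma d\<psi>hol: "deriv \<psi> holomorphic_on ex \<rho>" using \<psi>hol open_exterior by (rule holomorphic_deriv)

lemma d\<phi>_d\<psi>: assumes "\<rho> < norm w" shows "deriv \<phi> (\<psi> w) * deriv \<psi> w = 1"
proof -
  have "(\<psi> has_field_derivative deriv \<psi> w) (at w)" using assms by (intro holomorphic_derivI[OF \<psi>hol open_exterior]) auto
  moreover have "(\<phi> has_field_derivative deriv \<phi> (\<psi> w)) (at (\<psi> w))"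
    using assms by (intro holomorphic_derivI[OF \<phi>hol open_\<psi>_ex]) auto
  ultimately have "((\<lambda>w. \<phi> (\<psi> w)) has_field_derivative deriv \<phi> (\<psi> w) * deriv \<psi> w) (at w)"
    by (intro DERIV_chain2)
  moreover have "((\<lambda>w. \<phi> (\<psi> w)) has_field_derivative 1) (at w)"
    by (rule has_field_derivative_transform_within_open[of "\<lambda>w. w" _ _ "ex \<rho>"]) (use assms \<phi>\<psi> open_exterior in auto)
  ultimately show ?thesis by (rule DERIV_unique)
qed

lemma d\<psi>_nz: "\<rho> < norm w \<Longrightarrow> deriv \<psi> w \<noteq> 0" using d\<phi>_d\<psi>[of w] by auto
lemma d\<phi>_eq: "\<rho> < norm w \<Longrightarrow> deriv \<phi> (\<psi> w) = 1 / deriv \<psi> w" using d\<phi>_d\<psi>[of w] d\<psi>_nz[of w] by (simp add: field_simps)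

definition v :: "complex \<Rightarrow> complex" where "v w = exp (V (\<psi> w)) / deriv \<psi> w"

lemma V\<psi>hol: "(\<lambda>w. V (\<psi> w)) holomorphic_on ex \<rho>" by (rule hol_comp[OF Vhol \<psi>hol]) auto
lemma vhol: "v holomorphic_on ex \<rho>"
  unfolding v_def using d\<psi>_nz by (intro holomorphic_intros V\<psi>hol d\<psi>hol) auto
lemma v_nz: "\<rho> < norm w \<Longrightarrow> v w \<noteq> 0" using d\<psi>_nz by (simp add: v_def)

lemma d\<phi>\<psi>_lim: "((\<lambda>w. deriv \<phi> (\<psi> w)) \<longlongrightarrow> of_real c) at_infinity"
  by (rule filterlim_compose[OF c(2) \<psi>inf])

lemma ev_ex: "\<forall>\<^sub>F w in at_infinity. r < norm (w::complex)"
  unfolding eventually_at_infinity by (intro exI[of _ "r+1"]) auto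

lemma v_lim: "(v \<longlongrightarrow> exp (of_real vinf) * of_real c) at_infinity"
proof -
  have "((\<lambda>w. exp (V (\<psi> w)) * deriv \<phi> (\<psi> w)) \<longlongrightarrow> exp (of_real vinf) * of_real c) at_infinity"
    by (intro tendsto_intros d\<phi>\<psi>_lim filterlim_compose[OF vinf \<psi>inf])
  moreover have "\<forall>\<^sub>F w in at_infinity. exp (V (\<psi> w)) * deriv \<phi> (\<psi> w) = v w"
    using ev_ex[of \<rho>] by eventually_elim (simp add: v_def d\<phi>_eq)
  ultimately show ?thesis by (rule Lim_transform_eventually)
qed

lemma \<phi>_quotient: "((\<lambda>z. \<phi> z / z) \<longlongrightarrow> of_real c) at_infinity"
proof -
  obtain B where B: "D \<subseteq> ball 0 B" using bounded_subset_ballD[OF D(2)] by blast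
  hence "{z. B < norm z} \<subseteq> \<psi> ` {w. 1 \<le> norm w}" unfolding \<psi>D by auto
  moreover have "\<psi> ` {w. 1 \<le> norm w} \<subseteq> \<psi> ` ex \<rho>" using \<rho> by auto
  ultimately have "\<phi> holomorphic_on {z. B < norm z}" by (intro holomorphic_on_subset[OF \<phi>hol]) blast
  thus ?thesis using c(2) by (rule tendsto_quotient_at_infinity)
qed

lemma \<psi>_quotient: "((\<lambda>w. w / \<psi> w) \<longlongrightarrow> of_real c) at_infinity"
proof -
  have "((\<lambda>w. \<phi> (\<psi> w) / \<psi> w) \<longlongrightarrow> of_real c) at_infinity" by (rule filterlim_compose[OF \<phi>_quotient \<psi>inf])
  moreover have "\<forall>\<^sub>F w in at_infinity. \<phi> (\<psi> w) / \<psi> w = w / \<psi> w"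
    using ev_ex[of \<rho>] by eventually_elim (simp add: \<phi>\<psi>)
  ultimately show ?thesis by (rule Lim_transform_eventually)
qed

lemma C_const_eq: "C_const \<phi> V N = 1 / (c ^ (N + 1) * exp vinf)"
proof -
  have "Lim at_infinity (deriv \<phi>) = of_real c" by (rule tendsto_Lim[OF trivial_limit_at_infinity c(2)])
  moreover have "Lim at_infinity V = of_real vinf" by (rule tendsto_Lim[OF trivial_limit_at_infinity vinf])
  ultimately show ?thesis by (simp add: C_const_def deriv_at_inf_def value_at_inf_def exp_minus field_simps)
qed

lemma C_const_pos: "C_const \<phi> V N > 0" unfolding C_const_eq using c by simp

text \<open>This measures q in units of the expected behaviour w^N v w. For degree at most N its
  limit at infinity reads off the coefficient of degree N, so polynomials of smaller degree become
  functions vanishing at infinity.\<close>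

definition hq :: "nat \<Rightarrow> complex poly \<Rightarrow> complex \<Rightarrow> complex" where
  "hq N q w = poly q (\<psi> w) / (w ^ N * v w)"

lemma ex_nz: "\<rho> < norm w \<Longrightarrow> w \<noteq> 0" using \<rho> by auto

lemma hq_hol: "hq N q holomorphic_on ex \<rho>"
  unfolding hq_def using v_nz ex_nz
  by (intro holomorphic_intros vhol hol_comp[of "poly q" UNIV, OF _ \<psi>hol]) auto

lemma hq_lim:
  assumes "degree q \<le> N"
  shows "(hq N q \<longlongrightarrow> coeff q N * of_real (C_const \<phi> V N)) at_infinity"
proof -
  have "((\<lambda>w. poly q (\<psi> w) / \<psi> w ^ N) \<longlongrightarrow> coeff q N) at_infinity"
    by (rule filterlim_compose[OF tendsto_poly_quotient[OF assms] \<psi>inf])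
  hence l1: "((\<lambda>w. (poly q (\<psi> w) / \<psi> w ^ N) / ((w / \<psi> w) ^ N * v w)) \<longlongrightarrow> coeff q N / (of_real c ^ N * (exp (of_real vinf) * of_real c))) at_infinity"
    using c by (intro tendsto_intros \<psi>_quotient v_lim) auto
  have "\<forall>\<^sub>F w in at_infinity. \<psi> w \<noteq> 0"
    using \<psi>inf unfolding filterlim_at_infinity[of 0, OF order.refl]
    by (metis (mono_tags, lifting) eventually_mono norm_zero not_less zero_less_one dual_order.strict_trans1 order.refl zero_less_norm_iff)
  hence l2: "\<forall>\<^sub>F w in at_infinity. (poly q (\<psi> w) / \<psi> w ^ N) / ((w / \<psi> w) ^ N * v w) = hq N q w"
    by eventually_elim (simp add: hq_def field_simps)
  have l3: "coeff q N / (of_real c ^ N * (exp (of_real vinf) * of_real c)) = coeff q N * of_real (C_const \<phi> V N)"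
    unfolding C_const_eq by (simp add: exp_of_real mult_ac)
  show ?thesis unfolding l3[symmetric] by (rule Lim_transform_eventually[OF l1 l2])
qed

lemma separation:
  assumes "compact A" "closed B" "A \<inter> B = {}"
  obtains d where "d > 0" "\<And>x y. x \<in> A \<Longrightarrow> y \<in> B \<Longrightarrow> d \<le> norm (x - y :: complex)"
  using separate_compact_closed[OF assms] unfolding dist_norm by blast

lemma compact_\<psi>_sphere: "\<rho> < r \<Longrightarrow> compact (\<psi> ` sphere 0 r)"
  by (intro compact_continuous_image continuous_on_subset[OF holomorphic_on_imp_continuous_on[OF \<psi>hol]]) auto

text \<open>The two integrals differ by the residue at u. Dividing by the difference quotient of
  \<psi>, which has no zeros because \<psi> is injective with nonvanishing derivative, reduces the
  kernel to the one of \<open>cmean_laurent\<close>.\<close>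

lemma contour_jump:
  assumes F: "F holomorphic_on ex \<rho>" and r: "\<rho> < r" "r < norm u" "norm u < r4"
  shows "cmean (\<lambda>w. F w * deriv \<psi> w * w / (\<psi> w - \<psi> u)) r4 = F u + cmean (\<lambda>w. F w * deriv \<psi> w * w / (\<psi> w - \<psi> u)) r"
proof -
  define dq where "dq w = (if w = u then deriv \<psi> u else (\<psi> w - \<psi> u) / (w - u))" for w
  have u: "\<rho> < norm u" using r by simp
  have dq: "dq holomorphic_on ex \<rho>" unfolding dq_def
    by (rule pole_lemma_open[OF \<psi>hol open_exterior])
  have dq_nz: "dq w \<noteq> 0" if "\<rho> < norm w" for w
    using that d\<psi>_nz[OF u] inj_onD[OF \<psi>inj, of w u] u by (auto simp: dq_def)
  define p where "p w = F w * deriv \<psi> w / dq w" for w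
  have "p holomorphic_on ex \<rho>" unfolding p_def using dq_nz by (intro holomorphic_intros F d\<psi>hol dq) auto
  hence "p holomorphic_on {w. \<rho> < norm w \<and> norm w < r4 + 1}" by (rule holomorphic_on_subset) auto
  from cmean_laurent[OF this, of r u r4]
  have "p u = cmean (\<lambda>\<zeta>. p \<zeta> * \<zeta> / (\<zeta> - u)) r4 - cmean (\<lambda>\<zeta>. p \<zeta> * \<zeta> / (\<zeta> - u)) r"
    using r \<rho> by simp
  moreover have "p u = F u" using d\<psi>_nz[OF u] by (simp add: p_def dq_def)
  moreover have "cmean (\<lambda>\<zeta>. p \<zeta> * \<zeta> / (\<zeta> - u)) t = cmean (\<lambda>w. F w * deriv \<psi> w * w / (\<psi> w - \<psi> u)) t" if "t \<noteq> norm u" "0 \<le> t" for t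
    using that by (intro cmean_cong) (auto simp: p_def dq_def)
  ultimately show ?thesis using r \<rho> by simp
qed

text \<open>The Cauchy transform over the circle of radius r4, and the function w^N v w g w plus the
  transform over the circle of radius r, agree on their common domain by
  \<open>contour_jump\<close>. They glue to an entire function that grows like z^N, hence to a
  polynomial; its quotient by z^N gives the coefficient of degree N.\<close>

lemma faber_polynomial:
  fixes N :: nat
  assumes r: "\<rho> < r" "r < r4"
    and g: "g holomorphic_on ex \<rho>" "(g \<longlongrightarrow> 1) at_infinity"
  defines "k \<equiv> (\<lambda>w. (w ^ N * v w * g w) * deriv \<psi> w * w)"
  obtains Q where "degree Q \<le> N" "coeff Q N = of_real (1 / C_const \<phi> V N)"
    "\<And>u. r < norm u \<Longrightarrow> poly Q (\<psi> u) = u ^ N * v u * g u + cmean (\<lambda>w. k w / (\<psi> w - \<psi> u)) r"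
    "\<And>z. z \<notin> \<psi> ` exc r4 \<Longrightarrow> poly Q z = cmean (\<lambda>w. k w / (\<psi> w - z)) r4"
proof -
  define F where "F w = w ^ N * v w * g w" for w
  have F: "F holomorphic_on ex \<rho>" unfolding F_def by (intro holomorphic_intros vhol g)
  have k: "k holomorphic_on ex \<rho>" unfolding k_def F_def[symmetric] by (intro holomorphic_intros F d\<psi>hol)
  define I where "I t z = cmean (\<lambda>w. k w / (\<psi> w - z)) t" for t z
  have cont: "continuous_on (sphere 0 t) k" "continuous_on (sphere 0 t) \<psi>" if "\<rho> < t" for t
    using that by (auto intro!: continuous_on_subset[OF holomorphic_on_imp_continuous_on[OF k]]
        continuous_on_subset[OF holomorphic_on_imp_continuous_on[OF \<psi>hol]])
  have Ihol: "I t holomorphic_on - (\<psi> ` sphere 0 t)" if "\<rho> < t" for t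
    unfolding I_def[abs_def] using that \<rho> by (intro cauchy_transform_holomorphic cont) auto
  define A1 where "A1 = \<psi> ` ex r"
  define A2 where "A2 = - \<psi> ` exc r4"
  define H where "H z = (if z \<in> A1 then F (\<phi> z) + I r z else I r4 z)" for z
  have A: "open A1" "open A2" "A1 \<union> A2 = UNIV"
    using open_\<psi>_ex[of r] closed_\<psi>_exc[of r4] r by (auto simp: A1_def A2_def)
  have jump: "F (\<phi> z) + I r z = I r4 z" if z: "z \<in> A1" "z \<in> A2" for z
  proof -
    from z obtain u where u: "z = \<psi> u" "r < norm u" by (auto simp: A1_def)
    have "norm u < r4" using z u mem_\<psi>_exc_iff[of u r4] r by (auto simp: A2_def)
    from contour_jump[OF F r(1) u(2) this] show ?thesis
      using \<phi>\<psi>[of u] u r unfolding I_def k_def F_def[symmetric] by simp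
  qed
  have "H holomorphic_on (A1 \<union> A2)" unfolding H_def
  proof (rule holomorphic_on_If_Un)
    have "\<phi> holomorphic_on A1" by (rule holomorphic_on_subset[OF \<phi>hol]) (use r in \<open>auto simp: A1_def\<close>)
    hence "(\<lambda>z. F (\<phi> z)) holomorphic_on A1"
      by (rule hol_comp[OF F]) (use r \<phi>\<psi> in \<open>auto simp: A1_def\<close>)
    moreover have "I r holomorphic_on A1"
    proof (rule holomorphic_on_subset[OF Ihol[OF r(1)]])
      have "\<psi> w \<notin> \<psi> ` ex r" if "norm w = r" for w using mem_\<psi>_ex_iff[of w r] that r by simp
      thus "A1 \<subseteq> - \<psi> ` sphere 0 r" unfolding A1_def subset_iff Compl_iff by (metis imageE mem_sphere_0)
    qed
    ultimately show "(\<lambda>z. F (\<phi> z) + I r z) holomorphic_on A1" by (intro holomorphic_intros)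
    show "I r4 holomorphic_on A2"
      by (rule holomorphic_on_subset[OF Ihol]) (use r in \<open>auto simp: A2_def\<close>)
  qed (use A jump in auto)
  hence Hhol: "H holomorphic_on UNIV" using A by simp
  define L where "L = complex_of_real (1 / C_const \<phi> V N)"
  have evD: "\<forall>\<^sub>F z in at_infinity. z \<notin> D"
    using D(2) unfolding eventually_at_infinity bounded_iff by (metis add.commute gt_ex less_add_one linorder_not_le order_trans)
  have \<phi>inf: "filterlim \<phi> at_infinity at_infinity"
  proof -
    have "filterlim (\<lambda>z. (\<phi> z / z) * z) at_infinity at_infinity"
      by (rule tendsto_mult_filterlim_at_infinity[OF \<phi>_quotient]) (use c in \<open>auto simp: filterlim_ident\<close>)
    moreover have "\<forall>\<^sub>F z in at_infinity. (\<phi> z / z) * z = \<phi> z"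
      unfolding eventually_at_infinity by (intro exI[of _ 1]) auto
    ultimately show ?thesis using filterlim_cong[OF refl refl] by fastforce
  qed
  have "((\<lambda>z. (\<phi> z / z) ^ N * v (\<phi> z) * g (\<phi> z) + I r z * (inverse z) ^ N) \<longlongrightarrow>
      of_real c ^ N * (exp (of_real vinf) * of_real c) * 1 + 0) at_infinity"
  proof (intro tendsto_add tendsto_mult tendsto_power \<phi>_quotient filterlim_compose[OF v_lim \<phi>inf] filterlim_compose[OF g(2) \<phi>inf])
    have "(I r \<longlongrightarrow> 0) at_infinity" unfolding I_def[abs_def]
      using r \<rho> by (intro cauchy_transform_tendsto_0 cont) auto
    hence "((\<lambda>z. I r z * inverse z ^ N) \<longlongrightarrow> 0 * 0 ^ N) at_infinity" by (intro tendsto_intros tendsto_inverse_0)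
    thus "((\<lambda>z. I r z * inverse z ^ N) \<longlongrightarrow> 0) at_infinity" by simp
  qed
  moreover have "of_real c ^ N * (exp (of_real vinf) * of_real c) * 1 + 0 = L"
    unfolding L_def C_const_eq by (simp add: exp_of_real mult_ac)
  moreover have "\<forall>\<^sub>F z in at_infinity. (\<phi> z / z) ^ N * v (\<phi> z) * g (\<phi> z) + I r z * (inverse z) ^ N = H z / z ^ N"
  proof -
    have "\<forall>\<^sub>F z in at_infinity. z \<in> A1"
    proof -
      have "\<forall>\<^sub>F w in at_infinity. r < norm (w::complex)" by (rule ev_ex)
      hence "\<forall>\<^sub>F z in at_infinity. r < norm (\<phi> z)" by (rule eventually_compose_filterlim[OF _ \<phi>inf])
      with evD show ?thesis
      proof eventually_elim
        case (elim z)
        then obtain u where u: "z = \<psi> u" "1 \<le> norm u" using \<psi>D by (metis (mono_tags, lifting) ComplI image_iff mem_Collect_eq)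
        hence "\<phi> z = u" using \<phi>\<psi> \<rho> by auto
        thus ?case using u elim by (auto simp: A1_def)
      qed
    qed
    thus ?thesis by eventually_elim (simp add: H_def F_def add_divide_distrib power_divide inverse_eq_divide)
  qed
  ultimately have Hlim: "((\<lambda>z. H z / z ^ N) \<longlongrightarrow> L) at_infinity" by (simp only:) (rule Lim_transform_eventually)
  have "\<forall>\<^sub>F z in at_infinity. norm (H z / z ^ N - L) < 1" using tendstoD[OF Hlim, of 1] by (simp add: dist_norm)
  then obtain b where b: "\<And>z. norm z \<ge> b \<Longrightarrow> norm (H z / z ^ N - L) < 1" unfolding eventually_at_infinity by blast
  have Hb: "norm (H z) \<le> (norm L + 1) * norm z ^ N" if "max b 1 \<le> norm z" for z
  proof -
    have "norm (H z / z ^ N) \<le> norm L + 1" using b[of z] that norm_triangle_ineq2[of "H z / z ^ N" L] by simp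
    moreover have "norm (z ^ N) > 0" using that by auto
    ultimately show ?thesis by (simp add: norm_divide divide_le_eq norm_power)
  qed
  define Q where "Q = (\<Sum>j\<le>N. monom ((deriv ^^ j) H 0 / fact j) j)"
  have Q: "poly Q z = H z" for z
  proof -
    have "H z = (\<Sum>j\<le>N. (deriv ^^ j) H 0 / fact j * z ^ j)" by (rule Liouville_polynomial[OF Hhol Hb])
    thus ?thesis by (simp add: Q_def poly_sum poly_monom)
  qed
  have dQ: "degree Q \<le> N" unfolding Q_def by (intro degree_sum_le) (auto intro: order_trans[OF degree_monom_le])
  have "coeff Q N = L"
    using tendsto_unique[OF trivial_limit_at_infinity tendsto_poly_quotient[OF dQ]] Hlim by (simp add: Q)
  moreover have "poly Q (\<psi> u) = F u + I r (\<psi> u)" if "r < norm u" for u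
    using that \<phi>\<psi>[of u] r by (auto simp: Q H_def A1_def)
  moreover have "poly Q z = I r4 z" if "z \<notin> \<psi> ` exc r4" for z
    using jump[of z] that by (auto simp: Q H_def A2_def)
  ultimately show ?thesis using that[of Q] dQ unfolding L_def F_def I_def by simp
qed

text \<open>Each representation of Q gives one bound: beyond radius r3 the error is an integral over
  the circle of radius r, of size r^N, and on the rest of the plane Q itself is an integral over the
  circle of radius r4. The constant does not depend on N or g, so that g may vary with N.\<close>

lemma faber_bounds:
  assumes r: "\<rho> < r" "r < r3" "r3 < r4" "r4 < 1"
  obtains C where "C \<ge> 0" "\<And>N g M. g holomorphic_on ex \<rho> \<Longrightarrow> (g \<longlongrightarrow> 1) at_infinity \<Longrightarrow>
      (\<And>w. r \<le> norm w \<Longrightarrow> norm w \<le> 1 \<Longrightarrow> norm (g w) \<le> M) \<Longrightarrow>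
      \<exists>Q. degree Q \<le> N \<and> coeff Q N = of_real (1 / C_const \<phi> V N) \<and>
        (\<forall>u. r3 \<le> norm u \<longrightarrow> norm (poly Q (\<psi> u) - u ^ N * v u * g u) \<le> C * M * r ^ N) \<and>
        (\<forall>z. z \<notin> \<psi> ` ex r3 \<longrightarrow> norm (poly Q z) \<le> C * M * r4 ^ N)"
proof -
  have r0: "0 < r" "0 < r4" "\<rho> < r4" using r \<rho> by auto
  \<comment> \<open>d1 and d2 are lower bounds for the denominators: the image of each circle of
    integration has positive distance from the set of points at which the transform is
    evaluated.\<close>
  obtain d1 where d1: "d1 > 0" "\<And>x y. x \<in> \<psi> ` sphere 0 r \<Longrightarrow> y \<in> \<psi> ` exc r3 \<Longrightarrow> d1 \<le> norm (x - y)"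
  proof (rule separation[OF compact_\<psi>_sphere[OF r(1)] closed_\<psi>_exc[of r3]])
    have "\<psi> w \<notin> \<psi> ` exc r3" if "norm w = r" for w using mem_\<psi>_exc_iff[of w r3] that r by simp
    thus "\<psi> ` sphere 0 r \<inter> \<psi> ` exc r3 = {}" by fastforce
  qed (use r in auto)
  obtain d2 where d2: "d2 > 0" "\<And>x y. x \<in> \<psi> ` sphere 0 r4 \<Longrightarrow> y \<in> - \<psi> ` ex r3 \<Longrightarrow> d2 \<le> norm (x - y)"
  proof (rule separation[OF compact_\<psi>_sphere[OF r0(3)]])
    show "closed (- \<psi> ` ex r3)" using open_\<psi>_ex[of r3] r by (intro closed_Compl) simp
  qed (use r in auto)
  define d where "d = min d1 d2"
  have d: "d > 0" "d \<le> d1" "d \<le> d2" using d1 d2 by (auto simp: d_def)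
  let ?C = "{w::complex. r \<le> norm w \<and> norm w \<le> 1}"
  have "?C = cball 0 1 - ball 0 r" by auto
  hence "compact ?C" by (simp add: compact_diff)
  moreover have "continuous_on ?C (\<lambda>w. v w * deriv \<psi> w)"
    by (intro continuous_intros continuous_on_subset[OF holomorphic_on_imp_continuous_on[OF vhol]]
      continuous_on_subset[OF holomorphic_on_imp_continuous_on[OF d\<psi>hol]]) (use r in auto)
  ultimately have "bounded ((\<lambda>w. v w * deriv \<psi> w) ` ?C)" by (intro compact_imp_bounded compact_continuous_image)
  then obtain L where L: "L > 0" "\<And>w. r \<le> norm w \<Longrightarrow> norm w \<le> 1 \<Longrightarrow> norm (v w * deriv \<psi> w) \<le> L"
    unfolding bounded_pos by (metis (mono_tags, lifting) imageI mem_Collect_eq)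
  show ?thesis
  proof (rule that[of "L / d"])
    show "0 \<le> L / d" using L d by simp
    fix N :: nat and g M
    assume g: "g holomorphic_on ex \<rho>" "(g \<longlongrightarrow> 1) at_infinity" and M: "\<And>w. r \<le> norm w \<Longrightarrow> norm w \<le> 1 \<Longrightarrow> norm (g w) \<le> M"
    have M0: "M \<ge> 0" using order_trans[OF norm_ge_zero M[of 1]] r by simp
    let ?k = "\<lambda>w. (w ^ N * v w * g w) * deriv \<psi> w * w"
    obtain Q where Q: "degree Q \<le> N" "coeff Q N = of_real (1 / C_const \<phi> V N)"
      "\<And>u. r < norm u \<Longrightarrow> poly Q (\<psi> u) = u ^ N * v u * g u + cmean (\<lambda>w. ?k w / (\<psi> w - \<psi> u)) r"
      "\<And>z. z \<notin> \<psi> ` exc r4 \<Longrightarrow> poly Q z = cmean (\<lambda>w. ?k w / (\<psi> w - z)) r4"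
      by (rule faber_polynomial[of r r4 g N]) (use r g in auto)
    have khol: "?k holomorphic_on ex \<rho>" by (intro holomorphic_intros vhol d\<psi>hol g)
    have bd: "norm (cmean (\<lambda>w. ?k w / (\<psi> w - z)) t) \<le> L / d * M * t ^ N"
      if t: "r \<le> t" "t \<le> 1" and z: "\<And>w. norm w = t \<Longrightarrow> d \<le> norm (\<psi> w - z)" for t z
    proof (rule cmean_bound)
      show "continuous_on (sphere 0 t) (\<lambda>w. ?k w / (\<psi> w - z))"
        by (intro continuous_on_divide continuous_on_subset[OF holomorphic_on_imp_continuous_on[OF khol]] continuous_intros
           continuous_on_subset[OF holomorphic_on_imp_continuous_on[OF \<psi>hol]]) (use t r d z in fastforce)+
      fix w :: complex assume w: "norm w = t"
      have "norm (?k w) = norm w ^ N * norm (g w) * norm (v w * deriv \<psi> w) * norm w"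
        by (simp add: norm_mult norm_power mult_ac)
      also have "\<dots> \<le> t ^ N * M * L * 1"
        unfolding w using M[of w] L(2)[of w] w t M0 L r0 by (intro mult_mono) auto
      finally have "norm (?k w) \<le> t ^ N * M * L" by simp
      moreover have "t ^ N * M * L \<ge> 0" using t r0 M0 L by simp
      ultimately have "norm (?k w / (\<psi> w - z)) \<le> t ^ N * M * L / d"
        unfolding norm_divide using z[OF w] d by (intro frac_le) auto
      thus "norm (?k w / (\<psi> w - z)) \<le> L / d * M * t ^ N" by (simp add: mult_ac)
    qed (use t r0 in auto)
    show "\<exists>Q. degree Q \<le> N \<and> coeff Q N = of_real (1 / C_const \<phi> V N) \<and>
        (\<forall>u. r3 \<le> norm u \<longrightarrow> norm (poly Q (\<psi> u) - u ^ N * v u * g u) \<le> L / d * M * r ^ N) \<and>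
        (\<forall>z. z \<notin> \<psi> ` ex r3 \<longrightarrow> norm (poly Q z) \<le> L / d * M * r4 ^ N)"
    proof (intro exI[of _ Q] conjI Q(1,2) allI impI)
      fix u :: complex assume u: "r3 \<le> norm u"
      have "norm (cmean (\<lambda>w. ?k w / (\<psi> w - \<psi> u)) r) \<le> L / d * M * r ^ N"
        by (rule bd) (use r d1(2) d u in \<open>auto intro!: order_trans[OF d(2)] d1(2)\<close>)
      thus "norm (poly Q (\<psi> u) - u ^ N * v u * g u) \<le> L / d * M * r ^ N" using Q(3)[of u] u r by simp
    next
      fix z assume z: "z \<notin> \<psi> ` ex r3"
      hence "z \<notin> \<psi> ` exc r4" using r by auto
      moreover have "norm (cmean (\<lambda>w. ?k w / (\<psi> w - z)) r4) \<le> L / d * M * r4 ^ N"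
        by (rule bd) (use r d2(2) d z in \<open>auto intro!: order_trans[OF d(3)] d2(2)\<close>)
      ultimately show "norm (poly Q z) \<le> L / d * M * r4 ^ N" using Q(4)[of z] by simp
    qed
  qed
qed

end

section \<open>Inversion of the exterior map and level domains\<close>


text \<open>The third fact makes every boundary point a limit of exterior points, so that boundary
  values of \<phi> can be found by continuity.\<close>

lemma jordan_domain_facts:
  fixes \<gamma> :: "real \<Rightarrow> complex"
  assumes "simple_path \<gamma>" "pathfinish \<gamma> = pathstart \<gamma>" "D = inside (path_image \<gamma>)"
  shows "open D" "bounded D" "frontier D \<subseteq> closure (- closure D)"
proof -
  note J = Jordan_inside_outside[OF assms(1,2)]
  show "open D" "bounded D" using J assms(3) by auto
  have fr: "frontier D = path_image \<gamma>" using J assms(3) by auto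
  have cl: "closure D = inside (path_image \<gamma>) \<union> path_image \<gamma>"
    using closure_Un_frontier[of D] unfolding fr by (simp only: assms(3))
  have J1: "inside (path_image \<gamma>) \<inter> outside (path_image \<gamma>) = {}"
    and J2: "inside (path_image \<gamma>) \<union> outside (path_image \<gamma>) = - path_image \<gamma>" using J by simp_all
  have "- (X \<union> Z) = Y" if "X \<inter> Y = {}" "X \<union> Y = - Z" for X Y Z :: "complex set"
    using that by blast
  from this[OF J1 J2] have "- closure D = outside (path_image \<gamma>)" unfolding cl .
  moreover have "frontier (outside (path_image \<gamma>)) = path_image \<gamma>" using J by auto
  ultimately show "frontier D \<subseteq> closure (- closure D)" using fr by (metis Diff_subset frontier_def)
qed

text \<open>The bijectivity of \<phi> is given only off the closure of \<open>D\<close>. Once the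
  boundary is known to be mapped onto the unit circle, openness of the image of the larger domain of
  \<phi> yields a full collar \<rho> < norm w on which the inverse exists.\<close>

lemma exterior_inverse:
  assumes D: "open D" "bounded D" "frontier D \<subseteq> closure (- closure D)"
    and \<phi>: "exterior_conformal_map D \<phi>" and V: "szego_function D \<omega> V"
  obtains \<psi> \<rho> c vinf where "ext_map D \<phi> V \<psi> \<rho> c vinf"
proof -
  obtain W1 where W1: "open W1" "- D \<subseteq> W1" "\<phi> holomorphic_on W1" "inj_on \<phi> W1"
    and bij: "bij_betw \<phi> (- closure D) {w. 1 < norm w}" and inf: "filterlim \<phi> at_infinity at_infinity"
    using \<phi> unfolding exterior_conformal_map_def by blast
  obtain c :: real where c: "0 < c" "(deriv \<phi> \<longlongrightarrow> of_real c) at_infinity"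
    using \<phi> unfolding exterior_conformal_map_def by blast
  obtain W2 where W2: "open W2" "- D \<subseteq> W2" "V holomorphic_on W2"
    using V unfolding szego_function_def by blast
  obtain vinf :: real where vinf: "(V \<longlongrightarrow> of_real vinf) at_infinity"
    using V unfolding szego_function_def by blast
  define W where "W = W1 \<inter> W2"
  have W: "open W" "- D \<subseteq> W" "\<phi> holomorphic_on W" "inj_on \<phi> W" "V holomorphic_on W"
    unfolding W_def using W1 W2 by (auto intro: holomorphic_on_subset inj_on_subset)
  have clD: "- closure D \<subseteq> - D" using closure_subset by auto
  have out: "norm (\<phi> z) > 1" if "z \<in> - closure D" for z using bij_betwE[OF bij] that by auto
  have isc: "isCont \<phi> z" if "z \<in> W" for z
    using that W(1) holomorphic_on_imp_continuous_on[OF W(3)] continuous_on_eq_continuous_at by blast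
  have ge1: "norm (\<phi> z) \<ge> 1" if z: "z \<in> closure (- closure D)" "z \<in> W" for z
  proof -
    from z(1) obtain x where x: "\<And>n. x n \<in> - closure D" "x \<longlonglongrightarrow> z" unfolding closure_sequential by blast
    have "(\<lambda>n. norm (\<phi> (x n))) \<longlonglongrightarrow> norm (\<phi> z)" by (intro tendsto_norm isCont_tendsto_compose[OF isc[OF z(2)] x(2)])
    thus ?thesis by (rule LIMSEQ_le_const) (use out[OF x(1)] less_imp_le in blast)
  qed
  \<comment> \<open>Continuity gives modulus at least 1. A value of larger modulus is already taken
    outside the closure of \<open>D\<close>, which contradicts injectivity.\<close>
  have fr: "norm (\<phi> z) = 1" if z: "z \<in> frontier D" for z
  proof (rule ccontr)
    assume ne: "norm (\<phi> z) \<noteq> 1"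
    have zD: "z \<in> - D" using z D(1) by (simp add: frontier_def interior_open)
    hence "norm (\<phi> z) > 1" using ge1[of z] z D(3) W(2) ne by force
    then obtain z1 where z1: "z1 \<in> - closure D" "\<phi> z1 = \<phi> z"
      using bij unfolding bij_betw_def by (metis (mono_tags, lifting) imageE mem_Collect_eq)
    hence "z1 = z" using inj_onD[OF W(4) z1(2)] zD W(2) clD by blast
    thus False using z1 z by (auto simp: frontier_def)
  qed
  have cl_split: "- D = frontier D \<union> - closure D"
    using D(1) clD by (auto simp: frontier_def interior_open)
  have clcl: "closure (- closure D) \<subseteq> - D" using clD D(1) by (intro closure_minimal) auto
  have surj1: "\<exists>z\<in>- D. \<phi> z = w" if w: "norm w = 1" for w
  proof -
    \<comment> \<open>These points of the open exterior converge to w. Their preimages stay bounded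
      because \<phi> tends to infinity while norm (y n) is at most 2, and a limit point of the
      preimages is mapped to w.\<close>
    define y where "y n = of_real (1 + 1 / real (Suc n)) * w" for n
    have ny: "norm (y n) = 1 + 1 / real (Suc n)" for n
    proof -
      have "norm (y n) = \<bar>1 + 1 / real (Suc n)\<bar> * 1" unfolding y_def norm_mult norm_of_real w ..
      thus ?thesis by simp
    qed
    have "\<exists>z. z \<in> - closure D \<and> \<phi> z = y n" for n
    proof -
      have "y n \<in> {w. 1 < norm w}" using ny[of n] by simp
      thus ?thesis using bij unfolding bij_betw_def by (metis imageE)
    qed
    then obtain x where x: "\<And>n. x n \<in> - closure D" "\<And>n. \<phi> (x n) = y n" by metis
    have "\<forall>\<^sub>F z in at_infinity. 3 \<le> norm (\<phi> z)"
      using inf unfolding filterlim_at_infinity[of 0, OF order.refl] by auto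
    then obtain B where B: "\<And>z. norm z \<ge> B \<Longrightarrow> 3 \<le> norm (\<phi> z)" unfolding eventually_at_infinity by blast
    have "norm (x n) \<le> B" for n
    proof (rule ccontr)
      assume "\<not> norm (x n) \<le> B"
      hence "3 \<le> 1 + 1 / real (Suc n)" using B[of "x n"] x(2) ny by simp
      moreover have "1 / real (Suc n) \<le> 1" by simp
      ultimately show False by linarith
    qed
    hence "\<forall>n. x n \<in> cball 0 B" by simp
    moreover have "seq_compact (cball (0::complex) B)" by (simp add: compact_imp_seq_compact)
    ultimately obtain l r where l: "strict_mono r" "(x \<circ> r) \<longlonglongrightarrow> l" unfolding seq_compact_def by metis
    have lc: "l \<in> closure (- closure D)" unfolding closure_sequential
      by (rule exI[of _ "x \<circ> r"]) (use l x in auto)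
    hence lD: "l \<in> - D" using clcl by blast
    have "(\<lambda>n. \<phi> ((x \<circ> r) n)) \<longlonglongrightarrow> \<phi> l"
      using lD W(2) by (intro isCont_tendsto_compose[OF isc l(2)]) auto
    moreover have "y \<longlonglongrightarrow> of_real (1 + 0) * w" unfolding y_def
      by (intro tendsto_intros LIMSEQ_Suc[OF lim_1_over_n])
    hence "(y \<circ> r) \<longlonglongrightarrow> w" using LIMSEQ_subseq_LIMSEQ[OF _ l(1)] by fastforce
    moreover have "(\<lambda>n. \<phi> ((x \<circ> r) n)) = y \<circ> r" by (simp add: fun_eq_iff x(2))
    ultimately have "\<phi> l = w" by (metis LIMSEQ_unique)
    thus ?thesis using lD by blast
  qed
  have im: "\<phi> ` (- D) = {w. 1 \<le> norm w}"
  proof (intro equalityI subsetI)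
    fix w assume "w \<in> \<phi> ` (- D)"
    thus "w \<in> {w. 1 \<le> norm w}" using fr out cl_split by fastforce
  next
    fix w :: complex assume w: "w \<in> {w. 1 \<le> norm w}"
    show "w \<in> \<phi> ` (- D)"
    proof (cases "norm w = 1")
      case True thus ?thesis using surj1 by blast
    next
      case False
      hence "w \<in> \<phi> ` (- closure D)" using w bij unfolding bij_betw_def by auto
      thus ?thesis using clD by blast
    qed
  qed
  have "open (\<phi> ` W)" by (rule open_mapping_thm3[OF W(3,1,4)])
  moreover have "sphere 0 1 \<subseteq> \<phi> ` W" using im W(2) by fastforce
  ultimately obtain \<epsilon> where \<epsilon>: "\<epsilon> > 0" "(\<Union>x\<in>sphere 0 1. ball x \<epsilon>) \<subseteq> \<phi> ` W"
    by (metis compact_subset_open_imp_ball_epsilon_subset[OF compact_sphere])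
  \<comment> \<open>Points with 1 - \<epsilon> < norm w < 1 lie within \<epsilon> of the unit
    circle; the entry 1 / 2 keeps \<rho> positive.\<close>
  define \<rho> where "\<rho> = max (1/2) (1 - \<epsilon>)"
  have \<rho>: "0 < \<rho>" "\<rho> < 1" using \<epsilon> by (auto simp: \<rho>_def)
  have sub: "{w. \<rho> < norm w} \<subseteq> \<phi> ` W"
  proof
    fix w :: complex assume w: "w \<in> {w. \<rho> < norm w}"
    show "w \<in> \<phi> ` W"
    proof (cases "1 \<le> norm w")
      case True thus ?thesis using im W(2) by blast
    next
      case False
      define w' where "w' = w / of_real (norm w)"
      have w0: "norm w > 0" using w \<rho> by (auto intro: less_trans)
      have 1: "norm w' = 1" using w0 by (simp add: w'_def norm_divide)
      have "w' - w = of_real (1 - norm w) * w'" using w0 by (simp add: w'_def field_simps)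
      hence "norm (w' - w) = 1 - norm w" using False 1 by (metis abs_of_nonneg diff_ge_0_iff_ge linear mult.right_neutral norm_mult norm_of_real)
      also have "\<dots> < \<epsilon>" using w by (auto simp: \<rho>_def)
      finally have "w \<in> ball w' \<epsilon>" by (simp add: dist_norm)
      thus ?thesis using \<epsilon>(2) 1 by force
    qed
  qed
  obtain \<psi> where \<psi>: "\<psi> holomorphic_on \<phi> ` W" "\<And>z. z \<in> W \<Longrightarrow> \<psi> (\<phi> z) = z"
    using holomorphic_has_inverse[OF W(3,1,4)] by metis
  have \<phi>\<psi>: "\<phi> (\<psi> w) = w" "\<psi> w \<in> W" if "\<rho> < norm w" for w
    using sub that \<psi>(2) by fastforce+
  have \<psi>D: "\<psi> ` {w. 1 \<le> norm w} = - D"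
    unfolding im[symmetric] image_image using \<psi>(2) W(2) by force
  have "filterlim \<psi> at_infinity at_infinity"
    unfolding filterlim_at_infinity[of 0, OF order.refl]
  proof (intro allI impI)
    fix B :: real assume "B > 0"
    have "compact (- D \<inter> cball 0 B)" using D(1) by (intro closed_Int_compact) auto
    moreover have "continuous_on (- D \<inter> cball 0 B) \<phi>"
      by (rule continuous_on_subset[OF holomorphic_on_imp_continuous_on[OF W(3)]]) (use W in auto)
    ultimately have "bounded (\<phi> ` (- D \<inter> cball 0 B))" by (intro compact_imp_bounded compact_continuous_image)
    then obtain M where M0: "\<forall>y\<in>\<phi> ` (- D \<inter> cball 0 B). norm y \<le> M" unfolding bounded_iff by blast
    have M: "norm (\<phi> z) \<le> M" if "z \<in> - D" "norm z \<le> B" for z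
      using M0 that by auto
    have "norm (\<psi> w) \<ge> B" if w: "max 1 (M + 1) \<le> norm w" for w
    proof (rule ccontr)
      assume "\<not> B \<le> norm (\<psi> w)"
      moreover have "\<psi> w \<in> - D" unfolding \<psi>D[symmetric] using w by auto
      ultimately have "norm w \<le> M" using M[of "\<psi> w"] \<phi>\<psi>(1)[of w] \<rho> w by auto
      thus False using w by simp
    qed
    thus "\<forall>\<^sub>F w in at_infinity. B \<le> norm (\<psi> w)" unfolding eventually_at_infinity by blast
  qed
  moreover have "\<psi> ` {w. \<rho> < norm w} \<subseteq> W" using \<phi>\<psi> by auto
  ultimately have "ext_map D \<phi> V \<psi> \<rho> c vinf"
    using \<rho> D W \<psi>(1) \<phi>\<psi> \<psi>D c vinf sub
    by unfold_locales (auto intro: holomorphic_on_subset)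
  thus ?thesis by (rule that)
qed

section \<open>Level curves and distance to the boundary\<close>

context ext_map
begin

text \<open>This shrinks the collar to the radius a at which the kernel is available.\<close>

lemma ext_map_mono:
  assumes "\<rho> \<le> \<rho>'" "\<rho>' < 1"
  shows "ext_map D \<phi> V \<psi> \<rho>' c vinf"
proof
  show "\<psi> holomorphic_on ex \<rho>'" by (rule holomorphic_on_subset[OF \<psi>hol]) (use assms in auto)
  show "\<phi> holomorphic_on \<psi> ` ex \<rho>'" by (rule holomorphic_on_subset[OF \<phi>hol]) (use assms in auto)
  show "V holomorphic_on \<psi> ` ex \<rho>'" by (rule holomorphic_on_subset[OF Vhol]) (use assms in auto)
qed (use assms \<rho> D \<phi>\<psi> \<psi>D \<psi>inf c vinf in auto)

lemma circle_path:
  assumes r: "\<rho> < r"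
  shows "simple_path (\<psi> \<circ> circlepath 0 r)" "pathfinish (\<psi> \<circ> circlepath 0 r) = pathstart (\<psi> \<circ> circlepath 0 r)"
    "path_image (\<psi> \<circ> circlepath 0 r) = \<psi> ` sphere 0 r"
proof -
  have r0: "r > 0" using r \<rho> by simp
  have im: "path_image (circlepath 0 r) = sphere 0 r" using r0 by simp
  have sub: "sphere 0 r \<subseteq> ex \<rho>" using r by auto
  show "simple_path (\<psi> \<circ> circlepath 0 r)"
    by (rule simple_path_continuous_image)
       (use r0 sub in \<open>auto simp: simple_path_circlepath intro!: continuous_on_subset[OF holomorphic_on_imp_continuous_on[OF \<psi>hol]] inj_on_subset[OF \<psi>inj]\<close>)
  show "pathfinish (\<psi> \<circ> circlepath 0 r) = pathstart (\<psi> \<circ> circlepath 0 r)"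
    by (simp add: pathfinish_compose pathstart_compose)
  show "path_image (\<psi> \<circ> circlepath 0 r) = \<psi> ` sphere 0 r" unfolding path_image_compose im ..
qed

lemma connected_\<psi>_ex:
  assumes "\<rho> \<le> r" shows "connected (\<psi> ` ex r)"
proof -
  have "connected (- cball (0::complex) r)" by (rule connected_complement_bounded_convex) auto
  moreover have "- cball 0 r = ex r" by auto
  ultimately have "connected (ex r)" by simp
  thus ?thesis using assms
    by (intro connected_continuous_image continuous_on_subset[OF holomorphic_on_imp_continuous_on[OF \<psi>hol]]) auto
qed

text \<open>The part of the plane beyond the curve is connected and unbounded, so it misses the
  inside. The remaining part lies in \<open>D\<close>, and a component that starts there cannot
  cross the curve, so it is bounded.\<close>

lemma inside_level_curve:
  assumes r: "\<rho> < r" "r < 1"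
  shows "inside (\<psi> ` sphere 0 r) = - \<psi> ` exc r"
proof -
  let ?\<Gamma> = "\<psi> ` sphere 0 r"
  have split: "\<psi> ` exc r = ?\<Gamma> \<union> \<psi> ` ex r" by force
  have "\<psi> w \<notin> \<psi> ` ex r" if "norm w = r" for w using mem_\<psi>_ex_iff[of w r] that r by simp
  hence disj: "\<psi> ` ex r \<inter> ?\<Gamma> = {}" unfolding disjoint_iff by (metis imageE mem_sphere_0)
  have unb: "\<not> bounded (\<psi> ` ex r)"
  proof
    assume "bounded (\<psi> ` ex r)"
    hence "bounded (- D)" unfolding \<psi>D[symmetric] by (rule bounded_subset) (use r in auto)
    with D(2) have "bounded (D \<union> - D)" by (simp only: bounded_Un)
    thus False using not_bounded_UNIV[where 'a = complex] by simp
  qed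
  have i1: "\<psi> ` ex r \<inter> inside ?\<Gamma> = {}"
  proof (rule ccontr)
    assume "\<psi> ` ex r \<inter> inside ?\<Gamma> \<noteq> {}"
    then obtain z where z: "z \<in> \<psi> ` ex r" "z \<in> inside ?\<Gamma>" by blast
    have "\<psi> ` ex r \<subseteq> connected_component_set (- ?\<Gamma>) z"
      using z(1) disj connected_\<psi>_ex[of r] r by (intro connected_component_maximal) auto
    moreover have "bounded (connected_component_set (- ?\<Gamma>) z)" using z(2) by (simp add: inside_def)
    ultimately show False using unb bounded_subset by blast
  qed
  have i2: "z \<in> inside ?\<Gamma>" if z: "z \<notin> \<psi> ` exc r" for z
  proof -
    let ?C = "connected_component_set (- ?\<Gamma>) z"
    have zG: "z \<in> - ?\<Gamma>" using z split by auto
    have "?C \<subseteq> - \<psi> ` exc r"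
    proof (rule ccontr)
      assume "\<not> ?C \<subseteq> - \<psi> ` exc r"
      moreover have CG: "?C \<subseteq> - ?\<Gamma>" by (rule connected_component_subset)
      ultimately have "?C \<inter> \<psi> ` ex r \<noteq> {}" using split by blast
      moreover have "z \<in> ?C" using zG by (simp add: connected_component_refl)
      hence "?C \<inter> - \<psi> ` exc r \<noteq> {}" using z by blast
      moreover have "?C \<subseteq> \<psi> ` ex r \<union> - \<psi> ` exc r" using CG split by blast
      moreover have "open (\<psi> ` ex r)" "open (- \<psi> ` exc r)" using open_\<psi>_ex[of r] closed_\<psi>_exc[of r] r by auto
      moreover have "\<psi> ` ex r \<inter> - \<psi> ` exc r \<inter> ?C = {}" using split by blast
      ultimately show False using connected_connected_component[of "- ?\<Gamma>" z] unfolding connected_def by blast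
    qed
    moreover have "- \<psi> ` exc r \<subseteq> D"
    proof -
      have "- D \<subseteq> \<psi> ` exc r" unfolding \<psi>D[symmetric] using r by auto
      thus ?thesis by blast
    qed
    ultimately have "?C \<subseteq> D" by (rule order_trans)
    hence "bounded ?C" by (rule bounded_subset[OF D(2)])
    thus ?thesis using zG by (simp add: inside_def)
  qed
  have i3: "inside ?\<Gamma> \<inter> ?\<Gamma> = {}" by (rule inside_no_overlap)
  show ?thesis
  proof (intro equalityI subsetI)
    fix z assume "z \<in> inside ?\<Gamma>"
    hence "z \<notin> ?\<Gamma>" "z \<notin> \<psi> ` ex r" using i1 i3 unfolding disjoint_iff by blast+
    thus "z \<in> - \<psi> ` exc r" unfolding split by simp
  next
    fix z assume "z \<in> - \<psi> ` exc r"
    thus "z \<in> inside ?\<Gamma>" using i2[of z] by simp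
  qed
qed

lemma level_domain_facts:
  assumes r: "\<rho> < r" "r < 1"
  defines "Dr \<equiv> - \<psi> ` exc r"
  shows "level_domain D \<phi> V r Dr" "- closure Dr = \<psi> ` ex r" "closure Dr = - \<psi> ` ex r"
proof -
  have cl: "closure Dr = - \<psi> ` ex r"
  proof
    show "closure Dr \<subseteq> - \<psi> ` ex r" unfolding Dr_def
      using open_\<psi>_ex[of r] r by (intro closure_minimal) auto
    show "- \<psi> ` ex r \<subseteq> closure Dr"
    proof
      fix z assume z: "z \<in> - \<psi> ` ex r"
      show "z \<in> closure Dr"
      proof (cases "z \<in> Dr")
        case True thus ?thesis using closure_subset by blast
      next
        case False
        then obtain w where w: "z = \<psi> w" "r \<le> norm w" by (auto simp: Dr_def)
        hence nw: "norm w = r" using z by force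
        \<comment> \<open>A radial approach to w from smaller moduli; the factor 1 - \<rho> / r
          keeps the modulus of x n above \<rho>, where \<psi> is controlled.\<close>
        define x where "x n = of_real (1 - (1 - \<rho> / r) * inverse (real (Suc (Suc n)))) * w" for n
        have q: "0 < 1 - \<rho> / r" "1 - \<rho> / r < 1" using r \<rho> by (auto simp: field_simps)
        have nx: "\<rho> < norm (x n) \<and> norm (x n) < r" for n
        proof -
          define t where "t = inverse (real (Suc (Suc n)))"
          have t: "0 < t" "t < 1" by (auto simp: t_def inverse_less_1_iff)
          define y where "y = (1 - \<rho> / r) * t"
          have y: "y < 1 - \<rho> / r" "0 < y" using t q by (auto simp: y_def)
          have "norm (x n) = \<bar>1 - y\<bar> * r" unfolding x_def norm_mult norm_of_real nw t_def[symmetric] y_def ..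
          hence "norm (x n) = (1 - y) * r" using y q by simp
          moreover have "(1 - y) * r < 1 * r" using y r \<rho> by (intro mult_strict_right_mono) auto
          moreover have "(\<rho> / r) * r < (1 - y) * r" using y r \<rho> by (intro mult_strict_right_mono) linarith+
          ultimately show ?thesis using r \<rho> by simp
        qed
        have "x \<longlonglongrightarrow> of_real (1 - (1 - \<rho> / r) * 0) * w" unfolding x_def
          by (intro tendsto_intros LIMSEQ_Suc[OF LIMSEQ_inverse_real_of_nat])
        moreover have "isCont \<psi> w" using nw r
          by (intro holomorphic_on_imp_differentiable_at[OF \<psi>hol open_exterior, THEN field_differentiable_imp_continuous_at]) auto
        ultimately have "(\<lambda>n. \<psi> (x n)) \<longlonglongrightarrow> z" using w by (auto intro: isCont_tendsto_compose)
        moreover have "\<psi> (x n) \<in> Dr" for n using nx[of n] mem_\<psi>_exc_iff[of "x n" r] r by (auto simp: Dr_def)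
        ultimately show ?thesis unfolding closure_sequential by (intro exI[of _ "\<lambda>n. \<psi> (x n)"]) simp
      qed
    qed
  qed
  thus "closure Dr = - \<psi> ` ex r" "- closure Dr = \<psi> ` ex r" by auto
  have "open Dr" unfolding Dr_def using closed_\<psi>_exc[of r] r by auto
  hence fr: "frontier Dr = \<psi> ` exc r - \<psi> ` ex r" unfolding frontier_def cl by (simp add: interior_open) (auto simp: Dr_def)
  have "jordan_domain Dr" unfolding jordan_domain_def
    using circle_path[OF r(1)] inside_level_curve[OF r]
    by (intro exI[of _ "\<psi> \<circ> circlepath 0 r"]) (auto simp: Dr_def)
  moreover have "- D \<subseteq> \<psi> ` exc r" unfolding \<psi>D[symmetric] using r by auto
  hence "Dr \<subseteq> D" by (auto simp: Dr_def)
  moreover have "\<psi> ` exc r \<subseteq> \<psi> ` ex \<rho>" using r by auto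
  hence "- Dr \<subseteq> \<psi> ` ex \<rho>" by (simp add: Dr_def)
  moreover have "inj_on \<phi> (\<psi> ` ex \<rho>)" using \<phi>\<psi> by (auto simp: inj_on_def)
  moreover have "frontier Dr = {z \<in> \<psi> ` ex \<rho>. norm (\<phi> z) = r}"
  proof (intro equalityI subsetI)
    fix z assume "z \<in> frontier Dr"
    then obtain w where w: "z = \<psi> w" "r \<le> norm w" "z \<notin> \<psi> ` ex r" unfolding fr by auto
    hence "norm w = r" using mem_\<psi>_ex_iff[of w r] r by force
    thus "z \<in> {z \<in> \<psi> ` ex \<rho>. norm (\<phi> z) = r}" using w \<phi>\<psi>[of w] r by auto
  next
    fix z assume "z \<in> {z \<in> \<psi> ` ex \<rho>. norm (\<phi> z) = r}"
    then obtain w where w0: "z = \<psi> w" "\<rho> < norm w" "norm (\<phi> z) = r" by auto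
    hence w: "z = \<psi> w" "\<rho> < norm w" "norm w = r" using \<phi>\<psi>[of w] by simp_all
    thus "z \<in> frontier Dr" unfolding fr using mem_\<psi>_ex_iff[of w r] r by auto
  qed
  ultimately show "level_domain D \<phi> V r Dr" unfolding level_domain_def
    using open_\<psi>_ex[of \<rho>] \<phi>hol Vhol by (intro conjI exI[of _ "\<psi> ` ex \<rho>"]) auto
qed

text \<open>On a ball about the nearest point of the complement of \<open>D\<close> the map \<phi>
  is Lipschitz with constant L, and at that point its modulus is at least 1. This translates
  Euclidean distance into the modulus of the exterior coordinate.\<close>

lemma near_boundary:
  assumes r3: "\<rho> < r3" "r3 < 1"
  obtains d L where "d > 0" "L > 0" "\<And>z \<delta>. infdist z (- D) \<le> \<delta> \<Longrightarrow> \<delta> < d \<Longrightarrow> \<exists>w. z = \<psi> w \<and> r3 < norm w \<and> 1 - L * \<delta> \<le> norm w"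
proof -
  have Dne: "- D \<noteq> {}" using \<psi>D by (metis (mono_tags, lifting) empty_is_image mem_Collect_eq norm_one order_refl empty_iff)
  let ?K = "- \<psi> ` ex r3"
  have "?K \<subseteq> D" using \<psi>D r3 by (force simp: set_eq_iff image_iff)
  hence "bounded ?K" using D(2) bounded_subset by blast
  hence "compact ?K" using open_\<psi>_ex[of r3] r3 by (simp add: compact_eq_bounded_closed closed_Compl)
  moreover have "?K \<inter> - D = {}" using \<open>?K \<subseteq> D\<close> by blast
  ultimately obtain d where d: "d > 0" "\<And>x y. x \<in> ?K \<Longrightarrow> y \<in> - D \<Longrightarrow> d \<le> norm (x - y)"
    using D(1) by (metis separation closed_Compl)
  have "\<exists>L>0. \<forall>w\<in>exc r3. norm (deriv \<phi> (\<psi> w)) \<le> L"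
  proof -
    from tendstoD[OF d\<phi>\<psi>_lim, of 1] obtain b where b: "\<And>w. norm w \<ge> b \<Longrightarrow> norm (deriv \<phi> (\<psi> w) - of_real c) < 1"
      unfolding eventually_at_infinity dist_norm by auto
    let ?C = "{w::complex. r3 \<le> norm w \<and> norm w \<le> b}"
    have "?C = cball 0 b - ball 0 r3" by auto
    hence "compact ?C" by (simp add: compact_diff)
    moreover have "continuous_on ?C (\<lambda>w. 1 / deriv \<psi> w)"
      using r3 d\<psi>_nz by (intro continuous_intros continuous_on_subset[OF holomorphic_on_imp_continuous_on[OF d\<psi>hol]]) auto
    ultimately have "bounded ((\<lambda>w. 1 / deriv \<psi> w) ` ?C)" by (intro compact_imp_bounded compact_continuous_image)
    then obtain M where M: "M > 0" "\<And>w. w \<in> ?C \<Longrightarrow> norm (1 / deriv \<psi> w) \<le> M" unfolding bounded_pos by blast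
    have "norm (deriv \<phi> (\<psi> w)) \<le> M + c + 1" if "r3 \<le> norm w" for w
    proof (cases "norm w \<le> b")
      case True
      thus ?thesis using M(2)[of w] that d\<phi>_eq[of w] r3 c by simp
    next
      case False
      have "norm (deriv \<phi> (\<psi> w)) \<le> norm (deriv \<phi> (\<psi> w) - of_real c) + norm (complex_of_real c)"
        using norm_triangle_ineq[of "deriv \<phi> (\<psi> w) - of_real c" "of_real c"] by simp
      thus ?thesis using b[of w] False M c by simp
    qed
    thus ?thesis using M c by (intro exI[of _ "M + c + 1"]) auto
  qed
  then obtain L where L: "L > 0" "\<And>w. r3 \<le> norm w \<Longrightarrow> norm (deriv \<phi> (\<psi> w)) \<le> L" by auto
  show ?thesis
  proof (rule that[OF d(1) L(1)])
    fix z \<delta> assume z: "infdist z (- D) \<le> \<delta>" "\<delta> < d"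
    obtain z' where z': "z' \<in> - D" "infdist z (- D) = dist z z'"
      using infdist_attains_inf[of "- D" z] D(1) Dne by auto
    have dz: "norm (z - z') \<le> \<delta>" using z z' by (simp add: dist_norm)
    have ball: "ball z' d \<subseteq> \<psi> ` ex r3"
    proof
      fix y assume "y \<in> ball z' d"
      hence "norm (y - z') < d" by (simp add: dist_norm norm_minus_commute)
      thus "y \<in> \<psi> ` ex r3" using d(2)[of y z'] z'(1) by force
    qed
    have zb: "z \<in> ball z' d" "z' \<in> ball z' d" using dz z d by (auto simp: dist_norm norm_minus_commute)
    then obtain w where w: "z = \<psi> w" "r3 < norm w" using ball by auto
    have "norm (\<phi> z - \<phi> z') \<le> L * norm (z - z')"
    proof (rule field_differentiable_bound[of "ball z' d" \<phi> "deriv \<phi>"])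
      fix y assume y: "y \<in> ball z' d"
      then obtain u where u: "y = \<psi> u" "r3 < norm u" using ball by auto
      have "(\<phi> has_field_derivative deriv \<phi> y) (at y)"
        using u r3 by (intro holomorphic_derivI[OF \<phi>hol open_\<psi>_ex]) auto
      thus "(\<phi> has_field_derivative deriv \<phi> y) (at y within ball z' d)" by (rule has_field_derivative_at_within)
      show "norm (deriv \<phi> y) \<le> L" using L(2)[of u] u by simp
    qed (use zb in auto)
    also have "\<dots> \<le> L * \<delta>" using dz L by (intro mult_left_mono) auto
    finally have "norm (\<phi> z - \<phi> z') \<le> L * \<delta>" .
    moreover have "\<phi> z = w" using w \<phi>\<psi> r3 by auto
    moreover have "1 \<le> norm (\<phi> z')"
    proof -
      obtain u where u: "z' = \<psi> u" "1 \<le> norm u" using z'(1) unfolding \<psi>D[symmetric] by auto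
      thus ?thesis using \<phi>\<psi>[of u] \<rho> by simp
    qed
    ultimately have "1 - L * \<delta> \<le> norm w" using norm_triangle_ineq2[of "\<phi> z'" "\<phi> z"] by (simp add: norm_minus_commute)
    thus "\<exists>w. z = \<psi> w \<and> r3 < norm w \<and> 1 - L * \<delta> \<le> norm w" using w by blast
  qed
qed

end

section \<open>Area pairing near the boundary\<close>


lemma continuous_bounded_integrable:
  fixes f :: "complex \<Rightarrow> 'a::euclidean_space"
  assumes S: "open S" "bounded S" and f: "continuous_on S f" "\<And>z. z \<in> S \<Longrightarrow> norm (f z) \<le> B"
  shows "(\<lambda>z. indicator S z *\<^sub>R f z) \<in> borel_measurable borel" "set_integrable lborel S f"
    "f absolutely_integrable_on S" "set_integrable dA S f"
proof -
  show m: "(\<lambda>z. indicator S z *\<^sub>R f z) \<in> borel_measurable borel"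
    using S by (intro borel_measurable_continuous_on_indicator f) auto
  show i: "set_integrable lborel S f" unfolding set_integrable_def
  proof (rule integrableI_bounded_set[where A = S and B = B])
    show "emeasure lborel S < \<infinity>" using emeasure_bounded_finite[OF S(2)] by simp
  qed (use S m f in auto)
  show "f absolutely_integrable_on S"
    using i m unfolding set_integrable_def by (simp add: integrable_completion)
  show "set_integrable dA S f" using set_integrable_dA_iff[OF m] i by simp
qed

text \<open>\<open>x0\<close> is the depth of the collar in the coordinate x. The margins up to
  \<open>x2\<close> and \<open>x1\<close> leave room for complex x around the segment [0, x0], and a
  < exp (- x2) keeps exp (- x) \<sigma> in the domain of the coefficients for norm \<sigma> =
  1.\<close>

locale op_setup = ext_map D \<phi> V \<psi> a c vinf + annulus_kernel K a x1
  for D :: "complex set" and \<phi> V \<psi> :: "complex \<Rightarrow> complex" and a c vinf :: real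
    and K :: "complex \<Rightarrow> complex \<Rightarrow> complex" and x1 :: real +
  fixes \<omega> :: "complex \<Rightarrow> real" and x0 x2 :: real
  assumes \<omega>cont: "continuous_on D \<omega>" and \<omega>nn: "\<And>z. z \<in> D \<Longrightarrow> 0 \<le> \<omega> z"
    and \<omega>pos: "\<And>x w. 0 \<le> x \<Longrightarrow> x < x1 \<Longrightarrow> norm w = exp (- x / 2) \<Longrightarrow> a < norm w \<Longrightarrow> 0 < \<omega> (\<psi> w)"
    and K\<omega>: "\<And>x w. 0 \<le> x \<Longrightarrow> x < x1 \<Longrightarrow> norm w = exp (- x / 2) \<Longrightarrow> a < norm w \<Longrightarrow>
       K (of_real x) (of_real (exp x) * w) = of_real (exp (- x) * \<omega> (\<psi> w) * exp (2 * Re (V (\<psi> w))))"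
    and x: "0 < x0" "x0 < x2" "x2 < x1" "a < exp (- x2)"
begin

abbreviation "r3 \<equiv> exp (- x0 / 2)"
abbreviation "cann \<equiv> {w::complex. r3 \<le> norm w \<and> norm w \<le> 1}"

definition A :: "complex set" where "A = \<psi> ` {w. r3 < norm w \<and> norm w < 1}"

lemma r3: "a < r3" "r3 < 1" "0 < r3"
proof -
  have "exp (- x2) < exp (- x0 / 2)" using x by simp
  thus "a < r3" using x by linarith
qed (use x in auto)

lemma A_sub: "A \<subseteq> D" unfolding A_def using \<psi>_in_D r3 by auto

lemma A_open: "open A"
proof -
  have "A = \<psi> ` ex r3 \<inter> D"
  proof (intro equalityI subsetI)
    fix z assume "z \<in> A" thus "z \<in> \<psi> ` ex r3 \<inter> D" using A_sub by (auto simp: A_def)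
  next
    fix z assume z: "z \<in> \<psi> ` ex r3 \<inter> D"
    then obtain w where w: "z = \<psi> w" "r3 < norm w" by auto
    have "norm w < 1"
    proof (rule ccontr)
      assume "\<not> norm w < 1"
      hence "\<psi> w \<in> - D" unfolding \<psi>D[symmetric] by auto
      thus False using z w by simp
    qed
    thus "z \<in> A" using w by (auto simp: A_def)
  qed
  thus ?thesis using open_\<psi>_ex[of r3] r3 D by auto
qed

lemma A_bounded: "bounded A" using D(2) A_sub by (rule bounded_subset)

lemma D_cases:
  assumes "z \<in> D"
  obtains w where "z = \<psi> w" "r3 < norm w" "norm w < 1" "z \<in> A" | "z \<notin> \<psi> ` ex r3"
proof (cases "z \<in> \<psi> ` ex r3")
  case True
  then obtain w where w: "z = \<psi> w" "r3 < norm w" by auto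
  have "norm w < 1"
  proof (rule ccontr)
    assume "\<not> norm w < 1"
    hence "\<psi> w \<in> - D" unfolding \<psi>D[symmetric] by auto
    thus False using assms w by simp
  qed
  thus ?thesis using w that(1) by (auto simp: A_def)
qed (use that in blast)

lemma compact_cann: "compact cann"
proof -
  have "cann = cball 0 1 - ball 0 r3" by auto
  thus ?thesis by (simp add: compact_diff)
qed

lemma radius:
  assumes "w \<in> cann"
  obtains x where "0 \<le> x" "x \<le> x0" "x < x1" "norm w = exp (- x / 2)" "a < norm w" "x = - 2 * ln (norm w)"
proof -
  have w: "r3 \<le> norm w" "norm w \<le> 1" "0 < norm w" using assms r3 by auto
  have "ln r3 \<le> ln (norm w)" using w r3 by (subst ln_le_cancel_iff) auto
  hence "- x0 / 2 \<le> ln (norm w)" by simp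
  thus ?thesis using that[of "- 2 * ln (norm w)"] w r3 x by auto
qed

text \<open>\<omega> is assumed continuous on the open set \<open>D\<close>, but the closed collar
  contains boundary points. Continuity there is recovered from \<open>K\<close>, whose values at the
  real points determine \<omega>.\<close>

lemma \<Omega>_cont: "continuous_on cann (\<lambda>w. \<omega> (\<psi> w))"
proof -
  define X where "X w = - 2 * ln (norm w)" for w :: complex
  have dom: "(complex_of_real (X w), of_real (exp (X w)) * w) \<in> ball 0 x1 \<times> ann" if w: "w \<in> cann" for w
  proof -
    obtain x where x': "0 \<le> x" "x \<le> x0" "x < x1" "norm w = exp (- x / 2)" "a < norm w" "x = X w"
      using radius[OF w] unfolding X_def by blast
    have n: "norm (of_real (exp (X w)) * w) = exp (x / 2)"
      unfolding x'(6)[symmetric] by (simp add: norm_mult x'(4) exp_add[symmetric])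
    have "exp (x / 2) = 1 / norm w" unfolding x'(4) by (simp add: exp_minus inverse_eq_divide)
    moreover have "1 / norm w < 1 / a" using x' a by (intro divide_strict_left_mono mult_pos_pos) auto
    moreover have "a < exp (x / 2)" using a x' by (auto intro: less_le_trans[OF a(2)])
    moreover have Xw: "X w = x" using x'(6) by simp
    ultimately show ?thesis using n x'(1,3) unfolding Xw by simp
  qed
  have w0: "norm w \<noteq> 0" if "w \<in> cann" for w :: complex using that r3 by (metis (mono_tags, lifting) mem_Collect_eq not_less)
  have Xc: "continuous_on cann X" unfolding X_def using w0 by (intro continuous_intros) auto
  have "continuous_on cann (\<lambda>w. (\<lambda>(x, \<sigma>). K x \<sigma>) (of_real (X w), of_real (exp (X w)) * w))"
    by (rule continuous_on_compose2[OF cont]) (use dom Xc in \<open>auto intro!: continuous_intros\<close>)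
  hence Kc: "continuous_on cann (\<lambda>w. K (of_real (X w)) (of_real (exp (X w)) * w))" by simp
  have "continuous_on cann (\<lambda>w. Re (K (of_real (X w)) (of_real (exp (X w)) * w)) * exp (X w) * exp (- 2 * Re (V (\<psi> w))))"
    using r3 by (intro continuous_intros Kc Xc continuous_on_subset[OF holomorphic_on_imp_continuous_on[OF V\<psi>hol]]) auto
  moreover have "Re (K (of_real (X w)) (of_real (exp (X w)) * w)) * exp (X w) * exp (- 2 * Re (V (\<psi> w))) = \<omega> (\<psi> w)" if w: "w \<in> cann" for w
  proof -
    obtain x where x': "0 \<le> x" "x < x1" "norm w = exp (- x / 2)" "a < norm w" "x = X w"
      using radius[OF w] unfolding X_def by blast
    have "Re (K (of_real (X w)) (of_real (exp (X w)) * w)) = exp (- x) * \<omega> (\<psi> w) * exp (2 * Re (V (\<psi> w)))"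
      using K\<omega>[OF x'(1-4)] unfolding x'(5)[symmetric] by simp
    thus ?thesis unfolding x'(5)[symmetric] by (simp add: exp_minus field_simps)
  qed
  ultimately show ?thesis by (rule continuous_on_eq)
qed

lemma \<Omega>_lower:
  obtains w0 where "w0 > 0" "\<And>w. w \<in> cann \<Longrightarrow> w0 \<le> \<omega> (\<psi> w)"
proof -
  have "cann \<noteq> {}" using r3 by (auto intro!: exI[of _ 1])
  then obtain u where u: "u \<in> cann" "\<And>w. w \<in> cann \<Longrightarrow> \<omega> (\<psi> u) \<le> \<omega> (\<psi> w)"
    using continuous_attains_inf[OF compact_cann _ \<Omega>_cont] by blast
  moreover have "\<omega> (\<psi> u) > 0" using radius[OF u(1)] \<omega>pos by metis
  ultimately show ?thesis using that by blast
qed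

lemma \<omega>_upper:
  obtains W where "W > 0" "\<And>z. z \<in> D \<Longrightarrow> \<omega> z \<le> W"
proof -
  have "bounded ((\<lambda>w. \<omega> (\<psi> w)) ` cann)"
    by (intro compact_imp_bounded compact_continuous_image \<Omega>_cont compact_cann)
  then obtain W1 where W1: "W1 > 0" "\<And>w. w \<in> cann \<Longrightarrow> norm (\<omega> (\<psi> w)) \<le> W1" unfolding bounded_pos by blast
  let ?C = "- \<psi> ` ex r3"
  have sub: "?C \<subseteq> D"
  proof -
    have "r3 < norm w" if "1 \<le> norm w" for w :: complex using r3(2) that by linarith
    hence "- D \<subseteq> \<psi> ` ex r3" unfolding \<psi>D[symmetric] by blast
    thus ?thesis by blast
  qed
  have "compact ?C" unfolding compact_eq_bounded_closed
    using bounded_subset[OF D(2) sub] open_\<psi>_ex[of r3] r3 by (auto intro!: closed_Compl)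
  hence "bounded (\<omega> ` ?C)" using sub
    by (intro compact_imp_bounded compact_continuous_image continuous_on_subset[OF \<omega>cont])
  then obtain W2 where W2: "W2 > 0" "\<And>z. z \<in> ?C \<Longrightarrow> norm (\<omega> z) \<le> W2" unfolding bounded_pos by blast
  show ?thesis
  proof (rule that[of "W1 + W2"])
    fix z assume z: "z \<in> D"
    show "\<omega> z \<le> W1 + W2"
    proof (rule D_cases[OF z])
      fix w assume w: "z = \<psi> w" "r3 < norm w" "norm w < 1"
      thus ?thesis using W1(2)[of w] W2(1) by simp
    next
      assume "z \<notin> \<psi> ` ex r3"
      thus ?thesis using W2(2)[of z] W1(1) by simp
    qed
  qed (use W1 W2 in auto)
qed

text \<open>Pointwise |w|^(2 N) is exp (- N x), and the modulus of \<psi>' cancels against the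
  denominator of \<open>v\<close>, leaving exp (2 Re V); with \<omega> and the area element this is
  \<open>K\<close>. The means remain on their original circles, where the weight is positive, since
  \<open>pointwise_bound\<close> relies on this form.\<close>

lemma area_pairing_radial:
  assumes g: "g holomorphic_on ex a" and h: "h holomorphic_on ex a"
    and F: "continuous_on A F" "\<And>w. r3 < norm w \<Longrightarrow> norm w < 1 \<Longrightarrow> F (\<psi> w) = w ^ N * v w * g w"
    and H: "continuous_on A H" "\<And>w. r3 < norm w \<Longrightarrow> norm w < 1 \<Longrightarrow> H (\<psi> w) = w ^ N * v w * h w"
  shows "(LINT z:A|dA. F z * cnj (H z) * of_real (\<omega> z)) =
    integral {0..x0} (\<lambda>x. of_real (exp (- (real N * x))) *
      cmean (\<lambda>w. g w * cnj (h w) * K (of_real x) (of_real (exp x) * w)) (exp (- x / 2)))"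
proof -
  define f where "f z = F z * cnj (H z) * of_real (\<omega> z)" for z
  define gf where "gf w = (w ^ N * v w * g w) * cnj (w ^ N * v w * h w) * of_real (\<omega> (\<psi> w))" for w
  have gfc: "continuous_on cann gf" unfolding gf_def using r3
    by (intro continuous_intros \<Omega>_cont continuous_on_subset[OF holomorphic_on_imp_continuous_on[OF vhol]]
       continuous_on_subset[OF holomorphic_on_imp_continuous_on[OF g]] continuous_on_subset[OF holomorphic_on_imp_continuous_on[OF h]]) auto
  have fgf: "f (\<psi> w) = gf w" if "r3 < norm w" "norm w < 1" for w
    using F(2)[OF that] H(2)[OF that] by (simp add: f_def gf_def)
  have "bounded (gf ` cann)" by (intro compact_imp_bounded compact_continuous_image gfc compact_cann)
  then obtain B where B: "\<And>w. w \<in> cann \<Longrightarrow> norm (gf w) \<le> B" unfolding bounded_iff by blast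
  have fc: "continuous_on A f" unfolding f_def
    by (intro continuous_intros F H continuous_on_subset[OF \<omega>cont A_sub])
  have fB: "norm (f z) \<le> B" if "z \<in> A" for z using that fgf B unfolding A_def by fastforce
  note int = continuous_bounded_integrable[OF A_open A_bounded fc fB]
  have "(LINT z:A|dA. f z) = (1 / pi) *\<^sub>R integral A f"
    using set_integral_dA[OF int(1)] set_borel_integral_eq_integral(2)[OF int(2)] by simp
  also have "integral A f = of_real pi * integral {0..x0} (\<lambda>x. of_real (exp (- x)) * cmean (\<lambda>w. of_real ((norm (deriv \<psi> w))\<^sup>2) * gf w) (exp (- x / 2)))"
    unfolding A_def
    by (rule exterior_area_integral[OF \<psi>hol \<psi>inj r3(1) x(1) _ gfc fgf]) (use int(3) in \<open>auto simp: A_def\<close>)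
  also have "integral {0..x0} (\<lambda>x. of_real (exp (- x)) * cmean (\<lambda>w. of_real ((norm (deriv \<psi> w))\<^sup>2) * gf w) (exp (- x / 2))) =
     integral {0..x0} (\<lambda>x. of_real (exp (- (real N * x))) * cmean (\<lambda>w. g w * cnj (h w) * K (of_real x) (of_real (exp x) * w)) (exp (- x / 2)))"
  proof (rule integral_cong)
    fix t assume t: "t \<in> {0..x0}"
    show "of_real (exp (- t)) * cmean (\<lambda>w. of_real ((norm (deriv \<psi> w))\<^sup>2) * gf w) (exp (- t / 2)) =
      of_real (exp (- (real N * t))) * cmean (\<lambda>w. g w * cnj (h w) * K (of_real t) (of_real (exp t) * w)) (exp (- t / 2))"
      unfolding cmean_mult_left[symmetric]
    proof (rule cmean_cong)
      fix w :: complex assume w: "norm w = exp (- t / 2)"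
      have wc: "w \<in> cann" using w t by simp
      have wa: "a < norm w" using wc r3 by auto
      have K: "K (of_real t) (of_real (exp t) * w) = of_real (exp (- t) * \<omega> (\<psi> w) * exp (2 * Re (V (\<psi> w))))"
        by (rule K\<omega>) (use t x w wa in auto)
      have 1: "w ^ N * cnj (w ^ N) = of_real (exp (- (real N * t)))"
      proof -
        have "(norm (w ^ N))\<^sup>2 = exp (- (real N * t))"
          unfolding norm_power w by (simp add: exp_of_nat_mult[symmetric] exp_double[symmetric])
        thus ?thesis by (metis complex_norm_square)
      qed
      have 2: "of_real ((norm (deriv \<psi> w))\<^sup>2) * (v w * cnj (v w)) = of_real (exp (2 * Re (V (\<psi> w))))"
      proof -
        have "(norm (deriv \<psi> w))\<^sup>2 * (norm (v w))\<^sup>2 = exp (2 * Re (V (\<psi> w)))"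
          using d\<psi>_nz[OF wa] by (simp add: v_def norm_divide power_divide exp_double[symmetric])
        moreover have "v w * cnj (v w) = of_real ((norm (v w))\<^sup>2)" by (metis complex_norm_square)
        ultimately show ?thesis by (metis of_real_mult)
      qed
      have "of_real (exp (- t)) * (of_real ((norm (deriv \<psi> w))\<^sup>2) * gf w) =
          of_real (exp (- t)) * (w ^ N * cnj (w ^ N)) * (of_real ((norm (deriv \<psi> w))\<^sup>2) * (v w * cnj (v w))) * g w * cnj (h w) * of_real (\<omega> (\<psi> w))"
        by (simp add: gf_def mult_ac)
      also have "\<dots> = of_real (exp (- (real N * t))) * (g w * cnj (h w) * K (of_real t) (of_real (exp t) * w))"
        unfolding 1 2 K by (simp add: mult_ac)
      finally show "of_real (exp (- t)) * (of_real ((norm (deriv \<psi> w))\<^sup>2) * gf w) =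
          of_real (exp (- (real N * t))) * (g w * cnj (h w) * K (of_real t) (of_real (exp t) * w))" .
    qed simp
  qed
  finally show ?thesis unfolding f_def by (simp add: scaleR_conv_of_real)
qed

text \<open>On the circle of radius \<open>exp (x / 2)\<close> one has \<open>exp (- x) * \<sigma> = 1 / cnj \<sigma>\<close>, so the integrand extends
  holomorphically and the contour can be moved to the unit circle.\<close>

lemma shift_to_unit_circle:
  assumes g: "g holomorphic_on ex a" and h: "h holomorphic_on ex a" and t: "0 \<le> t" "t \<le> x0"
  shows "cmean (\<lambda>w. g w * cnj (h w) * K (of_real t) (of_real (exp t) * w)) (exp (- t / 2)) =
    cmean (\<lambda>\<sigma>. g (exp (- of_real t) * \<sigma>) * K (of_real t) \<sigma> * cnj (h \<sigma>)) 1"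
proof -
  define G where "G \<sigma> = g (exp (- of_real t) * \<sigma>) * K (of_real t) \<sigma> * cnj (h (cnj (1 / \<sigma>)))" for \<sigma>
  \<comment> \<open>\<open>G\<close> is holomorphic for a exp t < norm \<sigma> < 1 / a; this
    inequality puts both radii, 1 and exp (t / 2), into that range.\<close>
  have et: "a * exp t < 1"
  proof -
    have "a < exp (- t)" using x t by (smt (verit) exp_less_mono)
    thus ?thesis by (simp add: exp_minus field_simps)
  qed
  have recip: "cnj (1 / \<sigma>) = of_real (1 / s\<^sup>2) * \<sigma>" if "norm \<sigma> = s" "s > 0" for \<sigma> s
  proof -
    have "\<sigma> * cnj \<sigma> = of_real (s\<^sup>2)" using that complex_norm_square[of \<sigma>] by simp
    moreover have "\<sigma> \<noteq> 0" using that by auto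
    ultimately have "1 / cnj \<sigma> = \<sigma> / of_real (s\<^sup>2)" using that by (simp add: field_simps)
    thus ?thesis by simp
  qed
  have "cmean (\<lambda>w. g w * cnj (h w) * K (of_real t) (of_real (exp t) * w)) (exp (- t / 2)) = cmean (\<lambda>w. G (of_real (exp t) * w)) (exp (- t / 2))"
  proof (rule cmean_cong)
    fix w :: complex assume w: "norm w = exp (- t / 2)"
    have n: "norm (of_real (exp t) * w) = exp (t / 2)" by (simp add: norm_mult w exp_add[symmetric])
    have "(exp (t / 2))\<^sup>2 = exp t" by (simp add: exp_double[symmetric])
    hence e1: "cnj (1 / (of_real (exp t) * w)) = w" using recip[OF n] by simp
    have e2: "exp (- of_real t) * (of_real (exp t) * w) = w" by (simp add: exp_minus exp_of_real)
    show "g w * cnj (h w) * K (of_real t) (of_real (exp t) * w) = G (of_real (exp t) * w)"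
      unfolding G_def e1 e2 by (simp only: mult_ac)
  qed simp
  also have "\<dots> = cmean G (exp t * exp (- t / 2))" unfolding cmean_def by (simp add: mult.assoc)
  also have "exp t * exp (- t / 2) = exp (t / 2)" by (simp add: exp_add[symmetric])
  also have "cmean G (exp (t / 2)) = cmean G 1"
  proof (rule cmean_const[where ?r1.0 = "a * exp t" and ?r2.0 = "1 / a"])
    let ?A = "{w::complex. a * exp t < norm w \<and> norm w < 1 / a}"
    have a': "a < norm w" if "w \<in> ?A" for w
    proof -
      have "a * 1 \<le> a * exp t" using a t by (intro mult_left_mono) auto
      thus ?thesis using that by simp
    qed
    have e': "a < norm (exp (- of_real t) * w)" if "w \<in> ?A" for w
    proof -
      have "norm (exp (- of_real t :: complex)) = exp (- t)" by simp
      hence "norm (exp (- of_real t) * w) = norm w / exp t" by (simp add: norm_mult exp_minus divide_inverse mult.commute)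
      thus ?thesis using that by (simp add: pos_less_divide_eq)
    qed
    have tb: "of_real t \<in> ball (0::complex) x1" using t x by simp
    have "(\<lambda>\<sigma>. g (exp (- of_real t) * \<sigma>)) holomorphic_on ?A"
      by (rule hol_comp[OF g]) (use e' in \<open>auto intro!: holomorphic_intros\<close>)
    moreover have "K (of_real t) holomorphic_on ?A"
      by (rule holomorphic_on_subset[OF hols[OF tb]]) (use a' in auto)
    moreover have "(\<lambda>\<sigma>. cnj (h (cnj (1 / \<sigma>)))) holomorphic_on ?A"
    proof (rule holomorphic_reflected[OF h open_annulus])
      show "0 \<notin> ?A" using a by (auto simp: not_less)
      show "a < 1 / norm w" if "w \<in> ?A" for w
      proof -
        have "0 < norm w" using a'[OF that] a by linarith
        thus ?thesis using that a by (simp add: pos_less_divide_eq mult.commute)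
      qed
    qed
    ultimately show "G holomorphic_on ?A" unfolding G_def by (intro holomorphic_intros)
    show "exp (t / 2) < 1 / a"
    proof -
      have "exp (t / 2) \<le> exp t" using t by simp
      also have "exp t < 1 / a" using et a by (simp add: pos_less_divide_eq mult.commute)
      finally show ?thesis .
    qed
    show "a * exp t < exp (t / 2)" using et t by (auto intro: less_le_trans)
  qed (use a et in auto)
  also have "cmean G 1 = cmean (\<lambda>\<sigma>. g (exp (- of_real t) * \<sigma>) * K (of_real t) \<sigma> * cnj (h \<sigma>)) 1"
  proof (rule cmean_cong)
    fix w :: complex assume "norm w = 1"
    from recip[OF this] have "cnj (1 / w) = w" by simp
    thus "G w = g (exp (- of_real t) * w) * K (of_real t) w * cnj (h w)" unfolding G_def by simp
  qed simp
  finally show ?thesis .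
qed

lemma gK_cont:
  assumes g: "g holomorphic_on ex a"
  shows "continuous_on ({0..x0} \<times> sphere 0 1) (\<lambda>(t, \<sigma>). g (exp (- of_real t) * \<sigma>) * K (of_real t) \<sigma>)"
proof -
  have E: "a < norm (exp (- of_real t) * \<sigma>)" if "t \<in> {0..x0}" "norm \<sigma> = 1" for t and \<sigma> :: complex
    using norm_exp_minus_mult_ge[of "of_real t" x2 \<sigma>] that x by auto
  have "continuous_on ({0..x0} \<times> sphere 0 1) (\<lambda>p. g (exp (- of_real (fst p)) * snd p))"
    by (rule continuous_on_compose2[OF holomorphic_on_imp_continuous_on[OF g]])
       (use E in \<open>auto intro!: continuous_intros\<close>)
  moreover have "continuous_on ({0..x0} \<times> sphere 0 1) (\<lambda>p. (\<lambda>(x, \<sigma>). K x \<sigma>) (of_real (fst p), snd p))"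
    by (rule continuous_on_compose2[OF cont]) (use x a in \<open>auto intro!: continuous_intros\<close>)
  ultimately show ?thesis unfolding split_def by (auto intro!: continuous_intros)
qed

lemma laplace_cont:
  assumes g: "g holomorphic_on ex a"
  shows "continuous_on (sphere 0 1) (\<lambda>\<sigma>. laplace N x0 (\<lambda>x. g (exp (- x) * \<sigma>) * K x \<sigma>))"
proof -
  have "continuous_on (sphere 0 1 \<times> cbox 0 x0) (\<lambda>q. (\<lambda>(t, \<sigma>). g (exp (- of_real t) * \<sigma>) * K (of_real t) \<sigma>) (snd q, fst q))"
    by (rule continuous_on_compose2[OF gK_cont[OF g]]) (auto intro!: continuous_intros)
  hence "continuous_on (sphere 0 1 \<times> cbox 0 x0) (\<lambda>(\<sigma>, t). of_real (exp (- (real N * t))) * (g (exp (- of_real t) * \<sigma>) * K (of_real t) \<sigma>))"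
    unfolding split_def by (auto intro!: continuous_intros)
  from integral_continuous_on_param[OF this] show ?thesis unfolding laplace_def by simp
qed

text \<open>After the shift all means are taken over the same circle, so the integrals can be
  exchanged and the x-integral becomes a Laplace integral for each fixed \<sigma>.\<close>

lemma area_pairing:
  assumes g: "g holomorphic_on ex a" and h: "h holomorphic_on ex a"
    and F: "continuous_on A F" "\<And>w. r3 < norm w \<Longrightarrow> norm w < 1 \<Longrightarrow> F (\<psi> w) = w ^ N * v w * g w"
    and H: "continuous_on A H" "\<And>w. r3 < norm w \<Longrightarrow> norm w < 1 \<Longrightarrow> H (\<psi> w) = w ^ N * v w * h w"
  shows "(LINT z:A|dA. F z * cnj (H z) * of_real (\<omega> z)) =
    cmean (\<lambda>\<sigma>. laplace N x0 (\<lambda>x. g (exp (- x) * \<sigma>) * K x \<sigma>) * cnj (h \<sigma>)) 1"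
proof -
  let ?G = "\<lambda>t \<sigma>. g (exp (- of_real t) * \<sigma>) * K (of_real t) \<sigma>"
  let ?E = "\<lambda>t::real. of_real (exp (- (real N * t))) :: complex"
  have "(LINT z:A|dA. F z * cnj (H z) * of_real (\<omega> z)) =
    integral {0..x0} (\<lambda>t. ?E t * cmean (\<lambda>w. g w * cnj (h w) * K (of_real t) (of_real (exp t) * w)) (exp (- t / 2)))"
    by (rule area_pairing_radial[OF assms])
  also have "\<dots> = integral {0..x0} (\<lambda>t. ?E t * cmean (\<lambda>\<sigma>. ?G t \<sigma> * cnj (h \<sigma>)) 1)"
    by (intro integral_cong arg_cong2[of _ _ _ _ "(*)"] refl shift_to_unit_circle g h) auto
  also have "\<dots> = integral {0..x0} (\<lambda>t. integral {0..2*pi} (\<lambda>\<theta>. ?E t * ?G t (cis \<theta>) * cnj (h (cis \<theta>)))) / of_real (2*pi)"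
    unfolding cmean_def integral_divide[symmetric] by (simp add: mult.assoc)
  also have "integral {0..x0} (\<lambda>t. integral {0..2*pi} (\<lambda>\<theta>. ?E t * ?G t (cis \<theta>) * cnj (h (cis \<theta>)))) =
      integral {0..2*pi} (\<lambda>\<theta>. integral {0..x0} (\<lambda>t. ?E t * ?G t (cis \<theta>) * cnj (h (cis \<theta>))))"
  proof -
    have "continuous_on (cbox (0, 0) (x0, 2*pi)) (\<lambda>p. (\<lambda>(t, \<sigma>). ?G t \<sigma>) (fst p, cis (snd p)))"
      by (rule continuous_on_compose2[OF gK_cont[OF g]]) (auto intro!: continuous_intros simp: cbox_Pair_eq)
    moreover have "continuous_on (cbox (0, 0) (x0, 2*pi)) (\<lambda>p. h (cis (snd p)))"
      by (rule continuous_on_compose2[OF holomorphic_on_imp_continuous_on[OF h]]) (use a in \<open>auto intro!: continuous_intros\<close>)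
    ultimately have "continuous_on (cbox (0, 0) (x0, 2*pi)) (\<lambda>(t, \<theta>). ?E t * ?G t (cis \<theta>) * cnj (h (cis \<theta>)))"
      unfolding split_def by (auto intro!: continuous_intros)
    from integral_swap_continuous[OF this] show ?thesis by simp
  qed
  also have "\<dots> / of_real (2*pi) = cmean (\<lambda>\<sigma>. laplace N x0 (\<lambda>x. g (exp (- x) * \<sigma>) * K x \<sigma>) * cnj (h \<sigma>)) 1"
    unfolding cmean_def laplace_def integral_mult_left by (simp add: mult.assoc)
  finally show ?thesis .
qed

end

section \<open>The weighted Hilbert space\<close>


lemma Re_cmean:
  assumes "0 \<le> r" "continuous_on (sphere 0 r) f"
  shows "Re (cmean f r) = integral {0..2*pi} (\<lambda>\<theta>. Re (f (of_real r * cis \<theta>))) / (2*pi)"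
proof -
  have "integral {0..2*pi} (\<lambda>\<theta>. Re (f (of_real r * cis \<theta>))) = Re (integral {0..2*pi} (\<lambda>\<theta>. f (of_real r * cis \<theta>)))"
    using integral_linear[OF integrable_circle_param[OF assms] bounded_linear_Re] by (simp add: o_def)
  moreover have "Re (z / of_real (2*pi)) = Re z / (2*pi)" for z by (simp only: Re_divide_of_real)
  ultimately show ?thesis unfolding cmean_def by simp
qed

context op_setup
begin

text \<open>The conditions concern \<open>D\<close> alone, because the approximations have no
  meaning far from it or deep inside unless cut off. As \<open>D\<close> and \<omega> are bounded,
  they suffice for all the integrals.\<close>

definition nice :: "(complex \<Rightarrow> complex) \<Rightarrow> bool" where
  "nice f \<longleftrightarrow> (\<lambda>z. indicator D z *\<^sub>R f z) \<in> borel_measurable borel \<and> bounded (f ` D)"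

definition nn :: "(complex \<Rightarrow> complex) \<Rightarrow> real" where
  "nn f = (LINT z:D|dA. (norm (f z))\<^sup>2 * \<omega> z)"

abbreviation ip :: "(complex \<Rightarrow> complex) \<Rightarrow> (complex \<Rightarrow> complex) \<Rightarrow> complex" where
  "ip f g \<equiv> weighted_inner D \<omega> f g"

lemma bounded_measurable_integrable:
  fixes f :: "complex \<Rightarrow> 'a::{banach,second_countable_topology}"
  assumes m: "(\<lambda>z. indicator D z *\<^sub>R f z) \<in> borel_measurable borel" and B: "\<And>z. z \<in> D \<Longrightarrow> norm (f z) \<le> B"
  shows "set_integrable dA D f"
  unfolding set_integrable_dA_iff[OF m]
  unfolding set_integrable_def
proof (rule integrableI_bounded_set[where A = D and B = B])
  show "emeasure lborel D < \<infinity>" using emeasure_bounded_finite[OF D(2)] by simp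
qed (use D m B in auto)

lemma \<omega>_meas: "(\<lambda>z. indicator D z *\<^sub>R \<omega> z) \<in> borel_measurable borel"
  using D by (intro borel_measurable_continuous_on_indicator \<omega>cont) auto

lemma niceD1: "nice f \<Longrightarrow> (\<lambda>z. indicator D z *\<^sub>R f z) \<in> borel_measurable borel"
  unfolding nice_def by (rule conjunct1)

lemma niceD:
  assumes "nice f"
  obtains B where "B > 0" "\<And>z. z \<in> D \<Longrightarrow> norm (f z) \<le> B"
  using assms unfolding nice_def bounded_pos by blast

lemma nice_nn_integrable: assumes f: "nice f" shows "set_integrable dA D (\<lambda>z. (norm (f z))\<^sup>2 * \<omega> z)"
proof -
  obtain B where B: "B > 0" "\<And>z. z \<in> D \<Longrightarrow> norm (f z) \<le> B" by (rule niceD[OF f]) blast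
  obtain W where W: "W > 0" "\<And>z. z \<in> D \<Longrightarrow> \<omega> z \<le> W" by (rule \<omega>_upper) blast
  show ?thesis
  proof (rule bounded_measurable_integrable[where B = "B\<^sup>2 * W"])
    have "(\<lambda>z. (norm (indicator D z *\<^sub>R f z))\<^sup>2 * (indicator D z *\<^sub>R \<omega> z)) \<in> borel_measurable borel"
    proof (intro borel_measurable_times borel_measurable_power \<omega>_meas)
      have "cmod \<in> borel_measurable borel" by (intro borel_measurable_continuous_onI continuous_intros)
      from measurable_compose[OF niceD1[OF f] this]
      show "(\<lambda>z. norm (indicator D z *\<^sub>R f z)) \<in> borel_measurable borel" .
    qed
    moreover have "(\<lambda>z. (norm (indicator D z *\<^sub>R f z))\<^sup>2 * (indicator D z *\<^sub>R \<omega> z)) = (\<lambda>z. indicator D z *\<^sub>R ((norm (f z))\<^sup>2 * \<omega> z))"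
      by (auto simp: indicator_def)
    ultimately show "(\<lambda>z. indicator D z *\<^sub>R ((norm (f z))\<^sup>2 * \<omega> z)) \<in> borel_measurable borel" by simp
    show "norm ((norm (f z))\<^sup>2 * \<omega> z) \<le> B\<^sup>2 * W" if "z \<in> D" for z
      using B(2)[OF that] W(2)[OF that] \<omega>nn[OF that] B(1) W(1)
      by (auto simp: abs_mult intro!: mult_mono power_mono)
  qed
qed

lemma nice_ip_integrable: assumes f: "nice f" and g: "nice g" shows "set_integrable dA D (\<lambda>z. f z * cnj (g z) * of_real (\<omega> z))"
proof -
  obtain B where B: "B > 0" "\<And>z. z \<in> D \<Longrightarrow> norm (f z) \<le> B" by (rule niceD[OF f]) blast
  obtain B' where B': "B' > 0" "\<And>z. z \<in> D \<Longrightarrow> norm (g z) \<le> B'" by (rule niceD[OF g]) blast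
  obtain W where W: "W > 0" "\<And>z. z \<in> D \<Longrightarrow> \<omega> z \<le> W" by (rule \<omega>_upper) blast
  show ?thesis
  proof (rule bounded_measurable_integrable[where B = "B * B' * W"])
    have "(\<lambda>z. (indicator D z *\<^sub>R f z) * cnj (indicator D z *\<^sub>R g z) * of_real (indicator D z *\<^sub>R \<omega> z)) \<in> borel_measurable borel"
    proof (intro borel_measurable_times niceD1[OF f])
      have "cnj \<in> borel_measurable borel" "complex_of_real \<in> borel_measurable borel"
        by (intro borel_measurable_continuous_onI continuous_intros)+
      from measurable_compose[OF niceD1[OF g] this(1)] measurable_compose[OF \<omega>_meas this(2)]
      show "(\<lambda>z. cnj (indicator D z *\<^sub>R g z)) \<in> borel_measurable borel"
        "(\<lambda>z. complex_of_real (indicator D z *\<^sub>R \<omega> z)) \<in> borel_measurable borel" .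
    qed
    moreover have "(\<lambda>z. (indicator D z *\<^sub>R f z) * cnj (indicator D z *\<^sub>R g z) * of_real (indicator D z *\<^sub>R \<omega> z)) =
        (\<lambda>z. indicator D z *\<^sub>R (f z * cnj (g z) * of_real (\<omega> z)))"
      by (auto simp: indicator_def)
    ultimately show "(\<lambda>z. indicator D z *\<^sub>R (f z * cnj (g z) * of_real (\<omega> z))) \<in> borel_measurable borel" by simp
    show "norm (f z * cnj (g z) * of_real (\<omega> z)) \<le> B * B' * W" if "z \<in> D" for z
      using B(2)[OF that] B'(2)[OF that] W(2)[OF that] \<omega>nn[OF that] B(1) W(1) B'(1)
      by (auto simp: norm_mult intro!: mult_mono)
  qed
qed

lemma nice_continuous: assumes "continuous_on UNIV f" shows "nice f"
  unfolding nice_def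
proof
  show "(\<lambda>z. indicator D z *\<^sub>R f z) \<in> borel_measurable borel"
    using D by (intro borel_measurable_continuous_on_indicator continuous_on_subset[OF assms]) auto
  have "compact (closure D)" using D(2) by simp
  hence "bounded (f ` closure D)" by (intro compact_imp_bounded compact_continuous_image continuous_on_subset[OF assms]) auto
  thus "bounded (f ` D)" by (rule bounded_subset) (use closure_subset in blast)
qed

lemma nice_poly: "nice (poly q)" by (intro nice_continuous continuous_intros)

lemma nice_add: assumes "nice f" "nice g" shows "nice (\<lambda>z. f z + g z)"
  unfolding nice_def
proof
  show "(\<lambda>z. indicator D z *\<^sub>R (f z + g z)) \<in> borel_measurable borel"
    using assms unfolding nice_def scaleR_add_right by (intro borel_measurable_add) auto
  obtain B where B: "\<And>z. z \<in> D \<Longrightarrow> norm (f z) \<le> B" using niceD[OF assms(1)] by blast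
  obtain B' where B': "\<And>z. z \<in> D \<Longrightarrow> norm (g z) \<le> B'" using niceD[OF assms(2)] by blast
  show "bounded ((\<lambda>z. f z + g z) ` D)" unfolding bounded_iff
    by (intro exI[of _ "B + B'"]) (auto intro!: norm_triangle_le add_mono B B')
qed

lemma nice_scale: assumes "nice f" shows "nice (\<lambda>z. k * f z)"
  unfolding nice_def
proof
  have "(\<lambda>z. k * (indicator D z *\<^sub>R f z)) \<in> borel_measurable borel"
    using assms unfolding nice_def by (intro borel_measurable_times) auto
  thus "(\<lambda>z. indicator D z *\<^sub>R (k * f z)) \<in> borel_measurable borel" by simp
  obtain B where B: "\<And>z. z \<in> D \<Longrightarrow> norm (f z) \<le> B" using niceD[OF assms(1)] by blast
  show "bounded ((\<lambda>z. k * f z) ` D)" unfolding bounded_iff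
    by (intro exI[of _ "norm k * B"]) (auto simp: norm_mult intro!: mult_left_mono B)
qed

lemma ip_add_left:
  assumes "nice f" "nice g" "nice h"
  shows "ip (\<lambda>z. f z + g z) h = ip f h + ip g h"
  using set_integral_add(2)[OF nice_ip_integrable[OF assms(1,3)] nice_ip_integrable[OF assms(2,3)]]
  unfolding weighted_inner_def by (simp only: distrib_right)

lemma ip_add_right:
  assumes "nice f" "nice g" "nice h"
  shows "ip h (\<lambda>z. f z + g z) = ip h f + ip h g"
  using set_integral_add(2)[OF nice_ip_integrable[OF assms(3,1)] nice_ip_integrable[OF assms(3,2)]]
  unfolding weighted_inner_def by (simp only: distrib_right distrib_left complex_cnj_add)

lemma ip_scale_left: "ip (\<lambda>z. k * f z) h = k * ip f h"
proof -
  have "(\<lambda>z. k * f z * cnj (h z) * of_real (\<omega> z)) = (\<lambda>z. k * (f z * cnj (h z) * of_real (\<omega> z)))" by (simp add: mult_ac)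
  thus ?thesis unfolding weighted_inner_def by simp
qed

lemma ip_self: "ip f f = of_real (nn f)"
proof -
  have "f z * cnj (f z) * of_real (\<omega> z) = of_real ((norm (f z))\<^sup>2 * \<omega> z)" for z
    using complex_norm_square[of "f z"] by simp
  thus ?thesis unfolding weighted_inner_def nn_def by (simp only: set_integral_complex_of_real)
qed

lemma space_dA: "sets dA = sets borel" "space dA = UNIV" by (auto simp: dA_def)

lemma nn_nonneg: "nn f \<ge> 0"
  unfolding nn_def set_lebesgue_integral_def
  by (intro Bochner_Integration.integral_nonneg) (auto simp: indicator_def \<omega>nn)

lemma ip_cnj:
  assumes "nice f" "nice g"
  shows "ip g f = cnj (ip f g)"
proof -
  have "integrable dA (\<lambda>z. indicator D z *\<^sub>R (f z * cnj (g z) * of_real (\<omega> z)))"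
    using nice_ip_integrable[OF assms] unfolding set_integrable_def .
  from integral_bounded_linear[OF bounded_linear_cnj this]
  have "cnj (ip f g) = (LINT z:D|dA. cnj (f z * cnj (g z) * of_real (\<omega> z)))"
    unfolding weighted_inner_def set_lebesgue_integral_def by (simp only: complex_cnj_scaleR)
  thus ?thesis unfolding weighted_inner_def by (simp add: mult_ac)
qed

text \<open>From E t \<le> E^2 + t^2 / 4. The weight 1 / 4 is chosen for \<open>absorb_half\<close>,
  where two such terms still leave half of the norm to solve for.\<close>

lemma ip_bound:
  assumes f: "nice f" "\<And>z. z \<in> D \<Longrightarrow> norm (f z) \<le> E" and g: "nice g" and E: "E \<ge> 0"
  shows "norm (ip f g) \<le> E\<^sup>2 * nn (\<lambda>_. 1) + nn g / 4"
proof -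
  have i1: "set_integrable dA D (\<lambda>z. E\<^sup>2 * ((norm (1::complex))\<^sup>2 * \<omega> z))"
    by (intro set_integrable_mult_right nice_nn_integrable nice_continuous continuous_intros)
  have i2: "set_integrable dA D (\<lambda>z. (1/4) * ((norm (g z))\<^sup>2 * \<omega> z))"
    by (intro set_integrable_mult_right nice_nn_integrable g)
  have "norm (ip f g) \<le> (LINT z:D|dA. norm (f z * cnj (g z) * of_real (\<omega> z)))"
    unfolding weighted_inner_def by (rule set_integral_norm_bound[OF nice_ip_integrable[OF f(1) g]])
  also have "\<dots> \<le> (LINT z:D|dA. E\<^sup>2 * ((norm (1::complex))\<^sup>2 * \<omega> z) + (1/4) * ((norm (g z))\<^sup>2 * \<omega> z))"
  proof (rule set_integral_mono)
    show "set_integrable dA D (\<lambda>z. norm (f z * cnj (g z) * of_real (\<omega> z)))"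
      by (rule set_integrable_norm[OF nice_ip_integrable[OF f(1) g]])
    fix z assume z: "z \<in> D"
    have "norm (f z) * norm (g z) \<le> E * norm (g z)" using f(2)[OF z] by (intro mult_right_mono) auto
    also have "\<dots> \<le> E\<^sup>2 + (norm (g z))\<^sup>2 / 4"
      using zero_le_power2[of "E - norm (g z) / 2"] by (simp add: power2_diff power_divide)
    finally have "norm (f z) * norm (g z) * \<omega> z \<le> (E\<^sup>2 + (norm (g z))\<^sup>2 / 4) * \<omega> z"
      using \<omega>nn[OF z] by (intro mult_right_mono)
    thus "norm (f z * cnj (g z) * of_real (\<omega> z)) \<le> E\<^sup>2 * ((norm (1::complex))\<^sup>2 * \<omega> z) + (1/4) * ((norm (g z))\<^sup>2 * \<omega> z)"
      using \<omega>nn[OF z] by (simp add: norm_mult algebra_simps)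
  qed (intro set_integral_add i1 i2)
  also have "\<dots> = (LINT z:D|dA. E\<^sup>2 * ((norm (1::complex))\<^sup>2 * \<omega> z)) + (LINT z:D|dA. (1/4) * ((norm (g z))\<^sup>2 * \<omega> z))"
    by (rule set_integral_add(2)[OF i1 i2])
  also have "\<dots> = E\<^sup>2 * nn (\<lambda>_. 1) + nn g / 4" unfolding nn_def by simp
  finally show ?thesis .
qed

text \<open>This is \<open>K\<close> at its real points, in a form in which positivity is
  visible.\<close>

definition \<kappa> :: "complex \<Rightarrow> real" where "\<kappa> w = (norm w)\<^sup>2 * \<omega> (\<psi> w) * exp (2 * Re (V (\<psi> w)))"

lemma \<kappa>_cont: "continuous_on cann \<kappa>"
  unfolding \<kappa>_def using r3
  by (intro continuous_intros \<Omega>_cont continuous_on_subset[OF holomorphic_on_imp_continuous_on[OF V\<psi>hol]]) auto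

lemma K_\<kappa>: assumes "0 \<le> t" "t \<le> x0" "norm w = exp (- t / 2)" shows "K (of_real t) (of_real (exp t) * w) = of_real (\<kappa> w)"
proof -
  have "w \<in> cann" using assms by simp
  hence "a < norm w" using r3 by auto
  hence "K (of_real t) (of_real (exp t) * w) = of_real (exp (- t) * \<omega> (\<psi> w) * exp (2 * Re (V (\<psi> w))))"
    using assms x by (intro K\<omega>) auto
  moreover have "(norm w)\<^sup>2 = exp (- t)" unfolding assms(3) by (simp add: exp_double[symmetric])
  ultimately show ?thesis by (simp add: \<kappa>_def)
qed

lemma \<kappa>_lower: obtains k0 where "k0 > 0" "\<And>w. w \<in> cann \<Longrightarrow> k0 \<le> \<kappa> w"
proof -
  have "cann \<noteq> {}" using r3 by (auto intro!: exI[of _ 1])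
  then obtain u where u: "u \<in> cann" "\<And>w. w \<in> cann \<Longrightarrow> \<kappa> u \<le> \<kappa> w"
    using continuous_attains_inf[OF compact_cann _ \<kappa>_cont] by blast
  moreover obtain w0 where w0: "w0 > 0" "\<And>w. w \<in> cann \<Longrightarrow> w0 \<le> \<omega> (\<psi> w)" by (rule \<Omega>_lower) blast
  have "norm u > 0" using u(1) r3 by auto
  hence "\<kappa> u > 0" unfolding \<kappa>_def using w0(2)[OF u(1)] w0(1) by (intro mult_pos_pos) auto
  ultimately show ?thesis using that by blast
qed

text \<open>Cauchy's formula for the square of \<open>h = hq N q\<close> on circles of radius \<open>exp (- t / 2)\<close>, averaged over
  an interval of \<open>t\<close> of length comparable to \<open>1 / N\<close>.\<close>

lemma pointwise_bound:
  obtains C where "C > 0" "\<And>N q y w0. N \<ge> 1 \<Longrightarrow> degree q < N \<Longrightarrow> 0 \<le> y \<Longrightarrow> y \<le> x0 / 2 \<Longrightarrow> exp (- y / 2) \<le> norm w0 \<Longrightarrow>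
     (norm (hq N q w0))\<^sup>2 \<le> C * (real N)\<^sup>2 * exp (real N * y) * nn (poly q)"
proof -
  obtain k0 where k0: "k0 > 0" "\<And>w. w \<in> cann \<Longrightarrow> k0 \<le> \<kappa> w" by (rule \<kappa>_lower) blast
  define C where "C = 32 * exp (x0 / 2) / (k0 * x0\<^sup>2)"
  show ?thesis
  proof (rule that[of C])
    show "C > 0" using k0 x by (simp add: C_def)
    fix N :: nat and q :: "complex poly" and y :: real and w0 :: complex
    assume N: "N \<ge> 1" and q: "degree q < N" and y: "0 \<le> y" "y \<le> x0 / 2" and w0: "exp (- y / 2) \<le> norm w0"
    define h where "h = hq N q"
    have hh: "h holomorphic_on ex a" unfolding h_def by (rule hq_hol)
    have hc: "continuous_on (ex a) h" by (rule holomorphic_on_imp_continuous_on[OF hh])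
    have hlim: "(h \<longlongrightarrow> 0) at_infinity"
      using hq_lim[of q N] q by (simp add: h_def coeff_eq_0)
    have qh: "poly q (\<psi> w) = w ^ N * v w * h w" if "r3 < norm w" "norm w < 1" for w
      using that v_nz[of w] ex_nz[of w] r3 by (simp add: h_def hq_def)
    define M where "M t = Re (cmean (\<lambda>w. h w * cnj (h w) * of_real (\<kappa> w)) (exp (- t / 2)))" for t
    have hk: "continuous_on cann (\<lambda>w. h w * cnj (h w) * of_real (\<kappa> w))"
      using r3 by (intro continuous_intros \<kappa>_cont continuous_on_subset[OF hc]) auto
    have Mc: "continuous_on {0..x0} M"
    proof -
      have "continuous_on {r3..1} (cmean (\<lambda>w. h w * cnj (h w) * of_real (\<kappa> w)))"
        by (rule continuous_on_mean_radius) (use hk r3 in \<open>auto intro: order_trans[OF exp_ge_zero]\<close>)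
      thus ?thesis unfolding M_def
        by (intro continuous_intros continuous_on_compose2[of "{r3..1}" _ "{0..x0}" "\<lambda>t. exp (- t / 2)"]) auto
    qed
    have Mint: "M t = integral {0..2*pi} (\<lambda>\<theta>. (norm (h (of_real (exp (- t / 2)) * cis \<theta>)))\<^sup>2 * \<kappa> (of_real (exp (- t / 2)) * cis \<theta>)) / (2*pi)"
      if t: "t \<in> {0..x0}" for t
    proof -
      have "continuous_on (sphere 0 (exp (- t / 2))) (\<lambda>w. h w * cnj (h w) * of_real (\<kappa> w))"
        by (rule continuous_on_subset[OF hk]) (use t in auto)
      from Re_cmean[OF _ this] have "M t = integral {0..2*pi} (\<lambda>\<theta>. Re (h (of_real (exp (- t / 2)) * cis \<theta>) * cnj (h (of_real (exp (- t / 2)) * cis \<theta>)) * of_real (\<kappa> (of_real (exp (- t / 2)) * cis \<theta>)))) / (2*pi)"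
        unfolding M_def by simp
      moreover have "Re (z * cnj z * of_real s) = (norm z)\<^sup>2 * s" for z s
        using complex_norm_square[of z] by (metis Re_complex_of_real of_real_mult)
      ultimately show ?thesis by (simp only:)
    qed
    have M0: "0 \<le> M t" if t: "t \<in> {0..x0}" for t
    proof -
      have "0 \<le> \<kappa> (of_real (exp (- t / 2)) * cis \<theta>)" for \<theta>
        using k0(1) k0(2)[of "of_real (exp (- t / 2)) * cis \<theta>"] t by (auto simp: norm_mult intro: order_trans[OF less_imp_le])
      moreover have "(\<lambda>\<theta>. (norm (h (of_real (exp (- t / 2)) * cis \<theta>)))\<^sup>2 * \<kappa> (of_real (exp (- t / 2)) * cis \<theta>)) integrable_on {0..2*pi}"
      proof (rule integrable_circle_param[of _ "\<lambda>w. (norm (h w))\<^sup>2 * \<kappa> w"])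
        show "continuous_on (sphere 0 (exp (- t / 2))) (\<lambda>w. (norm (h w))\<^sup>2 * \<kappa> w)"
          by (rule continuous_on_subset[of cann], intro continuous_intros \<kappa>_cont continuous_on_subset[OF hc]) (use t r3 in auto)
      qed simp
      ultimately show ?thesis unfolding Mint[OF t]
        by (intro divide_nonneg_nonneg Henstock_Kurzweil_Integration.integral_nonneg) auto
    qed
    have Mlow: "(norm (h w0))\<^sup>2 * k0 * (t - y) / 2 \<le> M t" if t: "y < t" "t \<le> x0" for t
    proof -
      define r where "r = exp (- t / 2)"
      have tI: "t \<in> {0..x0}" using t y by simp
      have r: "a < r" "r < norm w0" "0 < r" "r3 \<le> r" "r \<le> 1"
      proof -
        show "r3 \<le> r" unfolding r_def using t by simp
        thus "a < r" using r3 by linarith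
        have "r < exp (- y / 2)" unfolding r_def using t by simp
        thus "r < norm w0" using w0 by linarith
        show "r \<le> 1" unfolding r_def using tI by simp
      qed (simp add: r_def)
      have hcs: "continuous_on (sphere 0 r) h" by (rule continuous_on_subset[OF hc]) (use r in auto)
      have \<kappa>cs: "continuous_on (sphere 0 r) \<kappa>" by (rule continuous_on_subset[OF \<kappa>_cont]) (use r in auto)
      \<comment> \<open>The Cauchy kernel costs 1 / (t - y). Below, t - y and the length of the
        averaging interval are both of order 1 / N, which accounts for the factor N^2 in the
        bound.\<close>
      have gap: "r * (t - y) / 2 \<le> norm w0 - r"
      proof -
        have "1 + (t - y) / 2 \<le> exp ((t - y) / 2)" by (rule exp_ge_add_one_self)
        hence "r * (1 + (t - y) / 2) \<le> r * exp ((t - y) / 2)" using r by (intro mult_left_mono) auto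
        also have "r * exp ((t - y) / 2) = exp (- y / 2)" unfolding r_def by (simp add: exp_add[symmetric] field_simps)
        finally show ?thesis using w0 by (simp add: algebra_simps)
      qed
      have "(\<lambda>w. (h w)\<^sup>2) holomorphic_on ex a" by (intro holomorphic_intros hh)
      moreover have "((\<lambda>w. (h w)\<^sup>2) \<longlongrightarrow> 0) at_infinity" using tendsto_power[OF hlim, of 2] by simp
      ultimately have "(h w0)\<^sup>2 = - cmean (\<lambda>\<zeta>. (h \<zeta>)\<^sup>2 * \<zeta> / (\<zeta> - w0)) r"
        by (rule cauchy_exterior) (use a r in auto)
      hence "(norm (h w0))\<^sup>2 = norm (cmean (\<lambda>\<zeta>. (h \<zeta>)\<^sup>2 * \<zeta> / (\<zeta> - w0)) r)" by (metis norm_minus_cancel norm_power)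
      also have "\<dots> \<le> integral {0..2*pi} (\<lambda>\<theta>. (2 / ((t - y) * k0)) * ((norm (h (of_real r * cis \<theta>)))\<^sup>2 * \<kappa> (of_real r * cis \<theta>))) / (2*pi)"
      proof (rule cmean_norm_le_mean_norm[where g = "\<lambda>w. (2 / ((t - y) * k0)) * ((norm (h w))\<^sup>2 * \<kappa> w)"])
        show "continuous_on (sphere 0 r) (\<lambda>\<zeta>. (h \<zeta>)\<^sup>2 * \<zeta> / (\<zeta> - w0))"
          using r by (intro continuous_intros hcs) auto
        show "continuous_on (sphere 0 r) (\<lambda>w. (2 / ((t - y) * k0)) * ((norm (h w))\<^sup>2 * \<kappa> w))"
          by (intro continuous_intros hcs \<kappa>cs)
        fix w :: complex assume w: "norm w = r"
        have "r * (t - y) / 2 \<le> norm (w - w0)"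
          using gap norm_triangle_ineq2[of w0 w] w by (simp add: norm_minus_commute)
        moreover have "0 < r * (t - y) / 2" using r t by simp
        ultimately have "r / norm (w - w0) \<le> r / (r * (t - y) / 2)" using r by (intro divide_left_mono mult_pos_pos) auto
        also have "\<dots> = 2 / (t - y)" using r by simp
        also have "\<dots> \<le> 2 / (t - y) * (\<kappa> w / k0)"
          using k0(1) k0(2)[of w] w r t by (simp add: divide_right_mono pos_le_divide_eq mult_le_cancel_left1)
        finally have "r / norm (w - w0) \<le> 2 / (t - y) * (\<kappa> w / k0)" .
        hence "(norm (h w))\<^sup>2 * (r / norm (w - w0)) \<le> (norm (h w))\<^sup>2 * (2 / (t - y) * (\<kappa> w / k0))"
          by (intro mult_left_mono) auto
        thus "norm ((h w)\<^sup>2 * w / (w - w0)) \<le> (2 / ((t - y) * k0)) * ((norm (h w))\<^sup>2 * \<kappa> w)"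
          using w by (simp add: norm_mult norm_divide norm_power mult_ac)
      qed (use r in auto)
      also have "\<dots> = (2 / ((t - y) * k0)) * M t"
        unfolding Mint[OF tI] r_def by simp
      finally show ?thesis using t k0 by (simp add: field_simps)
    qed
    \<comment> \<open>The interval from y + s to y + 2 s lies in [0, x0] because y is at most x0 /
      2, and on it exp (- N t) is at least exp (- N y) exp (- x0 / 2).\<close>
    define s where "s = x0 / (4 * real N)"
    have s: "0 < s" "s \<le> x0 / 4" using x N by (auto simp: s_def field_simps)
    define L where "L = exp (- (real N * y)) * exp (- (x0 / 2)) * ((norm (h w0))\<^sup>2 * k0 * s / 2)"
    have int: "(\<lambda>t. exp (- (real N * t)) * M t) integrable_on {0..x0}"
      by (intro integrable_continuous_interval continuous_intros Mc)
    have "L * s \<le> integral {y + s .. y + 2 * s} (\<lambda>t. exp (- (real N * t)) * M t)"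
    proof -
      have "integral {y + s .. y + 2 * s} (\<lambda>_. L) \<le> integral {y + s .. y + 2 * s} (\<lambda>t. exp (- (real N * t)) * M t)"
      proof (rule integral_le)
        show "(\<lambda>t. exp (- (real N * t)) * M t) integrable_on {y + s .. y + 2 * s}"
          by (rule integrable_on_subinterval[OF int]) (use y s x in auto)
        fix t assume t: "t \<in> {y + s .. y + 2 * s}"
        have "real N * t \<le> real N * y + x0 / 2"
        proof -
          have "real N * t \<le> real N * (y + 2 * s)" using t by (intro mult_left_mono) auto
          also have "\<dots> = real N * y + x0 / 2" using N by (simp add: s_def field_simps)
          finally show ?thesis .
        qed
        hence "exp (- (real N * y)) * exp (- (x0 / 2)) \<le> exp (- (real N * t))" by (simp add: exp_add[symmetric])
        moreover have "(norm (h w0))\<^sup>2 * k0 * s / 2 \<le> M t"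
        proof -
          have "(norm (h w0))\<^sup>2 * k0 * s / 2 \<le> (norm (h w0))\<^sup>2 * k0 * (t - y) / 2"
            using t k0 by (intro divide_right_mono mult_left_mono) auto
          also have "\<dots> \<le> M t" by (rule Mlow) (use t s y x in auto)
          finally show ?thesis .
        qed
        ultimately show "L \<le> exp (- (real N * t)) * M t"
          unfolding L_def using k0 s by (intro mult_mono) auto
      qed auto
      thus ?thesis using s by (simp add: mult.commute)
    qed
    also have "\<dots> \<le> integral {0..x0} (\<lambda>t. exp (- (real N * t)) * M t)"
      by (rule integral_subset_le) (use y s x M0 int in \<open>auto intro!: integrable_on_subinterval[OF int]\<close>)
    also have "\<dots> = Re (LINT z:A|dA. poly q z * cnj (poly q z) * of_real (\<omega> z))"
    proof -
      have "(LINT z:A|dA. poly q z * cnj (poly q z) * of_real (\<omega> z)) =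
        integral {0..x0} (\<lambda>t. of_real (exp (- (real N * t))) * cmean (\<lambda>w. h w * cnj (h w) * K (of_real t) (of_real (exp t) * w)) (exp (- t / 2)))"
        by (rule area_pairing_radial[OF hh hh _ qh _ qh]) (auto intro!: continuous_intros)
      also have "\<dots> = integral {0..x0} (\<lambda>t. of_real (exp (- (real N * t))) * cmean (\<lambda>w. h w * cnj (h w) * of_real (\<kappa> w)) (exp (- t / 2)))"
        by (intro integral_cong arg_cong2[of _ _ _ _ "(*)"] refl cmean_cong) (auto simp: K_\<kappa>)
      finally have 1: "(LINT z:A|dA. poly q z * cnj (poly q z) * of_real (\<omega> z)) = integral {0..x0} (\<lambda>t. of_real (exp (- (real N * t))) * cmean (\<lambda>w. h w * cnj (h w) * of_real (\<kappa> w)) (exp (- t / 2)))" .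
      have "continuous_on {r3..1} (cmean (\<lambda>w. h w * cnj (h w) * of_real (\<kappa> w)))"
        by (rule continuous_on_mean_radius) (use hk r3 in \<open>auto intro: order_trans[OF exp_ge_zero]\<close>)
      hence "continuous_on {0..x0} (\<lambda>t. of_real (exp (- (real N * t))) * cmean (\<lambda>w. h w * cnj (h w) * of_real (\<kappa> w)) (exp (- t / 2)))"
        by (intro continuous_intros continuous_on_compose2[of "{r3..1}" _ "{0..x0}" "\<lambda>t. exp (- t / 2)"]) auto
      hence "(\<lambda>t. of_real (exp (- (real N * t))) * cmean (\<lambda>w. h w * cnj (h w) * of_real (\<kappa> w)) (exp (- t / 2))) integrable_on {0..x0}"
        by (rule integrable_continuous_interval)
      from integral_linear[OF this bounded_linear_Re] show ?thesis
        unfolding 1 M_def by (simp add: o_def)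
    qed
    also have "\<dots> \<le> nn (poly q)"
    proof -
      have sub: "set_integrable dA A (\<lambda>z. (norm (poly q z))\<^sup>2 * \<omega> z)"
        by (rule set_integrable_subset[OF nice_nn_integrable[OF nice_poly]]) (use A_open A_sub space_dA in auto)
      have "poly q z * cnj (poly q z) * of_real (\<omega> z) = of_real ((norm (poly q z))\<^sup>2 * \<omega> z)" for z
        using complex_norm_square[of "poly q z"] by simp
      hence "Re (LINT z:A|dA. poly q z * cnj (poly q z) * of_real (\<omega> z)) = (LINT z:A|dA. (norm (poly q z))\<^sup>2 * \<omega> z)"
        by (simp only: set_integral_complex_of_real Re_complex_of_real)
      also have "\<dots> \<le> (LINT z:D|dA. (norm (poly q z))\<^sup>2 * \<omega> z)"
        unfolding set_lebesgue_integral_def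
        by (rule integral_mono) (use sub nice_nn_integrable[OF nice_poly] A_sub \<omega>nn in \<open>auto simp: set_integrable_def indicator_def\<close>)
      finally show ?thesis unfolding nn_def .
    qed
    finally have "L * s \<le> nn (poly q)" .
    moreover have "L * s * (C * (real N)\<^sup>2 * exp (real N * y)) = (norm (h w0))\<^sup>2"
    proof -
      have "exp (- (real N * y)) * exp (real N * y) = 1" "exp (- (x0 / 2)) * exp (x0 / 2) = 1" by (simp_all add: exp_minus)
      moreover have "L * s * (C * (real N)\<^sup>2 * exp (real N * y)) =
          (exp (- (real N * y)) * exp (real N * y)) * (exp (- (x0 / 2)) * exp (x0 / 2)) * ((norm (h w0))\<^sup>2 * k0 * s / 2 * s * (32 / (k0 * x0\<^sup>2)) * (real N)\<^sup>2)"
        unfolding L_def C_def by (simp add: field_simps)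
      moreover have "(norm (h w0))\<^sup>2 * k0 * s / 2 * s * (32 / (k0 * x0\<^sup>2)) * (real N)\<^sup>2 = (norm (h w0))\<^sup>2"
        unfolding s_def using k0 x N by (simp add: field_simps power2_eq_square)
      ultimately show ?thesis by (simp only: mult_1_left)
    qed
    moreover have "0 \<le> C * (real N)\<^sup>2 * exp (real N * y)" using k0 x by (simp add: C_def)
    ultimately show "(norm (hq N q w0))\<^sup>2 \<le> C * (real N)\<^sup>2 * exp (real N * y) * nn (poly q)"
      unfolding h_def by (metis mult.commute mult_right_mono)
  qed
qed

lemma ip_bound2:
  assumes f: "nice f" "\<And>z. z \<in> D \<Longrightarrow> norm (f z) \<le> E" and g: "nice g" "\<And>z. z \<in> D \<Longrightarrow> norm (g z) \<le> B" and E: "E \<ge> 0"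
  shows "norm (ip f g) \<le> E * B * nn (\<lambda>_. 1)"
proof -
  have "norm (ip f g) \<le> (LINT z:D|dA. norm (f z * cnj (g z) * of_real (\<omega> z)))"
    unfolding weighted_inner_def by (rule set_integral_norm_bound[OF nice_ip_integrable[OF f(1) g(1)]])
  also have "\<dots> \<le> (LINT z:D|dA. (E * B) * ((norm (1::complex))\<^sup>2 * \<omega> z))"
  proof (rule set_integral_mono)
    show "set_integrable dA D (\<lambda>z. norm (f z * cnj (g z) * of_real (\<omega> z)))"
      by (rule set_integrable_norm[OF nice_ip_integrable[OF f(1) g(1)]])
    show "set_integrable dA D (\<lambda>z. (E * B) * ((norm (1::complex))\<^sup>2 * \<omega> z))"
      by (intro set_integrable_mult_right nice_nn_integrable nice_continuous continuous_intros)
    fix z assume z: "z \<in> D"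
    have "norm (f z) * norm (g z) * \<omega> z \<le> E * B * \<omega> z"
      using f(2)[OF z] g(2)[OF z] \<omega>nn[OF z] E by (intro mult_right_mono mult_mono) auto
    thus "norm (f z * cnj (g z) * of_real (\<omega> z)) \<le> (E * B) * ((norm (1::complex))\<^sup>2 * \<omega> z)"
      using \<omega>nn[OF z] by (simp add: norm_mult)
  qed
  also have "\<dots> = E * B * nn (\<lambda>_. 1)" unfolding nn_def by simp
  finally show ?thesis .
qed

lemma nn_scale: "nn (\<lambda>z. k * f z) = (norm k)\<^sup>2 * nn f"
proof -
  have "(\<lambda>z. (norm (k * f z))\<^sup>2 * \<omega> z) = (\<lambda>z. (norm k)\<^sup>2 * ((norm (f z))\<^sup>2 * \<omega> z))"
    by (simp add: norm_mult power_mult_distrib mult_ac)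
  thus ?thesis unfolding nn_def by simp
qed

lemma exterior_bounded:
  assumes f: "f holomorphic_on ex a" and lim: "(f \<longlongrightarrow> l) at_infinity" and r: "a < r"
  obtains M where "M > 0" "\<And>w. r \<le> norm w \<Longrightarrow> norm (f w) \<le> M"
proof -
  from tendstoD[OF lim, of 1] obtain B where B: "\<And>w. norm w \<ge> B \<Longrightarrow> norm (f w - l) < 1"
    unfolding eventually_at_infinity dist_norm by auto
  let ?C = "{w::complex. r \<le> norm w \<and> norm w \<le> B}"
  have "?C = cball 0 B - ball 0 r" by auto
  hence "compact ?C" by (simp add: compact_diff)
  hence "bounded (f ` ?C)" using r
    by (intro compact_imp_bounded compact_continuous_image continuous_on_subset[OF holomorphic_on_imp_continuous_on[OF f]]) auto
  then obtain M where M: "M > 0" "\<And>w. w \<in> ?C \<Longrightarrow> norm (f w) \<le> M" unfolding bounded_pos by blast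
  show ?thesis
  proof (rule that[of "M + norm l + 1"])
    show "M + norm l + 1 > 0" using M by (simp add: add_pos_nonneg)
    fix w :: complex assume w: "r \<le> norm w"
    show "norm (f w) \<le> M + norm l + 1"
    proof (cases "norm w \<le> B")
      case True
      hence "norm (f w) \<le> M" using M(2)[of w] w by simp
      thus ?thesis using norm_ge_zero[of l] by linarith
    next
      case False
      thus ?thesis using B[of w] norm_triangle_ineq[of "f w - l" l] M(1) by simp
    qed
  qed
qed

lemma v_bounds:
  assumes r: "a < r"
  obtains M where "M > 0" "\<And>w. r \<le> norm w \<Longrightarrow> norm (v w) \<le> M" "\<And>w. r \<le> norm w \<Longrightarrow> 1 / norm (v w) \<le> M"
proof -
  obtain M1 where M1: "M1 > 0" "\<And>w. r \<le> norm w \<Longrightarrow> norm (v w) \<le> M1" by (rule exterior_bounded[OF vhol v_lim r]) blast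
  have "(\<lambda>w. 1 / v w) holomorphic_on ex a" using v_nz by (intro holomorphic_intros vhol) auto
  moreover have "((\<lambda>w. 1 / v w) \<longlongrightarrow> 1 / (exp (of_real vinf) * of_real c)) at_infinity"
    using c by (intro tendsto_intros v_lim) auto
  ultimately obtain M2 where M2: "M2 > 0" "\<And>w. r \<le> norm w \<Longrightarrow> norm (1 / v w) \<le> M2" using r by (rule exterior_bounded) blast
  show ?thesis
  proof (rule that[of "max M1 M2"])
    fix w :: complex assume w: "r \<le> norm w"
    show "norm (v w) \<le> max M1 M2" using M1(2)[OF w] by simp
    show "1 / norm (v w) \<le> max M1 M2" using M2(2)[OF w] by (simp add: norm_divide)
  qed (use M1 in auto)
qed

end

section \<open>Comparison with the orthogonal polynomials\<close>


lemma geometric_le_power: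
  assumes "0 < q" "q < (1::real)"
  obtains C where "C > 0" "\<And>N. N \<ge> 1 \<Longrightarrow> q ^ N \<le> C / real N ^ k"
proof (rule that[of "fact k / (- ln q) ^ k"])
  show "fact k / (- ln q) ^ k > 0" using assms by simp
  fix N :: nat assume N: "N \<ge> 1"
  have "q ^ N = exp (- (real N * (- ln q)))" using assms by (simp add: exp_of_nat_mult)
  also have "\<dots> \<le> (fact k / (- ln q) ^ k) / real N ^ k" using assms N by (intro exp_neg_le_power) auto
  finally show "q ^ N \<le> fact k / (- ln q) ^ k / real N ^ k" .
qed

text \<open>The unknown n occurs on the right with total weight 1 / 2 and can be moved to the
  left.\<close>

lemma absorb_half:
  fixes n s t u p q :: real
  assumes "n \<le> s + t" "s \<le> u + n / 4" "t \<le> q + n / 4" "u \<le> p"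
  shows "n \<le> 2 * (p + q)"
proof -
  have "4 * n \<le> 4 * s + 4 * t" "4 * s \<le> 4 * u + n" "4 * t \<le> 4 * q + n" "4 * u \<le> 4 * p" using assms by simp_all
  thus ?thesis unfolding distrib_left by linarith
qed

locale op_coeffs = op_setup D \<phi> V \<psi> a c vinf K x1 \<omega> x0 x2
  for D :: "complex set" and \<phi> V \<psi> :: "complex \<Rightarrow> complex" and a c vinf :: real
    and K :: "complex \<Rightarrow> complex \<Rightarrow> complex" and x1 :: real and \<omega> :: "complex \<Rightarrow> real" and x0 x2 :: real +
  fixes b R :: "nat \<Rightarrow> complex \<Rightarrow> complex" and P :: "nat \<Rightarrow> complex poly"
  assumes b0: "b 0 = (\<lambda>_. 1)" and bhol: "\<And>l. b l holomorphic_on {w. a < norm w}"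
    and blim: "\<And>l. l \<ge> 1 \<Longrightarrow> (b l \<longlongrightarrow> 0) at_infinity"
    and Rhol: "\<And>l. R l holomorphic_on ball 0 (1/a)" and R0: "\<And>\<sigma>. R 0 \<sigma> = 1"
    and bR: "\<And>l \<sigma>. \<sigma> \<in> {w. a < norm w \<and> norm w < 1/a} \<Longrightarrow> (\<Sum>i\<le>l. T i (b (l - i)) \<sigma>) = R l \<sigma>"
    and P: "normalized_orthogonal_polynomials D \<omega> P"
begin

definition gm :: "nat \<Rightarrow> nat \<Rightarrow> complex \<Rightarrow> complex" where
  "gm m N w = (\<Sum>j\<le>m. b j w / of_nat N ^ j)"

lemma gm_hol: assumes "N \<ge> 1" shows "gm m N holomorphic_on ex a"
  unfolding gm_def using assms by (intro holomorphic_intros bhol) auto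

lemma b_lim: "(b j \<longlongrightarrow> (if j = 0 then 1 else 0)) at_infinity"
  using blim[of j] by (cases "j = 0") (auto simp: b0)

lemma gm_lim: assumes "N \<ge> 1" shows "(gm m N \<longlongrightarrow> 1) at_infinity"
proof -
  have "((\<lambda>w. \<Sum>j\<le>m. b j w / of_nat N ^ j) \<longlongrightarrow> (\<Sum>j\<le>m. (if j = 0 then 1 else 0) / of_nat N ^ j)) at_infinity"
    using assms by (intro tendsto_intros b_lim) auto
  moreover have "(\<Sum>j\<le>m. (if j = 0 then 1 else 0) / of_nat N ^ j) = (1 :: complex)"
  proof -
    have "(\<Sum>j\<le>m. (if j = 0 then 1 else 0) / of_nat N ^ j) = (\<Sum>j\<le>m. if j = 0 then (1 :: complex) else 0)"
      by (rule sum.cong) auto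
    thus ?thesis by simp
  qed
  ultimately show ?thesis unfolding gm_def by simp
qed

lemma b_bounded:
  assumes r: "a < r"
  obtains M where "\<And>j. M j > 0" "\<And>j w. r \<le> norm w \<Longrightarrow> norm (b j w) \<le> M j"
proof -
  have "\<exists>M>0. \<forall>w. r \<le> norm w \<longrightarrow> norm (b j w) \<le> M" for j
    by (rule exterior_bounded[OF bhol b_lim r]) blast
  then obtain M where "\<And>j. M j > 0 \<and> (\<forall>w. r \<le> norm w \<longrightarrow> norm (b j w) \<le> M j)" by metis
  thus ?thesis using that by blast
qed

text \<open>This permits an expansion to be carried to a larger order m and then truncated at
  k.\<close>

lemma gm_diff_bound:
  assumes r: "a < r" and km: "k \<le> m"
  obtains M where "M > 0" "\<And>N w. N \<ge> 1 \<Longrightarrow> r \<le> norm w \<Longrightarrow> norm (gm m N w - gm k N w) \<le> M / real N ^ (k + 1)"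
proof -
  obtain B where B: "\<And>j. B j > 0" "\<And>j w. r \<le> norm w \<Longrightarrow> norm (b j w) \<le> B j" by (rule b_bounded[OF r]) blast
  define M where "M = (\<Sum>j\<in>{k+1..m}. B j) + 1"
  show ?thesis
  proof (rule that[of M])
    show "M > 0" unfolding M_def using B(1) by (intro add_nonneg_pos sum_nonneg less_imp_le) auto
    fix N :: nat and w :: complex assume N: "N \<ge> 1" and w: "r \<le> norm w"
    have "{..m} = {..k} \<union> {k+1..m}" using km by auto
    hence "gm m N w = gm k N w + (\<Sum>j\<in>{k+1..m}. b j w / of_nat N ^ j)"
      unfolding gm_def by (simp only:) (rule sum.union_disjoint, auto)
    hence "norm (gm m N w - gm k N w) = norm (\<Sum>j\<in>{k+1..m}. b j w / of_nat N ^ j)" by simp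
    also have "\<dots> \<le> (\<Sum>j\<in>{k+1..m}. B j / real N ^ (k + 1))"
    proof (rule sum_norm_le)
      fix j assume j: "j \<in> {k+1..m}"
      show "norm (b j w / of_nat N ^ j) \<le> B j / real N ^ (k + 1)"
        unfolding norm_divide norm_power norm_of_nat using B(1)[of j] B(2)[OF w, of j] j N
        by (intro frac_le power_increasing) auto
    qed
    also have "\<dots> = (\<Sum>j\<in>{k+1..m}. B j) / real N ^ (k + 1)" by (simp only: sum_divide_distrib)
    also have "\<dots> \<le> M / real N ^ (k + 1)" unfolding M_def by (intro divide_right_mono) auto
    finally show "norm (gm m N w - gm k N w) \<le> M / real N ^ (k + 1)" .
  qed
qed

lemma gm_bound:
  assumes r: "a < r"
  obtains M where "M > 0" "\<And>N w. N \<ge> 1 \<Longrightarrow> r \<le> norm w \<Longrightarrow> norm (gm m N w) \<le> M"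
proof -
  obtain M where M: "M > 0" "\<And>N w. N \<ge> 1 \<Longrightarrow> r \<le> norm w \<Longrightarrow> norm (gm m N w - gm 0 N w) \<le> M / real N ^ (0 + 1)"
    by (rule gm_diff_bound[OF r, of 0 m]) auto
  show ?thesis
  proof (rule that[of "M + 1"])
    fix N :: nat and w :: complex assume N: "N \<ge> 1" and w: "r \<le> norm w"
    have "gm 0 N w = 1" by (simp add: gm_def b0)
    hence "norm (gm m N w) \<le> norm (gm m N w - gm 0 N w) + 1" using norm_triangle_ineq[of "gm m N w - gm 0 N w" "gm 0 N w"] by simp
    also have "norm (gm m N w - gm 0 N w) \<le> M / real N" using M(2)[OF N w] by simp
    also have "M / real N \<le> M / 1" using N M(1) by (intro divide_left_mono) auto
    finally show "norm (gm m N w) \<le> M + 1" by simp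
  qed (use M in auto)
qed

definition Ff :: "nat \<Rightarrow> nat \<Rightarrow> complex \<Rightarrow> complex" where
  "Ff m N z = \<phi> z ^ N * v (\<phi> z) * gm m N (\<phi> z)"

text \<open>The candidate for \<pi>_N / C_N, cut off sharply to the collar. Deeper inside
  \<open>D\<close> the function \<open>Ff\<close> need not be meaningful, and Q is exponentially
  small there. The sharp cut makes the scalar product exactly the one computed in
  \<open>area_pairing\<close>.\<close>

definition GA :: "nat \<Rightarrow> nat \<Rightarrow> complex \<Rightarrow> complex" where
  "GA m N z = (if z \<in> A then Ff m N z else 0)"

lemma Ff_\<psi>: "a < norm w \<Longrightarrow> Ff m N (\<psi> w) = w ^ N * v w * gm m N w" by (simp add: Ff_def \<phi>\<psi>)

lemma Ff_cont: assumes "N \<ge> 1" shows "continuous_on A (Ff m N)"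
proof -
  have sub: "A \<subseteq> \<psi> ` ex a" unfolding A_def using r3 by auto
  have \<phi>A: "\<phi> holomorphic_on A" by (rule holomorphic_on_subset[OF \<phi>hol sub])
  have \<phi>ex: "\<phi> z \<in> ex a" if "z \<in> A" for z using that sub \<phi>\<psi> by auto
  have "(\<lambda>z. Ff m N z) holomorphic_on A" unfolding Ff_def
    by (intro holomorphic_intros \<phi>A hol_comp[OF vhol \<phi>A] hol_comp[OF gm_hol[OF assms] \<phi>A] \<phi>ex)
  thus ?thesis by (rule holomorphic_on_imp_continuous_on)
qed

lemma Ff_bound:
  obtains B where "B > 0" "\<And>N w. N \<ge> 1 \<Longrightarrow> r3 \<le> norm w \<Longrightarrow> norm w \<le> 1 \<Longrightarrow> norm (w ^ N * v w * gm m N w) \<le> B"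
proof -
  obtain M1 where M1: "M1 > 0" "\<And>w. r3 \<le> norm w \<Longrightarrow> norm (v w) \<le> M1" by (rule v_bounds[OF r3(1)]) blast
  obtain M2 where M2: "M2 > 0" "\<And>N w. N \<ge> 1 \<Longrightarrow> r3 \<le> norm w \<Longrightarrow> norm (gm m N w) \<le> M2" by (rule gm_bound[OF r3(1)]) blast
  show ?thesis
  proof (rule that[of "1 * M1 * M2"])
    fix N :: nat and w :: complex assume N: "N \<ge> 1" and w: "r3 \<le> norm w" "norm w \<le> 1"
    show "norm (w ^ N * v w * gm m N w) \<le> 1 * M1 * M2" unfolding norm_mult norm_power
      using M1 M2 N w by (intro mult_mono power_le_one) auto
  qed (use M1 M2 in auto)
qed

lemma A_\<psi>: assumes "z \<in> A" obtains w where "z = \<psi> w" "r3 < norm w" "norm w < 1" "a < norm w"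
  using assms r3 unfolding A_def by (auto intro: less_trans)

lemma GA_bound:
  obtains B where "B > 0" "\<And>N z. N \<ge> 1 \<Longrightarrow> norm (GA m N z) \<le> B"
proof -
  obtain B where B: "B > 0" "\<And>N w. N \<ge> 1 \<Longrightarrow> r3 \<le> norm w \<Longrightarrow> norm w \<le> 1 \<Longrightarrow> norm (w ^ N * v w * gm m N w) \<le> B" by (rule Ff_bound) blast
  show ?thesis
  proof (rule that[OF B(1)])
    fix N :: nat and z assume N: "N \<ge> 1"
    show "norm (GA m N z) \<le> B"
    proof (cases "z \<in> A")
      case True
      then obtain w where w: "z = \<psi> w" "r3 < norm w" "norm w < 1" "a < norm w" by (rule A_\<psi>)
      thus ?thesis using B(2)[OF N, of w] True by (simp add: GA_def Ff_\<psi>)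
    qed (use B(1) in \<open>simp add: GA_def\<close>)
  qed
qed

lemma ind_GA: "indicator D z *\<^sub>R (GA m N z * y) = indicator A z *\<^sub>R (Ff m N z * y)"
  using A_sub by (auto simp: GA_def indicator_def)

lemma GA_nice: assumes "N \<ge> 1" shows "nice (GA m N)"
  unfolding nice_def
proof
  have "(\<lambda>z. indicator A z *\<^sub>R Ff m N z) \<in> borel_measurable borel"
    using A_open by (intro borel_measurable_continuous_on_indicator Ff_cont assms) auto
  thus "(\<lambda>z. indicator D z *\<^sub>R GA m N z) \<in> borel_measurable borel" using ind_GA[of _ m N 1] by simp
  obtain B where "\<And>N z. N \<ge> 1 \<Longrightarrow> norm (GA m N z) \<le> B" by (rule GA_bound[of m]) blast
  thus "bounded (GA m N ` D)" unfolding bounded_iff using assms by blast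
qed

definition S :: "nat \<Rightarrow> nat \<Rightarrow> complex \<Rightarrow> complex" where
  "S m N \<sigma> = (\<Sum>l\<le>m. R l \<sigma> / of_nat N ^ Suc l)"

text \<open>On the unit circle the Laplace integral differs from \<open>S\<close> by O(N^(- m - 2)),
  and \<open>S\<close> pairs exactly by \<open>cmean_pairing\<close>. The case l = 0 gives near
  orthogonality to lower degrees; the case l = 1, with h the series itself, gives the norm.\<close>

lemma GA_pairing:
  obtains C where "C \<ge> 0" "\<And>N H h l E. N \<ge> 1 \<Longrightarrow> continuous_on A H \<Longrightarrow> h holomorphic_on ex a \<Longrightarrow> (h \<longlongrightarrow> l) at_infinity \<Longrightarrow>
     (\<And>w. r3 < norm w \<Longrightarrow> norm w < 1 \<Longrightarrow> H (\<psi> w) = w ^ N * v w * h w) \<Longrightarrow> (\<And>\<sigma>. norm \<sigma> = 1 \<Longrightarrow> norm (h \<sigma>) \<le> E) \<Longrightarrow>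
     norm (ip (GA m N) H - S m N 0 * cnj l) \<le> C * E / real N ^ (m + 2)"
proof -
  obtain C where C: "C \<ge> 0" "\<And>N \<sigma>. N \<ge> 1 \<Longrightarrow> norm \<sigma> = 1 \<Longrightarrow>
    norm (laplace N x0 (\<lambda>x. (\<Sum>j\<le>m. b j (exp (- x) * \<sigma>) / of_nat N ^ j) * K x \<sigma>) - (\<Sum>l\<le>m. R l \<sigma> / of_nat N ^ Suc l)) \<le> C / real N ^ (m + 2)"
    by (rule laplace_asymptotics[OF bhol bR x, of m]) blast+
  show ?thesis
  proof (rule that[OF C(1)])
    fix N :: nat and H h l E
    assume N: "N \<ge> 1" and H: "continuous_on A H" and h: "h holomorphic_on ex a" "(h \<longlongrightarrow> l) at_infinity"
      and Hh: "\<And>w. r3 < norm w \<Longrightarrow> norm w < 1 \<Longrightarrow> H (\<psi> w) = w ^ N * v w * h w" and E: "\<And>\<sigma>. norm \<sigma> = 1 \<Longrightarrow> norm (h \<sigma>) \<le> E"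
    have ghol: "gm m N holomorphic_on ex a" by (rule gm_hol[OF N])
    let ?L = "\<lambda>\<sigma>. laplace N x0 (\<lambda>x. gm m N (exp (- x) * \<sigma>) * K x \<sigma>)"
    have "ip (GA m N) H = (LINT z:A|dA. Ff m N z * cnj (H z) * of_real (\<omega> z))"
      unfolding weighted_inner_def set_lebesgue_integral_def mult.assoc ind_GA ..
    also have "\<dots> = cmean (\<lambda>\<sigma>. ?L \<sigma> * cnj (h \<sigma>)) 1"
      by (rule area_pairing[OF ghol h(1) Ff_cont[OF N] _ H Hh]) (use Ff_\<psi> r3 in auto)
    finally have 1: "ip (GA m N) H = cmean (\<lambda>\<sigma>. ?L \<sigma> * cnj (h \<sigma>)) 1" .
    have Shol: "S m N holomorphic_on ball 0 (1/a)" unfolding S_def using N by (intro holomorphic_intros Rhol) auto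
    have 2: "S m N 0 * cnj l = cmean (\<lambda>\<sigma>. S m N \<sigma> * cnj (h \<sigma>)) 1"
      by (rule cmean_pairing[OF a Shol h, symmetric])
    have hc: "continuous_on (sphere 0 1) h"
      by (rule continuous_on_subset[OF holomorphic_on_imp_continuous_on[OF h(1)]]) (use a in auto)
    have Sc: "continuous_on (sphere 0 1) (S m N)"
      by (rule continuous_on_subset[OF holomorphic_on_imp_continuous_on[OF Shol]]) (use a in auto)
    have Lc: "continuous_on (sphere 0 1) ?L" by (rule laplace_cont[OF ghol])
    have "ip (GA m N) H - S m N 0 * cnj l = cmean (\<lambda>\<sigma>. ?L \<sigma> * cnj (h \<sigma>) - S m N \<sigma> * cnj (h \<sigma>)) 1"
      unfolding 1 2 by (rule cmean_diff[symmetric]) (auto intro!: continuous_intros hc Sc Lc)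
    also have "norm \<dots> \<le> C * E / real N ^ (m + 2)"
    proof (rule cmean_bound)
      show "continuous_on (sphere 0 1) (\<lambda>\<sigma>. ?L \<sigma> * cnj (h \<sigma>) - S m N \<sigma> * cnj (h \<sigma>))"
        by (intro continuous_intros hc Sc Lc)
      fix \<sigma> :: complex assume \<sigma>: "norm \<sigma> = 1"
      have "norm (?L \<sigma> - S m N \<sigma>) \<le> C / real N ^ (m + 2)" unfolding gm_def S_def by (rule C(2)[OF N \<sigma>])
      hence "norm (?L \<sigma> - S m N \<sigma>) * norm (h \<sigma>) \<le> C / real N ^ (m + 2) * E"
        using E[OF \<sigma>] C(1) by (intro mult_mono) auto
      moreover have "norm (?L \<sigma> * cnj (h \<sigma>) - S m N \<sigma> * cnj (h \<sigma>)) = norm (?L \<sigma> - S m N \<sigma>) * norm (h \<sigma>)"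
        by (simp only: left_diff_distrib[symmetric] norm_mult complex_mod_cnj)
      ultimately show "norm (?L \<sigma> * cnj (h \<sigma>) - S m N \<sigma> * cnj (h \<sigma>)) \<le> C * E / real N ^ (m + 2)" by simp
    qed simp
    finally show "norm (ip (GA m N) H - S m N 0 * cnj l) \<le> C * E / real N ^ (m + 2)" .
  qed
qed

text \<open>Division by C_N gives the same coefficient of degree N as in Q, so that the difference
  has degree less than N.\<close>

definition ph :: "nat \<Rightarrow> complex poly" where
  "ph N = smult (of_real (1 / C_const \<phi> V N)) (monic_op P N)"

lemma lead: "0 < leading_const P N" "lead_coeff (P N) = of_real (leading_const P N)" "degree (P N) = N"
proof -
  obtain k :: real where k: "0 < k" "lead_coeff (P N) = of_real k" "degree (P N) = N"
    using P unfolding normalized_orthogonal_polynomials_def by blast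
  thus "0 < leading_const P N" "lead_coeff (P N) = of_real (leading_const P N)" "degree (P N) = N"
    by (auto simp: leading_const_def)
qed

lemma ph_eq: "ph N = smult (of_real (1 / (C_const \<phi> V N * leading_const P N))) (P N)"
  by (simp add: ph_def monic_op_def field_simps)

lemma ph_coeff: "coeff (ph N) N = of_real (1 / C_const \<phi> V N)" "degree (ph N) \<le> N"
  using lead[of N] C_const_pos[of N] by (auto simp: ph_eq)

lemma ph_orth: assumes "degree q < N" shows "ip (poly (ph N)) (poly q) = 0"
proof -
  have "ip (poly (P N)) (poly q) = 0" using P assms unfolding normalized_orthogonal_polynomials_def by blast
  moreover have "poly (ph N) = (\<lambda>z. of_real (1 / (C_const \<phi> V N * leading_const P N)) * poly (P N) z)"
    by (simp add: ph_eq fun_eq_iff)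
  ultimately show ?thesis by (simp only: ip_scale_left mult_zero_right)
qed

lemma ph_nn: "nn (poly (ph N)) = 1 / (C_const \<phi> V N * leading_const P N)\<^sup>2"
proof -
  have "ip (poly (P N)) (poly (P N)) = 1" using P unfolding normalized_orthogonal_polynomials_def by blast
  hence "nn (poly (P N)) = 1" unfolding ip_self by (metis of_real_eq_1_iff)
  moreover have "poly (ph N) = (\<lambda>z. of_real (1 / (C_const \<phi> V N * leading_const P N)) * poly (P N) z)"
    by (simp add: ph_eq fun_eq_iff)
  ultimately have "nn (poly (ph N)) = (norm (complex_of_real (1 / (C_const \<phi> V N * leading_const P N))))\<^sup>2 * 1"
    by (simp only: nn_scale)
  thus ?thesis by (simp only: norm_of_real power2_abs mult_1_right power_divide power_one)
qed

text \<open>\<open>Q\<close> is nearly orthogonal to all polynomials of lower degree, hence its distance to the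
  orthogonal polynomial with the same leading coefficient is small.\<close>

lemma main_estimate:
  assumes r: "a < r" "r < r3" "r3 < r4" "r4 < 1"
  obtains C where "C > 0" "\<And>N. N \<ge> 1 \<Longrightarrow> \<exists>Q. degree (Q - ph N) < N \<and>
     (\<forall>u. r3 \<le> norm u \<longrightarrow> norm (poly Q (\<psi> u) - u ^ N * v u * gm m N u) \<le> C * r ^ N) \<and>
     (\<forall>z. z \<notin> \<psi> ` ex r3 \<longrightarrow> norm (poly Q z) \<le> C * r4 ^ N) \<and>
     nn (poly (Q - ph N)) \<le> C / real N ^ (2 * m + 2) \<and>
     \<bar>nn (poly (ph N)) - Re (S m N 0)\<bar> \<le> C / real N ^ (m + 2)"
proof -
  obtain Mg where Mg: "Mg > 0" "\<And>N w. N \<ge> 1 \<Longrightarrow> r \<le> norm w \<Longrightarrow> norm (gm m N w) \<le> Mg" by (rule gm_bound[OF r(1)]) blast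
  obtain CF where CF: "CF \<ge> 0" "\<And>N g M. g holomorphic_on ex a \<Longrightarrow> (g \<longlongrightarrow> 1) at_infinity \<Longrightarrow>
      (\<And>w. r \<le> norm w \<Longrightarrow> norm w \<le> 1 \<Longrightarrow> norm (g w) \<le> M) \<Longrightarrow>
      \<exists>Q. degree Q \<le> N \<and> coeff Q N = of_real (1 / C_const \<phi> V N) \<and>
        (\<forall>u. r3 \<le> norm u \<longrightarrow> norm (poly Q (\<psi> u) - u ^ N * v u * g u) \<le> CF * M * r ^ N) \<and>
        (\<forall>z. z \<notin> \<psi> ` ex r3 \<longrightarrow> norm (poly Q z) \<le> CF * M * r4 ^ N)"
    by (rule faber_bounds[OF r]) blast
  obtain CL where CL: "CL \<ge> 0" "\<And>N H h l E. N \<ge> 1 \<Longrightarrow> continuous_on A H \<Longrightarrow> h holomorphic_on ex a \<Longrightarrow> (h \<longlongrightarrow> l) at_infinity \<Longrightarrow>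
     (\<And>w. r3 < norm w \<Longrightarrow> norm w < 1 \<Longrightarrow> H (\<psi> w) = w ^ N * v w * h w) \<Longrightarrow> (\<And>\<sigma>. norm \<sigma> = 1 \<Longrightarrow> norm (h \<sigma>) \<le> E) \<Longrightarrow>
     norm (ip (GA m N) H - S m N 0 * cnj l) \<le> CL * E / real N ^ (m + 2)" by (rule GA_pairing) blast
  obtain CP where CP: "CP > 0" "\<And>N q y w0. N \<ge> 1 \<Longrightarrow> degree q < N \<Longrightarrow> 0 \<le> y \<Longrightarrow> y \<le> x0 / 2 \<Longrightarrow> exp (- y / 2) \<le> norm w0 \<Longrightarrow>
     (norm (hq N q w0))\<^sup>2 \<le> CP * (real N)\<^sup>2 * exp (real N * y) * nn (poly q)" by (rule pointwise_bound) blast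
  obtain B where B: "B > 0" "\<And>N z. N \<ge> 1 \<Longrightarrow> norm (GA m N z) \<le> B" by (rule GA_bound[of m]) blast
  have r4: "0 < r4" "r4 < 1" using r r3 by linarith+
  obtain C4 where C4: "C4 > 0" "\<And>N. N \<ge> 1 \<Longrightarrow> r4 ^ N \<le> C4 / real N ^ (m + 2)" by (rule geometric_le_power[OF r4]) blast
  define W where "W = nn (\<lambda>_. 1)"
  have W: "W \<ge> 0" unfolding W_def by (rule nn_nonneg)
  define CE where "CE = CF * Mg * C4"
  have CE: "CE \<ge> 0" using CF Mg C4 by (simp add: CE_def)
  define C1 where "C1 = 2 * (CE\<^sup>2 * W + CL\<^sup>2 * CP)"
  have C1: "C1 \<ge> 0" using W CP by (simp add: C1_def)
  define C2 where "C2 = CE * (2 * B + CE) * W + CL * Mg + C1"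
  define C where "C = CF * Mg + C1 + C2 + 1"
  have C2: "C2 \<ge> 0" using CE B W CL Mg C1 by (simp add: C2_def)
  have CFM: "CF * Mg \<ge> 0" using CF Mg by simp
  have C: "C > 0" "CF * Mg \<le> C" "C1 \<le> C" "C2 \<le> C" using C1 C2 CFM by (auto simp: C_def)
  show ?thesis
  proof (rule that[OF C(1)])
    fix N :: nat assume N: "N \<ge> 1"
    have N0: "real N > 0" "real N \<ge> 1" using N by auto
    obtain Q where Q: "degree Q \<le> N" "coeff Q N = of_real (1 / C_const \<phi> V N)"
      "\<And>u. r3 \<le> norm u \<Longrightarrow> norm (poly Q (\<psi> u) - u ^ N * v u * gm m N u) \<le> CF * Mg * r ^ N"
      "\<And>z. z \<notin> \<psi> ` ex r3 \<Longrightarrow> norm (poly Q z) \<le> CF * Mg * r4 ^ N"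
      using CF(2)[OF gm_hol[OF N, of m] gm_lim[OF N, of m] Mg(2)[OF N]] by blast
    define q where "q = Q - ph N"
    have dq: "degree q < N"
    proof -
      have "degree q \<le> N" unfolding q_def using Q(1) ph_coeff(2) by (rule degree_diff_le)
      moreover have "coeff q N = 0" using Q(2) ph_coeff(1) by (simp add: q_def)
      ultimately show ?thesis using N by (metis degree_0 leading_coeff_0_iff le_neq_implies_less less_le_trans zero_less_one)
    qed
    \<comment> \<open>A common bound for the difference of Q and \<open>GA\<close> on and off the
      collar; the exponential smallness is weakened to a power of N that fits the other
      terms.\<close>
    define E where "E = CE / real N ^ (m + 2)"
    have E0: "E \<ge> 0" using CE by (simp add: E_def)
    have E1: "CF * Mg * r4 ^ N \<le> E"
      using mult_left_mono[OF C4(2)[OF N] CFM] by (simp add: E_def CE_def mult.assoc)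
    have E2: "CF * Mg * r ^ N \<le> E"
    proof -
      have "r ^ N \<le> r4 ^ N" using r a by (intro power_mono) auto
      hence "CF * Mg * r ^ N \<le> CF * Mg * r4 ^ N" using CFM by (intro mult_left_mono)
      thus ?thesis using E1 by linarith
    qed
    define F where "F z = poly Q z + (- 1) * GA m N z" for z
    have Fn: "nice F" unfolding F_def by (intro nice_add nice_poly nice_scale GA_nice N)
    have FE: "norm (F z) \<le> E" if z: "z \<in> D" for z
      using z
    proof (cases rule: D_cases)
      case (1 w)
      hence "F z = poly Q (\<psi> w) - w ^ N * v w * gm m N w" using r3 by (simp add: F_def GA_def Ff_\<psi>)
      thus ?thesis using Q(3)[of w] 1 E2 by simp
    next
      case 2
      hence "z \<notin> A" unfolding A_def by auto
      hence "F z = poly Q z" by (simp add: F_def GA_def)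
      thus ?thesis using Q(4)[OF 2] E1 by simp
    qed
    have QF: "poly Q = (\<lambda>z. F z + GA m N z)" by (simp add: F_def fun_eq_iff)
    have Qq: "poly Q = (\<lambda>z. poly q z + poly (ph N) z)" by (simp add: q_def fun_eq_iff)
    define n where "n = nn (poly q)"
    have n0: "n \<ge> 0" unfolding n_def by (rule nn_nonneg)
    have orth: "ip (poly (ph N)) (poly q) = 0" by (rule ph_orth[OF dq])
    have "of_real n = ip (poly q) (poly q)" unfolding n_def ip_self ..
    also have "\<dots> = ip (poly Q) (poly q)"
      unfolding Qq using orth by (simp add: ip_add_left nice_poly)
    also have "\<dots> = ip F (poly q) + ip (GA m N) (poly q)"
      unfolding QF by (rule ip_add_left[OF Fn GA_nice[OF N] nice_poly])
    finally have "norm (complex_of_real n) \<le> norm (ip F (poly q)) + norm (ip (GA m N) (poly q))"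
      by (simp only: norm_triangle_ineq)
    hence n1: "n \<le> norm (ip F (poly q)) + norm (ip (GA m N) (poly q))" using n0 by simp
    have n2: "norm (ip F (poly q)) \<le> E\<^sup>2 * W + n / 4"
      unfolding W_def n_def by (rule ip_bound[OF Fn FE nice_poly E0])
    \<comment> \<open>The pairing estimate needs a bound for h on the unit circle. The pointwise
      bound with y = 0 gives a multiple of N sqrt n, so one power of N is lost; the resulting
      product with sqrt n is split so that a quarter of n appears.\<close>
    have n3: "norm (ip (GA m N) (poly q)) \<le> CL\<^sup>2 * CP / real N ^ (2 * m + 2) + n / 4"
    proof -
      define h where "h = hq N q"
      define X where "X = sqrt (CP * n)"
      have hE: "norm (h \<sigma>) \<le> X * real N" if "norm \<sigma> = 1" for \<sigma>
      proof -
        have "(norm (h \<sigma>))\<^sup>2 \<le> CP * (real N)\<^sup>2 * exp (real N * 0) * n"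
          unfolding h_def n_def by (rule CP(2)[OF N dq]) (use x that in auto)
        also have "\<dots> = (X * real N)\<^sup>2" using CP(1) n0 by (simp add: X_def power_mult_distrib mult_ac)
        finally show ?thesis by (rule power2_le_imp_le) (use CP(1) n0 in \<open>simp add: X_def\<close>)
      qed
      have "norm (ip (GA m N) (poly q) - S m N 0 * cnj 0) \<le> CL * (X * real N) / real N ^ (m + 2)"
      proof (rule CL(2)[OF N _ _ _ _ hE])
        show "continuous_on A (poly q)" by (intro continuous_intros)
        show "h holomorphic_on ex a" unfolding h_def by (rule hq_hol)
        show "(h \<longlongrightarrow> 0) at_infinity" using hq_lim[of q N] dq by (simp add: h_def coeff_eq_0)
        show "poly q (\<psi> w) = w ^ N * v w * h w" if "r3 < norm w" "norm w < 1" for w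
          using that v_nz[of w] ex_nz[of w] r3 by (simp add: h_def hq_def)
      qed
      also have "CL * (X * real N) / real N ^ (m + 2) = (CL * sqrt CP / real N ^ (m + 1)) * sqrt n"
        using N0 CP by (simp add: X_def real_sqrt_mult field_simps)
      also have "\<dots> \<le> (CL * sqrt CP / real N ^ (m + 1))\<^sup>2 + (sqrt n)\<^sup>2 / 4"
        using zero_le_power2[of "CL * sqrt CP / real N ^ (m + 1) - sqrt n / 2"] by (simp add: power2_diff power_divide)
      also have "\<dots> = CL\<^sup>2 * CP / real N ^ (2 * m + 2) + n / 4"
        using CP n0 by (simp add: power_mult_distrib power_divide flip: power_mult power_add) (simp add: mult.commute)
      finally show ?thesis by simp
    qed
    have pw: "1 / real N ^ (2 * m + 4) \<le> 1 / real N ^ (2 * m + 2)" "1 / real N ^ (2 * m + 2) \<le> 1 / real N ^ (m + 2)"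
      using N0 by (intro divide_left_mono power_increasing mult_pos_pos zero_less_power; simp)+
    have E3: "E\<^sup>2 \<le> CE\<^sup>2 / real N ^ (2 * m + 2)"
    proof -
      have "E\<^sup>2 = CE\<^sup>2 * (1 / real N ^ (2 * m + 4))"
      proof -
        have "(real N ^ (m + 2))\<^sup>2 = real N ^ (2 * m + 4)" by (simp only: power_mult[symmetric] add_mult_distrib) (simp only: mult.commute, simp)
        thus ?thesis unfolding E_def power_divide by simp
      qed
      also have "\<dots> \<le> CE\<^sup>2 * (1 / real N ^ (2 * m + 2))" using pw by (intro mult_left_mono) auto
      finally show ?thesis by simp
    qed
    have n4: "n \<le> C1 / real N ^ (2 * m + 2)"
    proof -
      have "E\<^sup>2 * W \<le> CE\<^sup>2 / real N ^ (2 * m + 2) * W" using E3 W by (rule mult_right_mono)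
      hence "n \<le> 2 * (CE\<^sup>2 / real N ^ (2 * m + 2) * W + CL\<^sup>2 * CP / real N ^ (2 * m + 2))" by (rule absorb_half[OF n1 n2 n3])
      also have "\<dots> = C1 / real N ^ (2 * m + 2)" by (simp add: C1_def add_divide_distrib)
      finally show ?thesis .
    qed
    have nQ: "nn (poly Q) = nn (poly (ph N)) + n"
    proof -
      have "ip (poly q) (poly (ph N)) = 0" using ip_cnj[OF nice_poly nice_poly, of "ph N" q] orth by simp
      hence "ip (poly Q) (poly Q) = ip (poly q) (poly q) + ip (poly (ph N)) (poly (ph N))"
        unfolding Qq using orth by (simp add: ip_add_left ip_add_right nice_poly nice_add)
      hence "complex_of_real (nn (poly Q)) = of_real (n + nn (poly (ph N)))" unfolding ip_self n_def by simp
      thus ?thesis by (simp only: of_real_eq_iff)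
    qed
    have e1: "norm (ip (poly Q) (poly Q) - ip (GA m N) (GA m N)) \<le> E * (B + E) * W + E * B * W"
    proof -
      have "ip (poly Q) (poly Q) = ip F (poly Q) + ip (GA m N) (poly Q)"
        using ip_add_left[OF Fn GA_nice[OF N, of m] nice_poly, of Q] unfolding QF[symmetric] .
      moreover have "ip (GA m N) (poly Q) = ip (GA m N) F + ip (GA m N) (GA m N)"
        using ip_add_right[OF Fn GA_nice[OF N, of m] GA_nice[OF N, of m]] unfolding QF[symmetric] .
      ultimately have "ip (poly Q) (poly Q) - ip (GA m N) (GA m N) = ip F (poly Q) + ip (GA m N) F" by simp
      hence "norm (ip (poly Q) (poly Q) - ip (GA m N) (GA m N)) \<le> norm (ip F (poly Q)) + norm (ip (GA m N) F)"
        by (simp only: norm_triangle_ineq)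
      moreover have "norm (ip F (poly Q)) \<le> E * (B + E) * W" unfolding W_def
      proof (rule ip_bound2[OF Fn FE nice_poly _ E0])
        fix z assume z: "z \<in> D"
        have "poly Q z = F z + GA m N z" by (simp add: F_def)
        hence "norm (poly Q z) \<le> norm (F z) + norm (GA m N z)" by (simp only: norm_triangle_ineq)
        thus "norm (poly Q z) \<le> B + E" using FE[OF z] B(2)[OF N, of z] by linarith
      qed
      moreover have "norm (ip (GA m N) F) \<le> E * B * W"
      proof -
        have "norm (ip F (GA m N)) \<le> E * B * W" unfolding W_def
          by (rule ip_bound2[OF Fn FE GA_nice[OF N] B(2)[OF N] E0])
        thus ?thesis using ip_cnj[OF Fn GA_nice[OF N, of m]] by simp
      qed
      ultimately show ?thesis by linarith
    qed
    \<comment> \<open>Here the series is paired with itself. It tends to 1 at infinity, so the main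
      term is \<open>S m N 0\<close>.\<close>
    have e2: "norm (ip (GA m N) (GA m N) - S m N 0) \<le> CL * Mg / real N ^ (m + 2)"
    proof -
      have "ip (GA m N) (GA m N) = ip (GA m N) (Ff m N)"
      proof -
        have "indicator D z *\<^sub>R (GA m N z * cnj (GA m N z) * of_real (\<omega> z)) = indicator D z *\<^sub>R (GA m N z * cnj (Ff m N z) * of_real (\<omega> z))" for z
          by (simp add: GA_def)
        thus ?thesis unfolding weighted_inner_def set_lebesgue_integral_def by (simp only:)
      qed
      moreover have "norm (ip (GA m N) (Ff m N) - S m N 0 * cnj 1) \<le> CL * Mg / real N ^ (m + 2)"
        by (rule CL(2)[OF N Ff_cont[OF N] gm_hol[OF N] gm_lim[OF N]])
           (use Ff_\<psi> r3 r Mg(2)[OF N] in auto)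
      ultimately show ?thesis by simp
    qed
    have "\<bar>nn (poly (ph N)) - Re (S m N 0)\<bar> \<le> C2 / real N ^ (m + 2)"
    proof -
      have "\<bar>nn (poly Q) - Re (S m N 0)\<bar> = \<bar>Re (ip (poly Q) (poly Q) - S m N 0)\<bar>" unfolding ip_self by simp
      also have "\<dots> \<le> norm (ip (poly Q) (poly Q) - S m N 0)" by (rule abs_Re_le_cmod)
      also have "\<dots> \<le> norm (ip (poly Q) (poly Q) - ip (GA m N) (GA m N)) + norm (ip (GA m N) (GA m N) - S m N 0)"
        using norm_triangle_ineq[of "ip (poly Q) (poly Q) - ip (GA m N) (GA m N)" "ip (GA m N) (GA m N) - S m N 0"] by simp
      finally have "\<bar>nn (poly Q) - Re (S m N 0)\<bar> \<le> E * (B + E) * W + E * B * W + CL * Mg / real N ^ (m + 2)"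
        using e1 e2 by linarith
      moreover have "E * (B + E) * W + E * B * W \<le> CE * (2 * B + CE) * W / real N ^ (m + 2)"
      proof -
        have "E \<le> CE"
          using divide_left_mono[OF one_le_power[OF N0(2), of "m + 2"] CE] N0 by (simp add: E_def)
        hence "E * (2 * B + E) \<le> E * (2 * B + CE)" using E0 by (intro mult_left_mono) auto
        hence "E * (2 * B + E) * W \<le> E * (2 * B + CE) * W" using W by (intro mult_right_mono)
        thus ?thesis by (simp add: E_def algebra_simps)
      qed
      moreover have "n \<le> C1 / real N ^ (m + 2)"
        using n4 mult_left_mono[OF pw(2) C1] by simp
      ultimately have "\<bar>nn (poly (ph N)) - Re (S m N 0)\<bar> \<le> CE * (2 * B + CE) * W / real N ^ (m + 2) + CL * Mg / real N ^ (m + 2) + C1 / real N ^ (m + 2)"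
        using nQ n0 by linarith
      thus ?thesis by (simp add: C2_def add_divide_distrib)
    qed
    moreover have "C2 / real N ^ (m + 2) \<le> C / real N ^ (m + 2)" "C1 / real N ^ (2 * m + 2) \<le> C / real N ^ (2 * m + 2)"
      using C by (auto intro!: divide_right_mono)
    moreover have "CF * Mg * r ^ N \<le> C * r ^ N" "CF * Mg * r4 ^ N \<le> C * r4 ^ N"
      using C r4 r a by (auto intro!: mult_right_mono)
    ultimately show "\<exists>Q. degree (Q - ph N) < N \<and>
       (\<forall>u. r3 \<le> norm u \<longrightarrow> norm (poly Q (\<psi> u) - u ^ N * v u * gm m N u) \<le> C * r ^ N) \<and>
       (\<forall>z. z \<notin> \<psi> ` ex r3 \<longrightarrow> norm (poly Q z) \<le> C * r4 ^ N) \<and>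
       nn (poly (Q - ph N)) \<le> C / real N ^ (2 * m + 2) \<and>
       \<bar>nn (poly (ph N)) - Re (S m N 0)\<bar> \<le> C / real N ^ (m + 2)"
      using dq Q(3,4) n4 unfolding q_def[symmetric] n_def[symmetric]
      by (intro exI[of _ Q]) (auto simp: q_def[symmetric] n_def[symmetric] intro: order_trans)
  qed
qed

end

section \<open>Pointwise and mean square expansions\<close>


text \<open>The series s is the formal square root of the reciprocal of e, which exists because the
  constant term is 1. Its truncation satisfies s^2 e = 1 modulo x^(k + 1), and the cofactor is a
  polynomial, hence bounded on the unit interval.\<close>

lemma truncated_inverse_sqrt:
  fixes e :: "nat \<Rightarrow> real"
  assumes e0: "e 0 = 1"
  obtains s where "s 0 = 1" "\<And>k. \<exists>C. \<forall>x. 0 \<le> x \<longrightarrow> x \<le> 1 \<longrightarrow>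
      \<bar>(\<Sum>j\<le>k. s j * x ^ j)\<^sup>2 * (\<Sum>l\<le>k. e l * x ^ l) - 1\<bar> \<le> C * x ^ (k + 1)"
proof -
  define E where "E = Abs_fps e"
  define s where "s = fps_radical (\<lambda>_ _. 1) (Suc 1) (inverse E)"
  have "inverse E $ 0 = 1" by (simp add: E_def e0)
  hence "s ^ Suc 1 = inverse E" unfolding s_def by (subst power_radical[symmetric]) auto
  hence sE: "s * s * E = 1" using inverse_mult_eq_1[of E] by (simp add: E_def e0)
  show ?thesis
  proof (rule that[of "\<lambda>j. s $ j"])
    show "s $ 0 = 1" by (simp add: s_def)
    fix k
    define u where "u = (\<Sum>j\<le>k. monom (s $ j) j)"
    define p where "p = (\<Sum>j\<le>k. monom (e j) j)"
    have cu: "coeff u j = s $ j" if "j \<le> k" for j using that by (simp add: u_def coeff_sum)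
    have cp: "coeff p j = E $ j" if "j \<le> k" for j using that by (simp add: p_def E_def coeff_sum)
    have cuu: "coeff (u * u) j = (s * s) $ j" if "j \<le> k" for j
      using that by (auto simp: coeff_mult fps_mult_nth cu atMost_atLeast0 intro!: sum.cong)
    have cuup: "coeff (u * u * p) j = (s * s * E) $ j" if "j \<le> k" for j
      unfolding coeff_mult[of "u * u"] fps_mult_nth[of "s * s"] atMost_atLeast0
      using that by (intro sum.cong refl) (simp add: cuu cp)
    have "monom 1 (k + 1) dvd u * u * p - 1" unfolding monom_1_dvd_iff'
      using cuup by (auto simp: sE coeff_1)
    then obtain t where t: "u * u * p - 1 = monom 1 (k + 1) * t" by (rule dvdE)
    have "bounded (poly t ` {0..1})" by (intro compact_imp_bounded compact_continuous_image continuous_intros compact_Icc)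
    then obtain C where C: "\<And>x. x \<in> {0..1} \<Longrightarrow> norm (poly t x) \<le> C"
      unfolding bounded_iff by blast
    show "\<exists>C. \<forall>x. 0 \<le> x \<longrightarrow> x \<le> 1 \<longrightarrow>
      \<bar>(\<Sum>j\<le>k. s $ j * x ^ j)\<^sup>2 * (\<Sum>l\<le>k. e l * x ^ l) - 1\<bar> \<le> C * x ^ (k + 1)"
    proof (intro exI[of _ C] allI impI)
      fix x :: real assume x: "0 \<le> x" "x \<le> 1"
      have "(\<Sum>j\<le>k. s $ j * x ^ j)\<^sup>2 * (\<Sum>l\<le>k. e l * x ^ l) - 1 = poly (u * u * p - 1) x"
        by (simp add: u_def p_def poly_sum poly_monom power2_eq_square)
      also have "\<dots> = x ^ (k + 1) * poly t x" unfolding t by (simp add: poly_monom)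
      finally show "\<bar>(\<Sum>j\<le>k. s $ j * x ^ j)\<^sup>2 * (\<Sum>l\<le>k. e l * x ^ l) - 1\<bar> \<le> C * x ^ (k + 1)"
        using mult_left_mono[OF C[of x], of "x ^ (k + 1)"] x by (simp add: abs_mult mult.commute)
    qed
  qed
qed

text \<open>Squares are compared first: y^2 and the square of the truncated series u agree to the
  required order. Dividing by y + u, which is at least 1 / 2, transfers this to y itself. The bound
  on y^2 is kept because the mean square expansion uses it.\<close>

lemma inverse_sqrt_expansion:
  fixes y e :: "nat \<Rightarrow> real"
  assumes pos: "\<And>N. N \<ge> 1 \<Longrightarrow> y N > 0" and e0: "e 0 = 1"
    and ex: "\<And>m. \<exists>C. \<forall>N\<ge>1. \<bar>1 / (y N)\<^sup>2 - (\<Sum>l\<le>m. e l / real N ^ l)\<bar> \<le> C / real N ^ (m + 1)"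
  obtains d where "\<And>k. (\<lambda>N. y N - (1 + (\<Sum>j=1..k. d j / real N ^ j))) \<in> O(\<lambda>N. 1 / real N ^ (k + 1))"
    "\<forall>\<^sub>F N in sequentially. (y N)\<^sup>2 \<le> 2"
proof -
  obtain s where s: "s 0 = 1" "\<And>k. \<exists>C. \<forall>x. 0 \<le> x \<longrightarrow> x \<le> 1 \<longrightarrow>
      \<bar>(\<Sum>j\<le>k. s j * x ^ j)\<^sup>2 * (\<Sum>l\<le>k. e l * x ^ l) - 1\<bar> \<le> C * x ^ (k + 1)"
    by (rule truncated_inverse_sqrt[of e, OF e0]) blast
  obtain C0 where C0: "\<And>N. N \<ge> 1 \<Longrightarrow> \<bar>1 / (y N)\<^sup>2 - 1\<bar> \<le> C0 / real N" using ex[of 0] e0 by auto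
  have "((\<lambda>N. C0 / real N) \<longlongrightarrow> 0) sequentially" by (rule lim_const_over_n)
  hence "\<forall>\<^sub>F N in sequentially. C0 / real N < 1 / 2" by (rule order_tendstoD) simp
  hence y2: "\<forall>\<^sub>F N in sequentially. (y N)\<^sup>2 \<le> 2"
    using eventually_ge_at_top[of 1]
  proof eventually_elim
    case (elim N)
    hence "1 / 2 \<le> 1 / (y N)\<^sup>2" using C0[of N] by linarith
    thus ?case using pos[of N] elim by (simp add: field_simps)
  qed
  have "(\<lambda>N. y N - (1 + (\<Sum>j=1..k. s j / real N ^ j))) \<in> O(\<lambda>N. 1 / real N ^ (k + 1))" for k
  proof -
    obtain C1 where C1: "\<And>N. N \<ge> 1 \<Longrightarrow> \<bar>1 / (y N)\<^sup>2 - (\<Sum>l\<le>k. e l / real N ^ l)\<bar> \<le> C1 / real N ^ (k + 1)" using ex[of k] by auto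
    obtain C2 where C2: "\<And>x. 0 \<le> x \<Longrightarrow> x \<le> 1 \<Longrightarrow> \<bar>(\<Sum>j\<le>k. s j * x ^ j)\<^sup>2 * (\<Sum>l\<le>k. e l * x ^ l) - 1\<bar> \<le> C2 * x ^ (k + 1)"
      using s(2)[of k] by auto
    define u where "u N = 1 + (\<Sum>j=1..k. s j / real N ^ j)" for N
    have u: "u N = (\<Sum>j\<le>k. s j * (1 / real N) ^ j)" for N
      unfolding u_def atMost_atLeast0 sum.atLeast_Suc_atMost[of 0 k, simplified] by (simp add: s(1) power_divide)
    have "(u \<longlongrightarrow> (\<Sum>j\<le>k. s j * 0 ^ j)) sequentially" unfolding u
      by (intro tendsto_intros lim_const_over_n)
    moreover have "(\<Sum>j\<le>k. s j * 0 ^ j) = 1"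
      using s(1) by (simp add: power_0_left if_distrib cong: if_cong)
    ultimately have lim: "(u \<longlongrightarrow> 1) sequentially" by simp
    have "\<forall>\<^sub>F N in sequentially. 1 / 2 < u N" "\<forall>\<^sub>F N in sequentially. u N < 2"
      by (rule order_tendstoD[OF lim], simp)+
    hence "\<forall>\<^sub>F N in sequentially. norm (y N - u N) \<le> (4 * (4 * C1 + C2)) * norm (1 / real N ^ (k + 1))"
      using y2 eventually_ge_at_top[of 1]
    proof eventually_elim
      case (elim N)
      let ?x = "1 / real N" let ?Y = "1 / (y N)\<^sup>2" let ?E = "\<Sum>l\<le>k. e l / real N ^ l"
      have y: "y N > 0" using pos elim by simp
      have x: "0 \<le> ?x" "?x \<le> 1" using elim by auto
      have E: "?E = (\<Sum>l\<le>k. e l * ?x ^ l)" by (simp add: power_divide)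
      have a1: "\<bar>(u N)\<^sup>2 * ?E - 1\<bar> \<le> C2 / real N ^ (k + 1)"
        using C2[OF x] unfolding u E by (simp add: power_divide)
      have u2: "(u N)\<^sup>2 \<le> 4" using power_mono[of "u N" 2 2] elim by simp
      have a2: "(u N)\<^sup>2 * \<bar>?Y - ?E\<bar> \<le> 4 * (C1 / real N ^ (k + 1))"
        using C1[of N] u2 elim by (intro mult_mono) auto
      have "(u N)\<^sup>2 * ?Y - 1 = (u N)\<^sup>2 * (?Y - ?E) + ((u N)\<^sup>2 * ?E - 1)" by (simp only: right_diff_distrib)
      hence "\<bar>(u N)\<^sup>2 * ?Y - 1\<bar> \<le> (u N)\<^sup>2 * \<bar>?Y - ?E\<bar> + \<bar>(u N)\<^sup>2 * ?E - 1\<bar>"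
        using abs_triangle_ineq[of "(u N)\<^sup>2 * (?Y - ?E)" "(u N)\<^sup>2 * ?E - 1"] by (simp add: abs_mult)
      hence a3: "\<bar>(u N)\<^sup>2 * ?Y - 1\<bar> \<le> 4 * (C1 / real N ^ (k + 1)) + C2 / real N ^ (k + 1)" using a1 a2 by linarith
      have "((u N)\<^sup>2 * ?Y - 1) * (y N)\<^sup>2 = (u N)\<^sup>2 - (y N)\<^sup>2" using y by (simp add: left_diff_distrib)
      hence "\<bar>(u N)\<^sup>2 - (y N)\<^sup>2\<bar> = \<bar>(u N)\<^sup>2 * ?Y - 1\<bar> * (y N)\<^sup>2" by (metis abs_mult abs_power2)
      also have "\<dots> \<le> (4 * (C1 / real N ^ (k + 1)) + C2 / real N ^ (k + 1)) * 2"
        using a3 elim by (intro mult_mono) auto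
      finally have a4: "\<bar>(u N)\<^sup>2 - (y N)\<^sup>2\<bar> \<le> (4 * (C1 / real N ^ (k + 1)) + C2 / real N ^ (k + 1)) * 2" .
      have "\<bar>y N - u N\<bar> * (1 / 2) \<le> \<bar>y N - u N\<bar> * (u N + y N)" using elim y by (intro mult_left_mono) auto
      also have "\<dots> = \<bar>(u N)\<^sup>2 - (y N)\<^sup>2\<bar>"
      proof -
        have "(u N)\<^sup>2 - (y N)\<^sup>2 = (u N - y N) * (u N + y N)" by (simp add: power2_eq_square algebra_simps)
        thus ?thesis using elim y by (simp add: abs_mult abs_minus_commute)
      qed
      finally have "\<bar>y N - u N\<bar> * (1 / 2) \<le> (4 * (C1 / real N ^ (k + 1)) + C2 / real N ^ (k + 1)) * 2" using a4 by (rule order_trans)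
      hence "\<bar>y N - u N\<bar> \<le> 2 * ((4 * (C1 / real N ^ (k + 1)) + C2 / real N ^ (k + 1)) * 2)" by simp
      also have "\<dots> = (4 * (4 * C1 + C2)) * norm (1 / real N ^ (k + 1))" by (simp add: add_divide_distrib distrib_left)
      finally show ?case by simp
    qed
    thus ?thesis unfolding u_def by (rule bigoI)
  qed
  thus ?thesis using that y2 by blast
qed

text \<open>This converts the lower bound 1 - t for a modulus into the exponential form in which
  \<open>pointwise_bound\<close> measures radii.\<close>

lemma exp_minus_double_le: assumes "0 \<le> t" "t \<le> (1/2 :: real)" shows "exp (- 2 * t) \<le> 1 - t"
proof -
  have "0 \<le> t * (1 - 2 * t)" using assms by (intro mult_nonneg_nonneg) auto
  hence "1 \<le> (1 - t) * (1 + 2 * t)" by (simp add: algebra_simps)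
  also have "\<dots> \<le> (1 - t) * exp (2 * t)" using assms exp_ge_add_one_self[of "2 * t"] by (intro mult_left_mono) auto
  finally have "1 / exp (2 * t) \<le> 1 - t" by (simp add: divide_le_eq)
  thus ?thesis by (simp add: exp_minus divide_inverse)
qed

context op_coeffs
begin

lemma hq_\<psi>: "a < norm w \<Longrightarrow> poly q (\<psi> w) = w ^ N * v w * hq N q w"
  using v_nz[of w] ex_nz[of w] by (simp add: hq_def)

lemma v_\<phi>: "a < norm w \<Longrightarrow> deriv \<phi> (\<psi> w) * exp (V (\<psi> w)) = v w"
  by (simp add: v_def d\<phi>_eq)

lemma mid: "a < (a + r3) / 2" "(a + r3) / 2 < r3" "r3 < (r3 + 1) / 2" "(r3 + 1) / 2 < 1"
proof -
  have "a < (a + y) / 2 \<and> (a + y) / 2 < y \<and> y < (y + 1) / 2 \<and> (y + 1) / 2 < 1" if "a < y" "y < 1" for y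
    using that by auto
  from this[OF r3(1,2)] show "a < (a + r3) / 2" "(a + r3) / 2 < r3" "r3 < (r3 + 1) / 2" "(r3 + 1) / 2 < 1" by blast+
qed

text \<open>At distance \<delta> = \<alpha> ln N / N from the complement of \<open>D\<close>, the
  division by w^N costs at most N^n0, and so does the exponential factor in
  \<open>pointwise_bound\<close> after taking a square root. A longer series pays for both.\<close>

lemma pointwise_expansion:
  fixes \<alpha> :: real
  assumes \<alpha>: "\<alpha> > 0"
  obtains C where "\<forall>\<^sub>F N in sequentially. \<forall>z. infdist z (- D) \<le> \<alpha> * ln (real N) / real N \<longrightarrow>
    (\<exists>w \<epsilon>. z = \<psi> w \<and> r3 < norm w \<and> norm \<epsilon> \<le> C / real N ^ (k + 1) \<and> poly (ph N) z = w ^ N * v w * (gm k N w + \<epsilon>))"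
proof -
  define r r4 where "r = (a + r3) / 2" and "r4 = (r3 + 1) / 2"
  have r: "a < r" "r < r3" "r3 < r4" "r4 < 1" using mid unfolding r_def r4_def by auto
  have r01: "0 < r" "r < 1" using r r3 a by linarith+
  obtain d L where dL: "d > 0" "L > 0" "\<And>z \<delta>. infdist z (- D) \<le> \<delta> \<Longrightarrow> \<delta> < d \<Longrightarrow> \<exists>w. z = \<psi> w \<and> r3 < norm w \<and> 1 - L * \<delta> \<le> norm w"
    by (rule near_boundary[OF r3(1,2)]) blast
  \<comment> \<open>With y = 4 L \<delta> the factor exp (N y / 2) equals N^(2 L \<alpha>).\<close>
  define n0 where "n0 = nat \<lceil>2 * L * \<alpha>\<rceil>"
  have n0: "2 * L * \<alpha> \<le> real n0" unfolding n0_def by linarith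
  \<comment> \<open>The summand n0 pays for exp (N y / 2), the summand 1 for the factor N that
    \<open>pointwise_bound\<close> leaves after a square root.\<close>
  define m where "m = k + 1 + n0"
  obtain C1 where C1: "C1 > 0" "\<And>N. N \<ge> 1 \<Longrightarrow> \<exists>Q. degree (Q - ph N) < N \<and>
     (\<forall>u. r3 \<le> norm u \<longrightarrow> norm (poly Q (\<psi> u) - u ^ N * v u * gm m N u) \<le> C1 * r ^ N) \<and>
     (\<forall>z. z \<notin> \<psi> ` ex r3 \<longrightarrow> norm (poly Q z) \<le> C1 * r4 ^ N) \<and>
     nn (poly (Q - ph N)) \<le> C1 / real N ^ (2 * m + 2) \<and>
     \<bar>nn (poly (ph N)) - Re (S m N 0)\<bar> \<le> C1 / real N ^ (m + 2)"
    by (rule main_estimate[OF r, of m]) blast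
  obtain CP where CP: "CP > 0" "\<And>N q y w0. N \<ge> 1 \<Longrightarrow> degree q < N \<Longrightarrow> 0 \<le> y \<Longrightarrow> y \<le> x0 / 2 \<Longrightarrow> exp (- y / 2) \<le> norm w0 \<Longrightarrow>
     (norm (hq N q w0))\<^sup>2 \<le> CP * (real N)\<^sup>2 * exp (real N * y) * nn (poly q)" by (rule pointwise_bound) blast
  obtain Mv where Mv: "Mv > 0" "\<And>w. r3 \<le> norm w \<Longrightarrow> 1 / norm (v w) \<le> Mv" by (rule v_bounds[OF r3(1)]) blast
  have km: "k \<le> m" by (simp add: m_def)
  obtain Md where Md: "Md > 0" "\<And>N w. N \<ge> 1 \<Longrightarrow> r3 \<le> norm w \<Longrightarrow> norm (gm m N w - gm k N w) \<le> Md / real N ^ (k + 1)"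
    by (rule gm_diff_bound[OF r3(1) km]) blast
  obtain Cg where Cg: "Cg > 0" "\<And>N. N \<ge> 1 \<Longrightarrow> r ^ N \<le> Cg / real N ^ (n0 + (k + 1))" by (rule geometric_le_power[OF r01]) blast
  define C where "C = C1 * Cg * Mv + sqrt (CP * C1) + Md"
  have "((\<lambda>N. \<alpha> * (ln (real N) / real N)) \<longlongrightarrow> \<alpha> * 0) sequentially" by (intro tendsto_intros)
  hence lim: "((\<lambda>N. \<alpha> * ln (real N) / real N) \<longlongrightarrow> 0) sequentially" by simp
  \<comment> \<open>The three entries make \<open>near_boundary\<close> applicable, give L \<delta>
    \<le> 1 / 2 as in \<open>exp_minus_double_le\<close>, and keep y = 4 L \<delta> at most x0 /
    2.\<close>
  define d' where "d' = min d (min (1 / (2 * L)) (x0 / (8 * L)))"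
  have "d' > 0" using dL x by (simp add: d'_def)
  hence "\<forall>\<^sub>F N in sequentially. \<alpha> * ln (real N) / real N < d'" using lim by (intro order_tendstoD)
  hence "\<forall>\<^sub>F N in sequentially. \<forall>z. infdist z (- D) \<le> \<alpha> * ln (real N) / real N \<longrightarrow>
    (\<exists>w \<epsilon>. z = \<psi> w \<and> r3 < norm w \<and> norm \<epsilon> \<le> C / real N ^ (k + 1) \<and> poly (ph N) z = w ^ N * v w * (gm k N w + \<epsilon>))"
    using eventually_ge_at_top[of 1]
  proof eventually_elim
    case (elim N)
    define \<delta> where "\<delta> = \<alpha> * ln (real N) / real N"
    have N: "N \<ge> 1" and N0: "real N > 0" "real N \<ge> 1" using elim by auto
    have \<delta>0: "\<delta> \<ge> 0" using \<alpha> N0 by (simp add: \<delta>_def)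
    have \<delta>: "\<delta> < d" "L * \<delta> \<le> 1 / 2" "4 * L * \<delta> \<le> x0 / 2" using elim(1) dL unfolding \<delta>_def[symmetric] d'_def by (auto simp: field_simps)
    show ?case
    proof (intro allI impI)
      fix z assume "infdist z (- D) \<le> \<alpha> * ln (real N) / real N"
      then obtain w where w: "z = \<psi> w" "r3 < norm w" "1 - L * \<delta> \<le> norm w" using dL(3)[of z \<delta>] \<delta>(1) unfolding \<delta>_def by blast
      have aw: "a < norm w" using w r3 by linarith
      have w0: "norm w > 0" using aw a by linarith
      define y where "y = 4 * L * \<delta>"
      have y: "0 \<le> y" "y \<le> x0 / 2" using \<delta>0 dL \<delta> by (auto simp: y_def)
      have "exp (- 2 * (L * \<delta>)) \<le> 1 - L * \<delta>" using \<delta> \<delta>0 dL by (intro exp_minus_double_le) auto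
      hence ew: "exp (- y / 2) \<le> norm w" using w(3) by (simp add: y_def)
      have Ny: "real N * y / 2 \<le> real n0 * ln (real N)"
        using mult_right_mono[OF n0, of "ln (real N)"] N0 by (simp add: y_def \<delta>_def mult_ac)
      have e2: "exp (real N * y / 2) \<le> real N ^ n0"
      proof -
        have "exp (real N * y / 2) \<le> exp (real n0 * ln (real N))" using Ny by simp
        thus ?thesis using N0 by (simp add: exp_of_nat_mult)
      qed
      have e1: "exp (real N * y) \<le> (real N ^ n0)\<^sup>2"
      proof -
        have "exp (real N * y) = (exp (real N * y / 2))\<^sup>2" by (simp add: power2_eq_square flip: exp_add)
        thus ?thesis using e2 by (simp add: power_mono)
      qed
      have wN: "1 / norm w ^ N \<le> real N ^ n0"
      proof -
        have "exp (- y / 2) ^ N \<le> norm w ^ N" using ew by (intro power_mono) auto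
        hence "1 / norm w ^ N \<le> 1 / exp (- y / 2) ^ N" using w0 by (intro divide_left_mono) auto
        also have "\<dots> = exp (real N * y / 2)"
          unfolding exp_of_nat_mult[symmetric] by (simp add: exp_minus inverse_eq_divide)
        finally show ?thesis using e2 by linarith
      qed
      obtain Q where Q: "degree (Q - ph N) < N"
        "\<And>u. r3 \<le> norm u \<Longrightarrow> norm (poly Q (\<psi> u) - u ^ N * v u * gm m N u) \<le> C1 * r ^ N"
        "nn (poly (Q - ph N)) \<le> C1 / real N ^ (2 * m + 2)"
        using C1(2)[OF N] by blast
      have t1: "norm (hq N Q w - gm m N w) \<le> C1 * Cg * Mv / real N ^ (k + 1)"
      proof -
        have "hq N Q w - gm m N w = (poly Q (\<psi> w) - w ^ N * v w * gm m N w) / (w ^ N * v w)"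
          using v_nz[OF aw] ex_nz[OF aw] by (simp add: hq_def diff_divide_distrib)
        hence "norm (hq N Q w - gm m N w) = norm (poly Q (\<psi> w) - w ^ N * v w * gm m N w) * (1 / norm w ^ N) * (1 / norm (v w))"
          by (simp add: norm_divide norm_mult norm_power)
        also have "\<dots> \<le> (C1 * r ^ N) * real N ^ n0 * Mv"
          using Q(2)[of w] wN Mv(2)[of w] w C1(1) r01 by (intro mult_mono) auto
        also have "\<dots> \<le> (C1 * (Cg / real N ^ (n0 + (k + 1)))) * real N ^ n0 * Mv"
          using Cg(2)[OF N] C1(1) Mv(1) by (intro mult_right_mono mult_left_mono) auto
        also have "\<dots> = C1 * Cg * Mv / real N ^ (k + 1)" using N0 by (simp add: power_add)
        finally show ?thesis .
      qed
      have t2: "norm (hq N (Q - ph N) w) \<le> sqrt (CP * C1) / real N ^ (k + 1)"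
      proof (rule power2_le_imp_le)
        have "(norm (hq N (Q - ph N) w))\<^sup>2 \<le> CP * (real N)\<^sup>2 * exp (real N * y) * nn (poly (Q - ph N))"
          by (rule CP(2)[OF N Q(1) y ew])
        also have "\<dots> \<le> CP * (real N)\<^sup>2 * (real N ^ n0)\<^sup>2 * (C1 / real N ^ (2 * m + 2))"
          using e1 Q(3) CP(1) nn_nonneg by (intro mult_mono mult_left_mono) auto
        also have "real N ^ (2 * m + 2) = (real N ^ (k + 1))\<^sup>2 * ((real N)\<^sup>2 * (real N ^ n0)\<^sup>2)"
          unfolding m_def by (simp add: power_add power_mult power_mult_distrib power2_eq_square mult_ac)
        also have "CP * (real N)\<^sup>2 * (real N ^ n0)\<^sup>2 * (C1 / ((real N ^ (k + 1))\<^sup>2 * ((real N)\<^sup>2 * (real N ^ n0)\<^sup>2)))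
            = CP * C1 / (real N ^ (k + 1))\<^sup>2"
          using N0 by (simp add: field_simps)
        also have "\<dots> = (sqrt (CP * C1) / real N ^ (k + 1))\<^sup>2" using CP C1 by (simp add: power_divide)
        finally show "(norm (hq N (Q - ph N) w))\<^sup>2 \<le> (sqrt (CP * C1) / real N ^ (k + 1))\<^sup>2" .
      qed (use CP C1 in auto)
      have t3: "norm (gm m N w - gm k N w) \<le> Md / real N ^ (k + 1)" using Md(2)[OF N, of w] w by simp
      define \<epsilon> where "\<epsilon> = hq N (ph N) w - gm k N w"
      \<comment> \<open>Three errors: that of the Faber polynomial, the distance from Q to the
        orthogonal polynomial, and the truncation from m to k.\<close>
      have "\<epsilon> = (hq N Q w - gm m N w) - hq N (Q - ph N) w + (gm m N w - gm k N w)"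
        by (simp add: \<epsilon>_def hq_def diff_divide_distrib)
      hence "norm \<epsilon> \<le> norm (hq N Q w - gm m N w) + norm (hq N (Q - ph N) w) + norm (gm m N w - gm k N w)"
        by (metis norm_triangle_le norm_triangle_ineq4 add_right_mono)
      also have "\<dots> \<le> C / real N ^ (k + 1)" using t1 t2 t3 by (simp add: C_def add_divide_distrib)
      finally have "norm \<epsilon> \<le> C / real N ^ (k + 1)" .
      moreover have "poly (ph N) z = w ^ N * v w * (gm k N w + \<epsilon>)" unfolding w(1) \<epsilon>_def using hq_\<psi>[OF aw] by simp
      ultimately show "\<exists>w \<epsilon>. z = \<psi> w \<and> r3 < norm w \<and> norm \<epsilon> \<le> C / real N ^ (k + 1) \<and> poly (ph N) z = w ^ N * v w * (gm k N w + \<epsilon>)"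
        using w by blast
    qed
  qed
  thus ?thesis by (rule that)
qed

lemma D_const_pos: "N \<ge> 1 \<Longrightarrow> D_const \<phi> V P N > 0"
  unfolding D_const_def using lead(1)[of N] C_const_pos[of N] by (intro divide_pos_pos mult_pos_pos) auto

lemma leading_const_eq: "N \<ge> 1 \<Longrightarrow> D_const \<phi> V P N * sqrt (real N) = C_const \<phi> V N * leading_const P N"
  by (simp add: D_const_def)

lemma inverse_D_const_square: "N \<ge> 1 \<Longrightarrow> 1 / (D_const \<phi> V P N)\<^sup>2 = real N * nn (poly (ph N))"
  by (simp add: D_const_def ph_nn power_divide power_mult_distrib mult.commute)

text \<open>The coefficients are the disc parts at the origin because pairing with a function that
  tends to 1 at infinity evaluates \<open>S\<close> there.\<close>

lemma inverse_D_const_expansion: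
  "\<exists>C. \<forall>N\<ge>1. \<bar>1 / (D_const \<phi> V P N)\<^sup>2 - (\<Sum>l\<le>m. Re (R l 0) / real N ^ l)\<bar> \<le> C / real N ^ (m + 1)"
proof -
  obtain C where C: "C > 0" "\<And>N. N \<ge> 1 \<Longrightarrow> \<bar>nn (poly (ph N)) - Re (S m N 0)\<bar> \<le> C / real N ^ (m + 2)"
    by (rule main_estimate[OF mid, of m]) blast
  show ?thesis
  proof (intro exI[of _ C] allI impI)
    fix N :: nat assume N: "N \<ge> 1"
    have "real N * Re (S m N 0) = (\<Sum>l\<le>m. Re (R l 0) / real N ^ l)"
      unfolding S_def Re_sum sum_distrib_left
    proof (rule sum.cong[OF refl])
      fix l
      have "R l 0 / of_nat N ^ Suc l = R l 0 / of_real (real N ^ Suc l)" by simp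
      hence "Re (R l 0 / of_nat N ^ Suc l) = Re (R l 0) / real N ^ Suc l" by (simp only: Re_divide_of_real)
      thus "real N * Re (R l 0 / of_nat N ^ Suc l) = Re (R l 0) / real N ^ l" using N by simp
    qed
    hence "1 / (D_const \<phi> V P N)\<^sup>2 - (\<Sum>l\<le>m. Re (R l 0) / real N ^ l) = real N * (nn (poly (ph N)) - Re (S m N 0))"
      using inverse_D_const_square[OF N] by (simp add: right_diff_distrib)
    also have "\<bar>\<dots>\<bar> = real N * \<bar>nn (poly (ph N)) - Re (S m N 0)\<bar>" by (simp add: abs_mult)
    also have "\<dots> \<le> real N * (C / real N ^ (m + 2))" using C(2)[OF N] by (intro mult_left_mono) auto
    also have "\<dots> = C / real N ^ (m + 1)" using N by simp
    finally show "\<bar>1 / (D_const \<phi> V P N)\<^sup>2 - (\<Sum>l\<le>m. Re (R l 0) / real N ^ l)\<bar> \<le> C / real N ^ (m + 1)" .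
  qed
qed

text \<open>Within the collar the cut-off differs from 1 only where norm w is at most some s < 1.
  There and deeper inside, both Q and the cut-off approximation are exponentially small.\<close>

lemma cutoff_bound:
  assumes r: "a < r" "r < r3" and \<eta>: "cutoff_function D (- \<psi> ` exc r) \<eta>"
  obtains C where "C > 0" "\<And>N. N \<ge> 1 \<Longrightarrow> \<exists>Q. degree (Q - ph N) < N \<and>
     (\<forall>z\<in>D. norm (poly Q z - of_real (\<eta> z) * Ff k N z) \<le> C / real N ^ (k + 1)) \<and>
     nn (poly (Q - ph N)) \<le> C / real N ^ (2 * k + 2)"
proof -
  define r4 where "r4 = (r3 + 1) / 2"
  have r4: "r3 < r4" "r4 < 1" using mid unfolding r4_def by auto
  obtain U where U: "open U" "- D \<subseteq> U" "\<And>z. z \<in> U \<Longrightarrow> \<eta> z = 1" using \<eta> unfolding cutoff_function_def by blast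
  have r1: "r < 1" using r r3 by linarith
  have \<eta>01: "0 \<le> \<eta> z" "\<eta> z \<le> 1" for z using \<eta> unfolding cutoff_function_def by auto
  have \<eta>0: "\<eta> z = 0" if "z \<notin> \<psi> ` ex r" for z
    using \<eta> that level_domain_facts(3)[OF r(1) r1] unfolding cutoff_function_def by auto
  \<comment> \<open>\<open>J\<close> is the compact part of the closed set beyond radius r3 that
    \<open>U\<close> does not cover. The modulus of \<phi> attains a maximum on it, which is below 1
    because \<open>J\<close> lies in \<open>D\<close>.\<close>
  obtain s where s: "r3 \<le> s" "s < 1" "\<And>w. s < norm w \<Longrightarrow> \<psi> w \<in> U"
  proof -
    define J where "J = - U \<inter> \<psi> ` exc r3"
    have "J \<subseteq> D" using U by (auto simp: J_def)
    hence "bounded J" using D(2) bounded_subset by blast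
    moreover have "closed J" unfolding J_def using U(1) closed_\<psi>_exc[OF r3(1)] by (intro closed_Int) (auto intro: closed_Compl)
    ultimately have "compact J" by (simp add: compact_eq_bounded_closed)
    moreover have "J \<subseteq> \<psi> ` ex a" unfolding J_def using r3 by force
    hence "continuous_on J (\<lambda>z. norm (\<phi> z))"
      by (intro continuous_intros continuous_on_subset[OF holomorphic_on_imp_continuous_on[OF \<phi>hol]])
    ultimately have *: "J = {} \<or> (\<exists>x\<in>J. \<forall>y\<in>J. norm (\<phi> y) \<le> norm (\<phi> x))" using continuous_attains_sup by blast
    have lt1: "norm (\<phi> z) < 1" if z: "z \<in> J" for z
    proof -
      obtain w where w: "z = \<psi> w" "r3 \<le> norm w" using z unfolding J_def by blast
      have "a < norm w" using w r3 by linarith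
      moreover have "z \<in> D" using z \<open>J \<subseteq> D\<close> by blast
      hence "\<not> 1 \<le> norm w" using \<psi>D w(1) by auto
      ultimately show ?thesis using w \<phi>\<psi> by auto
    qed
    have "\<exists>s. r3 \<le> s \<and> s < 1 \<and> (\<forall>y\<in>J. norm (\<phi> y) \<le> s)"
    proof (cases "J = {}")
      case True thus ?thesis using r3 by (intro exI[of _ r3]) auto
    next
      case False
      then obtain x' where x': "x' \<in> J" "\<forall>y\<in>J. norm (\<phi> y) \<le> norm (\<phi> x')" using * by blast
      show ?thesis
        by (rule exI[of _ "max r3 (norm (\<phi> x'))"]) (use x' lt1[OF x'(1)] r3 in \<open>auto intro: max.coboundedI2\<close>)
    qed
    then obtain s where s: "r3 \<le> s" "s < 1" "\<And>y. y \<in> J \<Longrightarrow> norm (\<phi> y) \<le> s" by blast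
    show ?thesis
    proof (rule that[OF s(1,2)])
      fix w :: complex assume w: "s < norm w"
      have aw: "a < norm w" using w s r3 by linarith
      show "\<psi> w \<in> U"
      proof (rule ccontr)
        assume "\<psi> w \<notin> U"
        hence "\<psi> w \<in> J" unfolding J_def using w s by auto
        thus False using s(3) \<phi>\<psi>[OF aw] w by force
      qed
    qed
  qed
  obtain C1 where C1: "C1 > 0" "\<And>N. N \<ge> 1 \<Longrightarrow> \<exists>Q. degree (Q - ph N) < N \<and>
     (\<forall>u. r3 \<le> norm u \<longrightarrow> norm (poly Q (\<psi> u) - u ^ N * v u * gm k N u) \<le> C1 * r ^ N) \<and>
     (\<forall>z. z \<notin> \<psi> ` ex r3 \<longrightarrow> norm (poly Q z) \<le> C1 * r4 ^ N) \<and>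
     nn (poly (Q - ph N)) \<le> C1 / real N ^ (2 * k + 2)"
    by (rule main_estimate[OF r r4, of k]) blast
  obtain M1 where M1: "M1 > 0" "\<And>w. r \<le> norm w \<Longrightarrow> norm (v w) \<le> M1" by (rule v_bounds[OF r(1)]) blast
  obtain M2 where M2: "M2 > 0" "\<And>N w. N \<ge> 1 \<Longrightarrow> r \<le> norm w \<Longrightarrow> norm (gm k N w) \<le> M2" by (rule gm_bound[OF r(1)]) blast
  \<comment> \<open>One rate for all errors: r^N from the Faber polynomial, r4^N from Q inside, s^N
    from the region where the cut-off may differ from 1.\<close>
  define t where "t = max s r4"
  have t: "0 < t" "t < 1" "s \<le> t" "r4 \<le> t" "r \<le> t" "r3 \<le> t"
  proof -
    show "0 < t" using r3(3) r4(1) unfolding t_def by linarith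
    show "t < 1" "s \<le> t" "r4 \<le> t" using s(2) r4(2) by (auto simp: t_def)
    show "r \<le> t" "r3 \<le> t" using r(2) r4(1) unfolding t_def by linarith+
  qed
  obtain Ct where Ct: "Ct > 0" "\<And>N. N \<ge> 1 \<Longrightarrow> t ^ N \<le> Ct / real N ^ (k + 1)" by (rule geometric_le_power[OF t(1,2)]) blast
  have M12: "M1 * M2 > 0" using M1 M2 by simp
  define C where "C = (C1 + M1 * M2) * Ct + C1"
  have C: "C > 0" "(C1 + M1 * M2) * Ct \<le> C" "C1 \<le> C" using C1 Ct M12 by (auto simp: C_def intro!: add_pos_pos)
  show ?thesis
  proof (rule that[OF C(1)])
    fix N :: nat assume N: "N \<ge> 1"
    obtain Q where Q: "degree (Q - ph N) < N"
        "\<And>u. r3 \<le> norm u \<Longrightarrow> norm (poly Q (\<psi> u) - u ^ N * v u * gm k N u) \<le> C1 * r ^ N"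
        "\<And>z. z \<notin> \<psi> ` ex r3 \<Longrightarrow> norm (poly Q z) \<le> C1 * r4 ^ N"
        "nn (poly (Q - ph N)) \<le> C1 / real N ^ (2 * k + 2)"
      using C1(2)[OF N] by blast
    have Fb: "norm (w ^ N * v w * gm k N w) \<le> M1 * M2 * t ^ N" if "r \<le> norm w" "norm w \<le> t" for w
    proof -
      have "norm (w ^ N * v w * gm k N w) = norm w ^ N * norm (v w) * norm (gm k N w)" by (simp add: norm_mult norm_power)
      also have "\<dots> \<le> t ^ N * M1 * M2" using that M1 M2 N t by (intro mult_mono power_mono) auto
      finally show ?thesis by (simp add: mult_ac)
    qed
    have pw: "C1 * r ^ N \<le> C1 * t ^ N" "C1 * r4 ^ N \<le> C1 * t ^ N"
      using C1(1) t r4 r3 r a by (auto intro!: mult_left_mono power_mono)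
    have tC: "C1 * t ^ N + M1 * M2 * t ^ N \<le> C / real N ^ (k + 1)"
    proof -
      have "C1 * t ^ N + M1 * M2 * t ^ N = (C1 + M1 * M2) * t ^ N" by (simp add: distrib_right)
      also have "\<dots> \<le> (C1 + M1 * M2) * (Ct / real N ^ (k + 1))" using Ct(2)[OF N] C1(1) M12 by (intro mult_left_mono) auto
      also have "\<dots> = ((C1 + M1 * M2) * Ct) / real N ^ (k + 1)" by simp
      also have "\<dots> \<le> C / real N ^ (k + 1)" using C by (intro divide_right_mono) auto
      finally show ?thesis .
    qed
    have "norm (poly Q z - of_real (\<eta> z) * Ff k N z) \<le> C1 * t ^ N + M1 * M2 * t ^ N" if z: "z \<in> D" for z
      using z
    proof (cases rule: D_cases)
      case (1 w)
      have aw: "a < norm w" using 1 r3 by linarith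
      let ?F = "w ^ N * v w * gm k N w"
      have "poly Q z - of_real (\<eta> z) * Ff k N z = (poly Q (\<psi> w) - ?F) + of_real (1 - \<eta> z) * ?F"
        using aw by (simp add: 1(1) Ff_\<psi> algebra_simps)
      hence "norm (poly Q z - of_real (\<eta> z) * Ff k N z) \<le> norm (poly Q (\<psi> w) - ?F) + norm (of_real (1 - \<eta> z) * ?F)"
        by (simp only: norm_triangle_ineq)
      moreover have "norm (of_real (1 - \<eta> z) * ?F) \<le> M1 * M2 * t ^ N"
      proof (cases "s < norm w")
        case True
        hence "\<eta> z = 1" using s(3) U(3) 1(1) by blast
        thus ?thesis using M12 t by simp
      next
        case False
        have "norm (of_real (1 - \<eta> z) * ?F) = (1 - \<eta> z) * norm ?F"
          using \<eta>01[of z] unfolding norm_mult norm_of_real by simp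
        also have "\<dots> \<le> 1 * norm ?F" using \<eta>01[of z] by (intro mult_right_mono) auto
        also have "\<dots> \<le> M1 * M2 * t ^ N" using Fb[of w] False t 1 r by simp
        finally show ?thesis .
      qed
      moreover have "norm (poly Q (\<psi> w) - ?F) \<le> C1 * t ^ N" using Q(2)[of w] 1 pw by linarith
      ultimately show ?thesis by linarith
    next
      case 2
      have "norm (of_real (\<eta> z) * Ff k N z) \<le> M1 * M2 * t ^ N"
      proof (cases "z \<in> \<psi> ` ex r")
        case True
        then obtain w where w: "z = \<psi> w" "r < norm w" by auto
        have "norm w \<le> r3" using 2 w(1) by (auto simp: not_less)
        hence "norm (Ff k N z) \<le> M1 * M2 * t ^ N" using Fb[of w] w t r by (simp add: Ff_\<psi>)
        moreover have "norm (of_real (\<eta> z) * Ff k N z) \<le> 1 * norm (Ff k N z)"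
          unfolding norm_mult using \<eta>01[of z] by (intro mult_right_mono) auto
        ultimately show ?thesis by linarith
      next
        case False
        thus ?thesis using \<eta>0[OF False] M12 t by simp
      qed
      moreover have "norm (poly Q z) \<le> C1 * t ^ N" using Q(3)[OF 2] pw by linarith
      ultimately show ?thesis using norm_triangle_ineq4[of "poly Q z" "of_real (\<eta> z) * Ff k N z"] by linarith
    qed
    moreover have "C1 / real N ^ (2 * k + 2) \<le> C / real N ^ (2 * k + 2)" using C by (intro divide_right_mono) auto
    ultimately show "\<exists>Q. degree (Q - ph N) < N \<and>
     (\<forall>z\<in>D. norm (poly Q z - of_real (\<eta> z) * Ff k N z) \<le> C / real N ^ (k + 1)) \<and>
     nn (poly (Q - ph N)) \<le> C / real N ^ (2 * k + 2)"
      using Q(1,4) tC by (intro exI[of _ Q]) (auto intro: order_trans)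
  qed
qed

text \<open>Passing from \<open>ph N\<close> to \<open>P N\<close> multiplies by a constant whose
  square is at most 2 N for large N. The squared errors are of order N^(- 2 k - 2), so the product
  is of order N^(- 2 k - 1), and 2 k + 1 is at least k + 1.\<close>

lemma l2_expansion:
  assumes r: "a < r" "r < r3" and \<eta>: "cutoff_function D (- \<psi> ` exc r) \<eta>"
    and D2: "\<forall>\<^sub>F N in sequentially. (D_const \<phi> V P N)\<^sup>2 \<le> 2"
  shows "(\<lambda>N. LINT z:D|dA. (norm (poly (P N) z - of_real (\<eta> z) * F_approx \<phi> V P (\<lambda>j z. b j (\<phi> z)) k N z))\<^sup>2 * \<omega> z)
        \<in> O(\<lambda>N. 1 / real N ^ (k + 1))"
proof -
  have r1: "r < 1" using r r3 by linarith
  have \<eta>0: "\<eta> z = 0" if "z \<notin> \<psi> ` ex r" for z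
    using \<eta> that level_domain_facts(3)[OF r(1) r1] unfolding cutoff_function_def by auto
  obtain C where C: "C > 0" "\<And>N. N \<ge> 1 \<Longrightarrow> \<exists>Q. degree (Q - ph N) < N \<and>
     (\<forall>z\<in>D. norm (poly Q z - of_real (\<eta> z) * Ff k N z) \<le> C / real N ^ (k + 1)) \<and>
     nn (poly (Q - ph N)) \<le> C / real N ^ (2 * k + 2)" by (rule cutoff_bound[OF r \<eta>]) blast
  define W where "W = nn (\<lambda>_. 1)"
  have W: "W \<ge> 0" unfolding W_def by (rule nn_nonneg)
  define I where "I N = (LINT z:D|dA. (norm (poly (P N) z - of_real (\<eta> z) * F_approx \<phi> V P (\<lambda>j z. b j (\<phi> z)) k N z))\<^sup>2 * \<omega> z)" for N
  have "\<forall>\<^sub>F N in sequentially. norm (I N) \<le> (4 * (C + C\<^sup>2 * W)) * norm (1 / real N ^ (k + 1))"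
    using D2 eventually_ge_at_top[of 1]
  proof eventually_elim
    case (elim N)
    have N: "N \<ge> 1" and N0: "real N > 0" "real N \<ge> 1" using elim by auto
    define c' where "c' = C_const \<phi> V N * leading_const P N"
    have c'0: "c' > 0" using lead(1)[of N] C_const_pos[of N] by (simp add: c'_def)
    have c': "c'\<^sup>2 \<le> 2 * real N"
    proof -
      have "c'\<^sup>2 = (D_const \<phi> V P N)\<^sup>2 * real N"
        unfolding c'_def leading_const_eq[OF N, symmetric] power_mult_distrib by simp
      thus ?thesis using elim(1) N0 by (simp add: mult_right_mono)
    qed
    obtain Q where Q: "degree (Q - ph N) < N"
      "\<And>z. z \<in> D \<Longrightarrow> norm (poly Q z - of_real (\<eta> z) * Ff k N z) \<le> C / real N ^ (k + 1)"
      "nn (poly (Q - ph N)) \<le> C / real N ^ (2 * k + 2)" using C(2)[OF N] by blast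
    define q where "q = Q - ph N"
    define E where "E = C / real N ^ (k + 1)"
    \<comment> \<open>Off the image of norm w > r the cut-off is 0, so the arbitrary values of
      \<phi> and V there do not enter.\<close>
    have id: "poly (P N) z - of_real (\<eta> z) * F_approx \<phi> V P (\<lambda>j z. b j (\<phi> z)) k N z
        = of_real c' * (poly (ph N) z - of_real (\<eta> z) * Ff k N z)" for z
    proof -
      have p: "poly (P N) z = of_real c' * poly (ph N) z" using c'0 unfolding ph_eq c'_def[symmetric] by simp
      show ?thesis
      proof (cases "z \<in> \<psi> ` ex r")
        case True
        then obtain w where w: "z = \<psi> w" "r < norm w" by auto
        hence aw: "a < norm w" using r by linarith
        have "F_approx \<phi> V P (\<lambda>j z. b j (\<phi> z)) k N z = of_real c' * Ff k N z"
          unfolding F_approx_def leading_const_eq[OF N] c'_def[symmetric] Ff_def gm_def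
          using v_\<phi>[OF aw] w(1) \<phi>\<psi>[OF aw] by (simp add: mult_ac)
        thus ?thesis using p by (simp add: algebra_simps)
      qed (use \<eta>0 p in simp)
    qed
    have i1: "set_integrable dA D (\<lambda>z. 2 * c'\<^sup>2 * ((norm (poly q z))\<^sup>2 * \<omega> z))"
      by (intro set_integrable_mult_right nice_nn_integrable nice_poly)
    have i2: "set_integrable dA D (\<lambda>z. 2 * c'\<^sup>2 * E\<^sup>2 * ((norm (1::complex))\<^sup>2 * \<omega> z))"
      by (intro set_integrable_mult_right nice_nn_integrable nice_continuous continuous_intros)
    have pt: "(norm (poly (P N) z - of_real (\<eta> z) * F_approx \<phi> V P (\<lambda>j z. b j (\<phi> z)) k N z))\<^sup>2 * \<omega> z
        \<le> 2 * c'\<^sup>2 * ((norm (poly q z))\<^sup>2 * \<omega> z) + 2 * c'\<^sup>2 * E\<^sup>2 * ((norm (1::complex))\<^sup>2 * \<omega> z)" if z: "z \<in> D" for z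
    proof -
      have "poly (ph N) z - of_real (\<eta> z) * Ff k N z = (poly Q z - of_real (\<eta> z) * Ff k N z) - poly q z" by (simp add: q_def)
      hence "norm (poly (ph N) z - of_real (\<eta> z) * Ff k N z) \<le> E + norm (poly q z)"
        unfolding E_def using Q(2)[OF z] norm_triangle_ineq4[of "poly Q z - of_real (\<eta> z) * Ff k N z" "poly q z"] by (simp only:)
      hence "(norm (poly (ph N) z - of_real (\<eta> z) * Ff k N z))\<^sup>2 \<le> (E + norm (poly q z))\<^sup>2" by (intro power_mono) auto
      also have "\<dots> \<le> 2 * (norm (poly q z))\<^sup>2 + 2 * E\<^sup>2"
        using zero_le_power2[of "E - norm (poly q z)"] by (simp add: power2_diff power2_sum)
      finally have "c'\<^sup>2 * (norm (poly (ph N) z - of_real (\<eta> z) * Ff k N z))\<^sup>2 * \<omega> z \<le> c'\<^sup>2 * (2 * (norm (poly q z))\<^sup>2 + 2 * E\<^sup>2) * \<omega> z"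
        using \<omega>nn[OF z] by (intro mult_right_mono mult_left_mono) auto
      moreover have "(norm (of_real c' * (poly (ph N) z - of_real (\<eta> z) * Ff k N z)))\<^sup>2 = c'\<^sup>2 * (norm (poly (ph N) z - of_real (\<eta> z) * Ff k N z))\<^sup>2"
        by (simp add: norm_mult power_mult_distrib)
      ultimately show ?thesis unfolding id by (simp add: algebra_simps)
    qed
    have "I N \<le> (LINT z:D|dA. 2 * c'\<^sup>2 * ((norm (poly q z))\<^sup>2 * \<omega> z) + 2 * c'\<^sup>2 * E\<^sup>2 * ((norm (1::complex))\<^sup>2 * \<omega> z))"
      unfolding I_def set_lebesgue_integral_def
    proof (rule integral_mono')
      show "integrable dA (\<lambda>z. indicat_real D z *\<^sub>R (2 * c'\<^sup>2 * ((norm (poly q z))\<^sup>2 * \<omega> z) + 2 * c'\<^sup>2 * E\<^sup>2 * ((norm (1::complex))\<^sup>2 * \<omega> z)))"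
        using set_integral_add(1)[OF i1 i2] unfolding set_integrable_def .
    qed (use pt \<omega>nn in \<open>auto simp: indicator_def simp del: norm_one\<close>)
    also have "\<dots> = 2 * c'\<^sup>2 * nn (poly q) + 2 * c'\<^sup>2 * E\<^sup>2 * W"
      unfolding set_integral_add(2)[OF i1 i2] nn_def W_def by simp
    also have "\<dots> = c'\<^sup>2 * (2 * (nn (poly q) + E\<^sup>2 * W))" by (simp add: algebra_simps)
    also have "\<dots> \<le> (2 * real N) * (2 * (C / real N ^ (2 * k + 2) + C\<^sup>2 * W / real N ^ (2 * k + 2)))"
    proof (intro mult_mono add_mono c')
      show "nn (poly q) \<le> C / real N ^ (2 * k + 2)" unfolding q_def by (rule Q(3))
      have "(real N ^ (k + 1))\<^sup>2 = real N ^ (2 * k + 2)" by (simp only: power_mult[symmetric] add_mult_distrib) (simp only: mult.commute, simp)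
      thus "E\<^sup>2 * W \<le> C\<^sup>2 * W / real N ^ (2 * k + 2)" unfolding E_def power_divide by simp
    qed (use W nn_nonneg N0 in auto)
    also have "\<dots> = (4 * (C + C\<^sup>2 * W)) * (1 / real N ^ (2 * k + 1))"
    proof -
      have "real N ^ (2 * k + 2) = real N * real N ^ (2 * k + 1)" by simp
      thus ?thesis using N0 by (simp only: add_divide_distrib[symmetric]) (simp add: field_simps)
    qed
    also have "\<dots> \<le> (4 * (C + C\<^sup>2 * W)) * (1 / real N ^ (k + 1))"
      using N0 C(1) W by (intro mult_left_mono divide_left_mono power_increasing) auto
    finally have "I N \<le> (4 * (C + C\<^sup>2 * W)) * (1 / real N ^ (k + 1))" .
    moreover have "I N \<ge> 0" unfolding I_def set_lebesgue_integral_def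
      using \<omega>nn by (intro Bochner_Integration.integral_nonneg) (auto simp: indicator_def)
    ultimately show ?case by simp
  qed
  thus ?thesis unfolding I_def by (rule bigoI)
qed

end


section \<open>Assembly of the expansions\<close>

lemma (in op_coeffs) full_expansion:
  "\<exists>(\<rho>::real) (Dr::complex set) (B :: nat \<Rightarrow> complex \<Rightarrow> complex) (d :: nat \<Rightarrow> real).
    0 < \<rho> \<and> \<rho> < 1 \<and> level_domain D \<phi> V \<rho> Dr \<and>
    (\<forall>j. B j holomorphic_on (- closure Dr) \<and> bounded (B j ` (- closure Dr))) \<and>
    (\<forall>z\<in>- closure Dr. B 0 z = 1) \<and>
    (\<forall>j\<ge>1. (B j \<longlongrightarrow> 0) at_infinity) \<and>
    (\<forall>(k::nat) (A::real). A > 0 \<longrightarrow>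
      (\<exists>K. \<forall>\<^sub>F N in sequentially. \<forall>z. infdist z (- D) \<le> A * ln (real N) / real N \<longrightarrow>
        (\<exists>\<epsilon>::complex. norm \<epsilon> \<le> K / real N ^ (k + 1) \<and>
          poly (monic_op P N) z =
            of_real (C_const \<phi> V N) * deriv \<phi> z * \<phi> z ^ N * exp (V z) *
            ((\<Sum>j\<le>k. B j z / of_nat N ^ j) + \<epsilon>)))) \<and>
    (\<forall>k::nat. (\<lambda>N. D_const \<phi> V P N - (1 + (\<Sum>j=1..k. d j / real N ^ j)))
        \<in> O(\<lambda>N. 1 / real N ^ (k + 1))) \<and>
    (\<forall>(k::nat) \<eta>. cutoff_function D Dr \<eta> \<longrightarrow>
      (\<lambda>N. LINT z:D|dA. (norm (poly (P N) z - of_real (\<eta> z) * F_approx \<phi> V P B k N z))\<^sup>2 * \<omega> z)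
        \<in> O(\<lambda>N. 1 / real N ^ (k + 1)))"
proof -
  \<comment> \<open>The level lies above a, so each \<open>B j\<close> is holomorphic across the
    boundary of the level domain and therefore bounded outside it, and below \<open>r3\<close>, as
    \<open>cutoff_bound\<close> requires.\<close>
  define r where "r = (a + r3) / 2"
  have r: "a < r" "r < r3" using mid unfolding r_def by auto
  have r1: "0 < r" "r < 1" using r r3 a by linarith+
  define B where "B j z = b j (\<phi> z)" for j z
  have cl: "- closure (- \<psi> ` exc r) = \<psi> ` ex r" by (rule level_domain_facts(2)[OF r(1) r1(2)])
  obtain d where d: "\<And>k. (\<lambda>N. D_const \<phi> V P N - (1 + (\<Sum>j=1..k. d j / real N ^ j))) \<in> O(\<lambda>N. 1 / real N ^ (k + 1))"
    and D2: "\<forall>\<^sub>F N in sequentially. (D_const \<phi> V P N)\<^sup>2 \<le> 2"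
    by (rule inverse_sqrt_expansion[of "D_const \<phi> V P" "\<lambda>l. Re (R l 0)"])
       (use D_const_pos R0 inverse_D_const_expansion in auto)
  show ?thesis
  proof (rule exI[of _ r], rule exI[of _ "- \<psi> ` exc r"], rule exI[of _ B], rule exI[of _ d], intro conjI allI impI ballI)
    show "0 < r" "r < 1" by (fact r1)+
    show "level_domain D \<phi> V r (- \<psi> ` exc r)" by (rule level_domain_facts(1)[OF r(1) r1(2)])
    show "B j holomorphic_on (- closure (- \<psi> ` exc r))" for j
    proof -
      have \<phi>r: "\<phi> holomorphic_on \<psi> ` ex r" by (rule holomorphic_on_subset[OF \<phi>hol]) (use r in auto)
      show ?thesis unfolding cl B_def by (rule hol_comp[OF bhol \<phi>r]) (use r \<phi>\<psi> in auto)
    qed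
    show "bounded (B j ` (- closure (- \<psi> ` exc r)))" for j
    proof -
      obtain M where M: "\<And>j w. r \<le> norm w \<Longrightarrow> norm (b j w) \<le> M j" by (rule b_bounded[OF r(1)]) blast
      show ?thesis unfolding cl bounded_iff B_def
        by (rule exI[of _ "M j"]) (use M[of _ j] r \<phi>\<psi> in auto)
    qed
    show "B 0 z = 1" for z by (simp add: B_def b0)
    show "(B j \<longlongrightarrow> 0) at_infinity" if "1 \<le> j" for j
    proof -
      have "filterlim (\<lambda>z. \<phi> z / z * z) at_infinity at_infinity"
        by (rule tendsto_mult_filterlim_at_infinity[OF \<phi>_quotient]) (use c in \<open>auto simp: filterlim_ident\<close>)
      moreover have "\<forall>\<^sub>F z in at_infinity. \<phi> z / z * z = \<phi> z"
        using ev_ex[of 0] by eventually_elim auto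
      ultimately have "filterlim \<phi> at_infinity at_infinity"
        using filterlim_cong[OF refl refl, of "\<lambda>z. \<phi> z / z * z" \<phi>] by blast
      thus ?thesis unfolding B_def by (rule filterlim_compose[OF blim[OF that]])
    qed
    show "\<exists>K. \<forall>\<^sub>F N in sequentially. \<forall>z. infdist z (- D) \<le> \<alpha> * ln (real N) / real N \<longrightarrow>
        (\<exists>\<epsilon>::complex. norm \<epsilon> \<le> K / real N ^ (k + 1) \<and>
          poly (monic_op P N) z =
            of_real (C_const \<phi> V N) * deriv \<phi> z * \<phi> z ^ N * exp (V z) *
            ((\<Sum>j\<le>k. B j z / of_nat N ^ j) + \<epsilon>))" if \<alpha>: "\<alpha> > 0" for k and \<alpha> :: real
    proof -
      obtain C where C: "\<forall>\<^sub>F N in sequentially. \<forall>z. infdist z (- D) \<le> \<alpha> * ln (real N) / real N \<longrightarrow>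
        (\<exists>w \<epsilon>. z = \<psi> w \<and> r3 < norm w \<and> norm \<epsilon> \<le> C / real N ^ (k + 1) \<and> poly (ph N) z = w ^ N * v w * (gm k N w + \<epsilon>))"
        by (rule pointwise_expansion[OF \<alpha>]) blast
      show ?thesis
      proof (rule exI[of _ C], rule eventually_mono[OF C], intro allI impI)
        fix N z
        assume *: "\<forall>z. infdist z (- D) \<le> \<alpha> * ln (real N) / real N \<longrightarrow>
          (\<exists>w \<epsilon>. z = \<psi> w \<and> r3 < norm w \<and> norm \<epsilon> \<le> C / real N ^ (k + 1) \<and> poly (ph N) z = w ^ N * v w * (gm k N w + \<epsilon>))"
          and z: "infdist z (- D) \<le> \<alpha> * ln (real N) / real N"
        obtain w \<epsilon> where w: "z = \<psi> w" "r3 < norm w" "norm \<epsilon> \<le> C / real N ^ (k + 1)"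
          "poly (ph N) z = w ^ N * v w * (gm k N w + \<epsilon>)" using * z by blast
        have aw: "a < norm w" using w r3 by linarith
        have "poly (monic_op P N) z = of_real (C_const \<phi> V N) * poly (ph N) z"
          using C_const_pos[of N] by (simp add: ph_def)
        also have "\<dots> = of_real (C_const \<phi> V N) * deriv \<phi> z * \<phi> z ^ N * exp (V z) * ((\<Sum>j\<le>k. B j z / of_nat N ^ j) + \<epsilon>)"
          unfolding w(1) w(4)[unfolded w(1)] gm_def B_def \<phi>\<psi>[OF aw] v_\<phi>[OF aw, symmetric] by (simp only: mult_ac)
        finally show "\<exists>\<epsilon>::complex. norm \<epsilon> \<le> C / real N ^ (k + 1) \<and>
          poly (monic_op P N) z = of_real (C_const \<phi> V N) * deriv \<phi> z * \<phi> z ^ N * exp (V z) * ((\<Sum>j\<le>k. B j z / of_nat N ^ j) + \<epsilon>)"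
          using w(3) by blast
      qed
    qed
    show "(\<lambda>N. D_const \<phi> V P N - (1 + (\<Sum>j=1..k. d j / real N ^ j))) \<in> O(\<lambda>N. 1 / real N ^ (k + 1))" for k by (rule d)
    show "(\<lambda>N. LINT z:D|dA. (norm (poly (P N) z - of_real (\<eta> z) * F_approx \<phi> V P B k N z))\<^sup>2 * \<omega> z)
        \<in> O(\<lambda>N. 1 / real N ^ (k + 1))" if "cutoff_function D (- \<psi> ` exc r) \<eta>" for k \<eta>
      using l2_expansion[OF r that D2, of k] unfolding B_def .
  qed
qed

text \<open>The point is approached radially from moduli below 1, where \<psi> takes values in
  \<open>D\<close>.\<close>

lemma (in ext_map) \<psi>_circle_frontier: assumes w: "norm w = 1" shows "\<psi> w \<in> frontier D"
proof -
  have nD: "\<psi> w \<notin> D" using \<psi>D w by force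
  have cont: "isCont \<psi> w"
    using holomorphic_on_imp_continuous_on[OF \<psi>hol] w \<rho> open_exterior by (simp add: continuous_on_eq_continuous_at)
  have "((\<lambda>t. complex_of_real t * w) \<longlongrightarrow> of_real 1 * w) (at_left 1)" by (intro tendsto_intros)
  hence "((\<lambda>t. complex_of_real t * w) \<longlongrightarrow> w) (at_left 1)" by simp
  with cont have "((\<lambda>t. \<psi> (of_real t * w)) \<longlongrightarrow> \<psi> w) (at_left (1::real))"
    by (rule isCont_tendsto_compose)
  moreover have "\<forall>\<^sub>F t in at_left (1::real). \<rho> < t \<and> t < 1"
    unfolding eventually_at_left[OF \<rho>(2)] using \<rho>(2) by blast
  hence "\<forall>\<^sub>F t in at_left (1::real). \<psi> (of_real t * w) \<in> closure D"
  proof eventually_elim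
    case (elim t)
    have "\<psi> (of_real t * w) \<in> D" by (rule \<psi>_in_D) (use elim w \<rho> in \<open>auto simp: norm_mult\<close>)
    thus ?case using closure_subset by blast
  qed
  ultimately have "\<psi> w \<in> closure D" by (intro Lim_in_closed_set[OF closed_closure]) auto
  thus ?thesis using nD D(1) by (simp add: frontier_def interior_open)
qed

theorem theorem1p2p3:
  fixes D :: "complex set" and \<omega> :: "complex \<Rightarrow> real"
    and \<phi> V :: "complex \<Rightarrow> complex" and P :: "nat \<Rightarrow> complex poly"
  assumes "analytic_jordan_domain D"
    and "admissible_weight D \<omega>"
    and "exterior_conformal_map D \<phi>"
    and "szego_function D \<omega> V"
    and "normalized_orthogonal_polynomials D \<omega> P"
  shows "\<exists>(\<rho>::real) (Dr::complex set) (B :: nat \<Rightarrow> complex \<Rightarrow> complex) (d :: nat \<Rightarrow> real).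
    0 < \<rho> \<and> \<rho> < 1 \<and> level_domain D \<phi> V \<rho> Dr \<and>
    (\<forall>j. B j holomorphic_on (- closure Dr) \<and> bounded (B j ` (- closure Dr))) \<and>
    (\<forall>z\<in>- closure Dr. B 0 z = 1) \<and>
    (\<forall>j\<ge>1. (B j \<longlongrightarrow> 0) at_infinity) \<and>
    (\<forall>(k::nat) (A::real). A > 0 \<longrightarrow>
      (\<exists>K. \<forall>\<^sub>F N in sequentially. \<forall>z. infdist z (- D) \<le> A * ln (real N) / real N \<longrightarrow>
        (\<exists>\<epsilon>::complex. norm \<epsilon> \<le> K / real N ^ (k + 1) \<and>
          poly (monic_op P N) z =
            of_real (C_const \<phi> V N) * deriv \<phi> z * \<phi> z ^ N * exp (V z) *
            ((\<Sum>j\<le>k. B j z / of_nat N ^ j) + \<epsilon>)))) \<and>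
    (\<forall>k::nat. (\<lambda>N. D_const \<phi> V P N - (1 + (\<Sum>j=1..k. d j / real N ^ j)))
        \<in> O(\<lambda>N. 1 / real N ^ (k + 1))) \<and>
    (\<forall>(k::nat) \<eta>. cutoff_function D Dr \<eta> \<longrightarrow>
      (\<lambda>N. LINT z:D|dA. (norm (poly (P N) z - of_real (\<eta> z) * F_approx \<phi> V P B k N z))\<^sup>2 * \<omega> z)
        \<in> O(\<lambda>N. 1 / real N ^ (k + 1)))"
proof -
  obtain \<gamma> :: "real \<Rightarrow> complex" where \<gamma>: "simple_path \<gamma>" "pathfinish \<gamma> = pathstart \<gamma>" "D = inside (path_image \<gamma>)"
    using assms(1) unfolding analytic_jordan_domain_def by blast
  obtain \<psi> \<rho> c vinf where E: "ext_map D \<phi> V \<psi> \<rho> c vinf"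
    by (rule exterior_inverse[OF jordan_domain_facts[OF \<gamma>] assms(3,4)])
  interpret E: ext_map D \<phi> V \<psi> \<rho> c vinf by (fact E)
  obtain U where U: "frontier D \<subseteq> U" "\<And>z. z \<in> U \<Longrightarrow> 0 < \<omega> z" "real_analytic_on (\<lambda>z. ln (\<omega> z)) U"
    and \<omega>: "continuous_on D \<omega>" "\<And>z. z \<in> D \<Longrightarrow> 0 \<le> \<omega> z"
    using assms(2) unfolding admissible_weight_def by blast
  have U1: "\<psi> w \<in> U" if "norm w = 1" for w using E.\<psi>_circle_frontier[OF that] U by blast
  have V1: "2 * Re (V (\<psi> w)) = - ln (\<omega> (\<psi> w))" if "norm w = 1" for w
    using E.\<psi>_circle_frontier[OF that] assms(4) unfolding szego_function_def by blast
  obtain K a x1 where K: "annulus_kernel K a x1" "\<rho> < a"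
    and KU: "\<And>x w. 0 \<le> x \<Longrightarrow> x < x1 \<Longrightarrow> norm w = exp (- x / 2) \<Longrightarrow> a < norm w \<Longrightarrow>
       \<psi> w \<in> U \<and> K (of_real x) (of_real (exp x) * w) = of_real (exp (- x + ln (\<omega> (\<psi> w)) + 2 * Re (V (\<psi> w))))"
    by (rule kernel_exists[OF E.\<rho> E.\<psi>hol E.V\<psi>hol U(3) U1 V1], assumption, assumption, rule that, assumption, assumption, metis)
  have a: "0 < a" "a < 1" "0 < x1" using K(1) unfolding annulus_kernel_def by auto
  \<comment> \<open>The bound x2 < - ln a is the condition a < exp (- x2); the depth of the collar
    is then taken as x2 / 2.\<close>
  define x2 where "x2 = min x1 (- ln a) / 2"
  have la: "ln a < 0" using a by simp
  have x2: "0 < x2" "x2 < x1" "x2 < - ln a" using a la by (auto simp: x2_def min_def)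
  have "exp (ln a) < exp (- x2)" using x2 by simp
  hence ax2: "a < exp (- x2)" using a by simp
  have "op_setup D \<phi> V \<psi> a c vinf K x1 \<omega> (x2 / 2) x2"
  proof (intro op_setup.intro op_setup_axioms.intro)
    show "ext_map D \<phi> V \<psi> a c vinf" by (rule E.ext_map_mono) (use K a in auto)
    fix x :: real and w :: complex assume *: "0 \<le> x" "x < x1" "norm w = exp (- x / 2)" "a < norm w"
    show pos: "0 < \<omega> (\<psi> w)" using KU[OF *] U(2) by blast
    show "K (of_real x) (of_real (exp x) * w) = of_real (exp (- x) * \<omega> (\<psi> w) * exp (2 * Re (V (\<psi> w))))"
      using KU[OF *] pos by (simp only: exp_add exp_ln)
  qed (use K \<omega> x2 ax2 in auto)
  then interpret S: op_setup D \<phi> V \<psi> a c vinf K x1 \<omega> "x2 / 2" x2 .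
  obtain b R where b: "b 0 = (\<lambda>_. 1)" "\<And>l. b l holomorphic_on {w. a < norm w}" "\<And>l. l \<ge> 1 \<Longrightarrow> (b l \<longlongrightarrow> 0) at_infinity"
    "\<And>l. R l holomorphic_on ball 0 (1/a)" "\<And>\<sigma>. R 0 \<sigma> = 1"
    "\<And>l \<sigma>. \<sigma> \<in> {w. a < norm w \<and> norm w < 1/a} \<Longrightarrow> (\<Sum>i\<le>l. S.T i (b (l - i)) \<sigma>) = R l \<sigma>"
    by (rule S.expansion_coefficients) blast
  interpret C: op_coeffs D \<phi> V \<psi> a c vinf K x1 \<omega> "x2 / 2" x2 b R P
    by (intro op_coeffs.intro op_coeffs_axioms.intro S.op_setup_axioms b assms(5))
  show ?thesis by (rule C.full_expansion)
qed

end
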